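(* Let $\mathcal{H}=\mathcal{H}_-\oplus\mathcal{H}_+$ be a polarized separable complex Hilbert space and let $\mathrm{Gr}^1_{\mathrm{res}}(\mathcal{H})$ be its $1$-restricted Grassmannian, with its Banach manifold structure given by the charts $\phi_V:\Omega_V\to L^1(V,V^\perp)$, $V\in\mathrm{Gr}^1_{\mathrm{res}}(\mathcal{H})$. Then a precotangent bundle $T_*\mathrm{Gr}^1_{\mathrm{res}}(\mathcal{H})\subset T^*\mathrm{Gr}^1_{\mathrm{res}}(\mathcal{H})$ exists, and it is given locally, for every $V\in\mathrm{Gr}^1_{\mathrm{res}}(\mathcal{H})$, by $$T_*\mathrm{Gr}^1_{\mathrm{res}}(\mathcal{H})_{|\Omega_V}=(T\phi_V)^*\big(L^0(V^\perp,V)\big),$$ i.e. for every $U\in\Omega_V$ the fiber of $T_*\mathrm{Gr}^1_{\mathrm{res}}(\mathcal{H})$ over $U$ is the set of functionals on $T_U\mathrm{Gr}^1_{\mathrm{res}}(\mathcal{H})$ of the form $\tilde v\mapsto\mathrm{Tr}\big(\mu\,T_U\phi_V(\tilde v)\big)$ with $\mu\in L^0(V^\perp,V)$.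
   Context: Precotangent bundle: for a smooth Banach manifold $M$, a precotangent bundle $T_*M$ is a Banach subbundle of the cotangent bundle $T^*M$ such that $({T_*}_pM)^*=T_pM$ for every $p\in M$; the identification is the one given by the canonical pairing, i.e. the evaluation map $T_pM\to({T_*}_pM)^*$, $v\mapsto(\mu\mapsto\mu(v))$, is an isomorphism of Banach spaces. Here a Banach subbundle of a Banach vector bundle $E\to M$ is a subset that around each point, in a suitable local trivialization $E_{|U}\cong U\times Y$ of $E$, corresponds to $U\times Z$ for a closed subspace $Z\subset Y$ (the subspace $Z$ is not required to be complemented). Notation: $L^1(X,Y)$ is the Banach space of trace-class operators (with trace norm) and $L^0(X,Y)$ the Banach space of compact operators (with operator norm) between Hilbert spaces. For a closed subspace $V\subset\mathcal{H}$, $P_V$ is the orthogonal projector onto $V$ and $(P_V)^\perp=P_{V^\perp}=1-P_V$. Polarized Hilbert space: a separable complex Hilbert space with a fixed orthogonal decomposition $\mathcal{H}=\mathcal{H}_-\oplus\mathcal{H}_+$, where $\mathcal{H}_\pm$ are infinite-dimensional closed subspaces orthogonal to each other. $1$-restricted Grassmannian: $\mathrm{Gr}^1_{\mathrm{res}}(\mathcal{H})$ is the set of closed subspaces $W\subset\mathcal{H}$ such that (i) the orthogonal projection $p_+:W\to\mathcal{H}_+$ is a Fredholm operator, and (ii) the orthogonal projection $p_-:W\to\mathcal{H}_-$ is of trace class. It is a Banach manifold with charts indexed by $V\in\mathrm{Gr}^1_{\mathrm{res}}(\mathcal{H})$: the domain is $\Omega_V=\{W\in\mathrm{Gr}^1_{\mathrm{res}}(\mathcal{H})\mid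 V\oplus W^\perp=\mathcal{H}\}$ and $\phi_V:\Omega_V\to L^1(V,V^\perp)$ is $\phi_V(W)=(P_V)^\perp P_WP_V(P_VP_WP_V)^{-1}$, where the inverse is that of $P_VP_WP_V$ regarded as an operator on $V$. The inverse chart sends $A\in L^1(V,V^\perp)$ to its graph $\{v+Av\mid v\in V\}$. For $U\in\Omega_V$, the tangent map $T_U\phi_V$ identifies $T_U\mathrm{Gr}^1_{\mathrm{res}}(\mathcal{H})$ with $L^1(V,V^\perp)$. The space $L^0(V^\perp,V)$ is regarded as a subspace of $L^1(V,V^\perp)^*$ via the trace pairing $\langle\mu;v\rangle=\mathrm{Tr}(\mu v)$. *)

theory Defs
  imports "HOL-Analysis.Analysis" "HOL-Library.Function_Algebras"
begin

section \<open>Complex vector spaces and complex Hilbert spaces\<close>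

class complex_vector = ab_group_add +
  fixes scaleC :: "complex \<Rightarrow> 'a \<Rightarrow> 'a"  (infixr \<open>*\<^sub>C\<close> 75)
  assumes scaleC_add_right: "a *\<^sub>C (x + y) = a *\<^sub>C x + a *\<^sub>C y"
    and scaleC_add_left: "(a + b) *\<^sub>C x = a *\<^sub>C x + b *\<^sub>C x"
    and scaleC_scaleC: "a *\<^sub>C b *\<^sub>C x = (a * b) *\<^sub>C x"
    and scaleC_one: "1 *\<^sub>C x = x"

global_interpretation complex_vector: vector_space "scaleC :: complex \<Rightarrow> 'a \<Rightarrow> 'a::complex_vector"
  defines csubspace = complex_vector.subspace
    and cspan = complex_vector.span
  by unfold_locales (simp_all add: scaleC_add_right scaleC_add_left scaleC_scaleC scaleC_one)

instantiation complex :: complex_vector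
begin

definition scaleC_complex :: "complex \<Rightarrow> complex \<Rightarrow> complex"
  where "scaleC_complex a x = a * x"

instance
  by standard (simp_all add: scaleC_complex_def algebra_simps)

end

instantiation "fun" :: (type, complex_vector) complex_vector
begin

definition scaleC_fun :: "complex \<Rightarrow> ('a \<Rightarrow> 'b) \<Rightarrow> 'a \<Rightarrow> 'b"
  where "scaleC_fun a f = (\<lambda>x. a *\<^sub>C f x)"

instance
  by standard
    (simp_all add: scaleC_fun_def fun_eq_iff scaleC_add_right scaleC_add_left scaleC_scaleC scaleC_one)

end

text \<open>The inner product is antilinear in its first argument.\<close>

class chilbert_space = complex_vector + banach +
  fixes cinner :: "'a \<Rightarrow> 'a \<Rightarrow> complex"
  assumes scaleR_scaleC: "r *\<^sub>R x = complex_of_real r *\<^sub>C x"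
    and cinner_commute: "cinner x y = cnj (cinner y x)"
    and cinner_add_right: "cinner x (y + z) = cinner x y + cinner x z"
    and cinner_scaleC_right: "cinner x (c *\<^sub>C y) = c * cinner x y"
    and cinner_self: "cinner x x = complex_of_real ((norm x)\<^sup>2)"

definition cfinite_dim :: "'a::complex_vector set \<Rightarrow> bool"
  where "cfinite_dim S \<longleftrightarrow> (\<exists>B. finite B \<and> S \<subseteq> cspan B)"


section \<open>Normed spaces on a carrier\<close>

text \<open>
  The model spaces below depend on a point of the manifold, and their norm (the trace norm) is not
  the restriction of a norm of the ambient type. A complex normed space is therefore a
  subspace of a complex vector space together with a norm that is relevant on that subspace only.
\<close>

record 'a nspace =
  pts :: "'a set"
  nrm :: "'a \<Rightarrow> real"

definition cnormed_space :: "'a::complex_vector nspace \<Rightarrow> bool"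
  where "cnormed_space E \<longleftrightarrow>
    csubspace (pts E) \<and>
    (\<forall>x\<in>pts E. 0 \<le> nrm E x \<and> (nrm E x = 0 \<longleftrightarrow> x = 0)) \<and>
    (\<forall>x\<in>pts E. \<forall>y\<in>pts E. nrm E (x + y) \<le> nrm E x + nrm E y) \<and>
    (\<forall>c. \<forall>x\<in>pts E. nrm E (c *\<^sub>C x) = cmod c * nrm E x)"

definition cbanach_space :: "'a::complex_vector nspace \<Rightarrow> bool"
  where "cbanach_space E \<longleftrightarrow>
    cnormed_space E \<and>
    (\<forall>X :: nat \<Rightarrow> 'a.
      range X \<subseteq> pts E \<and> (\<forall>e>0. \<exists>N. \<forall>m\<ge>N. \<forall>n\<ge>N. nrm E (X m - X n) < e) \<longrightarrow>
      (\<exists>x\<in>pts E. (\<lambda>n. nrm E (X n - x)) \<longlonglongrightarrow> 0))"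

definition open_in :: "'a::complex_vector nspace \<Rightarrow> 'a set \<Rightarrow> bool"
  where "open_in E S \<longleftrightarrow>
    S \<subseteq> pts E \<and> (\<forall>x\<in>S. \<exists>d>0. \<forall>y\<in>pts E. nrm E (y - x) < d \<longrightarrow> y \<in> S)"

definition closed_in :: "'a::complex_vector nspace \<Rightarrow> 'a set \<Rightarrow> bool"
  where "closed_in E S \<longleftrightarrow> S \<subseteq> pts E \<and> open_in E (pts E - S)"

definition subspace_of :: "'a nspace \<Rightarrow> 'a set \<Rightarrow> 'a nspace"
  where "subspace_of E Z = \<lparr>pts = Z, nrm = nrm E\<rparr>"

definition scalars :: "complex nspace"
  where "scalars = \<lparr>pts = UNIV, nrm = cmod\<rparr>"

definition clinear_between ::
    "'a::complex_vector set \<Rightarrow> 'b::complex_vector set \<Rightarrow> ('a \<Rightarrow> 'b) \<Rightarrow> bool"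
  where "clinear_between X Y T \<longleftrightarrow>
    T ` X \<subseteq> Y \<and>
    (\<forall>x\<in>X. \<forall>y\<in>X. T (x + y) = T x + T y) \<and>
    (\<forall>c. \<forall>x\<in>X. T (c *\<^sub>C x) = c *\<^sub>C T x)"

definition bounded_clinear_between ::
    "'a::complex_vector nspace \<Rightarrow> 'b::complex_vector nspace \<Rightarrow> ('a \<Rightarrow> 'b) \<Rightarrow> bool"
  where "bounded_clinear_between E F T \<longleftrightarrow>
    clinear_between (pts E) (pts F) T \<and> (\<exists>K. \<forall>x\<in>pts E. nrm F (T x) \<le> K * nrm E x)"

definition banach_iso ::
    "'a::complex_vector nspace \<Rightarrow> 'b::complex_vector nspace \<Rightarrow> ('a \<Rightarrow> 'b) \<Rightarrow> bool"
  where "banach_iso E F T \<longleftrightarrow>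
    bij_betw T (pts E) (pts F) \<and>
    bounded_clinear_between E F T \<and> bounded_clinear_between F E (inv_into (pts E) T)"

text \<open>
  A map with domain \<open>S\<close> is represented by the function that vanishes outside \<open>S\<close>, so that
  such maps form a vector space and are equal iff they agree on \<open>S\<close>.
\<close>

definition zero_off :: "'a set \<Rightarrow> ('a \<Rightarrow> 'b::zero) \<Rightarrow> 'a \<Rightarrow> 'b"
  where "zero_off S f = (\<lambda>x. if x \<in> S then f x else 0)"

definition hom_space ::
    "'a::complex_vector nspace \<Rightarrow> 'b::complex_vector nspace \<Rightarrow> ('a \<Rightarrow> 'b) nspace"
  where "hom_space E F =
    \<lparr>pts = {T. bounded_clinear_between E F T \<and> (\<forall>x. x \<notin> pts E \<longrightarrow> T x = 0)},
     nrm = (\<lambda>T. SUP x\<in>{x\<in>pts E. nrm E x \<le> 1}. nrm F (T x))\<rparr>"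

definition dual_space :: "'a::complex_vector nspace \<Rightarrow> ('a \<Rightarrow> complex) nspace"
  where "dual_space E = hom_space E scalars"


section \<open>Smooth maps\<close>

definition has_fderiv ::
    "'a::complex_vector nspace \<Rightarrow> 'b::complex_vector nspace \<Rightarrow> ('a \<Rightarrow> 'b) \<Rightarrow> 'a \<Rightarrow> ('a \<Rightarrow> 'b) \<Rightarrow> bool"
  where "has_fderiv E F f x L \<longleftrightarrow>
    bounded_clinear_between E F L \<and>
    (\<forall>e>0. \<exists>d>0. \<forall>h\<in>pts E. nrm E h < d \<longrightarrow> nrm F (f (x + h) - f x - L h) \<le> e * nrm E h)"

text \<open>
  \<open>diff_times k\<close> asks for Frechet derivatives whose values in each fixed direction are again
  differentiable; for an individual \<open>k\<close> this is slightly weaker than being of class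
  \<open>C\<^sup>k\<close> for the operator norm, but on Banach spaces the conjunction over all \<open>k\<close> is
  exactly \<open>C\<^sup>\<infinity>\<close>.
\<close>

primrec diff_times ::
    "nat \<Rightarrow> 'a::complex_vector nspace \<Rightarrow> 'b::complex_vector nspace \<Rightarrow> 'a set \<Rightarrow> ('a \<Rightarrow> 'b) \<Rightarrow> bool"
  where
    "diff_times 0 E F S f \<longleftrightarrow>
      f ` S \<subseteq> pts F \<and>
      (\<forall>x\<in>S. \<forall>e>0. \<exists>d>0. \<forall>y\<in>S. nrm E (y - x) < d \<longrightarrow> nrm F (f y - f x) < e)"
  | "diff_times (Suc k) E F S f \<longleftrightarrow>
      f ` S \<subseteq> pts F \<and>
      (\<exists>D. (\<forall>x\<in>S. has_fderiv E F f x (D x)) \<and>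
           (\<forall>v\<in>pts E. diff_times k E F S (\<lambda>x. D x v)))"

definition smooth_map ::
    "'a::complex_vector nspace \<Rightarrow> 'b::complex_vector nspace \<Rightarrow> 'a set \<Rightarrow> ('a \<Rightarrow> 'b) \<Rightarrow> bool"
  where "smooth_map E F S f \<longleftrightarrow> (\<forall>k. diff_times k E F S f)"


section \<open>Banach manifolds\<close>

record ('i, 'm, 'e) atlas =
  index :: "'i set"
  chart_dom :: "'i \<Rightarrow> 'm set"
  chart :: "'i \<Rightarrow> 'm \<Rightarrow> 'e"
  model :: "'i \<Rightarrow> 'e nspace"

definition mcarrier :: "('i, 'm, 'e) atlas \<Rightarrow> 'm set"
  where "mcarrier A = (\<Union>i\<in>index A. chart_dom A i)"

definition inv_chart :: "('i, 'm, 'e) atlas \<Rightarrow> 'i \<Rightarrow> 'e \<Rightarrow> 'm"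
  where "inv_chart A i = inv_into (chart_dom A i) (chart A i)"

definition banach_manifold :: "('i, 'm, 'e::complex_vector) atlas \<Rightarrow> bool"
  where "banach_manifold A \<longleftrightarrow>
    (\<forall>i\<in>index A.
      cbanach_space (model A i) \<and>
      inj_on (chart A i) (chart_dom A i) \<and>
      open_in (model A i) (chart A i ` chart_dom A i)) \<and>
    (\<forall>i\<in>index A. \<forall>j\<in>index A.
      open_in (model A i) (chart A i ` (chart_dom A i \<inter> chart_dom A j)) \<and>
      smooth_map (model A i) (model A j) (chart A i ` (chart_dom A i \<inter> chart_dom A j))
        (chart A j \<circ> inv_chart A i))"

definition mopen :: "('i, 'm, 'e::complex_vector) atlas \<Rightarrow> 'm set \<Rightarrow> bool"
  where "mopen A U \<longleftrightarrow>
    U \<subseteq> mcarrier A \<and> (\<forall>i\<in>index A. open_in (model A i) (chart A i ` (U \<inter> chart_dom A i)))"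

definition msmooth ::
    "('i, 'm, 'e::complex_vector) atlas \<Rightarrow> 'f::complex_vector nspace \<Rightarrow> 'm set \<Rightarrow> ('m \<Rightarrow> 'f) \<Rightarrow> bool"
  where "msmooth A F U f \<longleftrightarrow>
    (\<forall>i\<in>index A. smooth_map (model A i) F (chart A i ` (U \<inter> chart_dom A i)) (f \<circ> inv_chart A i))"

text \<open>
  A tangent vector at \<open>p\<close> is the family of its representatives in all charts around \<open>p\<close>,
  related by the derivatives of the chart changes (an equivalence class of pairs of a chart and
  a vector of its model space, viewed as a function of the chart).
\<close>

definition tangent_space :: "('i, 'm, 'e::complex_vector) atlas \<Rightarrow> 'm \<Rightarrow> ('i \<Rightarrow> 'e) set"
  where "tangent_space A p = {v.
    (\<forall>i. \<not> (i \<in> index A \<and> p \<in> chart_dom A i) \<longrightarrow> v i = 0) \<and>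
    (\<forall>i\<in>index A. p \<in> chart_dom A i \<longrightarrow> v i \<in> pts (model A i)) \<and>
    (\<forall>i\<in>index A. \<forall>j\<in>index A. p \<in> chart_dom A i \<inter> chart_dom A j \<longrightarrow>
      (\<exists>L. has_fderiv (model A i) (model A j) (chart A j \<circ> inv_chart A i) (chart A i p) L \<and>
           v j = L (v i)))}"

definition tangent_chart :: "'i \<Rightarrow> ('i \<Rightarrow> 'e) \<Rightarrow> 'e"
  where "tangent_chart i v = v i"

text \<open>
  The norm of a tangent space is determined up to equivalence only: it is transported from the
  model space by a chart \<open>i\<close> around \<open>p\<close>.
\<close>

definition tangent_nspace :: "('i, 'm, 'e::complex_vector) atlas \<Rightarrow> 'i \<Rightarrow> 'm \<Rightarrow> ('i \<Rightarrow> 'e) nspace"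
  where "tangent_nspace A i p =
    \<lparr>pts = tangent_space A p, nrm = (\<lambda>v. nrm (model A i) (tangent_chart i v))\<rparr>"

definition cotangent_space :: "('i, 'm, 'e::complex_vector) atlas \<Rightarrow> 'm \<Rightarrow> (('i \<Rightarrow> 'e) \<Rightarrow> complex) set"
  where "cotangent_space A p =
    {\<alpha>. \<exists>i\<in>index A. p \<in> chart_dom A i \<and> \<alpha> \<in> pts (dual_space (tangent_nspace A i p))}"


section \<open>Banach vector bundles and subbundles\<close>

text \<open>
  The field \<open>triv k p\<close> is the fibre part, over \<open>p \<in> triv_dom k\<close>, of a trivialization with typical
  fibre \<open>typical k\<close>.
\<close>

record ('k, 'm, 'v, 'y) vbundle =
  fibre :: "'m \<Rightarrow> 'v set"
  triv_index :: "'k set"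
  triv_dom :: "'k \<Rightarrow> 'm set"
  typical :: "'k \<Rightarrow> 'y nspace"
  triv :: "'k \<Rightarrow> 'm \<Rightarrow> 'v \<Rightarrow> 'y"

definition total_space :: "('i, 'm, 'e) atlas \<Rightarrow> ('k, 'm, 'v, 'y) vbundle \<Rightarrow> ('m \<times> 'v) set"
  where "total_space A B = Sigma (mcarrier A) (fibre B)"

definition local_trivialization ::
    "('i, 'm, 'e::complex_vector) atlas \<Rightarrow> ('k, 'm, 'v::complex_vector, 'y::complex_vector) vbundle \<Rightarrow>
     'm set \<Rightarrow> 'y nspace \<Rightarrow> ('m \<Rightarrow> 'v \<Rightarrow> 'y) \<Rightarrow> bool"
  where "local_trivialization A B U Y \<sigma> \<longleftrightarrow>
    mopen A U \<and> cbanach_space Y \<and>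
    (\<forall>p\<in>U. clinear_between (fibre B p) (pts Y) (\<sigma> p) \<and> bij_betw (\<sigma> p) (fibre B p) (pts Y)) \<and>
    (\<forall>k\<in>triv_index B.
      msmooth A (hom_space Y (typical B k)) (U \<inter> triv_dom B k)
        (\<lambda>p. zero_off (pts Y) (triv B k p \<circ> inv_into (fibre B p) (\<sigma> p))) \<and>
      msmooth A (hom_space (typical B k) Y) (U \<inter> triv_dom B k)
        (\<lambda>p. zero_off (pts (typical B k)) (\<sigma> p \<circ> inv_into (fibre B p) (triv B k p))))"

text \<open>
  Typical fibres are taken in the type of the typical fibres of the bundle's atlas. This is no
  restriction, as the typical fibre of any trivialization near \<open>p\<close> is isomorphic to one of those.
\<close>

definition banach_subbundle ::
    "('i, 'm, 'e::complex_vector) atlas \<Rightarrow> ('k, 'm, 'v::complex_vector, 'y::complex_vector) vbundle \<Rightarrow>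
     ('m \<times> 'v) set \<Rightarrow> bool"
  where "banach_subbundle A B T \<longleftrightarrow>
    T \<subseteq> total_space A B \<and>
    (\<forall>p\<in>mcarrier A. \<exists>U Y \<sigma> Z.
      p \<in> U \<and> local_trivialization A B U Y \<sigma> \<and>
      csubspace Z \<and> closed_in Y Z \<and> (\<forall>q\<in>U. \<sigma> q ` (T `` {q}) = Z))"

text \<open>The trivialization of the cotangent bundle over a chart domain is the inverse transpose of
  the tangent map of the chart.\<close>

definition cotangent_bundle ::
    "('i, 'm, 'e::complex_vector) atlas \<Rightarrow> ('i, 'm, ('i \<Rightarrow> 'e) \<Rightarrow> complex, 'e \<Rightarrow> complex) vbundle"
  where "cotangent_bundle A =
    \<lparr>fibre = cotangent_space A,
     triv_index = index A,
     triv_dom = chart_dom A,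
     typical = (\<lambda>i. dual_space (model A i)),
     triv = (\<lambda>i p \<alpha>. zero_off (pts (model A i)) (\<alpha> \<circ> inv_into (tangent_space A p) (tangent_chart i)))\<rparr>"

text \<open>
  Each fibre carries the norm of the cotangent space, i.e. the dual norm. The isomorphism
  condition does not depend on the chart used to norm the tangent space.
\<close>

definition precotangent_bundle ::
    "('i, 'm, 'e::complex_vector) atlas \<Rightarrow> ('m \<times> (('i \<Rightarrow> 'e) \<Rightarrow> complex)) set \<Rightarrow> bool"
  where "precotangent_bundle A T \<longleftrightarrow>
    banach_manifold A \<and>
    banach_subbundle A (cotangent_bundle A) T \<and>
    (\<forall>p\<in>mcarrier A. \<forall>i\<in>index A. p \<in> chart_dom A i \<longrightarrow>
      banach_iso (tangent_nspace A i p)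
        (dual_space (subspace_of (dual_space (tangent_nspace A i p)) (T `` {p})))
        (\<lambda>v. zero_off (T `` {p}) (\<lambda>\<mu>. \<mu> v)))"


section \<open>Operators on a Hilbert space\<close>

definition closed_csubspace :: "'h::chilbert_space set \<Rightarrow> bool"
  where "closed_csubspace V \<longleftrightarrow> csubspace V \<and> closed V"

definition orth :: "'h::chilbert_space set \<Rightarrow> 'h set"
  where "orth V = {x. \<forall>y\<in>V. cinner y x = 0}"

definition orth_proj :: "'h::chilbert_space set \<Rightarrow> 'h \<Rightarrow> 'h"
  where "orth_proj V x = (THE y. y \<in> V \<and> x - y \<in> orth V)"

definition bounded_clinear :: "('h::chilbert_space \<Rightarrow> 'h) \<Rightarrow> bool"
  where "bounded_clinear T \<longleftrightarrow> bounded_linear T \<and> (\<forall>c x. T (c *\<^sub>C x) = c *\<^sub>C T x)"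

definition orthonormal_basis :: "'h::chilbert_space set \<Rightarrow> bool"
  where "orthonormal_basis B \<longleftrightarrow>
    (\<forall>e\<in>B. \<forall>f\<in>B. cinner e f = (if e = f then 1 else 0)) \<and> closure (cspan B) = UNIV"

definition some_basis :: "'h::chilbert_space set"
  where "some_basis = (SOME B. orthonormal_basis B)"

definition adj :: "('h::chilbert_space \<Rightarrow> 'h) \<Rightarrow> 'h \<Rightarrow> 'h"
  where "adj T = (THE S. \<forall>x y. cinner (T x) y = cinner x (S y))"

definition positive_op :: "('h::chilbert_space \<Rightarrow> 'h) \<Rightarrow> bool"
  where "positive_op T \<longleftrightarrow> bounded_clinear T \<and> (\<forall>x. cinner x (T x) \<in> \<real> \<and> 0 \<le> Re (cinner x (T x)))"

definition abs_op :: "('h::chilbert_space \<Rightarrow> 'h) \<Rightarrow> 'h \<Rightarrow> 'h"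
  where "abs_op T = (THE S. positive_op S \<and> S \<circ> S = adj T \<circ> T)"

text \<open>The notions below do not depend on the orthonormal basis chosen.\<close>

definition trace_class :: "('h::chilbert_space \<Rightarrow> 'h) \<Rightarrow> bool"
  where "trace_class T \<longleftrightarrow>
    bounded_clinear T \<and> (\<lambda>e. cinner e (abs_op T e)) summable_on some_basis"

definition op_trace :: "('h::chilbert_space \<Rightarrow> 'h) \<Rightarrow> complex"
  where "op_trace T = (\<Sum>\<^sub>\<infinity>e\<in>some_basis. cinner e (T e))"

definition trace_norm :: "('h::chilbert_space \<Rightarrow> 'h) \<Rightarrow> real"
  where "trace_norm T = Re (op_trace (abs_op T))"

definition compact_op :: "('h::chilbert_space \<Rightarrow> 'h) \<Rightarrow> bool"
  where "compact_op T \<longleftrightarrow> bounded_clinear T \<and> compact (closure (T ` cball 0 1))"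

text \<open>
  An operator from a closed subspace \<open>X\<close> to a closed subspace \<open>Y\<close> is identified with its extension
  by zero on the orthogonal complement of \<open>X\<close>; this preserves composition, compactness, the trace
  class, and the trace norm.
\<close>

definition ops :: "'h::chilbert_space set \<Rightarrow> 'h set \<Rightarrow> ('h \<Rightarrow> 'h) set"
  where "ops X Y = {T. bounded_clinear T \<and> (\<forall>x\<in>orth X. T x = 0) \<and> range T \<subseteq> Y}"

definition L1 :: "'h::chilbert_space set \<Rightarrow> 'h set \<Rightarrow> ('h \<Rightarrow> 'h) nspace"
  where "L1 X Y = \<lparr>pts = {T \<in> ops X Y. trace_class T}, nrm = trace_norm\<rparr>"

definition L0 :: "'h::chilbert_space set \<Rightarrow> 'h set \<Rightarrow> ('h \<Rightarrow> 'h) set"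
  where "L0 X Y = {T \<in> ops X Y. compact_op T}"

definition hsubspace :: "'h::chilbert_space set \<Rightarrow> 'h nspace"
  where "hsubspace V = \<lparr>pts = V, nrm = norm\<rparr>"

definition fredholm :: "'h::chilbert_space set \<Rightarrow> 'h set \<Rightarrow> ('h \<Rightarrow> 'h) \<Rightarrow> bool"
  where "fredholm X Y T \<longleftrightarrow>
    bounded_clinear_between (hsubspace X) (hsubspace Y) T \<and>
    cfinite_dim {x\<in>X. T x = 0} \<and>
    closed (T ` X) \<and>
    (\<exists>B. finite B \<and> B \<subseteq> Y \<and> (\<forall>y\<in>Y. \<exists>x\<in>X. \<exists>b\<in>cspan B. y = T x + b))"


section \<open>The restricted Grassmannian\<close>

definition polarized :: "'h::chilbert_space set \<Rightarrow> 'h set \<Rightarrow> bool"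
  where "polarized Hm Hp \<longleftrightarrow>
    (\<exists>D :: 'h set. countable D \<and> closure D = UNIV) \<and>
    closed_csubspace Hm \<and> closed_csubspace Hp \<and>
    \<not> cfinite_dim Hm \<and> \<not> cfinite_dim Hp \<and>
    (\<forall>x\<in>Hm. \<forall>y\<in>Hp. cinner x y = 0) \<and>
    (\<forall>x. \<exists>a\<in>Hm. \<exists>b\<in>Hp. x = a + b)"

definition Gr1res :: "'h::chilbert_space set \<Rightarrow> 'h set \<Rightarrow> 'h set set"
  where "Gr1res Hm Hp =
    {W. closed_csubspace W \<and> fredholm W Hp (orth_proj Hp) \<and> orth_proj Hm \<circ> orth_proj W \<in> pts (L1 W Hm)}"

definition Omega :: "'h::chilbert_space set \<Rightarrow> 'h set \<Rightarrow> 'h set \<Rightarrow> 'h set set"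
  where "Omega Hm Hp V =
    {W \<in> Gr1res Hm Hp. V \<inter> orth W = {0} \<and> (\<forall>x. \<exists>a\<in>V. \<exists>b\<in>orth W. x = a + b)}"

definition phi :: "'h::chilbert_space set \<Rightarrow> 'h set \<Rightarrow> 'h \<Rightarrow> 'h"
  where "phi V W =
    orth_proj (orth V) \<circ> orth_proj W \<circ> orth_proj V \<circ> inv_into V (orth_proj V \<circ> orth_proj W \<circ> orth_proj V) \<circ> orth_proj V"

definition Gr_atlas ::
    "'h::chilbert_space set \<Rightarrow> 'h set \<Rightarrow> ('h set, 'h set, 'h \<Rightarrow> 'h) atlas"
  where "Gr_atlas Hm Hp =
    \<lparr>index = Gr1res Hm Hp,
     chart_dom = Omega Hm Hp,
     chart = phi,
     model = (\<lambda>V. L1 V (orth V))\<rparr>"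

end

theory Submission
  imports Defs
begin

text \<open>
  The chart \<open>\<phi>\<^sub>V\<close> sends \<open>W\<close> to \<open>J - P\<^sub>V\<close>, where \<open>J\<close> is the (oblique) projection onto \<open>W\<close> along
  \<open>V\<^sup>\<bottom>\<close>, and the Grassmannian consists of the closed \<open>W\<close> for which \<open>P\<^sub>W - P\<^sub>+\<close> is of trace class. If
  \<open>J, J'\<close> project onto \<open>U, U'\<close> along \<open>V\<^sup>\<bottom>\<close> and \<open>Q, Q'\<close> project onto \<open>U, U'\<close> along \<open>W\<^sup>\<bottom>\<close>, then
  \<open>J' - J = (1 - J) (Q' - Q) J'\<close>. Hence the change from the chart at \<open>W\<close> to the one at \<open>V\<close> has the
  derivative \<open>K \<mapsto> (1 - J) K J\<close>, which is polynomial in \<open>J\<close>, so that smoothness follows by induction.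

  Since \<open>Tr (\<mu> (1 - J) K J) = Tr (J \<mu> (1 - J) K)\<close>, the transposed derivative maps functionals given by
  compact operators to functionals of the same kind; thus the fibre does not depend on the chart. It is
  closed because the trace pairing embeds the compact operators isometrically into the dual of the
  trace-class operators, and the duality \<open>(L\<^sup>0)\<^sup>* = L\<^sup>1\<close> makes it a predual of the tangent space.
\<close>

section \<open>Inner product spaces and orthogonal projections\<close>

text \<open>The trace norm is defined through \<open>abs_op\<close> and one chosen basis, a form in
  which not even the triangle inequality is visible. The proof therefore works with inequalities
  over finite subsets of \<open>some_basis\<close>: \<open>hs_bound\<close> for Hilbert-Schmidt
  operators and \<open>trace_bound\<close> for trace-class ones. Square roots and the polar
  decomposition serve to connect them with the definition. Boundedness of the oblique projections
  comes from compactness: P_V - P_W is of trace class, hence compact, so P_W is bounded below on V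
  as soon as V meets the orthogonal complement of W trivially. The same kind of argument yields the
  Fredholm property. The model spaces change with the chart, but extension by zero places all of
  them inside the operators on the whole space, where J and K compose freely. Since
  \<open>diff_times\<close> differentiates in fixed directions, the direction K stays constant
  during the induction, and the calculus reduces to sums, bounded linear maps and bounded bilinear
  maps.\<close>

lemma cinner_add_left: "cinner (x + y) z = cinner x z + cinner y (z::'h::chilbert_space)"
  by (metis cinner_commute cinner_add_right complex_cnj_add)

lemma cinner_scaleC_left: "cinner (c *\<^sub>C x) y = cnj c * cinner x (y::'h::chilbert_space)"
  by (metis cinner_commute cinner_scaleC_right complex_cnj_mult)

lemma cinner_zero_right [simp]: "cinner x (0::'h::chilbert_space) = 0"
  using cinner_add_right[of x 0 0] by simp

lemma cinner_zero_left [simp]: "cinner (0::'h::chilbert_space) x = 0"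
  using cinner_add_left[of 0 0 x] by simp

lemma cinner_minus_right: "cinner x (- y) = - cinner x (y::'h::chilbert_space)"
  by (metis add.inverse_unique cinner_add_right cinner_zero_right right_minus)

lemma cinner_minus_left: "cinner (- x) y = - cinner x (y::'h::chilbert_space)"
  by (metis add.inverse_unique cinner_add_left cinner_zero_left right_minus)

lemma cinner_diff_right: "cinner x (y - z) = cinner x y - cinner x (z::'h::chilbert_space)"
  using cinner_add_right[of x y "- z"] by (simp add: cinner_minus_right)

lemma cinner_diff_left: "cinner (x - y) z = cinner x z - cinner y (z::'h::chilbert_space)"
  using cinner_add_left[of x "- y" z] by (simp add: cinner_minus_left)

lemma cinner_sum_right: "cinner x (\<Sum>i\<in>I. f i) = (\<Sum>i\<in>I. cinner x (f i :: 'h::chilbert_space))"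
  by (induction I rule: infinite_finite_induct) (simp_all add: cinner_add_right)

lemma cinner_sum_left: "cinner (\<Sum>i\<in>I. f i) x = (\<Sum>i\<in>I. cinner (f i) (x :: 'h::chilbert_space))"
  by (induction I rule: infinite_finite_induct) (simp_all add: cinner_add_left)

lemmas cinner_simps = cinner_add_left cinner_add_right cinner_diff_left cinner_diff_right
  cinner_scaleC_left cinner_scaleC_right cinner_minus_left cinner_minus_right

lemma scaleC_zero_left [simp]: "0 *\<^sub>C x = (0::'a::complex_vector)"
  by (rule complex_vector.scale_zero_left)

lemma scaleC_zero_right [simp]: "c *\<^sub>C 0 = (0::'a::complex_vector)"
  by (rule complex_vector.scale_zero_right)

lemma scaleC_minus1: "(-1) *\<^sub>C x = - (x::'a::complex_vector)"
  by (metis complex_vector.scale_minus_left scaleC_one)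

declare scaleC_one [simp]

lemma cinner_self_norm: "cmod (cinner x x) = (norm (x::'h::chilbert_space))\<^sup>2"
  by (simp add: cinner_self norm_power)

lemma Re_cinner_self: "Re (cinner x x) = (norm (x::'h::chilbert_space))\<^sup>2"
  by (simp add: cinner_self)

lemma cinner_self_eq_0 [simp]: "cinner x x = 0 \<longleftrightarrow> x = (0::'h::chilbert_space)"
  by (simp add: cinner_self)

lemma norm_scaleC: "norm (c *\<^sub>C x) = cmod c * norm (x::'h::chilbert_space)"
proof -
  have "(norm (c *\<^sub>C x))\<^sup>2 = cmod (cinner (c *\<^sub>C x) (c *\<^sub>C x))"
    by (simp only: cinner_self_norm)
  also have "\<dots> = (cmod c * norm x)\<^sup>2"
    by (simp add: cinner_simps norm_mult cinner_self_norm power2_eq_square)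
  finally show ?thesis
    by (simp add: power2_eq_iff_nonneg)
qed

lemma norm_add_sq: "(norm (x + y))\<^sup>2 = (norm x)\<^sup>2 + 2 * Re (cinner x y) + (norm (y::'h::chilbert_space))\<^sup>2"
proof -
  have "Re (cinner y x) = Re (cinner x y)"
    by (metis cinner_commute cnj.simps(1))
  then show ?thesis
    by (simp flip: Re_cinner_self add: cinner_simps)
qed

lemma norm_diff_sq: "(norm (x - y))\<^sup>2 = (norm x)\<^sup>2 - 2 * Re (cinner x y) + (norm (y::'h::chilbert_space))\<^sup>2"
  using norm_add_sq[of x "- y"] by (simp add: cinner_simps)

text \<open>Pythagoras for the component of \<open>x\<close> along \<open>v\<close>. The same
  identity yields Cauchy-Schwarz and the variational argument for nearest points.\<close>

lemma norm_diff_component_sq: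
  fixes x v :: "'h::chilbert_space"
  assumes "v \<noteq> 0"
  shows "(norm (x - (cinner v x / (norm v)\<^sup>2) *\<^sub>C v))\<^sup>2 = (norm x)\<^sup>2 - (cmod (cinner v x))\<^sup>2 / (norm v)\<^sup>2"
proof -
  let ?a = "cinner v x"
  have "Re (cinner x ((?a / (norm v)\<^sup>2) *\<^sub>C v)) = (cmod ?a)\<^sup>2 / (norm v)\<^sup>2"
  proof -
    have "cinner x ((?a / (norm v)\<^sup>2) *\<^sub>C v) = ?a * cnj ?a / (norm v)\<^sup>2"
      by (subst (2) cinner_commute) (simp add: cinner_simps)
    also have "\<dots> = complex_of_real ((cmod ?a)\<^sup>2 / (norm v)\<^sup>2)"
      by (subst complex_norm_square[symmetric]) simp
    finally show ?thesis by (metis Re_complex_of_real)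
  qed
  moreover have "(norm ((?a / (norm v)\<^sup>2) *\<^sub>C v))\<^sup>2 = (cmod ?a)\<^sup>2 / (norm v)\<^sup>2"
  proof -
    have "cmod (?a / (norm v)\<^sup>2) = cmod ?a / (norm v)\<^sup>2"
      by (simp add: norm_divide norm_power)
    then have "norm ((?a / (norm v)\<^sup>2) *\<^sub>C v) = cmod ?a / norm v"
      using assms by (simp add: norm_scaleC power2_eq_square)
    then show ?thesis by (simp add: power_divide)
  qed
  ultimately show ?thesis by (simp add: norm_diff_sq)
qed

lemma cauchy_schwarz: "cmod (cinner x y) \<le> norm x * norm (y::'h::chilbert_space)"
proof (cases "x = 0")
  case False
  have "0 \<le> (norm y)\<^sup>2 - (cmod (cinner x y))\<^sup>2 / (norm x)\<^sup>2"
    by (subst norm_diff_component_sq[OF False, symmetric]) simp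
  then have "(cmod (cinner x y))\<^sup>2 \<le> (norm x * norm y)\<^sup>2"
    using False by (simp add: field_simps power_mult_distrib)
  then show ?thesis by (simp add: power2_le_iff_abs_le)
qed simp

interpretation cinner: bounded_bilinear "cinner :: 'h::chilbert_space \<Rightarrow> 'h \<Rightarrow> complex"
proof
  show "cinner (r *\<^sub>R a) b = r *\<^sub>R cinner a b" for r and a b :: 'h
    by (simp add: scaleR_scaleC cinner_scaleC_left scaleR_conv_of_real)
  show "cinner a (r *\<^sub>R b) = r *\<^sub>R cinner a b" for r and a b :: 'h
    by (simp add: scaleR_scaleC cinner_scaleC_right scaleR_conv_of_real)
  show "\<exists>K. \<forall>a b::'h. norm (cinner a b) \<le> norm a * norm b * K"
    by (intro exI[of _ 1]) (simp add: cauchy_schwarz)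
qed (simp_all add: cinner_add_left cinner_add_right)

lemma cinner_ext: "(\<And>z. cinner z x = cinner z y) \<Longrightarrow> x = (y::'h::chilbert_space)"
  using cinner_self_eq_0[of "x - y"] by (simp add: cinner_diff_right)

lemma parallelogram: "(norm (x + y))\<^sup>2 + (norm (x - y))\<^sup>2 = 2 * (norm x)\<^sup>2 + 2 * (norm (y::'h::chilbert_space))\<^sup>2"
  by (simp add: norm_add_sq norm_diff_sq)

lemma pythagoras: "cinner x y = 0 \<Longrightarrow> (norm (x + y))\<^sup>2 = (norm x)\<^sup>2 + (norm (y::'h::chilbert_space))\<^sup>2"
  by (simp add: norm_add_sq)

lemma cinner_eq_0_commute: "cinner x y = 0 \<longleftrightarrow> cinner y (x::'h::chilbert_space) = 0"
  by (metis cinner_commute complex_cnj_zero)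

section \<open>Orthogonal complements and orthogonal projections\<close>

lemma csubspace_orth [simp]: "csubspace (orth V)"
  unfolding complex_vector.subspace_def orth_def by (simp add: cinner_simps)

lemma closed_orth [simp]: "closed (orth (V::'h::chilbert_space set))"
proof -
  have "orth V = (\<Inter>y\<in>V. {x. cinner y x = 0})"
    by (auto simp: orth_def)
  also have "closed \<dots>"
    by (intro closed_INT ballI closed_Collect_eq continuous_intros cinner.continuous_on)
  finally show ?thesis .
qed

lemma closed_csubspace_orth [simp]: "closed_csubspace (orth V)"
  by (simp add: closed_csubspace_def)

lemma closed_csubspaceD: "closed_csubspace V \<Longrightarrow> csubspace V" "closed_csubspace V \<Longrightarrow> closed V"
  by (simp_all add: closed_csubspace_def)

text \<open>A minimizing sequence is Cauchy: midpoints stay in \<open>V\<close> and so cannot be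
  nearer to \<open>x\<close> than the infimum \<open>d\<close>, and the parallelogram law turns this
  into a bound on the distances.\<close>

lemma nearest_point_exists:
  fixes V :: "'h::chilbert_space set"
  assumes V: "closed_csubspace V"
  obtains y where "y \<in> V" "\<And>v. v \<in> V \<Longrightarrow> norm (x - y) \<le> norm (x - v)"
proof -
  have ne: "V \<noteq> {}" using V complex_vector.subspace_0 closed_csubspace_def by blast
  define d where "d = Inf ((\<lambda>v. norm (x - v)) ` V)"
  have bdd: "bdd_below ((\<lambda>v. norm (x - v)) ` V)" by (rule bdd_belowI2[of _ 0]) simp
  have dle: "d \<le> norm (x - v)" if "v \<in> V" for v
    unfolding d_def using that bdd by (auto intro: cINF_lower)
  have d0: "0 \<le> d" unfolding d_def using ne by (auto intro: cINF_greatest)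
  have "\<exists>y\<in>V. norm (x - y) < d + 1 / Suc n" for n
  proof -
    have "Inf ((\<lambda>v. norm (x - v)) ` V) < d + 1 / Suc n" by (simp add: d_def)
    then show ?thesis using ne by (metis (no_types, lifting) bdd cINF_less_iff)
  qed
  then obtain y where yV: "\<And>n. y n \<in> V" and y: "\<And>n. norm (x - y n) < d + 1 / Suc n" by metis
  have lim: "(\<lambda>n. norm (x - y n)) \<longlonglongrightarrow> d"
  proof (rule tendsto_sandwich)
    show "(\<lambda>n. d) \<longlonglongrightarrow> d" by simp
    show "(\<lambda>n. d + 1 / Suc n) \<longlonglongrightarrow> d"
      using tendsto_add[OF tendsto_const LIMSEQ_inverse_real_of_nat, of d] by (simp add: inverse_eq_divide)
    show "\<forall>\<^sub>F n in sequentially. norm (x - y n) \<le> d + 1 / Suc n"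
      by (rule always_eventually) (blast intro: less_imp_le y)
    show "\<forall>\<^sub>F n in sequentially. d \<le> norm (x - y n)"
      by (rule always_eventually) (blast intro: dle yV)
  qed
  have par: "(norm (y m - y n))\<^sup>2 \<le> 2 * ((norm (x - y m))\<^sup>2 - d\<^sup>2) + 2 * ((norm (x - y n))\<^sup>2 - d\<^sup>2)" for m n
  proof -
    have mid: "(1/2) *\<^sub>C (y m + y n) \<in> V"
      using V yV by (simp add: closed_csubspace_def complex_vector.subspace_add complex_vector.subspace_scale)
    have "(x - y m) + (x - y n) = 2 *\<^sub>R (x - (1/2) *\<^sub>R (y m + y n))"
      by (simp add: algebra_simps scaleR_2)
    then have "norm ((x - y m) + (x - y n)) = 2 * norm (x - (1/2) *\<^sub>R (y m + y n))"
      by simp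
    moreover have "d \<le> norm (x - (1/2) *\<^sub>R (y m + y n))"
      using dle[OF mid] by (simp add: scaleR_scaleC)
    ultimately have "2 * d \<le> norm ((x - y m) + (x - y n))" by simp
    then have "4 * d\<^sup>2 \<le> (norm ((x - y m) + (x - y n)))\<^sup>2"
      using d0 power_mono[of "2*d" _ 2] by (simp add: power_mult_distrib)
    moreover have "(x - y m) - (x - y n) = y n - y m" by simp
    ultimately show ?thesis
      using parallelogram[of "x - y m" "x - y n"] by (simp add: norm_minus_commute)
  qed
  have sq: "(\<lambda>n. (norm (x - y n))\<^sup>2 - d\<^sup>2) \<longlonglongrightarrow> 0"
    using tendsto_diff[OF tendsto_power[OF lim, of 2] tendsto_const[of "d\<^sup>2"]] by simp
  have "Cauchy y"
  proof (rule metric_CauchyI)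
    fix e :: real assume e: "0 < e"
    then have "0 < e\<^sup>2 / 4" by simp
    then obtain N where N: "\<And>n. n \<ge> N \<Longrightarrow> (norm (x - y n))\<^sup>2 - d\<^sup>2 < e\<^sup>2 / 4"
      using sq unfolding LIMSEQ_iff by (metis abs_less_iff diff_zero real_norm_def)
    show "\<exists>M. \<forall>m\<ge>M. \<forall>n\<ge>M. dist (y m) (y n) < e"
    proof (intro exI allI impI)
      fix m n assume "N \<le> m" "N \<le> n"
      then have "2 * ((norm (x - y m))\<^sup>2 - d\<^sup>2) + 2 * ((norm (x - y n))\<^sup>2 - d\<^sup>2) < 2 * (e\<^sup>2 / 4) + 2 * (e\<^sup>2 / 4)"
        by (intro add_strict_mono mult_strict_left_mono N) simp_all
      then have "(norm (y m - y n))\<^sup>2 < e\<^sup>2"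
        using par[of m n] by simp
      then show "dist (y m) (y n) < e"
        using e by (simp add: dist_norm power2_less_imp_less)
    qed
  qed
  then obtain l where l: "y \<longlonglongrightarrow> l" using Cauchy_convergent_iff convergent_def by blast
  have "l \<in> V" using V yV l closed_sequentially unfolding closed_csubspace_def by metis
  moreover have "norm (x - l) = d"
    using LIMSEQ_unique[OF tendsto_norm[OF tendsto_diff[OF tendsto_const[of x] l]] lim] .
  ultimately show thesis using that dle by metis
qed

lemma nearest_point_orth:
  fixes V :: "'h::chilbert_space set"
  assumes V: "csubspace V" and y: "y \<in> V" and min: "\<And>v. v \<in> V \<Longrightarrow> norm (x - y) \<le> norm (x - v)"
  shows "x - y \<in> orth V"
  unfolding orth_def
proof (intro CollectI ballI)
  fix v assume v: "v \<in> V"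
  show "cinner v (x - y) = 0"
  proof (cases "v = 0")
    case False
    \<comment> \<open>The optimal step length in the direction \<open>v\<close>: a nonzero inner
      product would bring \<open>y\<close> strictly closer to \<open>x\<close>.\<close>
    let ?c = "cinner v (x - y) / (norm v)\<^sup>2"
    have "y + ?c *\<^sub>C v \<in> V"
      by (intro complex_vector.subspace_add complex_vector.subspace_scale V y v)
    from min[OF this] have "norm (x - y) \<le> norm ((x - y) - ?c *\<^sub>C v)"
      by (simp add: algebra_simps)
    then have "(norm (x - y))\<^sup>2 \<le> (norm ((x - y) - ?c *\<^sub>C v))\<^sup>2" by simp
    then have "(cmod (cinner v (x - y)))\<^sup>2 / (norm v)\<^sup>2 \<le> 0"
      using norm_diff_component_sq[OF False, of "x - y"] by linarith
    then show ?thesis using False by (simp add: field_simps)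
  qed simp
qed

lemma orth_proj_unique:
  assumes "csubspace V" "y \<in> V" "x - y \<in> orth V" "z \<in> V" "x - z \<in> orth V"
  shows "y = (z::'h::chilbert_space)"
proof -
  have "y - z \<in> V" using assms complex_vector.subspace_diff by blast
  moreover have "(x - z) - (x - y) \<in> orth V" by (rule complex_vector.subspace_diff) (use assms in auto)
  ultimately have "cinner (y - z) (y - z) = 0" by (simp add: orth_def)
  then show ?thesis by simp
qed

lemma orth_proj_props:
  assumes V: "closed_csubspace V"
  shows "orth_proj V x \<in> V \<and> x - orth_proj V x \<in> orth V"
  unfolding orth_proj_def
proof (rule theI')
  obtain y where "y \<in> V" "\<And>v. v \<in> V \<Longrightarrow> norm (x - y) \<le> norm (x - v)"
    using nearest_point_exists[OF V] by metis
  then show "\<exists>!y. y \<in> V \<and> x - y \<in> orth V"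
    using nearest_point_orth orth_proj_unique closed_csubspaceD(1)[OF V] by metis
qed

lemma orth_proj_in: "closed_csubspace V \<Longrightarrow> orth_proj V x \<in> V"
  and orth_proj_compl: "closed_csubspace V \<Longrightarrow> x - orth_proj V x \<in> orth V"
  using orth_proj_props by blast+

lemma orth_proj_eqI: "closed_csubspace V \<Longrightarrow> y \<in> V \<Longrightarrow> x - y \<in> orth V \<Longrightarrow> orth_proj V x = y"
  using orth_proj_unique orth_proj_props closed_csubspaceD(1) by metis

lemma orth_proj_fixes: "closed_csubspace V \<Longrightarrow> x \<in> V \<Longrightarrow> orth_proj V x = x"
  by (rule orth_proj_eqI) (simp_all add: complex_vector.subspace_0)

lemma orth_proj_idem [simp]: "closed_csubspace V \<Longrightarrow> orth_proj V (orth_proj V x) = orth_proj V x"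
  by (simp add: orth_proj_fixes orth_proj_in)

lemma orth_proj_eq_0_iff: "closed_csubspace V \<Longrightarrow> orth_proj V x = 0 \<longleftrightarrow> x \<in> orth V"
  by (metis complex_vector.subspace_0 closed_csubspaceD(1) diff_zero orth_proj_compl orth_proj_eqI)

lemma cinner_orth_proj: 
  assumes "closed_csubspace V"
  shows "cinner (orth_proj V x) y = cinner x (orth_proj V y)"
proof -
  have "cinner (orth_proj V x) (y - orth_proj V y) = 0"
    using orth_proj_props[OF assms] unfolding orth_def by blast
  moreover have "cinner (x - orth_proj V x) (orth_proj V y) = 0"
    using orth_proj_props[OF assms] unfolding orth_def cinner_eq_0_commute[of "x - _"] by blast
  ultimately show ?thesis by (simp add: cinner_simps)
qed

text \<open>For \<open>x\<close> in the double complement, the vector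
  \<open>x - orth_proj V x\<close> is orthogonal both to \<open>x\<close> and to its projection,
  hence to itself.\<close>

lemma orth_orth [simp]:
  assumes "closed_csubspace V"
  shows "orth (orth V) = (V::'h::chilbert_space set)"
proof
  show "V \<subseteq> orth (orth V)" by (auto simp: orth_def) (metis cinner_eq_0_commute)
  show "orth (orth V) \<subseteq> V"
  proof
    fix x assume x: "x \<in> orth (orth V)"
    let ?z = "x - orth_proj V x"
    have z: "?z \<in> orth V" by (rule orth_proj_compl[OF assms])
    then have "cinner ?z x = 0" using x by (simp add: orth_def)
    moreover have "cinner ?z (orth_proj V x) = 0"
      using z orth_proj_in[OF assms] by (subst cinner_eq_0_commute) (simp add: orth_def)
    ultimately have "cinner ?z ?z = 0" by (simp only: cinner_diff_right diff_self)
    then show "x \<in> V" using orth_proj_in[OF assms, of x] by simp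
  qed
qed

lemma orth_proj_orth: "closed_csubspace V \<Longrightarrow> orth_proj (orth V) x = x - orth_proj V x"
  by (rule orth_proj_eqI) (simp_all add: orth_proj_compl orth_proj_in)

lemma norm_orth_proj_le: "closed_csubspace V \<Longrightarrow> norm (orth_proj V x) \<le> norm (x::'h::chilbert_space)"
proof -
  assume V: "closed_csubspace V"
  have "cinner (orth_proj V x) (x - orth_proj V x) = 0"
    using orth_proj_props[OF V] unfolding orth_def by blast
  from pythagoras[OF this] have "(norm (orth_proj V x))\<^sup>2 \<le> (norm x)\<^sup>2" by simp
  then show ?thesis by simp
qed


section \<open>Bounded operators\<close>

lemma bounded_clinearI:
  assumes "\<And>x y. T (x + y) = T x + T y" "\<And>c x. T (c *\<^sub>C x) = c *\<^sub>C T x" "\<And>x. norm (T x) \<le> K * norm x"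
  shows "bounded_clinear T"
  unfolding bounded_clinear_def
  by (intro conjI bounded_linear_intro[of T K]) (use assms in \<open>simp_all add: scaleR_scaleC mult.commute\<close>)

lemma bounded_clinear_imp_bounded_linear: "bounded_clinear T \<Longrightarrow> bounded_linear T"
  by (simp add: bounded_clinear_def)

lemma bounded_clinear_add: "bounded_clinear T \<Longrightarrow> T (x + y) = T x + T y"
  by (simp add: bounded_clinear_def linear_simps)

lemma bounded_clinear_diff: "bounded_clinear T \<Longrightarrow> T (x - y) = T x - T y"
  by (simp add: bounded_clinear_def linear_simps)

lemma bounded_clinear_minus: "bounded_clinear T \<Longrightarrow> T (- x) = - T x"
  by (simp add: bounded_clinear_def linear_simps)

lemma bounded_clinear_zero: "bounded_clinear T \<Longrightarrow> T 0 = 0"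
  by (simp add: bounded_clinear_def linear_simps)

lemma bounded_clinear_scaleC: "bounded_clinear T \<Longrightarrow> T (c *\<^sub>C x) = c *\<^sub>C T x"
  by (simp add: bounded_clinear_def)

lemma bounded_clinear_sum: "bounded_clinear T \<Longrightarrow> T (\<Sum>i\<in>I. f i) = (\<Sum>i\<in>I. T (f i))"
  by (induction I rule: infinite_finite_induct) (simp_all add: bounded_clinear_add bounded_clinear_zero)

lemmas bounded_clinear_simps = bounded_clinear_add bounded_clinear_diff bounded_clinear_minus
  bounded_clinear_zero bounded_clinear_scaleC

lemma bounded_clinear_norm: "bounded_clinear T \<Longrightarrow> norm (T x) \<le> onorm T * norm x"
  by (simp add: bounded_clinear_def onorm)

lemma bounded_clinear_tendsto: "bounded_clinear T \<Longrightarrow> (f \<longlongrightarrow> l) F \<Longrightarrow> ((\<lambda>x. T (f x)) \<longlongrightarrow> T l) F"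
  by (simp add: bounded_clinear_def bounded_linear.tendsto)

lemma onorm_nonneg: "bounded_clinear T \<Longrightarrow> 0 \<le> onorm T"
  by (simp add: bounded_clinear_def onorm_pos_le)

named_theorems bclin

lemma bounded_clinear_id [bclin]: "bounded_clinear id" "bounded_clinear (\<lambda>x. x)"
  by (rule bounded_clinearI[where K=1]; simp)+

lemma bounded_clinear_const_zero [bclin]: "bounded_clinear (\<lambda>x. 0)" "bounded_clinear 0"
  by (rule bounded_clinearI[where K=0]; simp)+

lemma bounded_clinear_compose [bclin]:
  assumes "bounded_clinear S" "bounded_clinear T"
  shows "bounded_clinear (S \<circ> T)"
proof (rule bounded_clinearI)
  fix x
  have "norm (S (T x)) \<le> onorm S * (onorm T * norm x)"
    by (meson assms bounded_clinear_norm mult_left_mono onorm_nonneg order_trans)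
  then show "norm ((S \<circ> T) x) \<le> (onorm S * onorm T) * norm x" by (simp add: mult.assoc)
qed (use assms in \<open>simp_all add: bounded_clinear_simps\<close>)

lemma bounded_clinear_compose_fun:
  "bounded_clinear S \<Longrightarrow> bounded_clinear T \<Longrightarrow> bounded_clinear (\<lambda>x. S (T x))"
  using bounded_clinear_compose[of S T] by (simp add: o_def)

lemma bounded_clinear_add_fun [bclin]:
  assumes "bounded_clinear S" "bounded_clinear T"
  shows "bounded_clinear (\<lambda>x. S x + T x)" "bounded_clinear (S + T)"
proof -
  show 1: "bounded_clinear (\<lambda>x. S x + T x)"
  proof (rule bounded_clinearI)
    show "norm (S x + T x) \<le> (onorm S + onorm T) * norm x" for x
      by (rule order_trans[OF norm_triangle_ineq])
         (use assms in \<open>simp add: distrib_right add_mono bounded_clinear_norm\<close>)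
  qed (use assms in \<open>simp_all add: bounded_clinear_simps scaleC_add_right\<close>)
  then show "bounded_clinear (S + T)" by (simp add: plus_fun_def)
qed

lemma bounded_clinear_scaleC_fun [bclin]:
  assumes "bounded_clinear T"
  shows "bounded_clinear (\<lambda>x. c *\<^sub>C T x)" "bounded_clinear (c *\<^sub>C T)"
proof -
  show 1: "bounded_clinear (\<lambda>x. c *\<^sub>C T x)"
  proof (rule bounded_clinearI)
    show "norm (c *\<^sub>C T x) \<le> (cmod c * onorm T) * norm x" for x
      using bounded_clinear_norm[OF assms, of x] by (simp add: norm_scaleC mult.assoc mult_left_mono)
  qed (use assms in \<open>simp_all add: bounded_clinear_simps scaleC_add_right scaleC_scaleC mult.commute\<close>)
  then show "bounded_clinear (c *\<^sub>C T)" by (simp add: scaleC_fun_def)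
qed

lemma bounded_clinear_scale: "bounded_clinear (\<lambda>x. c *\<^sub>C x)"
  by (rule bounded_clinear_scaleC_fun(1)[OF bounded_clinear_id(2)])

lemma bounded_clinear_minus_fun [bclin]:
  assumes "bounded_clinear T"
  shows "bounded_clinear (\<lambda>x. - T x)" "bounded_clinear (- T)"
  using bounded_clinear_scaleC_fun[OF assms, of "-1"] by (simp_all add: scaleC_minus1 fun_Compl_def)

lemma bounded_clinear_diff_fun [bclin]:
  assumes "bounded_clinear S" "bounded_clinear T"
  shows "bounded_clinear (\<lambda>x. S x - T x)" "bounded_clinear (S - T)"
  using bounded_clinear_add_fun[OF assms(1) bounded_clinear_minus_fun(1)[OF assms(2)]]
  by (simp_all add: fun_diff_def plus_fun_def)

lemma bounded_clinear_sum_fun [bclin]: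
  "(\<And>i. i \<in> I \<Longrightarrow> bounded_clinear (T i)) \<Longrightarrow> bounded_clinear (\<lambda>x. \<Sum>i\<in>I. T i x)"
  by (induction I rule: infinite_finite_induct) (simp_all add: bclin)

lemma bounded_clinear_orth_proj [bclin]: 
  assumes V: "closed_csubspace V"
  shows "bounded_clinear (orth_proj V)"
proof (rule bounded_clinearI)
  have sub: "csubspace V" using V closed_csubspaceD by blast
  fix x y c
  show "orth_proj V (x + y) = orth_proj V x + orth_proj V y"
  proof (rule orth_proj_eqI[OF V])
    have "(x - orth_proj V x) + (y - orth_proj V y) \<in> orth V"
      by (intro complex_vector.subspace_add orth_proj_compl V) simp
    then show "x + y - (orth_proj V x + orth_proj V y) \<in> orth V" by (simp add: algebra_simps)
  qed (intro complex_vector.subspace_add sub orth_proj_in V)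
  show "orth_proj V (c *\<^sub>C x) = c *\<^sub>C orth_proj V x"
  proof (rule orth_proj_eqI[OF V])
    have "c *\<^sub>C (x - orth_proj V x) \<in> orth V"
      by (intro complex_vector.subspace_scale orth_proj_compl V) simp
    then show "c *\<^sub>C x - c *\<^sub>C orth_proj V x \<in> orth V"
      by (simp add: complex_vector.scale_right_diff_distrib)
  qed (intro complex_vector.subspace_scale sub orth_proj_in V)
  show "norm (orth_proj V x) \<le> 1 * norm x" using norm_orth_proj_le[OF V] by simp
qed

lemma onorm_orth_proj_le: "closed_csubspace V \<Longrightarrow> onorm (orth_proj V) \<le> 1"
  by (rule onorm_bound) (simp_all add: norm_orth_proj_le)

lemma onorm_compose_le: "bounded_clinear S \<Longrightarrow> bounded_clinear T \<Longrightarrow> onorm (S \<circ> T) \<le> onorm S * onorm T"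
  by (intro onorm_compose bounded_clinear_imp_bounded_linear)

lemma closed_kernel: "bounded_clinear T \<Longrightarrow> closed_csubspace {x. T x = 0}"
  unfolding closed_csubspace_def
proof
  assume T: "bounded_clinear T"
  show "csubspace {x. T x = 0}"
    by (simp add: complex_vector.subspace_def bounded_clinear_simps[OF T])
  show "closed {x. T x = 0}"
    by (intro closed_Collect_eq continuous_on_const
        linear_continuous_on bounded_clinear_imp_bounded_linear T)
qed

lemma closed_fixpoints:
  assumes "bounded_clinear T"
  shows "closed_csubspace {x. T x = x}"
  using closed_kernel[OF bounded_clinear_diff_fun(1)[OF assms bounded_clinear_id(2)]] by simp

text \<open>The operator |x><y| of Dirac notation. These operators serve as test operators wherever
  a norm or a duality has to be recovered from traces.\<close>

definition rank1 :: "'h::chilbert_space \<Rightarrow> 'h \<Rightarrow> 'h \<Rightarrow> 'h"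
  where "rank1 x y z = cinner y z *\<^sub>C x"

lemma rank1_norm: "norm (rank1 x y z) \<le> (norm x * norm y) * norm z"
  using mult_left_mono[OF cauchy_schwarz[of y z], of "norm x"] by (simp add: rank1_def norm_scaleC algebra_simps)

lemma bounded_clinear_rank1 [bclin]: "bounded_clinear (rank1 x y)"
  by (rule bounded_clinearI[OF _ _ rank1_norm])
     (simp_all add: rank1_def cinner_simps scaleC_add_left scaleC_scaleC)

lemma onorm_rank1_le: "onorm (rank1 x y) \<le> norm x * norm y"
  by (rule onorm_bound) (simp_all add: rank1_norm)

text \<open>A vector \<open>u\<close> orthogonal to the kernel with \<open>f u\<close> nonzero
  determines \<open>f\<close>, because every \<open>x\<close> differs from a multiple of
  \<open>u\<close> by an element of the kernel; \<open>z\<close> is a rescaling of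
  \<open>u\<close>.\<close>

lemma riesz:
  fixes f :: "'h::chilbert_space \<Rightarrow> complex"
  assumes add: "\<And>x y. f (x + y) = f x + f y" and scale: "\<And>c x. f (c *\<^sub>C x) = c * f x"
    and bound: "\<And>x. cmod (f x) \<le> K * norm x"
  obtains z where "\<And>x. f x = cinner z x" 
proof (cases "\<forall>x. f x = 0")
  case True
  then show thesis using that[of 0] by simp
next
  case False
  then obtain w where w: "f w \<noteq> 0" by blast
  have bl: "bounded_linear f"
    by (rule bounded_linear_intro[of f K])
       (use assms in \<open>simp_all add: scaleR_scaleC scaleR_conv_of_real mult.commute\<close>)
  have f0: "f 0 = 0" using scale[of 0 0] by simp
  have fd: "f (x - y) = f x - f y" for x y using bl by (simp add: linear_simps)
  define N where "N = {x. f x = 0}"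
  have N: "closed_csubspace N"
    unfolding closed_csubspace_def N_def
  proof
    show "csubspace {x. f x = 0}"
      by (simp add: complex_vector.subspace_def f0 add scale)
    show "closed {x. f x = 0}"
      by (intro closed_Collect_eq continuous_on_const linear_continuous_on bl)
  qed
  define u where "u = w - orth_proj N w"
  have u: "u \<in> orth N" unfolding u_def by (rule orth_proj_compl[OF N])
  have fu: "f u = f w" using orth_proj_in[OF N, of w] by (simp add: u_def fd N_def)
  have u0: "u \<noteq> 0" using fu w f0 by auto
  define z where "z = cnj (f u / (norm u)\<^sup>2) *\<^sub>C u"
  have "f x = cinner z x" for x
  proof -
    have "x - (f x / f u) *\<^sub>C u \<in> N" using fu w by (simp add: N_def fd scale)
    then have "cinner (x - (f x / f u) *\<^sub>C u) u = 0" using u by (simp add: orth_def)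
    then have "cinner u (x - (f x / f u) *\<^sub>C u) = 0" using cinner_eq_0_commute by blast
    then have "cinner u x = (f x / f u) * (norm u)\<^sup>2" by (simp add: cinner_simps cinner_self)
    then show ?thesis using fu w u0 by (simp add: z_def cinner_simps)
  qed
  then show thesis by (rule that)
qed

section \<open>Adjoints\<close>

lemma adj_eqI: 
  fixes T :: "'h::chilbert_space \<Rightarrow> 'h"
  assumes "\<And>x y. cinner (T x) y = cinner x (S y)"
  shows "adj T = S"
  unfolding adj_def
proof (rule the_equality)
  show "\<forall>x y. cinner (T x) y = cinner x (S y)" using assms by blast
  show "\<And>R. \<forall>x y. cinner (T x) y = cinner x (R y) \<Longrightarrow> R = S"
    using assms cinner_ext by (metis ext)
qed

lemma form_adjoint_exists:
  fixes T :: "'h::chilbert_space \<Rightarrow> 'h"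
  assumes T: "bounded_clinear T"
  obtains S where "\<And>x y. cinner (T x) y = cinner x (S y)"
proof -
  have "\<exists>z. \<forall>x. cinner y (T x) = cinner z x" for y
  proof -
    have "cmod (cinner y (T x)) \<le> (norm y * onorm T) * norm x" for x
      by (rule order_trans[OF cauchy_schwarz])
         (use bounded_clinear_norm[OF T, of x] in \<open>simp add: mult.assoc mult_left_mono\<close>)
    then obtain z where "\<And>x. cinner y (T x) = cinner z x"
      using riesz[of "\<lambda>x. cinner y (T x)" "norm y * onorm T"] T
      by (metis bounded_clinear_add bounded_clinear_scaleC cinner_add_right cinner_scaleC_right)
    then show ?thesis by blast
  qed
  then obtain S where "\<And>x y. cinner y (T x) = cinner (S y) x" by metis
  then have "cinner (T x) y = cinner x (S y)" for x y
    by (metis cinner_commute)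
  then show thesis by (rule that)
qed

lemma cinner_adj: 
  assumes "bounded_clinear T" 
  shows "cinner (T x) y = cinner x (adj T y)"
  using form_adjoint_exists[OF assms] adj_eqI by metis

lemma cinner_adj': "bounded_clinear T \<Longrightarrow> cinner (adj T x) y = cinner x (T y)"
  by (metis cinner_adj cinner_commute)

lemma norm_adj_le:
  assumes T: "bounded_clinear T"
  shows "norm (adj T y) \<le> onorm T * norm y"
proof -
  have "(norm (adj T y))\<^sup>2 = cmod (cinner (T (adj T y)) y)"
    by (simp only: cinner_adj[OF T] cinner_self_norm)
  also have "\<dots> \<le> (onorm T * norm (adj T y)) * norm y"
    by (rule order_trans[OF cauchy_schwarz]) (simp add: bounded_clinear_norm[OF T] mult_right_mono)
  finally have "norm (adj T y) * norm (adj T y) \<le> norm (adj T y) * (onorm T * norm y)"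
    by (simp add: power2_eq_square algebra_simps)
  then show ?thesis
    by (cases "norm (adj T y) = 0") (simp_all add: onorm_nonneg[OF T] mult_le_cancel_left_pos)
qed

lemma bounded_clinear_adj [bclin]:
  assumes T: "bounded_clinear T"
  shows "bounded_clinear (adj T)"
proof (rule bounded_clinearI[OF _ _ norm_adj_le[OF T]])
  show "adj T (x + y) = adj T x + adj T y" for x y
    by (rule cinner_ext) (simp add: cinner_add_right flip: cinner_adj[OF T])
  show "adj T (c *\<^sub>C x) = c *\<^sub>C adj T x" for c x
    by (rule cinner_ext) (simp add: cinner_scaleC_right flip: cinner_adj[OF T])
qed

lemma onorm_adj_le: "bounded_clinear T \<Longrightarrow> onorm (adj T) \<le> onorm T"
  by (rule onorm_bound) (simp_all add: norm_adj_le onorm_nonneg)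

lemma adj_adj [simp]: "bounded_clinear T \<Longrightarrow> adj (adj T) = T"
  by (rule adj_eqI) (simp add: cinner_adj')

lemma adj_compose: "bounded_clinear S \<Longrightarrow> bounded_clinear T \<Longrightarrow> adj (S \<circ> T) = adj T \<circ> adj S"
  by (rule adj_eqI) (simp add: cinner_adj)

lemma adj_orth_proj: "closed_csubspace V \<Longrightarrow> adj (orth_proj V) = orth_proj V"
  by (rule adj_eqI) (rule cinner_orth_proj)

text \<open>Completeness for the operator norm. Cauchy property and convergence are phrased as
  \<open>e * norm x\<close> estimates, so the pointwise limit inherits them by letting one index
  tend to infinity.\<close>

lemma bounded_clinear_limit:
  fixes T :: "nat \<Rightarrow> 'h::chilbert_space \<Rightarrow> 'h"
  assumes T: "\<And>n. bounded_clinear (T n)"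
    and Cauchy: "\<And>e. e > 0 \<Longrightarrow> \<exists>N. \<forall>m\<ge>N. \<forall>n\<ge>N. \<forall>x. norm (T m x - T n x) \<le> e * norm x"
  obtains L where "bounded_clinear L" "\<And>x. (\<lambda>n. T n x) \<longlonglongrightarrow> L x"
    "\<And>e. e > 0 \<Longrightarrow> \<exists>N. \<forall>n\<ge>N. \<forall>x. norm (T n x - L x) \<le> e * norm x"
proof -
  have "Cauchy (\<lambda>n. T n x)" for x
  proof (rule metric_CauchyI)
    fix e :: real assume "0 < e"
    then have "0 < e / (norm x + 1)" by (simp add: add_nonneg_pos)
    from Cauchy[OF this] obtain N
      where N: "\<And>m n x'. m \<ge> N \<Longrightarrow> n \<ge> N \<Longrightarrow> norm (T m x' - T n x') \<le> e / (norm x + 1) * norm x'"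
      by blast
    have "e / (norm x + 1) * norm x < e"
      using \<open>0 < e\<close> by (simp add: field_simps add_pos_nonneg)
    then show "\<exists>M. \<forall>m\<ge>M. \<forall>n\<ge>M. dist (T m x) (T n x) < e"
      unfolding dist_norm using N[of _ _ x] by (meson order_le_less_trans)
  qed
  then have "\<exists>l. (\<lambda>n. T n x) \<longlonglongrightarrow> l" for x
    using Cauchy_convergent_iff convergent_def by blast
  then obtain L where L: "\<And>x. (\<lambda>n. T n x) \<longlonglongrightarrow> L x" by metis
  have unif: "\<exists>N. \<forall>n\<ge>N. \<forall>x. norm (T n x - L x) \<le> e * norm x" if e: "e > 0" for e
  proof -
    obtain N where N: "\<And>m n x. m \<ge> N \<Longrightarrow> n \<ge> N \<Longrightarrow> norm (T m x - T n x) \<le> e * norm x"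
      using Cauchy[OF e] by blast
    have "norm (T n x - L x) \<le> e * norm x" if "n \<ge> N" for n x
    proof (rule tendsto_upperbound)
      show "(\<lambda>m. norm (T n x - T m x)) \<longlonglongrightarrow> norm (T n x - L x)"
        by (intro tendsto_intros L)
      show "\<forall>\<^sub>F m in sequentially. norm (T n x - T m x) \<le> e * norm x"
        using N[OF that] by (auto simp: eventually_sequentially)
    qed simp
    then show ?thesis by blast
  qed
  have "bounded_clinear L"
  proof -
    obtain N where N: "\<And>x. norm (T N x - L x) \<le> 1 * norm x" using unif[of 1] by auto
    show ?thesis
    proof (rule bounded_clinearI)
      show "L (x + y) = L x + L y" for x y
      proof (rule LIMSEQ_unique[OF L])
        show "(\<lambda>n. T n (x + y)) \<longlonglongrightarrow> L x + L y"
          unfolding bounded_clinear_add[OF T] by (intro tendsto_add L)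
      qed
      show "L (c *\<^sub>C x) = c *\<^sub>C L x" for c x
      proof (rule LIMSEQ_unique[OF L])
        show "(\<lambda>n. T n (c *\<^sub>C x)) \<longlonglongrightarrow> c *\<^sub>C L x"
          unfolding bounded_clinear_scaleC[OF T] by (rule bounded_clinear_tendsto[OF bounded_clinear_scale L])
      qed
      show "norm (L x) \<le> (onorm (T N) + 1) * norm x" for x
        using norm_triangle_ineq4[of "T N x" "T N x - L x"] N[of x] bounded_clinear_norm[OF T, of N x]
        by (simp add: distrib_right)
    qed
  qed
  then show thesis using that L unif by blast
qed

text \<open>Instead of summing the Neumann series, \<open>u + T u = y\<close> is solved as a fixed
  point of the contraction that sends \<open>u\<close> to \<open>y - T u\<close>.\<close>

lemma neumann_inverse:
  fixes T :: "'h::chilbert_space \<Rightarrow> 'h"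
  assumes T: "bounded_clinear T" and c: "c < 1" and Tc: "\<And>x. norm (T x) \<le> c * norm x"
  obtains N where "bounded_clinear N" "\<And>x. N x + T (N x) = x" "\<And>x. N (x + T x) = x"
proof -
  \<comment> \<open>The contraction principle asks for a nonnegative constant, and \<open>c\<close>
    may be negative.\<close>
  define k where "k = max c 0"
  have k: "0 \<le> k" "k < 1" and Tk: "norm (T x) \<le> k * norm x" for x
    using c order_trans[OF Tc[of x] mult_right_mono[of c k "norm x"]] by (auto simp: k_def)
  have "\<exists>u. y - T u = u" for y
  proof -
    have "\<exists>!u. y - T u = u"
    proof (rule banach_fix_type[OF k], intro allI)
      fix u v
      show "dist (y - T u) (y - T v) \<le> k * dist u v"
        using Tk[of "v - u"] by (simp add: dist_norm bounded_clinear_diff[OF T] norm_minus_commute)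
    qed
    then show ?thesis by blast
  qed
  then obtain N where "\<And>y. y - T (N y) = N y" by metis
  then have N1: "N y + T (N y) = y" for y by (metis add_diff_cancel_left' diff_add_cancel)
  have lower: "(1 - k) * norm u \<le> norm (u + T u)" for u
    using norm_triangle_ineq4[of "u + T u" "T u"] Tk[of u] by (simp add: algebra_simps)
  have inj: "u = v" if "u + T u = v + T v" for u v
  proof -
    have "(u - v) + T (u - v) = (u + T u) - (v + T v)"
      by (simp add: bounded_clinear_diff[OF T])
    then have "(u - v) + T (u - v) = 0" by (simp add: that)
    then have "(1 - k) * norm (u - v) \<le> 0" using lower[of "u - v"] by simp
    then show ?thesis using k by (simp add: mult_le_0_iff)
  qed
  have "bounded_clinear N"
  proof (rule bounded_clinearI)
    show "N (x + y) = N x + N y" for x y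
    proof (rule inj)
      have "N x + N y + T (N x + N y) = (N x + T (N x)) + (N y + T (N y))"
        by (simp add: bounded_clinear_add[OF T])
      then show "N (x + y) + T (N (x + y)) = N x + N y + T (N x + N y)" by (simp only: N1)
    qed
    show "N (a *\<^sub>C x) = a *\<^sub>C N x" for a x
      by (rule inj) (simp only: N1 bounded_clinear_scaleC[OF T] scaleC_add_right[symmetric])
    show "norm (N x) \<le> inverse (1 - k) * norm x" for x
      using lower[of "N x"] k unfolding N1 by (simp add: field_simps)
  qed
  moreover have "N (x + T x) = x" for x by (rule inj) (rule N1)
  ultimately show thesis using that N1 by blast
qed


section \<open>Square roots of positive operators\<close>

lemma positive_opD:
  assumes "positive_op A"
  shows "bounded_clinear A" "cinner x (A x) = complex_of_real (Re (cinner x (A x)))" "0 \<le> Re (cinner x (A x))"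
  using assms by (simp_all add: positive_op_def of_real_Re)

text \<open>Polarization: over the complex numbers a real quadratic form is symmetric.\<close>

lemma positive_op_symmetric:
  assumes A: "positive_op A"
  shows "cinner (A x) y = cinner x (A y)"
proof -
  note lin = bounded_clinear_simps[OF positive_opD(1)[OF A]]
  define f where "f x y = cinner x (A y) - cinner (A x) y" for x y
  have f0: "f z z = 0" for z
  proof -
    have "cinner (A z) z = cnj (cinner z (A z))" by (rule cinner_commute)
    then show ?thesis by (metis complex_cnj_complex_of_real diff_self f_def positive_opD(2)[OF A])
  qed
  have "f (x + y) (x + y) = f x x + f x y + f y x + f y y"
    by (simp add: f_def lin cinner_simps)
  then have 1: "f x y + f y x = 0" by (simp add: f0)
  have "f (x + \<i> *\<^sub>C y) (x + \<i> *\<^sub>C y) = f x x + \<i> * f x y - \<i> * f y x + f y y"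
    by (simp add: f_def lin cinner_simps algebra_simps)
  then have "\<i> * (f x y - f y x) = 0" by (simp add: f0 algebra_simps)
  then have "f x y = f y x" by simp
  with 1 have "f x y = 0" by simp
  then show ?thesis by (simp add: f_def)
qed

text \<open>This is positivity of the form at the vector x - (1/M) A x, expanded.\<close>

lemma positive_op_norm_sq_le:
  assumes A: "positive_op A" and M: "0 < M" "\<And>x. norm (A x) \<le> M * norm x"
  shows "(norm (A x))\<^sup>2 \<le> M * Re (cinner x (A x))"
proof -
  note lin = bounded_clinear_simps[OF positive_opD(1)[OF A]]
  let ?t = "complex_of_real (1 / M)"
  have eq: "Re (cinner (x - ?t *\<^sub>C A x) (A (x - ?t *\<^sub>C A x)))
    = Re (cinner x (A x)) - 2 * (norm (A x))\<^sup>2 / M + Re (cinner (A x) (A (A x))) / M\<^sup>2"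
  proof -
    have "cinner x (A (A x)) = (norm (A x))\<^sup>2"
      by (metis positive_op_symmetric[OF A] cinner_self)
    moreover have "cinner (A x) (A x) = (norm (A x))\<^sup>2" by (rule cinner_self)
    ultimately show ?thesis
      by (simp add: lin cinner_simps Re_divide_of_real power2_eq_square field_simps del: of_real_divide
          flip: of_real_power)
  qed
  have "Re (cinner (A x) (A (A x))) \<le> norm (A x) * (M * norm (A x))"
    by (rule order_trans[OF complex_Re_le_cmod order_trans[OF cauchy_schwarz]])
       (simp add: M mult_left_mono)
  then have "Re (cinner (A x) (A (A x))) / M\<^sup>2 \<le> (norm (A x))\<^sup>2 / M"
    using M(1) by (simp add: field_simps power2_eq_square)
  then have "0 \<le> Re (cinner x (A x)) - (norm (A x))\<^sup>2 / M"
    using positive_opD(3)[OF A, of "x - ?t *\<^sub>C A x"] unfolding eq by simp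
  then show ?thesis using M(1) by (simp add: field_simps)
qed

lemma positive_op_eq_0:
  assumes A: "positive_op A" and 0: "cinner x (A x) = 0"
  shows "A x = 0"
proof -
  \<comment> \<open>The added 1 keeps the constant positive when \<open>A\<close> is zero.\<close>
  let ?M = "onorm A + 1"
  have "0 < ?M" using onorm_nonneg[OF positive_opD(1)[OF A]] by simp
  moreover have "norm (A x) \<le> ?M * norm x" for x
    using bounded_clinear_norm[OF positive_opD(1)[OF A], of x] by (simp add: distrib_right add_increasing2)
  ultimately have "(norm (A x))\<^sup>2 \<le> ?M * Re (cinner x (A x))" by (rule positive_op_norm_sq_le[OF A])
  then show ?thesis by (simp add: 0)
qed

text \<open>The iteration for \<open>1 - sqrt (1 - X)\<close>, together with its scalar majorant at \<open>X = 1\<close>.\<close>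

primrec sqrt_iter :: "('h::chilbert_space \<Rightarrow> 'h) \<Rightarrow> nat \<Rightarrow> 'h \<Rightarrow> 'h"
  where
    "sqrt_iter X 0 = (\<lambda>x. 0)"
  | "sqrt_iter X (Suc n) = (\<lambda>x. (1/2) *\<^sub>C (X x + sqrt_iter X n (sqrt_iter X n x)))"

primrec sqrt_maj :: "nat \<Rightarrow> real"
  where
    "sqrt_maj 0 = 0"
  | "sqrt_maj (Suc n) = (1 + (sqrt_maj n)\<^sup>2) / 2"

lemma sqrt_maj_bounds: "0 \<le> sqrt_maj n \<and> sqrt_maj n \<le> 1"
  by (induction n) (auto simp: power_le_one)

lemma sqrt_maj_mono: "sqrt_maj n \<le> sqrt_maj (Suc n)"
  using zero_le_power2[of "1 - sqrt_maj n"] by (simp add: power2_eq_square algebra_simps)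

lemma Cauchy_sqrt_maj: "Cauchy sqrt_maj"
  using sqrt_maj_bounds sqrt_maj_mono Bseq_mono_convergent[of sqrt_maj]
  by (metis BseqI' Cauchy_convergent_iff abs_of_nonneg lift_Suc_mono_le real_norm_def)

lemma bounded_clinear_sqrt_iter:
  assumes X: "bounded_clinear X"
  shows "bounded_clinear (sqrt_iter X n)"
proof (induction n)
  case (Suc n)
  show ?case unfolding sqrt_iter.simps
    by (rule bounded_clinear_scaleC_fun(1)[OF bounded_clinear_add_fun(1)[OF X bounded_clinear_compose_fun[OF Suc Suc]]])
qed (simp add: bclin)

lemma norm_half: "norm ((1/2) *\<^sub>C x) = norm (x::'h::chilbert_space) / 2"
  by (simp add: norm_scaleC norm_divide)

lemma norm_sqrt_iter_le:
  assumes X: "\<And>x. norm (X x) \<le> norm x"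
  shows "norm (sqrt_iter X n x) \<le> sqrt_maj n * norm x"
proof (induction n arbitrary: x)
  case (Suc n)
  have "norm (sqrt_iter X n (sqrt_iter X n x)) \<le> sqrt_maj n * (sqrt_maj n * norm x)"
    using Suc[of "sqrt_iter X n x"] Suc[of x] sqrt_maj_bounds[of n] by (meson mult_left_mono order_trans)
  then have "norm (X x + sqrt_iter X n (sqrt_iter X n x)) \<le> norm x + sqrt_maj n * (sqrt_maj n * norm x)"
    using X[of x] by (intro order_trans[OF norm_triangle_ineq] add_mono)
  then show ?case
    unfolding sqrt_iter.simps sqrt_maj.simps norm_half
    by (simp add: power2_eq_square distrib_right mult.assoc)
qed simp

text \<open>With consecutive iterates B and C, BB - CC = B(B - C) + (B - C)C. The scalar majorant
  obeys b^2 - c^2 = (b - c)(b + c), so the estimate reproduces itself.\<close>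

lemma norm_sqrt_iter_step_le:
  assumes Xb: "bounded_clinear X" and X: "\<And>x. norm (X x) \<le> norm x"
  shows "norm (sqrt_iter X (Suc n) x - sqrt_iter X n x) \<le> (sqrt_maj (Suc n) - sqrt_maj n) * norm x"
proof (induction n arbitrary: x)
  case 0
  then show ?case using X[of x] by (simp add: norm_half)
next
  case (Suc n)
  let ?B = "sqrt_iter X (Suc n)" and ?C = "sqrt_iter X n" and ?b = "sqrt_maj (Suc n)" and ?c = "sqrt_maj n"
  have "sqrt_iter X (Suc (Suc n)) x - ?B x = (1/2) *\<^sub>C (?B (?B x) - ?C (?C x))"
    by (simp only: sqrt_iter.simps(2)[of X "Suc n"] sqrt_iter.simps(2)[of X n]
        flip: complex_vector.scale_right_diff_distrib) simp
  also have "?B (?B x) - ?C (?C x) = ?B (?B x - ?C x) + (?B (?C x) - ?C (?C x))"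
    by (simp only: bounded_clinear_diff[OF bounded_clinear_sqrt_iter[OF Xb]]) simp
  finally have eq: "norm (sqrt_iter X (Suc (Suc n)) x - ?B x) = norm (?B (?B x - ?C x) + (?B (?C x) - ?C (?C x))) / 2"
    by (simp only: norm_half)
  have d: "0 \<le> ?b - ?c" using sqrt_maj_mono[of n] by simp
  have "norm (?B (?B x - ?C x)) \<le> ?b * ((?b - ?c) * norm x)"
    using norm_sqrt_iter_le[OF X] Suc[of x] sqrt_maj_bounds[of "Suc n"] by (meson mult_left_mono order_trans)
  moreover have "norm (?B (?C x) - ?C (?C x)) \<le> (?b - ?c) * (?c * norm x)"
    using norm_sqrt_iter_le[OF X, of n x] Suc[of "?C x"] d by (meson mult_left_mono order_trans)
  ultimately have "norm (?B (?B x - ?C x) + (?B (?C x) - ?C (?C x))) \<le> (?b - ?c) * (?b + ?c) * norm x"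
    using norm_triangle_ineq[of "?B (?B x - ?C x)" "?B (?C x) - ?C (?C x)"]
    by (simp only: algebra_simps)
  moreover have "sqrt_maj (Suc (Suc n)) - ?b = (?b - ?c) * (?b + ?c) / 2"
    by (simp only: sqrt_maj.simps(2)[of "Suc n"] sqrt_maj.simps(2)[of n]) (simp add: power2_eq_square field_simps)
  ultimately show ?case unfolding eq by (simp only: times_divide_eq_left divide_right_mono)
qed

lemma norm_sqrt_iter_diff_le:
  assumes Xb: "bounded_clinear X" and X: "\<And>x. norm (X x) \<le> norm x" and "n \<le> m"
  shows "norm (sqrt_iter X m x - sqrt_iter X n x) \<le> (sqrt_maj m - sqrt_maj n) * norm x"
  using \<open>n \<le> m\<close>
proof (induction m rule: dec_induct)
  case (step m)
  have "norm (sqrt_iter X (Suc m) x - sqrt_iter X n x)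
    \<le> norm (sqrt_iter X (Suc m) x - sqrt_iter X m x) + norm (sqrt_iter X m x - sqrt_iter X n x)"
    using norm_triangle_ineq[of "sqrt_iter X (Suc m) x - sqrt_iter X m x" "sqrt_iter X m x - sqrt_iter X n x"] by simp
  also have "\<dots> \<le> (sqrt_maj (Suc m) - sqrt_maj m) * norm x + (sqrt_maj m - sqrt_maj n) * norm x"
    by (intro add_mono norm_sqrt_iter_step_le Xb X step.IH)
  finally show ?case by (simp only: distrib_right[symmetric]) (simp only: diff_add_eq_diff_diff_swap diff_add_cancel add_diff_eq)
qed simp

lemma sqrt_iter_symmetric:
  assumes "\<And>x y. cinner (X x) y = cinner x (X y)"
  shows "cinner (sqrt_iter X n x) y = cinner x (sqrt_iter X n y)"
  by (induction n arbitrary: x y) (simp_all add: cinner_simps assms)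

lemma sqrt_iter_commute:
  assumes R: "bounded_clinear R" and "\<And>x. R (X x) = X (R x)"
  shows "R (sqrt_iter X n x) = sqrt_iter X n (R x)"
  by (induction n arbitrary: x) (simp_all add: bounded_clinear_simps[OF R] assms)

text \<open>The iterates converge in operator norm because the majorant does. The last clause,
  commutation with everything that commutes with \<open>X\<close>, is what uniqueness of square
  roots will rest on.\<close>

lemma sqrt_iter_limit:
  fixes X :: "'h::chilbert_space \<Rightarrow> 'h"
  assumes Xb: "bounded_clinear X" and X: "\<And>x. norm (X x) \<le> norm x"
    and sym: "\<And>x y. cinner (X x) y = cinner x (X y)"
  obtains B where "bounded_clinear B" "\<And>x. norm (B x) \<le> norm x"
    "\<And>x y. cinner (B x) y = cinner x (B y)"
    "\<And>x. B x = (1/2) *\<^sub>C (X x + B (B x))"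
    "\<And>R x. bounded_clinear R \<Longrightarrow> (\<And>x. R (X x) = X (R x)) \<Longrightarrow> R (B x) = B (R x)"
proof -
  let ?T = "sqrt_iter X"
  have T: "bounded_clinear (?T n)" for n by (rule bounded_clinear_sqrt_iter[OF Xb])
  have "\<exists>N. \<forall>m\<ge>N. \<forall>n\<ge>N. \<forall>x. norm (?T m x - ?T n x) \<le> e * norm x" if e: "e > 0" for e
  proof -
    obtain N where N: "\<And>m n. m \<ge> N \<Longrightarrow> n \<ge> N \<Longrightarrow> \<bar>sqrt_maj m - sqrt_maj n\<bar> < e"
      using Cauchy_sqrt_maj e unfolding Cauchy_def dist_real_def by meson
    have "norm (?T m x - ?T n x) \<le> e * norm x" if "m \<ge> N" "n \<ge> N" for m n x
    proof -
      have "norm (?T m x - ?T n x) \<le> \<bar>sqrt_maj m - sqrt_maj n\<bar> * norm x"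
      proof (cases "n \<le> m")
        case True
        then show ?thesis
          by (rule order_trans[OF norm_sqrt_iter_diff_le[OF Xb X]]) (simp add: mult_right_mono)
      next
        case False
        then have "norm (?T n x - ?T m x) \<le> (sqrt_maj n - sqrt_maj m) * norm x"
          by (intro norm_sqrt_iter_diff_le[OF Xb X]) simp
        also have "\<dots> \<le> \<bar>sqrt_maj m - sqrt_maj n\<bar> * norm x"
          by (intro mult_right_mono) simp_all
        finally show ?thesis by (simp only: norm_minus_commute)
      qed
      also have "\<dots> \<le> e * norm x" using N[OF that] by (intro mult_right_mono) simp_all
      finally show ?thesis .
    qed
    then show ?thesis by blast
  qed
  from bounded_clinear_limit[OF T this] obtain B where B: "bounded_clinear B"
    and lim: "\<And>x. (\<lambda>n. ?T n x) \<longlonglongrightarrow> B x" by metis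
  have Tle: "norm (?T n x) \<le> norm x" for n x
    using norm_sqrt_iter_le[OF X, of n x] mult_right_mono[of "sqrt_maj n" 1 "norm x"] sqrt_maj_bounds[of n] by simp
  have lim2: "(\<lambda>n. ?T n (?T n x)) \<longlonglongrightarrow> B (B x)" for x
  proof -
    have "(\<lambda>n. ?T n (?T n x - B x)) \<longlonglongrightarrow> 0"
      by (rule tendsto_0_le[where K=1, OF LIM_zero[OF lim[of x]]]) (simp add: Tle)
    from tendsto_add[OF this lim[of "B x"]] show ?thesis
      by (simp add: bounded_clinear_diff[OF T])
  qed
  show thesis
  proof (rule that[OF B])
    show "norm (B x) \<le> norm x" for x
      by (rule tendsto_upperbound[OF tendsto_norm[OF lim]]) (simp_all add: Tle)
    show "cinner (B x) y = cinner x (B y)" for x y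
      using LIMSEQ_unique[OF cinner.tendsto[OF lim[of x] tendsto_const[of y]]]
        cinner.tendsto[OF tendsto_const[of x] lim[of y]] by (simp add: sqrt_iter_symmetric[OF sym])
    show "B x = (1/2) *\<^sub>C (X x + B (B x))" for x
    proof (rule LIMSEQ_unique)
      show "(\<lambda>n. ?T (Suc n) x) \<longlonglongrightarrow> B x" using lim by (rule LIMSEQ_Suc)
      from bounded_clinear_tendsto[OF bounded_clinear_scale[of "1/2"] tendsto_add[OF tendsto_const lim2[of x]]]
      show "(\<lambda>n. ?T (Suc n) x) \<longlonglongrightarrow> (1/2) *\<^sub>C (X x + B (B x))" by simp
    qed
    show "R (B x) = B (R x)" if R: "bounded_clinear R" and c: "\<And>x. R (X x) = X (R x)" for R x
      using LIMSEQ_unique[OF bounded_clinear_tendsto[OF R lim[of x]]] lim[of "R x"]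
      unfolding sqrt_iter_commute[where X=X, OF R c] by blast
  qed
qed

text \<open>For X = 1 - A the fixed-point equation B = (X + BB)/2 says (1 - B)^2 = 1 - X = A, so 1 -
  B is the root; it is positive because B is a contraction.\<close>

lemma positive_sqrt_exists_contraction:
  fixes A :: "'h::chilbert_space \<Rightarrow> 'h"
  assumes A: "positive_op A" and A1: "\<And>x. norm (A x) \<le> norm x"
  obtains S where "positive_op S" "S \<circ> S = A"
    "\<And>R x. bounded_clinear R \<Longrightarrow> (\<And>x. R (A x) = A (R x)) \<Longrightarrow> R (S x) = S (R x)"
proof -
  note Ab = positive_opD(1)[OF A]
  define X where "X = (\<lambda>x. x - A x)"
  have Xb: "bounded_clinear X" unfolding X_def by (intro bclin Ab)
  have Xs: "cinner (X x) y = cinner x (X y)" for x y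
    by (simp add: X_def cinner_simps positive_op_symmetric[OF A])
  \<comment> \<open>Expand the square: the term <Ax, Ax> is at most <x, Ax>, which is subtracted
    twice.\<close>
  have X1: "norm (X x) \<le> norm x" for x
  proof -
    have "(norm (A x))\<^sup>2 \<le> 1 * Re (cinner x (A x))"
      by (rule positive_op_norm_sq_le[OF A]) (use A1 in auto)
    then have "(norm (X x))\<^sup>2 \<le> (norm x)\<^sup>2"
      using positive_opD(3)[OF A, of x] by (simp add: X_def norm_diff_sq)
    then show ?thesis by simp
  qed
  obtain B where B: "bounded_clinear B" and B1: "\<And>x. norm (B x) \<le> norm x"
    and Bs: "\<And>x y. cinner (B x) y = cinner x (B y)"
    and Beq: "\<And>x. B x = (1/2) *\<^sub>C (X x + B (B x))"
    and Bc: "\<And>R x. bounded_clinear R \<Longrightarrow> (\<And>x. R (X x) = X (R x)) \<Longrightarrow> R (B x) = B (R x)"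
    using sqrt_iter_limit[OF Xb X1 Xs] by blast
  define S where "S = (\<lambda>x. x - B x)"
  have Sb: "bounded_clinear S" unfolding S_def by (intro bclin B)
  have "positive_op S"
    unfolding positive_op_def
  proof (intro conjI allI Sb)
    fix x
    have "cnj (cinner x (S x)) = cinner x (S x)"
      by (simp add: S_def cinner_simps Bs flip: cinner_commute)
    then show "cinner x (S x) \<in> \<real>" by (simp add: Reals_cnj_iff)
    have "Re (cinner x (B x)) \<le> norm x * norm x"
      by (rule order_trans[OF complex_Re_le_cmod order_trans[OF cauchy_schwarz]])
         (simp add: B1 mult_left_mono)
    then show "0 \<le> Re (cinner x (S x))"
      by (simp add: S_def cinner_simps Re_cinner_self power2_eq_square)
  qed
  moreover have "S \<circ> S = A"
  proof
    fix x
    have "B x + B x = X x + B (B x)"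
    proof -
      have "B x + B x = (1/2 + 1/2) *\<^sub>C (X x + B (B x))"
        using Beq[of x] by (simp only: scaleC_add_left)
      then show ?thesis by simp
    qed
    then show "(S \<circ> S) x = A x"
      by (simp add: S_def bounded_clinear_diff[OF B] X_def algebra_simps)
  qed
  moreover have "R (S x) = S (R x)" if R: "bounded_clinear R" and c: "\<And>x. R (A x) = A (R x)" for R x
    using Bc[OF R, of x] by (simp add: S_def X_def bounded_clinear_diff[OF R] c)
  ultimately show thesis using that by blast
qed

lemma positive_op_scale:
  assumes "positive_op A" "0 \<le> r"
  shows "positive_op (\<lambda>x. complex_of_real r *\<^sub>C A x)"
  using assms by (auto simp: positive_op_def cinner_simps intro: bclin Reals_mult)

lemma positive_sqrt_exists:
  fixes A :: "'h::chilbert_space \<Rightarrow> 'h"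
  assumes A: "positive_op A"
  obtains S where "positive_op S" "S \<circ> S = A"
    "\<And>R x. bounded_clinear R \<Longrightarrow> (\<And>x. R (A x) = A (R x)) \<Longrightarrow> R (S x) = S (R x)"
proof -
  define M where "M = onorm A + 1"
  have M: "0 < M" using onorm_nonneg[OF positive_opD(1)[OF A]] by (simp add: M_def)
  define A' where "A' = (\<lambda>x. complex_of_real (1/M) *\<^sub>C A x)"
  have pos: "positive_op A'" unfolding A'_def by (rule positive_op_scale[OF A]) (use M in simp)
  have AM: "A x = complex_of_real M *\<^sub>C A' x" for x using M by (simp add: A'_def scaleC_scaleC)
  have "norm (A' x) \<le> norm x" for x
  proof -
    have "norm (A x) \<le> M * norm x"
      using bounded_clinear_norm[OF positive_opD(1)[OF A], of x] by (simp add: M_def distrib_right add_increasing2)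
    then show ?thesis using M by (simp add: A'_def norm_scaleC norm_divide field_simps)
  qed
  then obtain S where S: "positive_op S" "S \<circ> S = A'"
    and Sc: "\<And>R x. bounded_clinear R \<Longrightarrow> (\<And>x. R (A' x) = A' (R x)) \<Longrightarrow> R (S x) = S (R x)"
    using positive_sqrt_exists_contraction[OF pos] by metis
  let ?S = "\<lambda>x. complex_of_real (sqrt M) *\<^sub>C S x"
  show thesis
  proof (rule that[of ?S])
    show "positive_op ?S" by (rule positive_op_scale[OF S(1)]) (use M in simp)
    show "?S \<circ> ?S = A"
    proof
      fix x
      have "S (S x) = A' x" using S(2) by (metis comp_apply)
      then show "(?S \<circ> ?S) x = A x" using M
        by (simp add: bounded_clinear_scaleC[OF positive_opD(1)[OF S(1)]] scaleC_scaleC AM flip: of_real_mult)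
    qed
    show "R (?S x) = ?S (R x)" if R: "bounded_clinear R" and c: "\<And>x. R (A x) = A (R x)" for R x
      using Sc[OF R, of x] by (simp add: A'_def bounded_clinear_scaleC[OF R] c)
  qed
qed

text \<open>Any root is compared with the constructed root \<open>R\<close>, since \<open>R\<close>
  commutes with every operator that commutes with the square.\<close>

lemma positive_sqrt_unique:
  fixes S :: "'h::chilbert_space \<Rightarrow> 'h"
  assumes S: "positive_op S" and S': "positive_op S'" and eq: "S \<circ> S = S' \<circ> S'"
  shows "S = S'"
proof -
  have "positive_op (S \<circ> S)"
    using S by (auto simp: positive_op_def bclin cinner_self simp flip: positive_op_symmetric[OF S])
  then obtain R where R: "positive_op R" and RR: "R \<circ> R = S \<circ> S"
    and Rc: "\<And>P x. bounded_clinear P \<Longrightarrow> (\<And>x. P ((S \<circ> S) x) = (S \<circ> S) (P x)) \<Longrightarrow> P (R x) = R (P x)"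
    by (rule positive_sqrt_exists[of "S \<circ> S"]) blast
  have main: "P x = R x" if P: "positive_op P" and PP: "P \<circ> P = S \<circ> S" for P x
  proof -
    note Pl = bounded_clinear_simps[OF positive_opD(1)[OF P]] and Rl = bounded_clinear_simps[OF positive_opD(1)[OF R]]
    have comm: "P (R z) = R (P z)" for z
      using Rc[OF positive_opD(1)[OF P]] by (simp flip: PP)
    \<comment> \<open>As P and R commute and have equal squares, (P + R) y = 0. Positivity of both
      terms forces P y = R y = 0, and <y, y> = <x, P y - R y> then vanishes.\<close>
    define y where "y = P x - R x"
    have PR: "P (P z) = R (R z)" for z using PP RR by (metis comp_apply)
    have "P y + R y = 0" by (simp add: y_def Pl Rl comm PR)
    then have "cinner y (P y) + cinner y (R y) = 0" by (metis cinner_add_right cinner_zero_right)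
    then have "Re (cinner y (P y)) + Re (cinner y (R y)) = 0" by (metis plus_complex.simps(1) zero_complex.simps(1))
    then have "Re (cinner y (P y)) = 0" "Re (cinner y (R y)) = 0"
      using positive_opD(3)[OF P, of y] positive_opD(3)[OF R, of y] by linarith+
    then have "cinner y (P y) = 0" "cinner y (R y) = 0"
      using positive_opD(2)[OF P, of y] positive_opD(2)[OF R, of y] by simp_all
    then have "P y = 0" "R y = 0" using positive_op_eq_0 P R by blast+
    moreover have "cinner y y = cinner x (P y) - cinner x (R y)"
      by (subst (1) y_def) (simp add: cinner_diff_left positive_op_symmetric[OF P] positive_op_symmetric[OF R])
    ultimately have "cinner y y = 0" by simp
    then show ?thesis by (simp add: y_def)
  qed
  have "S x = S' x" for x using main[OF S] main[OF S'] eq by simp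
  then show ?thesis by (rule ext)
qed

section \<open>Absolute values and the polar decomposition\<close>

lemma abs_op_props:
  fixes T :: "'h::chilbert_space \<Rightarrow> 'h"
  assumes T: "bounded_clinear T"
  shows "positive_op (abs_op T) \<and> abs_op T \<circ> abs_op T = adj T \<circ> T"
proof -
  have pos: "positive_op (adj T \<circ> T)"
    unfolding positive_op_def by (simp add: bclin T cinner_self flip: cinner_adj[OF T])
  obtain S where "positive_op S" "S \<circ> S = adj T \<circ> T"
    by (rule positive_sqrt_exists[OF pos]) blast
  then have "\<exists>!S. positive_op S \<and> S \<circ> S = adj T \<circ> T"
    by (intro ex1I[of _ S]) (auto intro: positive_sqrt_unique)
  then show ?thesis unfolding abs_op_def by (rule theI')
qed

lemmas positive_abs_op = abs_op_props[THEN conjunct1]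

lemma cinner_abs_op:
  assumes T: "bounded_clinear T"
  shows "cinner (abs_op T x) (abs_op T y) = cinner (T x) (T y)"
proof -
  have "abs_op T (abs_op T y) = adj T (T y)" using abs_op_props[OF T] by (metis comp_apply)
  then show ?thesis by (simp add: positive_op_symmetric[OF positive_abs_op[OF T]] cinner_adj[OF T])
qed

lemma closed_csubspace_closure:
  assumes S: "csubspace (S::'h::chilbert_space set)"
  shows "closed_csubspace (closure S)"
  unfolding closed_csubspace_def complex_vector.subspace_def
proof (intro conjI ballI allI)
  show "0 \<in> closure S" using complex_vector.subspace_0[OF S] closure_subset by blast
  show "x + y \<in> closure S" if "x \<in> closure S" "y \<in> closure S" for x y
  proof -
    from that obtain f g where "\<And>n. f n \<in> S" "f \<longlonglongrightarrow> x" "\<And>n. g n \<in> S" "g \<longlonglongrightarrow> y"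
      unfolding closure_sequential by blast
    then show ?thesis unfolding closure_sequential
      by (intro exI[of _ "\<lambda>n. f n + g n"]) (simp add: tendsto_add complex_vector.subspace_add[OF S])
  qed
  show "c *\<^sub>C x \<in> closure S" if "x \<in> closure S" for c x
  proof -
    from that obtain f where f: "\<And>n. f n \<in> S" "f \<longlonglongrightarrow> x" unfolding closure_sequential by blast
    from bounded_clinear_tendsto[OF bounded_clinear_scale f(2)] f(1) show ?thesis unfolding closure_sequential
      by (intro exI[of _ "\<lambda>n. c *\<^sub>C f n"]) (simp add: complex_vector.subspace_scale[OF S])
  qed
qed simp

text \<open>The assignment \<open>S a\<close> to \<open>T a\<close> preserves inner products, hence
  extends isometrically to the closure of the range of \<open>S\<close>; on the orthogonal
  complement it is set to zero.\<close>

lemma isometric_factor: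
  fixes S T :: "'h::chilbert_space \<Rightarrow> 'h"
  assumes S: "bounded_clinear S" and T: "bounded_clinear T"
    and iso: "\<And>x y. cinner (S x) (S y) = cinner (T x) (T y)"
  obtains U where "bounded_clinear U" "\<And>x. norm (U x) \<le> norm x" "U \<circ> S = T" "adj U \<circ> T = S"
proof -
  define K where "K = closure (range S)"
  have "csubspace (range S)"
    unfolding complex_vector.subspace_def
    by (auto simp: image_iff) (metis bounded_clinear_simps[OF S])+
  then have K: "closed_csubspace K" unfolding K_def by (rule closed_csubspace_closure)
  \<comment> \<open>The graph of the extension: both limits are taken along one common sequence of
    arguments. Preservation of inner products makes this relation single-valued.\<close>
  define rel where "rel y u \<longleftrightarrow> (\<exists>a. (\<lambda>n. S (a n)) \<longlonglongrightarrow> y \<and> (\<lambda>n. T (a n)) \<longlonglongrightarrow> u)" for y u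
  have inner: "cinner u u' = cinner y y'" if "rel y u" "rel y' u'" for y u y' u'
  proof -
    from that obtain a b where "(\<lambda>n. S (a n)) \<longlonglongrightarrow> y" "(\<lambda>n. T (a n)) \<longlonglongrightarrow> u"
      "(\<lambda>n. S (b n)) \<longlonglongrightarrow> y'" "(\<lambda>n. T (b n)) \<longlonglongrightarrow> u'" unfolding rel_def by blast
    then show ?thesis
      using LIMSEQ_unique[OF cinner.tendsto[of "\<lambda>n. T (a n)" u _ "\<lambda>n. T (b n)" u']]
        cinner.tendsto[of "\<lambda>n. S (a n)" y _ "\<lambda>n. S (b n)" y'] by (simp add: iso)
  qed
  have uniq: "u = u'" if "rel y u" "rel y u'" for y u u'
  proof -
    have "cinner (u - u') (u - u') = 0"
      using inner[OF that(1) that(1)] inner[OF that] inner[OF that(2) that(1)] inner[OF that(2) that(2)]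
      by (simp add: cinner_simps)
    then show ?thesis by simp
  qed
  have ex: "\<exists>u. rel y u" if y: "y \<in> K" for y
  proof -
    obtain f where "\<And>n. f n \<in> range S" and f: "f \<longlonglongrightarrow> y"
      using y unfolding K_def closure_sequential by blast
    then obtain a where a: "\<And>n. f n = S (a n)" unfolding image_iff by metis
    have "norm (T (a m) - T (a n)) = norm (S (a m) - S (a n))" for m n
    proof -
      have "(norm (T (a m - a n)))\<^sup>2 = (norm (S (a m - a n)))\<^sup>2"
        by (simp flip: Re_cinner_self add: iso)
      then show ?thesis by (simp add: bounded_clinear_diff S T)
    qed
    moreover have "Cauchy (\<lambda>n. S (a n))" using f a LIMSEQ_imp_Cauchy by (metis (no_types) ext)
    ultimately have "Cauchy (\<lambda>n. T (a n))" by (simp add: Cauchy_def dist_norm)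
    then obtain u where "(\<lambda>n. T (a n)) \<longlonglongrightarrow> u" using Cauchy_convergent_iff convergent_def by blast
    then show ?thesis using f a unfolding rel_def by (metis (no_types) ext)
  qed
  have rel_add: "rel (y + y') (u + u')" if "rel y u" "rel y' u'" for y u y' u'
  proof -
    from that obtain a b where "(\<lambda>n. S (a n)) \<longlonglongrightarrow> y" "(\<lambda>n. T (a n)) \<longlonglongrightarrow> u"
      "(\<lambda>n. S (b n)) \<longlonglongrightarrow> y'" "(\<lambda>n. T (b n)) \<longlonglongrightarrow> u'" unfolding rel_def by blast
    then show ?thesis unfolding rel_def
      by (intro exI[of _ "\<lambda>n. a n + b n"]) (simp add: bounded_clinear_add S T tendsto_add)
  qed
  have rel_scale: "rel (c *\<^sub>C y) (c *\<^sub>C u)" if "rel y u" for c y u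
  proof -
    from that obtain a where a: "(\<lambda>n. S (a n)) \<longlonglongrightarrow> y" "(\<lambda>n. T (a n)) \<longlonglongrightarrow> u" unfolding rel_def by blast
    from bounded_clinear_tendsto[OF bounded_clinear_scale a(1)] bounded_clinear_tendsto[OF bounded_clinear_scale a(2)] show ?thesis
      unfolding rel_def by (intro exI[of _ "\<lambda>n. c *\<^sub>C a n"]) (simp add: bounded_clinear_scaleC S T)
  qed
  have rel_ST: "rel (S x) (T x)" for x unfolding rel_def by (intro exI[of _ "\<lambda>n. x"]) simp
  \<comment> \<open>Inserting the projection onto \<open>K\<close> defines the operator on the whole
    space and makes it vanish on the complement.\<close>
  have "\<exists>u. rel (orth_proj K y) u" for y by (rule ex[OF orth_proj_in[OF K]])
  then obtain U where U: "\<And>y. rel (orth_proj K y) (U y)" by metis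
  note Pl = bounded_clinear_simps[OF bounded_clinear_orth_proj[OF K]]
  have Ub: "norm (U x) \<le> norm x" for x
  proof -
    have "(norm (U x))\<^sup>2 = (norm (orth_proj K x))\<^sup>2" by (simp flip: Re_cinner_self add: inner[OF U U])
    then show ?thesis using norm_orth_proj_le[OF K, of x] by simp
  qed
  have Ubc: "bounded_clinear U"
  proof (rule bounded_clinearI[where K=1])
    show "U (x + y) = U x + U y" for x y
      by (rule uniq[OF U]) (simp add: Pl rel_add U)
    show "U (c *\<^sub>C x) = c *\<^sub>C U x" for c x
      by (rule uniq[OF U]) (simp add: Pl rel_scale U)
  qed (simp add: Ub)
  have SK: "S x \<in> K" for x unfolding K_def by (rule subsetD[OF closure_subset]) simp
  show thesis
  proof (rule that[OF Ubc Ub])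
    show "U \<circ> S = T"
    proof
      fix x show "(U \<circ> S) x = T x"
        using uniq[OF _ rel_ST] U[of "S x"] by (simp add: orth_proj_fixes[OF K SK])
    qed
    show "adj U \<circ> T = S"
    proof
      fix x
      have "cinner y (adj U (T x)) = cinner y (S x)" for y
        by (simp add: inner[OF U rel_ST] cinner_orth_proj[OF K] orth_proj_fixes[OF K SK] flip: cinner_adj[OF Ubc])
      then show "(adj U \<circ> T) x = S x" by (simp add: cinner_ext)
    qed
  qed
qed

text \<open>\<open>T\<close> and \<open>abs_op T\<close> have the same inner products of values, so
  the preceding factorization applies. The second identity recovers \<open>abs_op T\<close> from
  \<open>T\<close> by a bounded factor, which is how trace norms get bounded from above.\<close>

lemma polar_decomposition:
  fixes T :: "'h::chilbert_space \<Rightarrow> 'h"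
  assumes T: "bounded_clinear T"
  obtains U where "bounded_clinear U" "onorm U \<le> 1" "onorm (adj U) \<le> 1" "U \<circ> abs_op T = T" "adj U \<circ> T = abs_op T"
proof -
  obtain U where U: "bounded_clinear U" "\<And>x. norm (U x) \<le> norm x" "U \<circ> abs_op T = T" "adj U \<circ> T = abs_op T"
    using isometric_factor[OF positive_opD(1)[OF positive_abs_op[OF T]] T cinner_abs_op[OF T]] by blast
  have "onorm U \<le> 1" by (rule onorm_bound) (simp_all add: U)
  then show thesis using that U onorm_adj_le[OF U(1)] by force
qed


section \<open>Orthonormal bases\<close>

text \<open>The part of \<open>orthonormal_basis\<close> that is stable under unions of chains, as
  Zorn's lemma requires.\<close>

definition orthonormal :: "'h::chilbert_space set \<Rightarrow> bool"
  where "orthonormal B \<longleftrightarrow> (\<forall>e\<in>B. \<forall>f\<in>B. cinner e f = (if e = f then 1 else 0))"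

text \<open>A maximal orthonormal set is complete: otherwise a unit vector orthogonal to its closed
  span could be added.\<close>

lemma orthonormal_basis_exists: "\<exists>B::'h::chilbert_space set. orthonormal_basis B"
proof -
  have "\<exists>M\<in>{B::'h set. orthonormal B}. \<forall>X\<in>{B. orthonormal B}. M \<subseteq> X \<longrightarrow> X = M"
  proof (rule subset_Zorn')
    fix C :: "'h set set" assume C: "subset.chain {B. orthonormal B} C"
    show "\<Union> C \<in> {B. orthonormal B}"
      unfolding orthonormal_def
    proof (intro CollectI ballI)
      fix e f assume "e \<in> \<Union> C" "f \<in> \<Union> C"
      then obtain X where "X \<in> C" "e \<in> X" "f \<in> X"
        using C unfolding subset_chain_def by blast
      then show "cinner e f = (if e = f then 1 else 0)"
        using C unfolding subset_chain_def orthonormal_def by blast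
    qed
  qed
  then obtain M :: "'h set" where M: "orthonormal M" and max: "\<And>X. orthonormal X \<Longrightarrow> M \<subseteq> X \<Longrightarrow> X = M" by blast
  let ?K = "closure (cspan M)"
  have K: "closed_csubspace ?K" by (rule closed_csubspace_closure) simp
  have MK: "M \<subseteq> ?K" using closure_subset complex_vector.span_superset by blast
  have "?K = UNIV"
  proof (rule ccontr)
    assume "?K \<noteq> UNIV"
    then obtain x where "x \<notin> ?K" by blast
    define z where "z = x - orth_proj ?K x"
    have z: "z \<noteq> 0" using \<open>x \<notin> ?K\<close> orth_proj_in[OF K, of x] by (auto simp: z_def)
    have zK: "z \<in> orth ?K" unfolding z_def by (rule orth_proj_compl[OF K])
    define u where "u = complex_of_real (1 / norm z) *\<^sub>C z"
    have uu: "cinner u u = 1" using z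
      by (simp add: u_def norm_scaleC norm_divide cinner_self)
    have Mu: "cinner e u = 0" if "e \<in> M" for e using zK MK that by (auto simp: u_def cinner_simps orth_def)
    then have "cinner u e = 0" if "e \<in> M" for e using that cinner_eq_0_commute by blast
    with M Mu uu have "orthonormal (insert u M)"
      unfolding orthonormal_def by auto
    then have "insert u M = M" by (rule max) blast
    then have "u \<in> M" by blast
    then have "cinner u u = 0" by (rule Mu)
    with uu show False by simp
  qed
  with M show ?thesis unfolding orthonormal_basis_def orthonormal_def by blast
qed

lemma orthonormal_some_basis: "orthonormal some_basis"
  and closure_span_some_basis: "closure (cspan some_basis) = UNIV"
  using someI_ex[OF orthonormal_basis_exists, folded some_basis_def] unfolding orthonormal_basis_def orthonormal_def
  by blast+

text \<open>For finite orthonormal \<open>J\<close> this is the orthogonal projection onto the span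
  of \<open>J\<close>.\<close>

definition coord_proj :: "'h::chilbert_space set \<Rightarrow> 'h \<Rightarrow> 'h"
  where "coord_proj J x = (\<Sum>e\<in>J. cinner e x *\<^sub>C e)"

lemma bounded_clinear_coord_proj [bclin]: "bounded_clinear (coord_proj J)"
proof -
  have "coord_proj J = (\<lambda>x. \<Sum>e\<in>J. rank1 e e x)" by (auto simp: coord_proj_def rank1_def)
  then show ?thesis by (simp add: bclin)
qed

lemma cinner_coord_proj: "cinner (coord_proj J x) y = cinner x (coord_proj J y)"
  unfolding coord_proj_def cinner_sum_left cinner_sum_right
  by (intro sum.cong refl) (simp add: cinner_simps flip: cinner_commute)

lemma cinner_coord_proj_basis:
  assumes "orthonormal B" "finite J" "J \<subseteq> B" "e \<in> B"
  shows "cinner e (coord_proj J x) = (if e \<in> J then cinner e x else 0)"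
proof -
  have "cinner e (coord_proj J x) = (\<Sum>f\<in>J. if e = f then cinner f x else 0)"
    unfolding coord_proj_def cinner_sum_right
    by (rule sum.cong) (use assms in \<open>auto simp: orthonormal_def cinner_simps subset_iff\<close>)
  then show ?thesis using assms(2) by (simp add: sum.delta')
qed

lemma coord_proj_basis:
  assumes "orthonormal B" "finite J" "J \<subseteq> B" "e \<in> B"
  shows "coord_proj J e = (if e \<in> J then e else 0)"
proof -
  have "coord_proj J e = (\<Sum>f\<in>J. if f = e then f else 0)"
    unfolding coord_proj_def
    by (rule sum.cong) (use assms in \<open>auto simp: orthonormal_def subset_iff\<close>)
  then show ?thesis using assms(2) by (simp add: sum.delta')
qed

lemma coord_proj_idem:
  assumes "orthonormal B" "finite J" "J \<subseteq> B"
  shows "coord_proj J (coord_proj J x) = coord_proj J x"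
  unfolding coord_proj_def[of J "coord_proj J x"]
  by (subst (2) coord_proj_def, rule sum.cong)
     (use assms in \<open>auto simp: cinner_coord_proj_basis[OF assms] subset_iff\<close>)

lemma norm_coord_proj_sq:
  assumes "orthonormal B" "finite J" "J \<subseteq> B"
  shows "(norm (coord_proj J x))\<^sup>2 = (\<Sum>e\<in>J. (cmod (cinner e x))\<^sup>2)"
proof -
  have "cinner (coord_proj J x) (coord_proj J x) = cinner x (coord_proj J x)"
    by (simp only: cinner_coord_proj coord_proj_idem[OF assms])
  also have "\<dots> = (\<Sum>e\<in>J. complex_of_real ((cmod (cinner e x))\<^sup>2))"
    unfolding coord_proj_def cinner_sum_right
    by (intro sum.cong refl) (subst cinner_scaleC_right, subst (2) cinner_commute, simp only: complex_norm_square)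
  also have "\<dots> = complex_of_real (\<Sum>e\<in>J. (cmod (cinner e x))\<^sup>2)" by simp
  finally show ?thesis unfolding cinner_self by (simp only: of_real_eq_iff)
qed

lemma norm_sq_coord_proj_decomp:
  assumes "orthonormal B" "finite J" "J \<subseteq> B"
  shows "(norm x)\<^sup>2 = (norm (coord_proj J x))\<^sup>2 + (norm (x - coord_proj J x))\<^sup>2"
proof -
  have "cinner (coord_proj J x) (x - coord_proj J x) = 0"
    by (simp add: cinner_coord_proj bounded_clinear_diff[OF bounded_clinear_coord_proj] coord_proj_idem[OF assms])
  from pythagoras[OF this] show ?thesis by simp
qed

lemma norm_coord_proj_le:
  assumes "orthonormal B" "finite J" "J \<subseteq> B"
  shows "norm (coord_proj J x) \<le> norm x" "norm (x - coord_proj J x) \<le> norm x"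
  using norm_sq_coord_proj_decomp[OF assms, of x]
  by (metis le_add_same_cancel1 le_add_same_cancel2 norm_ge_zero power2_le_imp_le zero_le_power2)+

lemma bessel:
  assumes "orthonormal B" "finite J" "J \<subseteq> B"
  shows "(\<Sum>e\<in>J. (cmod (cinner e x))\<^sup>2) \<le> (norm x)\<^sup>2"
  using norm_coord_proj_le(1)[OF assms, of x] by (simp flip: norm_coord_proj_sq[OF assms])

text \<open>Limits are taken along the net of finite parts of the basis, so that no enumeration of
  the basis has to be chosen.\<close>

abbreviation basis_filter :: "'h::chilbert_space set filter"
  where "basis_filter \<equiv> finite_subsets_at_top some_basis"

lemma eventually_basis_filter:
  "(\<And>J. finite J \<Longrightarrow> J \<subseteq> some_basis \<Longrightarrow> P J) \<Longrightarrow> eventually P basis_filter"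
  by (auto simp: eventually_finite_subsets_at_top)

text \<open>As soon as \<open>J\<close> contains the finitely many basis vectors occurring in an
  approximation \<open>y\<close> of \<open>x\<close>, the projection fixes \<open>y\<close>, and the
  complementary projection does not increase the error.\<close>

lemma tendsto_coord_proj: "((\<lambda>J. coord_proj J x) \<longlongrightarrow> x) basis_filter"
proof (rule tendstoI)
  fix d :: real assume "0 < d"
  then obtain y where y: "y \<in> cspan some_basis" "dist y x < d"
    using closure_span_some_basis closure_approachable by blast
  then obtain I r where I: "finite I" "I \<subseteq> some_basis" "y = (\<Sum>a\<in>I. r a *\<^sub>C a)"
    unfolding complex_vector.span_explicit by blast
  have "dist (coord_proj J x) x < d" if J: "finite J" "I \<subseteq> J" "J \<subseteq> some_basis" for J
  proof -
    have "coord_proj J a = a" if "a \<in> I" for a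
    proof -
      from that I J have "a \<in> some_basis" "a \<in> J" by auto
      then show ?thesis using coord_proj_basis[OF orthonormal_some_basis J(1,3)] by simp
    qed
    then have "coord_proj J y = y" unfolding I(3)
      by (simp add: bounded_clinear_sum bounded_clinear_coord_proj bounded_clinear_scaleC)
    then have "x - coord_proj J x = (x - y) - coord_proj J (x - y)"
      by (simp add: bounded_clinear_diff[OF bounded_clinear_coord_proj])
    also have "norm \<dots> \<le> norm (x - y)" by (rule norm_coord_proj_le[OF orthonormal_some_basis J(1,3)])
    finally show ?thesis using y(2) by (simp add: dist_norm norm_minus_commute)
  qed
  then show "eventually (\<lambda>J. dist (coord_proj J x) x < d) basis_filter"
    unfolding eventually_finite_subsets_at_top using I by blast
qed

lemma tendsto_bessel: "((\<lambda>J. \<Sum>e\<in>J. (cmod (cinner e x))\<^sup>2) \<longlongrightarrow> (norm x)\<^sup>2) basis_filter"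
proof (rule Lim_transform_eventually)
  show "((\<lambda>J. (norm (coord_proj J x))\<^sup>2) \<longlongrightarrow> (norm x)\<^sup>2) basis_filter"
    by (intro tendsto_intros tendsto_coord_proj)
  show "\<forall>\<^sub>F J in basis_filter. (norm (coord_proj J x))\<^sup>2 = (\<Sum>e\<in>J. (cmod (cinner e x))\<^sup>2)"
    by (rule eventually_basis_filter) (rule norm_coord_proj_sq[OF orthonormal_some_basis])
qed

section \<open>Hilbert--Schmidt bounds\<close>

lemma cmod_cinner_commute: "cmod (cinner x y) = cmod (cinner y x)"
  by (subst cinner_commute) simp

lemma basis_filter_neq_bot [simp]: "basis_filter \<noteq> bot"
  by (rule finite_subsets_at_top_neq_bot)

text \<open>A bound \<open>c\<close> for the Hilbert-Schmidt norm. Only finite partial sums occur,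
  so no summability has to be carried along.\<close>

definition hs_bound :: "('h::chilbert_space \<Rightarrow> 'h) \<Rightarrow> real \<Rightarrow> bool"
  where "hs_bound A c \<longleftrightarrow> bounded_clinear A \<and> 0 \<le> c \<and>
    (\<forall>J. finite J \<longrightarrow> J \<subseteq> some_basis \<longrightarrow> (\<Sum>e\<in>J. (norm (A e))\<^sup>2) \<le> c\<^sup>2)"

lemma hs_boundI:
  assumes "bounded_clinear A" "0 \<le> c"
    "\<And>J. finite J \<Longrightarrow> J \<subseteq> some_basis \<Longrightarrow> (\<Sum>e\<in>J. (norm (A e))\<^sup>2) \<le> c\<^sup>2"
  shows "hs_bound A c"
  using assms unfolding hs_bound_def by blast

lemma hs_boundD:
  assumes "hs_bound A c"
  shows "bounded_clinear A" "0 \<le> c"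
    "finite J \<Longrightarrow> J \<subseteq> some_basis \<Longrightarrow> (\<Sum>e\<in>J. (norm (A e))\<^sup>2) \<le> c\<^sup>2"
  using assms unfolding hs_bound_def by blast+

lemma hs_bound_mono:
  assumes A: "hs_bound A c" and "c \<le> d"
  shows "hs_bound A d"
proof (rule hs_boundI[OF hs_boundD(1)[OF A]])
  show "0 \<le> d" using hs_boundD(2)[OF A] assms by simp
  show "(\<Sum>e\<in>J. (norm (A e))\<^sup>2) \<le> d\<^sup>2" if "finite J" "J \<subseteq> some_basis" for J
    using hs_boundD(3)[OF A that] power_mono[OF \<open>c \<le> d\<close> hs_boundD(2)[OF A], of 2] by simp
qed

text \<open>By Parseval both sides are the double sum of squared matrix entries. One index set is
  kept finite, the sums are swapped, and Bessel bounds the inner one.\<close>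

lemma hs_bound_adj:
  assumes A: "hs_bound A c"
  shows "hs_bound (adj A) c"
proof (rule hs_boundI)
  note Ab = hs_boundD(1)[OF A]
  show "bounded_clinear (adj A)" by (rule bounded_clinear_adj[OF Ab])
  show "0 \<le> c" by (rule hs_boundD(2)[OF A])
  fix J :: "'a set" assume J: "finite J" "J \<subseteq> some_basis"
  show "(\<Sum>f\<in>J. (norm (adj A f))\<^sup>2) \<le> c\<^sup>2"
  proof (rule tendsto_upperbound)
    show "((\<lambda>I. \<Sum>f\<in>J. \<Sum>e\<in>I. (cmod (cinner e (adj A f)))\<^sup>2) \<longlongrightarrow> (\<Sum>f\<in>J. (norm (adj A f))\<^sup>2)) basis_filter"
      by (intro tendsto_sum tendsto_bessel)
    show "\<forall>\<^sub>F I in basis_filter. (\<Sum>f\<in>J. \<Sum>e\<in>I. (cmod (cinner e (adj A f)))\<^sup>2) \<le> c\<^sup>2"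
    proof (rule eventually_basis_filter)
      fix I :: "'a set" assume I: "finite I" "I \<subseteq> some_basis"
      have "(\<Sum>f\<in>J. \<Sum>e\<in>I. (cmod (cinner e (adj A f)))\<^sup>2) = (\<Sum>e\<in>I. \<Sum>f\<in>J. (cmod (cinner f (A e)))\<^sup>2)"
        by (subst sum.swap) (simp add: cmod_cinner_commute[of _ "A _"] cinner_adj[OF Ab])
      also have "\<dots> \<le> (\<Sum>e\<in>I. (norm (A e))\<^sup>2)"
        by (intro sum_mono bessel[OF orthonormal_some_basis J])
      also have "\<dots> \<le> c\<^sup>2" by (rule hs_boundD(3)[OF A I])
      finally show "(\<Sum>f\<in>J. \<Sum>e\<in>I. (cmod (cinner e (adj A f)))\<^sup>2) \<le> c\<^sup>2" .
    qed
  qed simp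
qed

lemma hs_bound_comp_left:
  assumes F: "bounded_clinear F" and A: "hs_bound A c"
  shows "hs_bound (F \<circ> A) (onorm F * c)"
proof (rule hs_boundI)
  show "bounded_clinear (F \<circ> A)" by (rule bounded_clinear_compose[OF F hs_boundD(1)[OF A]])
  show "0 \<le> onorm F * c" using onorm_nonneg[OF F] hs_boundD(2)[OF A] by simp
  fix J :: "'a set" assume J: "finite J" "J \<subseteq> some_basis"
  have "(\<Sum>e\<in>J. (norm ((F \<circ> A) e))\<^sup>2) \<le> (\<Sum>e\<in>J. (onorm F * norm (A e))\<^sup>2)"
    by (intro sum_mono power_mono) (simp_all add: bounded_clinear_norm[OF F])
  also have "\<dots> = (onorm F)\<^sup>2 * (\<Sum>e\<in>J. (norm (A e))\<^sup>2)"
    by (simp add: power_mult_distrib sum_distrib_left)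
  also have "\<dots> \<le> (onorm F * c)\<^sup>2"
    using hs_boundD(3)[OF A J] by (simp add: power_mult_distrib mult_left_mono)
  finally show "(\<Sum>e\<in>J. (norm ((F \<circ> A) e))\<^sup>2) \<le> (onorm F * c)\<^sup>2" .
qed

text \<open>Passing to adjoints turns the right factor into a left one.\<close>

lemma hs_bound_comp_right:
  assumes F: "bounded_clinear F" and A: "hs_bound A c"
  shows "hs_bound (A \<circ> F) (onorm F * c)"
proof -
  note Ab = hs_boundD(1)[OF A]
  have "hs_bound (adj F \<circ> adj A) (onorm F * c)"
    by (rule hs_bound_mono[OF hs_bound_comp_left[OF bounded_clinear_adj[OF F] hs_bound_adj[OF A]]])
       (simp add: mult_right_mono onorm_adj_le F hs_boundD(2)[OF A])
  from hs_bound_adj[OF this] show ?thesis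
    by (simp add: adj_compose[OF bounded_clinear_adj[OF F] bounded_clinear_adj[OF Ab]] F Ab)
qed

lemma sum_mult_le_of_sum_squares_le:
  fixes f g :: "'a \<Rightarrow> real"
  assumes "(\<Sum>e\<in>J. (f e)\<^sup>2) \<le> c\<^sup>2" "(\<Sum>e\<in>J. (g e)\<^sup>2) \<le> d\<^sup>2" "0 \<le> c" "0 \<le> d"
  shows "(\<Sum>e\<in>J. \<bar>f e\<bar> * \<bar>g e\<bar>) \<le> c * d"
proof -
  have "L2_set f J \<le> c" "L2_set g J \<le> d"
    unfolding L2_set_def using assms by (simp_all add: real_le_lsqrt sum_nonneg)
  then show ?thesis
    using L2_set_mult_ineq[of f g J] mult_mono[of "L2_set f J" c "L2_set g J" d] assms by simp
qed


section \<open>Trace-class operators\<close>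

text \<open>\<open>trace_bound T C\<close> expresses \<open>trace_norm T \<le> C\<close> through the pairing with bounded operators. Unlike
  the definition by \<open>abs_op\<close>, this form is visibly subadditive and stable under pointwise limits.\<close>

definition trace_bound :: "('h::chilbert_space \<Rightarrow> 'h) \<Rightarrow> real \<Rightarrow> bool"
  where "trace_bound T C \<longleftrightarrow> bounded_clinear T \<and> 0 \<le> C \<and>
    (\<forall>A J. bounded_clinear A \<longrightarrow> finite J \<longrightarrow> J \<subseteq> some_basis \<longrightarrow>
      cmod (\<Sum>e\<in>J. cinner e (A (T e))) \<le> C * onorm A)"

lemma trace_boundI:
  assumes "bounded_clinear T" "0 \<le> C"
    "\<And>A J. bounded_clinear A \<Longrightarrow> finite J \<Longrightarrow> J \<subseteq> some_basis \<Longrightarrow> cmod (\<Sum>e\<in>J. cinner e (A (T e))) \<le> C * onorm A"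
  shows "trace_bound T C"
  using assms unfolding trace_bound_def by blast

lemma trace_boundD:
  assumes "trace_bound T C"
  shows "bounded_clinear T" "0 \<le> C"
    "bounded_clinear A \<Longrightarrow> finite J \<Longrightarrow> J \<subseteq> some_basis \<Longrightarrow> cmod (\<Sum>e\<in>J. cinner e (A (T e))) \<le> C * onorm A"
  using assms unfolding trace_bound_def by blast+

text \<open>Moving \<open>X\<close> to the other side of the inner product leaves products of the
  norms of \<open>adj X e\<close> and \<open>Y e\<close>, to which Cauchy-Schwarz over
  \<open>J\<close> applies. The absolute values stand inside the sum so that the trace is seen to
  converge absolutely.\<close>

lemma hs_comp_abs_sum_le:
  assumes X: "hs_bound X c" and Y: "hs_bound Y d" and J: "finite J" "J \<subseteq> some_basis"
  shows "(\<Sum>e\<in>J. cmod (cinner e (X (Y e)))) \<le> c * d"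
proof -
  have "(\<Sum>e\<in>J. cmod (cinner e (X (Y e)))) \<le> (\<Sum>e\<in>J. \<bar>norm (adj X e)\<bar> * \<bar>norm (Y e)\<bar>)"
    by (rule sum_mono) (simp add: cauchy_schwarz flip: cinner_adj'[OF hs_boundD(1)[OF X]])
  also have "\<dots> \<le> c * d"
    by (rule sum_mult_le_of_sum_squares_le)
       (simp_all add: hs_boundD[OF hs_bound_adj[OF X]] hs_boundD[OF Y] J)
  finally show ?thesis .
qed

lemma trace_bound_hs_comp:
  assumes X: "hs_bound X c" and Y: "hs_bound Y d"
  shows "trace_bound (X \<circ> Y) (c * d)"
proof (rule trace_boundI)
  show "bounded_clinear (X \<circ> Y)" by (intro bounded_clinear_compose hs_boundD(1)[OF X] hs_boundD(1)[OF Y])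
  show "0 \<le> c * d" using hs_boundD(2)[OF X] hs_boundD(2)[OF Y] by simp
  fix A :: "'a \<Rightarrow> 'a" and J :: "'a set" assume A: "bounded_clinear A" and J: "finite J" "J \<subseteq> some_basis"
  have "cmod (\<Sum>e\<in>J. cinner e (A ((X \<circ> Y) e))) \<le> (\<Sum>e\<in>J. cmod (cinner e ((A \<circ> X) (Y e))))"
    by (rule order_trans[OF norm_sum]) simp
  also have "\<dots> \<le> (onorm A * c) * d"
    by (rule hs_comp_abs_sum_le[OF hs_bound_comp_left[OF A X] Y J])
  finally show "cmod (\<Sum>e\<in>J. cinner e (A ((X \<circ> Y) e))) \<le> c * d * onorm A" by (simp add: mult_ac)
qed

lemma trace_norm_eq_infsum:
  assumes "trace_class T"
  shows "(\<lambda>e. Re (cinner e (abs_op T e))) summable_on some_basis"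
    "trace_norm T = (\<Sum>\<^sub>\<infinity>e\<in>some_basis. Re (cinner e (abs_op T e)))"
  using assms unfolding trace_class_def trace_norm_def op_trace_def
  by (simp_all add: summable_on_Re infsum_Re)

lemma trace_class_bounded: "trace_class T \<Longrightarrow> bounded_clinear T"
  by (simp add: trace_class_def)

text \<open>With R the square root of \<open>abs_op T\<close> and U from the polar decomposition, T
  = (U R) R. The squared Hilbert-Schmidt norm of R is the trace of \<open>abs_op T\<close>, which is
  where \<open>c * c\<close> comes from.\<close>

lemma trace_class_factor:
  assumes T: "trace_class T"
  obtains X Y c where "T = X \<circ> Y" "hs_bound X c" "hs_bound Y c" "c * c = trace_norm T"
proof -
  note Tb = trace_class_bounded[OF T]
  note pos = positive_abs_op[OF Tb]
  obtain R where R: "positive_op R" "R \<circ> R = abs_op T"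
    by (rule positive_sqrt_exists[OF pos]) blast
  obtain U where U: "bounded_clinear U" "onorm U \<le> 1" "U \<circ> abs_op T = T"
    by (rule polar_decomposition[OF Tb]) blast
  have Re: "(norm (R x))\<^sup>2 = Re (cinner x (abs_op T x))" for x
    by (simp add: positive_op_symmetric[OF R(1)] flip: R(2) Re_cinner_self)
  have tn0: "0 \<le> trace_norm T"
    unfolding trace_norm_eq_infsum(2)[OF T] by (rule infsum_nonneg) (rule positive_opD(3)[OF pos])
  have hsR: "hs_bound R (sqrt (trace_norm T))"
  proof (rule hs_boundI[OF positive_opD(1)[OF R(1)]])
    fix J :: "'a set" assume J: "finite J" "J \<subseteq> some_basis"
    have "(\<Sum>e\<in>J. (norm (R e))\<^sup>2) = (\<Sum>e\<in>J. Re (cinner e (abs_op T e)))" by (simp add: Re)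
    also have "\<dots> \<le> trace_norm T"
      unfolding trace_norm_eq_infsum(2)[OF T]
      by (rule finite_sum_le_infsum[OF trace_norm_eq_infsum(1)[OF T] J]) (rule positive_opD(3)[OF pos])
    finally show "(\<Sum>e\<in>J. (norm (R e))\<^sup>2) \<le> (sqrt (trace_norm T))\<^sup>2" using tn0 by simp
  qed (simp add: tn0)
  show thesis
  proof (rule that)
    show "T = (U \<circ> R) \<circ> R" using U(3) R(2) by (simp add: comp_assoc)
    show "hs_bound (U \<circ> R) (sqrt (trace_norm T))"
      by (rule hs_bound_mono[OF hs_bound_comp_left[OF U(1) hsR]])
         (use U(2) tn0 mult_right_mono[OF U(2), of "sqrt (trace_norm T)"] in simp)
    show "sqrt (trace_norm T) * sqrt (trace_norm T) = trace_norm T" using tn0 by simp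
  qed (rule hsR)
qed

lemma trace_bound_trace_norm:
  assumes "trace_class T"
  shows "trace_bound T (trace_norm T)"
proof -
  obtain X Y c where "T = X \<circ> Y" "hs_bound X c" "hs_bound Y c" "c * c = trace_norm T"
    by (rule trace_class_factor[OF assms])
  then show ?thesis using trace_bound_hs_comp by metis
qed

text \<open>Tested against the adjoint of the polar factor, the inequality bounds the partial sums
  of the nonnegative series that defines the trace norm.\<close>

lemma trace_bound_imp:
  assumes T: "trace_bound T C"
  shows "trace_class T" "trace_norm T \<le> C"
proof -
  note Tb = trace_boundD(1)[OF T]
  note pos = positive_abs_op[OF Tb]
  obtain U where U: "bounded_clinear U" "onorm (adj U) \<le> 1" "adj U \<circ> T = abs_op T"
    by (rule polar_decomposition[OF Tb]) blast
  have le: "(\<Sum>e\<in>J. Re (cinner e (abs_op T e))) \<le> C" if J: "finite J" "J \<subseteq> some_basis" for J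
  proof -
    have "(\<Sum>e\<in>J. Re (cinner e (abs_op T e))) = Re (\<Sum>e\<in>J. cinner e (adj U (T e)))"
      by (simp add: Re_sum flip: U(3))
    also have "\<dots> \<le> cmod (\<Sum>e\<in>J. cinner e (adj U (T e)))" by (rule complex_Re_le_cmod)
    also have "\<dots> \<le> C * onorm (adj U)" by (rule trace_boundD(3)[OF T bounded_clinear_adj[OF U(1)] J])
    also have "\<dots> \<le> C" using mult_left_mono[OF U(2) trace_boundD(2)[OF T]] by simp
    finally show ?thesis .
  qed
  have summable: "(\<lambda>e. Re (cinner e (abs_op T e))) summable_on some_basis"
    by (rule nonneg_bounded_partial_sums_imp_summable_on[where C=C])
       (auto intro: eventually_basis_filter le positive_opD(3)[OF pos])
  then have "(\<lambda>e. complex_of_real (Re (cinner e (abs_op T e)))) summable_on some_basis"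
    by (rule summable_on_of_real)
  then have "(\<lambda>e. cinner e (abs_op T e)) summable_on some_basis"
    by (simp only: positive_opD(2)[OF pos, symmetric])
  then show tc: "trace_class T" using Tb by (simp add: trace_class_def)
  show "trace_norm T \<le> C"
    unfolding trace_norm_eq_infsum(2)[OF tc] by (rule infsum_le_finite_sums[OF summable le])
qed

lemma trace_norm_nonneg: "trace_class T \<Longrightarrow> 0 \<le> trace_norm T"
  by (rule trace_boundD(2)[OF trace_bound_trace_norm])

lemma trace_bound_add:
  assumes S: "trace_bound S c" and T: "trace_bound T d"
  shows "trace_bound (S + T) (c + d)"
proof (rule trace_boundI)
  show "bounded_clinear (S + T)" by (intro bclin trace_boundD(1)[OF S] trace_boundD(1)[OF T])
  show "0 \<le> c + d" using trace_boundD(2)[OF S] trace_boundD(2)[OF T] by simp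
  fix A :: "'a \<Rightarrow> 'a" and J :: "'a set" assume A: "bounded_clinear A" and J: "finite J" "J \<subseteq> some_basis"
  have "(\<Sum>e\<in>J. cinner e (A ((S + T) e))) = (\<Sum>e\<in>J. cinner e (A (S e))) + (\<Sum>e\<in>J. cinner e (A (T e)))"
    by (simp add: bounded_clinear_add[OF A] cinner_add_right sum.distrib)
  also have "cmod \<dots> \<le> c * onorm A + d * onorm A"
    by (rule order_trans[OF norm_triangle_ineq add_mono]) (intro trace_boundD(3)[OF S] trace_boundD(3)[OF T] A J)+
  finally show "cmod (\<Sum>e\<in>J. cinner e (A ((S + T) e))) \<le> (c + d) * onorm A" by (simp add: distrib_right)
qed

lemma trace_bound_scaleC:
  assumes T: "trace_bound T d"
  shows "trace_bound (c *\<^sub>C T) (cmod c * d)"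
proof (rule trace_boundI)
  show "bounded_clinear (c *\<^sub>C T)" by (intro bclin trace_boundD(1)[OF T])
  show "0 \<le> cmod c * d" using trace_boundD(2)[OF T] by simp
  fix A :: "'a \<Rightarrow> 'a" and J :: "'a set" assume A: "bounded_clinear A" and J: "finite J" "J \<subseteq> some_basis"
  have "(\<Sum>e\<in>J. cinner e (A ((c *\<^sub>C T) e))) = c * (\<Sum>e\<in>J. cinner e (A (T e)))"
    by (simp add: scaleC_fun_def bounded_clinear_scaleC[OF A] cinner_scaleC_right sum_distrib_left)
  then show "cmod (\<Sum>e\<in>J. cinner e (A ((c *\<^sub>C T) e))) \<le> cmod c * d * onorm A"
    using trace_boundD(3)[OF T A J] by (simp add: norm_mult mult.assoc mult_left_mono)
qed

lemma trace_class_add: "trace_class S \<Longrightarrow> trace_class T \<Longrightarrow> trace_class (S + T)"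
  and trace_norm_triangle: "trace_class S \<Longrightarrow> trace_class T \<Longrightarrow> trace_norm (S + T) \<le> trace_norm S + trace_norm T"
  by (blast intro: trace_bound_imp trace_bound_add trace_bound_trace_norm)+

lemma trace_class_scaleC: "trace_class T \<Longrightarrow> trace_class (c *\<^sub>C T)"
  and trace_norm_scaleC_le: "trace_class T \<Longrightarrow> trace_norm (c *\<^sub>C T) \<le> cmod c * trace_norm T"
  by (blast intro: trace_bound_imp trace_bound_scaleC trace_bound_trace_norm)+

lemma trace_bound_zero: "trace_bound (0 :: 'h::chilbert_space \<Rightarrow> 'h) 0"
  by (rule trace_boundI) (simp_all add: bclin bounded_clinear_zero)

lemma trace_class_zero [simp]: "trace_class (0 :: 'h::chilbert_space \<Rightarrow> 'h)"
  and trace_norm_zero [simp]: "trace_norm (0 :: 'h::chilbert_space \<Rightarrow> 'h) = 0"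
  using trace_bound_imp[OF trace_bound_zero, where 'a='h] trace_norm_nonneg by (blast intro: antisym)+

text \<open>The bound gives one inequality; the other one is the same inequality for the inverse
  scalar.\<close>

lemma trace_norm_scaleC:
  assumes T: "trace_class T"
  shows "trace_norm (c *\<^sub>C T) = cmod c * trace_norm T"
proof (cases "c = 0")
  case False
  have "trace_norm T = trace_norm (inverse c *\<^sub>C c *\<^sub>C T)" using False by (simp add: scaleC_scaleC)
  also have "\<dots> \<le> cmod (inverse c) * trace_norm (c *\<^sub>C T)"
    by (rule trace_norm_scaleC_le[OF trace_class_scaleC[OF T]])
  finally have "cmod c * trace_norm T \<le> trace_norm (c *\<^sub>C T)"
    using False by (simp add: norm_inverse norm_divide field_simps)
  then show ?thesis using trace_norm_scaleC_le[OF T, of c] by simp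
qed simp

lemma trace_class_minus: "trace_class T \<Longrightarrow> trace_class (- T)"
  using trace_class_scaleC[of T "-1"] by (simp add: scaleC_minus1)

lemma trace_class_diff: "trace_class S \<Longrightarrow> trace_class T \<Longrightarrow> trace_class (S - T)"
  using trace_class_add[OF _ trace_class_minus] by fastforce

lemma trace_bound_comp_left:
  assumes F: "bounded_clinear F" and T: "trace_bound T c"
  shows "trace_bound (F \<circ> T) (onorm F * c)"
proof (rule trace_boundI)
  show "bounded_clinear (F \<circ> T)" by (intro bounded_clinear_compose F trace_boundD(1)[OF T])
  show "0 \<le> onorm F * c" using trace_boundD(2)[OF T] onorm_nonneg[OF F] by simp
  fix A :: "'a \<Rightarrow> 'a" and J :: "'a set" assume A: "bounded_clinear A" and J: "finite J" "J \<subseteq> some_basis"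
  have "cmod (\<Sum>e\<in>J. cinner e ((A \<circ> F) (T e))) \<le> c * onorm (A \<circ> F)"
    by (rule trace_boundD(3)[OF T bounded_clinear_compose[OF A F] J])
  also have "\<dots> \<le> c * (onorm A * onorm F)"
    by (rule mult_left_mono[OF onorm_compose_le[OF A F] trace_boundD(2)[OF T]])
  finally show "cmod (\<Sum>e\<in>J. cinner e (A ((F \<circ> T) e))) \<le> onorm F * c * onorm A"
    by (simp add: mult_ac)
qed

lemma trace_class_comp_left: "bounded_clinear A \<Longrightarrow> trace_class T \<Longrightarrow> trace_class (A \<circ> T)"
  and trace_norm_comp_left: "bounded_clinear A \<Longrightarrow> trace_class T \<Longrightarrow> trace_norm (A \<circ> T) \<le> onorm A * trace_norm T"
  by (blast intro: trace_bound_imp trace_bound_comp_left trace_bound_trace_norm)+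

text \<open>The test operator in \<open>trace_bound\<close> stands on the left, so a factor on the
  right is absorbed into the right Hilbert-Schmidt factor.\<close>

lemma trace_bound_comp_right:
  assumes F: "bounded_clinear F" and T: "trace_class T"
  shows "trace_bound (T \<circ> F) (onorm F * trace_norm T)"
proof -
  obtain X Y c where X: "T = X \<circ> Y" "hs_bound X c" "hs_bound Y c" "c * c = trace_norm T"
    by (rule trace_class_factor[OF T])
  have "trace_bound (X \<circ> (Y \<circ> F)) (c * (onorm F * c))"
    by (rule trace_bound_hs_comp[OF X(2) hs_bound_comp_right[OF F X(3)]])
  then show ?thesis by (simp add: X(1,4)[symmetric] comp_assoc mult_ac) (simp add: X(1) comp_assoc)
qed

lemma trace_class_comp_right: "bounded_clinear A \<Longrightarrow> trace_class T \<Longrightarrow> trace_class (T \<circ> A)"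
  and trace_norm_comp_right: "bounded_clinear A \<Longrightarrow> trace_class T \<Longrightarrow> trace_norm (T \<circ> A) \<le> onorm A * trace_norm T"
  by (blast intro: trace_bound_imp trace_bound_comp_right)+

lemma trace_bound_adj:
  assumes T: "trace_class T"
  shows "trace_bound (adj T) (trace_norm T)"
proof -
  obtain X Y c where X: "T = X \<circ> Y" "hs_bound X c" "hs_bound Y c" "c * c = trace_norm T"
    by (rule trace_class_factor[OF T])
  have "adj T = adj Y \<circ> adj X" unfolding X(1) by (rule adj_compose[OF hs_boundD(1)[OF X(2)] hs_boundD(1)[OF X(3)]])
  then show ?thesis using trace_bound_hs_comp[OF hs_bound_adj[OF X(3)] hs_bound_adj[OF X(2)]] by (simp add: X(4))
qed

lemma trace_class_adj: "trace_class T \<Longrightarrow> trace_class (adj T)"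
  by (blast intro: trace_bound_imp trace_bound_adj)

lemma trace_bound_rank1: "trace_bound (rank1 x y) (norm x * norm y)"
proof (rule trace_boundI[OF bounded_clinear_rank1])
  fix A :: "'a \<Rightarrow> 'a" and J :: "'a set" assume A: "bounded_clinear A" and J: "finite J" "J \<subseteq> some_basis"
  have "(\<Sum>e\<in>J. cinner e (A (rank1 x y e))) = cinner y (coord_proj J (A x))"
    unfolding coord_proj_def cinner_sum_right
    by (rule sum.cong) (simp_all add: rank1_def bounded_clinear_scaleC[OF A] cinner_simps mult.commute)
  also have "cmod \<dots> \<le> norm y * norm (coord_proj J (A x))" by (rule cauchy_schwarz)
  also have "\<dots> \<le> norm y * (onorm A * norm x)"
    by (rule mult_left_mono[OF order_trans[OF norm_coord_proj_le(1)[OF orthonormal_some_basis J] bounded_clinear_norm[OF A]]]) simp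
  finally show "cmod (\<Sum>e\<in>J. cinner e (A (rank1 x y e))) \<le> norm x * norm y * onorm A" by (simp add: mult_ac)
qed simp

lemma trace_class_rank1: "trace_class (rank1 x y)"
  and trace_norm_rank1_le: "trace_norm (rank1 x y) \<le> norm x * norm y"
  by (blast intro: trace_bound_imp trace_bound_rank1)+

text \<open>The test operator \<open>rank1 x (T x)\<close> turns the finite sum into the inner
  product of \<open>T x\<close> with the image under \<open>T\<close> of the truncation of
  \<open>x\<close>; then the finite set grows.\<close>

lemma norm_le_trace_bound:
  assumes T: "trace_bound T C"
  shows "norm (T x) \<le> C * norm x"
proof -
  note Tb = trace_boundD(1)[OF T]
  let ?y = "T x"
  have "cmod (cinner ?y (T x)) \<le> C * (norm x * norm ?y)"
  proof (rule tendsto_upperbound)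
    show "((\<lambda>J. cmod (cinner ?y (T (coord_proj J x)))) \<longlongrightarrow> cmod (cinner ?y (T x))) basis_filter"
      by (intro tendsto_norm cinner.tendsto tendsto_const bounded_clinear_tendsto[OF Tb] tendsto_coord_proj)
    show "\<forall>\<^sub>F J in basis_filter. cmod (cinner ?y (T (coord_proj J x))) \<le> C * (norm x * norm ?y)"
    proof (rule eventually_basis_filter)
      fix J :: "'a set" assume J: "finite J" "J \<subseteq> some_basis"
      have "cinner ?y (T (coord_proj J x)) = (\<Sum>e\<in>J. cinner e (rank1 x ?y (T e)))"
        unfolding coord_proj_def bounded_clinear_sum[OF Tb] cinner_sum_right
        by (rule sum.cong) (simp_all add: rank1_def bounded_clinear_scaleC[OF Tb] cinner_simps)
      then show "cmod (cinner ?y (T (coord_proj J x))) \<le> C * (norm x * norm ?y)"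
        using trace_boundD(3)[OF T bounded_clinear_rank1 J, of x ?y]
          mult_left_mono[OF onorm_rank1_le trace_boundD(2)[OF T], of x ?y] by simp
    qed
  qed simp
  then have "norm ?y * norm ?y \<le> norm ?y * (C * norm x)" by (simp add: cinner_self_norm power2_eq_square mult_ac)
  then show ?thesis
    using trace_boundD(2)[OF T] by (cases "norm ?y = 0") (simp_all add: mult_le_cancel_left_pos)
qed

lemma norm_le_trace_norm: "trace_class T \<Longrightarrow> norm (T x) \<le> trace_norm T * norm x"
  by (rule norm_le_trace_bound[OF trace_bound_trace_norm])

lemma onorm_le_trace_norm: "trace_class T \<Longrightarrow> onorm T \<le> trace_norm T"
  by (rule onorm_bound[OF trace_norm_nonneg norm_le_trace_norm])

lemma trace_norm_eq_0_iff:
  assumes "trace_class T"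
  shows "trace_norm T = 0 \<longleftrightarrow> T = 0"
proof
  assume "trace_norm T = 0"
  then have "norm (T x) \<le> 0" for x using norm_le_trace_norm[OF assms, of x] by simp
  then show "T = 0" by (simp add: fun_eq_iff)
qed simp

text \<open>The limit is first found in operator norm. For a fixed test operator and a fixed finite
  \<open>J\<close>, the inequality of \<open>trace_bound\<close> passes to the pointwise limit,
  which upgrades the convergence to the trace norm.\<close>

lemma trace_norm_complete:
  fixes X :: "nat \<Rightarrow> 'h::chilbert_space \<Rightarrow> 'h"
  assumes X: "\<And>n. trace_class (X n)"
    and Cauchy: "\<And>e. e > 0 \<Longrightarrow> \<exists>N. \<forall>m\<ge>N. \<forall>n\<ge>N. trace_norm (X m - X n) < e"
  obtains T where "trace_class T" "\<And>x. (\<lambda>n. X n x) \<longlonglongrightarrow> T x" "(\<lambda>n. trace_norm (X n - T)) \<longlonglongrightarrow> 0"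
proof -
  have "\<exists>N. \<forall>m\<ge>N. \<forall>n\<ge>N. \<forall>x. norm (X m x - X n x) \<le> e * norm x" if e: "e > 0" for e
  proof -
    obtain N where N: "\<And>m n. m \<ge> N \<Longrightarrow> n \<ge> N \<Longrightarrow> trace_norm (X m - X n) < e"
      using Cauchy[OF e] by blast
    have "norm (X m x - X n x) \<le> e * norm x" if "m \<ge> N" "n \<ge> N" for m n x
      using order_trans[OF norm_le_trace_norm[OF trace_class_diff[OF X X], of m n x]
          mult_right_mono[OF less_imp_le[OF N[OF that]]]] by simp
    then show ?thesis by blast
  qed
  from bounded_clinear_limit[OF trace_class_bounded[OF X] this]
  obtain T where T: "bounded_clinear T" and lim: "\<And>x. (\<lambda>n. X n x) \<longlonglongrightarrow> T x" by metis
  have tb: "\<exists>N. \<forall>n\<ge>N. trace_bound (X n - T) e" if e: "e > 0" for e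
  proof -
    obtain N where N: "\<And>m n. m \<ge> N \<Longrightarrow> n \<ge> N \<Longrightarrow> trace_norm (X m - X n) < e"
      using Cauchy[OF e] by blast
    have "trace_bound (X n - T) e" if n: "n \<ge> N" for n
    proof (rule trace_boundI)
      show "bounded_clinear (X n - T)" by (intro bclin trace_class_bounded X T)
      fix A :: "'h \<Rightarrow> 'h" and J :: "'h set" assume A: "bounded_clinear A" and J: "finite J" "J \<subseteq> some_basis"
      show "cmod (\<Sum>e\<in>J. cinner e (A ((X n - T) e))) \<le> e * onorm A"
      proof (rule tendsto_upperbound)
        show "(\<lambda>m. cmod (\<Sum>e\<in>J. cinner e (A ((X n - X m) e)))) \<longlonglongrightarrow> cmod (\<Sum>e\<in>J. cinner e (A ((X n - T) e)))"
          by (intro tendsto_norm tendsto_sum cinner.tendsto tendsto_const bounded_clinear_tendsto[OF A])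
             (simp add: lim tendsto_diff)
        have "cmod (\<Sum>e\<in>J. cinner e (A ((X n - X m) e))) \<le> e * onorm A" if "m \<ge> N" for m
          using trace_boundD(3)[OF trace_bound_trace_norm[OF trace_class_diff[OF X X]] A J, of n m]
            mult_right_mono[OF less_imp_le[OF N[OF n that]] onorm_nonneg[OF A]] by simp
        then show "\<forall>\<^sub>F m in sequentially. cmod (\<Sum>e\<in>J. cinner e (A ((X n - X m) e))) \<le> e * onorm A"
          unfolding eventually_sequentially by blast
      qed simp
    qed (use \<open>e > 0\<close> in simp)
    then show ?thesis by blast
  qed
  have tc: "trace_class T"
  proof -
    obtain N where "trace_bound (X N - T) 1" using tb[of 1] by auto
    then have "trace_class (X N - (X N - T))" by (intro trace_class_diff X trace_bound_imp)
    then show ?thesis by simp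
  qed
  have "(\<lambda>n. trace_norm (X n - T)) \<longlonglongrightarrow> 0"
  proof (rule LIMSEQ_I)
    fix r :: real assume "r > 0"
    then obtain N where N: "\<And>n. n \<ge> N \<Longrightarrow> trace_bound (X n - T) (r / 2)" using tb[of "r/2"] by auto
    have "norm (trace_norm (X n - T) - 0) < r" if "n \<ge> N" for n
      using trace_bound_imp(2)[OF N[OF that]] trace_norm_nonneg[OF trace_class_diff[OF X tc], of n] \<open>r > 0\<close> by simp
    then show "\<exists>N. \<forall>n\<ge>N. norm (trace_norm (X n - T) - 0) < r" by blast
  qed
  with tc lim that show thesis by blast
qed


section \<open>The trace\<close>

lemma op_trace_has_sum:
  assumes T: "trace_class T"
  shows "((\<lambda>e. cinner e (T e)) has_sum op_trace T) some_basis"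
proof -
  obtain X Y c where X: "T = X \<circ> Y" "hs_bound X c" "hs_bound Y c" "c * c = trace_norm T"
    by (rule trace_class_factor[OF T])
  have "(\<lambda>e. cmod (cinner e (T e))) summable_on some_basis"
    by (rule nonneg_bounded_partial_sums_imp_summable_on[where C="c * c"])
       (auto intro!: eventually_basis_filter hs_comp_abs_sum_le[OF X(2,3)] simp: X(1))
  then have "(\<lambda>e. cinner e (T e)) summable_on some_basis" by (rule abs_summable_summable)
  then show ?thesis unfolding op_trace_def by (rule has_sum_infsum)
qed

lemma op_trace_eqI: "((\<lambda>e. cinner e (T e)) has_sum s) some_basis \<Longrightarrow> op_trace T = s"
  unfolding op_trace_def by (rule infsumI)

lemma op_trace_add: "trace_class S \<Longrightarrow> trace_class T \<Longrightarrow> op_trace (S + T) = op_trace S + op_trace T"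
  by (rule op_trace_eqI) (simp add: cinner_add_right has_sum_add op_trace_has_sum)

lemma op_trace_scaleC: "trace_class T \<Longrightarrow> op_trace (c *\<^sub>C T) = c * op_trace T"
  by (rule op_trace_eqI) (simp add: scaleC_fun_def cinner_scaleC_right has_sum_cmult_right op_trace_has_sum)

lemma op_trace_minus: "trace_class T \<Longrightarrow> op_trace (- T) = - op_trace T"
  using op_trace_scaleC[of T "-1"] by (simp add: scaleC_minus1)

lemma op_trace_diff: "trace_class S \<Longrightarrow> trace_class T \<Longrightarrow> op_trace (S - T) = op_trace S - op_trace T"
  using op_trace_add[OF _ trace_class_minus, of S T] by (simp add: op_trace_minus)

lemma cmod_op_trace_comp_le:
  assumes A: "bounded_clinear A" and T: "trace_class T"
  shows "cmod (op_trace (A \<circ> T)) \<le> onorm A * trace_norm T"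
proof (rule tendsto_upperbound)
  show "((\<lambda>J. cmod (\<Sum>e\<in>J. cinner e (A (T e)))) \<longlongrightarrow> cmod (op_trace (A \<circ> T))) basis_filter"
    using op_trace_has_sum[OF trace_class_comp_left[OF A T]] unfolding has_sum_def by (intro tendsto_norm) simp
  show "\<forall>\<^sub>F J in basis_filter. cmod (\<Sum>e\<in>J. cinner e (A (T e))) \<le> onorm A * trace_norm T"
    by (rule eventually_basis_filter)
       (use trace_boundD(3)[OF trace_bound_trace_norm[OF T] A] in \<open>simp add: mult.commute\<close>)
qed simp

lemma cmod_op_trace_le:
  assumes T: "trace_class T"
  shows "cmod (op_trace T) \<le> trace_norm T"
  using cmod_op_trace_comp_le[OF bounded_clinear_id(1) T]
    mult_right_mono[OF onorm_id_le[where 'a='a] trace_norm_nonneg[OF T]] by (simp add: id_def comp_def)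

lemma op_trace_rank1: "op_trace (rank1 x y) = cinner y x"
proof (rule op_trace_eqI)
  have "((\<lambda>J. cinner y (coord_proj J x)) \<longlongrightarrow> cinner y x) basis_filter"
    by (intro cinner.tendsto tendsto_const tendsto_coord_proj)
  then show "((\<lambda>e. cinner e (rank1 x y e)) has_sum cinner y x) some_basis"
    unfolding has_sum_def coord_proj_def cinner_sum_right by (simp add: rank1_def cinner_scaleC_right mult.commute)
qed

section \<open>Finite-rank approximation and cyclicity of the trace\<close>

lemma comp_rank1: "bounded_clinear A \<Longrightarrow> A \<circ> rank1 x y = rank1 (A x) y"
  by (rule ext) (simp add: rank1_def bounded_clinear_scaleC)

lemma rank1_comp: "bounded_clinear A \<Longrightarrow> rank1 x y \<circ> A = rank1 x (adj A y)"
  by (rule ext) (simp add: rank1_def cinner_adj')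

definition rank1_sum :: "'i set \<Rightarrow> ('i \<Rightarrow> 'h::chilbert_space) \<Rightarrow> ('i \<Rightarrow> 'h) \<Rightarrow> 'h \<Rightarrow> 'h"
  where "rank1_sum J x y = (\<Sum>i\<in>J. rank1 (x i) (y i))"

lemma sum_fun_apply: "(\<Sum>i\<in>J. f i) z = (\<Sum>i\<in>J. f i z)"
  by (induction J rule: infinite_finite_induct) simp_all

lemma trace_class_sum: "(\<And>i. i \<in> J \<Longrightarrow> trace_class (T i)) \<Longrightarrow> trace_class (\<Sum>i\<in>J. T i)"
  by (induction J rule: infinite_finite_induct) (simp_all add: trace_class_add)

lemma trace_class_rank1_sum: "trace_class (rank1_sum J x y)"
  unfolding rank1_sum_def by (intro trace_class_sum trace_class_rank1)

lemma op_trace_zero [simp]: "op_trace 0 = 0"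
  by (simp add: op_trace_def)

lemma op_trace_sum: "(\<And>i. i \<in> J \<Longrightarrow> trace_class (T i)) \<Longrightarrow> op_trace (\<Sum>i\<in>J. T i) = (\<Sum>i\<in>J. op_trace (T i))"
  by (induction J rule: infinite_finite_induct) (simp_all add: op_trace_add trace_class_sum)

text \<open>The squared norms of \<open>adj Y e\<close> are summable over the basis, so outside a
  finite set they sum to at most d^2. This bounds the restriction of \<open>adj Y\<close> to the
  complement; its adjoint is the truncated \<open>Y\<close>.\<close>

lemma hs_bound_tail:
  assumes Y: "hs_bound Y c" and d: "0 < d"
  obtains J where "finite J" "J \<subseteq> some_basis" "hs_bound (\<lambda>z. Y z - coord_proj J (Y z)) d"
proof -
  note Yb = hs_boundD(1)[OF Y] and Z = hs_bound_adj[OF Y]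
  note Zb = hs_boundD(1)[OF Z]
  define f where "f e = (norm (adj Y e))\<^sup>2" for e
  have summable: "f summable_on some_basis"
    by (rule nonneg_bounded_partial_sums_imp_summable_on[where C="c\<^sup>2"])
       (auto intro!: eventually_basis_filter hs_boundD(3)[OF Z] simp: f_def)
  have "eventually (\<lambda>J. dist (sum f J) (infsum f some_basis) < d\<^sup>2) basis_filter"
    using tendstoD[OF infsum_tendsto[OF summable], of "d\<^sup>2"] d by simp
  then obtain J where J: "finite J" "J \<subseteq> some_basis" and near: "dist (sum f J) (infsum f some_basis) < d\<^sup>2"
    unfolding eventually_finite_subsets_at_top by blast
  have tail: "hs_bound (\<lambda>z. adj Y (z - coord_proj J z)) d"
  proof (rule hs_boundI)
    show "bounded_clinear (\<lambda>z. adj Y (z - coord_proj J z))"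
      by (rule bounded_clinear_compose_fun[OF Zb]) (intro bclin)
    fix I :: "'a set" assume I: "finite I" "I \<subseteq> some_basis"
    have "(\<Sum>e\<in>I. (norm (adj Y (e - coord_proj J e)))\<^sup>2) = (\<Sum>e\<in>I. if e \<in> I - J then f e else 0)"
    proof (rule sum.cong[OF refl])
      fix e assume "e \<in> I"
      then have "coord_proj J e = (if e \<in> J then e else 0)"
        using I by (intro coord_proj_basis[OF orthonormal_some_basis J]) auto
      then show "(norm (adj Y (e - coord_proj J e)))\<^sup>2 = (if e \<in> I - J then f e else 0)"
        using \<open>e \<in> I\<close> by (simp add: f_def bounded_clinear_zero[OF Zb])
    qed
    also have "\<dots> = sum f (I - J)" using I(1) by (simp add: sum.If_cases Int_def set_diff_eq)
    also have "\<dots> = sum f (I \<union> J) - sum f J"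
      using I(1) J(1) by (simp add: sum_diff[of "I \<union> J" J, symmetric] Un_Diff)
    also have "\<dots> \<le> infsum f some_basis - sum f J"
      by (rule diff_right_mono, rule finite_sum_le_infsum[OF summable]) (use I J in \<open>auto simp: f_def\<close>)
    also have "\<dots> \<le> d\<^sup>2" using near by (simp add: dist_real_def)
    finally show "(\<Sum>e\<in>I. (norm (adj Y (e - coord_proj J e)))\<^sup>2) \<le> d\<^sup>2" .
  qed (use d in simp)
  have "adj (\<lambda>z. adj Y (z - coord_proj J z)) = (\<lambda>z. Y z - coord_proj J (Y z))"
    by (rule adj_eqI) (simp add: cinner_adj'[OF Yb] cinner_simps cinner_coord_proj)
  with hs_bound_adj[OF tail] J that show thesis by simp
qed

text \<open>In a factorization into two Hilbert-Schmidt operators only \<open>Y\<close> is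
  truncated: inserting a finite coordinate projection between the factors gives a sum of rank-one
  operators.\<close>

lemma finite_rank_dense:
  fixes T :: "'h::chilbert_space \<Rightarrow> 'h"
  assumes T: "trace_class T" and d: "0 < d"
  obtains J :: "'h set" and x y where "finite J" "trace_norm (T - rank1_sum J x y) < d"
proof -
  obtain X Y c where X: "T = X \<circ> Y" "hs_bound X c" "hs_bound Y c"
    by (rule trace_class_factor[OF T])
  note Xb = hs_boundD(1)[OF X(2)] and Yb = hs_boundD(1)[OF X(3)] and c0 = hs_boundD(2)[OF X(2)]
  \<comment> \<open>The summand 1 avoids a division by zero and makes the product with
    \<open>c\<close> strictly smaller than \<open>d\<close>.\<close>
  have "0 < d / (c + 1)" using d c0 by simp
  then obtain J where J: "finite J" and tail: "hs_bound (\<lambda>z. Y z - coord_proj J (Y z)) (d / (c + 1))"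
    by (rule hs_bound_tail[OF X(3)])
  have "T - rank1_sum J X (adj Y) = X \<circ> (\<lambda>z. Y z - coord_proj J (Y z))"
  proof
    fix z
    have "rank1_sum J X (adj Y) z = X (coord_proj J (Y z))"
      by (simp add: rank1_sum_def sum_fun_apply rank1_def coord_proj_def bounded_clinear_sum[OF Xb]
          bounded_clinear_scaleC[OF Xb] cinner_adj'[OF Yb])
    then show "(T - rank1_sum J X (adj Y)) z = (X \<circ> (\<lambda>z. Y z - coord_proj J (Y z))) z"
      by (simp add: X(1) bounded_clinear_diff[OF Xb])
  qed
  then have "trace_norm (T - rank1_sum J X (adj Y)) \<le> c * (d / (c + 1))"
    using trace_bound_imp(2)[OF trace_bound_hs_comp[OF X(2) tail]] by simp
  also have "\<dots> < d" using d c0 by (simp add: field_simps)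
  finally show thesis using that J by blast
qed

text \<open>For rank-one operators both sides are the same inner product. Finite sums of them are
  dense in trace norm, and both sides are continuous for it.\<close>

lemma op_trace_commute:
  assumes A: "bounded_clinear A" and T: "trace_class T"
  shows "op_trace (A \<circ> T) = op_trace (T \<circ> A)"
proof -
  have "cmod (op_trace (A \<circ> T) - op_trace (T \<circ> A)) \<le> e" if e: "e > 0" for e
  proof -
    \<comment> \<open>Each of the two traces of the error term costs at most the norm of
      \<open>A\<close>; the 1 keeps the constant positive.\<close>
    let ?K = "2 * onorm A + 1"
    have K: "0 < ?K" using onorm_nonneg[OF A] by simp
    then have "0 < e / ?K" using e by simp
    then obtain J :: "'a set" and x y where F: "finite J" "trace_norm (T - rank1_sum J x y) < e / ?K"
      by (rule finite_rank_dense[OF T])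
    let ?F = "rank1_sum J x y"
    let ?D = "T - ?F"
    have D: "trace_class ?D" by (rule trace_class_diff[OF T trace_class_rank1_sum])
    have AF: "A \<circ> ?F = rank1_sum J (\<lambda>i. A (x i)) y"
      by (rule ext) (simp add: rank1_sum_def sum_fun_apply bounded_clinear_sum[OF A] flip: comp_rank1[OF A])
    have FA: "?F \<circ> A = rank1_sum J x (\<lambda>i. adj A (y i))"
      by (rule ext) (simp add: rank1_sum_def sum_fun_apply flip: rank1_comp[OF A])
    have "op_trace (A \<circ> ?F) = op_trace (?F \<circ> A)"
      unfolding AF FA by (simp add: rank1_sum_def op_trace_sum trace_class_rank1 op_trace_rank1 cinner_adj'[OF A])
    moreover have "A \<circ> ?D = (A \<circ> T) - (A \<circ> ?F)" by (rule ext) (simp add: bounded_clinear_diff[OF A])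
    moreover have "?D \<circ> A = (T \<circ> A) - (?F \<circ> A)" by (rule ext) simp
    ultimately have eq: "op_trace (A \<circ> T) - op_trace (T \<circ> A) = op_trace (A \<circ> ?D) - op_trace (?D \<circ> A)"
      by (simp add: op_trace_diff trace_class_comp_left trace_class_comp_right A T trace_class_rank1_sum)
    have "cmod (op_trace (A \<circ> ?D) - op_trace (?D \<circ> A)) \<le> onorm A * trace_norm ?D + onorm A * trace_norm ?D"
      by (rule order_trans[OF norm_triangle_ineq4 add_mono])
         (rule cmod_op_trace_comp_le[OF A D],
          rule order_trans[OF cmod_op_trace_le[OF trace_class_comp_right[OF A D]] trace_norm_comp_right[OF A D]])
    moreover have "onorm A * trace_norm ?D + onorm A * trace_norm ?D \<le> ?K * trace_norm ?D"
      using trace_norm_nonneg[OF D] by (simp add: distrib_right)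
    moreover have "?K * trace_norm ?D \<le> e"
      using mult_left_mono[OF less_imp_le[OF F(2)] less_imp_le[OF K]] K by (simp only: times_divide_eq_right nonzero_mult_div_cancel_left)
    ultimately show ?thesis unfolding eq by linarith
  qed
  then have "cmod (op_trace (A \<circ> T) - op_trace (T \<circ> A)) \<le> 0" by (rule field_le_epsilon) simp
  then show ?thesis by simp
qed

section \<open>Compact operators\<close>

lemma compact_op_bounded: "compact_op T \<Longrightarrow> bounded_clinear T"
  by (simp add: compact_op_def)

lemma compact_opI:
  assumes "bounded_clinear T" "compact C" "\<And>x. norm x \<le> 1 \<Longrightarrow> T x \<in> C"
  shows "compact_op T"
proof -
  have "closure (T ` cball 0 1) \<subseteq> C"
    using assms by (intro closure_minimal compact_imp_closed) auto
  then have "compact (closure (T ` cball 0 1))"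
    using compact_Int_closed[OF assms(2) closed_closure[of "T ` cball 0 1"]] by (simp add: Int_absorb1)
  then show ?thesis using assms(1) by (simp add: compact_op_def)
qed

lemma compact_opE:
  assumes "compact_op T"
  obtains C where "compact C" "\<And>x. norm x \<le> 1 \<Longrightarrow> T x \<in> C"
proof (rule that)
  show "compact (closure (T ` cball 0 1))" using assms by (simp add: compact_op_def)
  show "T x \<in> closure (T ` cball 0 1)" if "norm x \<le> 1" for x
    by (rule subsetD[OF closure_subset]) (use that in auto)
qed

lemma continuous_on_bounded_clinear: "bounded_clinear A \<Longrightarrow> continuous_on S A"
  by (intro linear_continuous_on bounded_clinear_imp_bounded_linear)

lemma compact_op_comp_left:
  assumes A: "bounded_clinear A" and T: "compact_op T"
  shows "compact_op (A \<circ> T)"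
proof -
  obtain C where C: "compact C" "\<And>x. norm x \<le> 1 \<Longrightarrow> T x \<in> C" by (rule compact_opE[OF T]) blast
  show ?thesis
    by (rule compact_opI[of _ "A ` C"])
       (use C in \<open>auto intro: bounded_clinear_compose A compact_op_bounded[OF T]
          compact_continuous_image continuous_on_bounded_clinear\<close>)
qed

lemma compact_op_comp_right:
  assumes A: "bounded_clinear A" and T: "compact_op T"
  shows "compact_op (T \<circ> A)"
proof -
  obtain C where C: "compact C" "\<And>x. norm x \<le> 1 \<Longrightarrow> T x \<in> C" by (rule compact_opE[OF T]) blast
  note Tb = compact_op_bounded[OF T]
  define M where "M = onorm A + 1"
  have M: "0 < M" using onorm_nonneg[OF A] by (simp add: M_def)
  show ?thesis
  proof (rule compact_opI[of _ "(\<lambda>z. M *\<^sub>R z) ` C"])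
    show "bounded_clinear (T \<circ> A)" by (rule bounded_clinear_compose[OF Tb A])
    show "compact ((\<lambda>z. M *\<^sub>R z) ` C)" by (rule compact_scaling[OF C(1)])
    fix x :: 'a assume "norm x \<le> 1"
    then have "norm (A x) \<le> M"
      using bounded_clinear_norm[OF A, of x] mult_left_mono[of "norm x" 1 "onorm A"] onorm_nonneg[OF A]
      by (simp add: M_def)
    then have "norm ((1 / M) *\<^sub>R A x) \<le> 1" using M by (simp add: field_simps)
    then have "T ((1 / M) *\<^sub>R A x) \<in> C" by (rule C(2))
    moreover have "T (A x) = M *\<^sub>R T ((1 / M) *\<^sub>R A x)"
      using M by (simp add: linear_simps(5)[OF bounded_clinear_imp_bounded_linear[OF Tb]])
    ultimately show "(T \<circ> A) x \<in> (\<lambda>z. M *\<^sub>R z) ` C" by auto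
  qed
qed

lemma compact_op_add:
  assumes S: "compact_op S" and T: "compact_op T"
  shows "compact_op (S + T)"
proof -
  obtain C where C: "compact C" "\<And>x. norm x \<le> 1 \<Longrightarrow> S x \<in> C" by (rule compact_opE[OF S]) blast
  obtain D where D: "compact D" "\<And>x. norm x \<le> 1 \<Longrightarrow> T x \<in> D" by (rule compact_opE[OF T]) blast
  show ?thesis
  proof (rule compact_opI[OF _ compact_sums[OF C(1) D(1)]])
    show "bounded_clinear (S + T)" by (intro bounded_clinear_add_fun(2) compact_op_bounded S T)
  qed (use C(2) D(2) in auto)
qed

lemma compact_op_scaleC:
  assumes T: "compact_op T"
  shows "compact_op (c *\<^sub>C T)"
proof -
  have "c *\<^sub>C T = (\<lambda>x. c *\<^sub>C x) \<circ> T" by (auto simp: scaleC_fun_def)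
  then show ?thesis by (simp add: compact_op_comp_left bounded_clinear_scale T)
qed

lemma compact_op_zero: "compact_op (0 :: 'h::chilbert_space \<Rightarrow> 'h)"
  by (rule compact_opI[of _ "{0}"]) (simp_all add: bclin)

lemma compact_op_rank1: "compact_op (rank1 x y)"
proof (rule compact_opI[of _ "(\<lambda>c. c *\<^sub>C x) ` cball 0 (norm y)"])
  have "bounded_linear (\<lambda>c. c *\<^sub>C x)"
    by (rule bounded_linear_intro[where K="norm x"])
       (simp_all add: scaleC_add_left scaleR_scaleC scaleC_scaleC norm_scaleC scaleR_conv_of_real)
  then show "compact ((\<lambda>c. c *\<^sub>C x) ` cball 0 (norm y))"
    by (intro compact_continuous_image linear_continuous_on compact_cball)
  fix z :: 'a assume "norm z \<le> 1"
  then have "cmod (cinner y z) \<le> norm y"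
    using cauchy_schwarz[of y z] mult_left_mono[of "norm z" 1 "norm y"] by simp
  then show "rank1 x y z \<in> (\<lambda>c. c *\<^sub>C x) ` cball 0 (norm y)" unfolding rank1_def by (intro imageI) simp
qed (rule bounded_clinear_rank1)

lemma compact_op_rank1_sum: "compact_op (rank1_sum J x y)"
  unfolding rank1_sum_def
proof (induction J rule: infinite_finite_induct)
  case (insert i J)
  then show ?case unfolding sum.insert[OF insert.hyps] by (intro compact_op_add compact_op_rank1)
next
  case (infinite J)
  show ?case unfolding sum.infinite[OF infinite] by (rule compact_op_zero)
next
  case empty
  show ?case unfolding sum.empty by (rule compact_op_zero)
qed

lemma compact_op_approx:
  assumes T: "bounded_clinear T"
    and approx: "\<And>e. e > 0 \<Longrightarrow> \<exists>S. compact_op S \<and> (\<forall>x. norm (T x - S x) \<le> e * norm x)"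
  shows "compact_op T"
proof -
  have "\<exists>k. finite k \<and> closure (T ` cball 0 1) \<subseteq> (\<Union>x\<in>k. ball x e)" if e: "e > 0" for e
  proof -
    have "e / 4 > 0" using e by simp
    then obtain S where S: "compact_op S" "\<And>x. norm (T x - S x) \<le> e / 4 * norm x" using approx by blast
    obtain C where C: "compact C" "\<And>x. norm x \<le> 1 \<Longrightarrow> S x \<in> C" by (rule compact_opE[OF S(1)]) blast
    from C(1) obtain k where k: "finite k" "C \<subseteq> (\<Union>x\<in>k. ball x (e / 4))"
      using \<open>e / 4 > 0\<close> unfolding compact_eq_totally_bounded by blast
    \<comment> \<open>With closed balls the finite union is closed and so contains the closure of
      the image; radius \<open>e / 2\<close> leaves room to return to open balls of radius
      \<open>e\<close>.\<close>
    have "T ` cball 0 1 \<subseteq> (\<Union>x\<in>k. cball x (e / 2))"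
    proof safe
      fix x :: 'a assume "x \<in> cball 0 1"
      then have x: "norm x \<le> 1" by simp
      then obtain y where y: "y \<in> k" "dist y (S x) < e / 4" using C(2) k(2) by force
      have "dist (S x) (T x) \<le> e / 4"
        using order_trans[OF S(2)[of x] mult_left_mono[OF x, of "e / 4"]] e
        by (simp add: dist_norm norm_minus_commute)
      then have "dist y (T x) \<le> e / 2" using y(2) dist_triangle[of y "T x" "S x"] by simp
      then show "T x \<in> (\<Union>x\<in>k. cball x (e / 2))" using y(1) by auto
    qed
    then have "closure (T ` cball 0 1) \<subseteq> (\<Union>x\<in>k. cball x (e / 2))"
      by (rule closure_minimal) (intro closed_UN k(1) ballI closed_cball)
    also have "\<dots> \<subseteq> (\<Union>x\<in>k. ball x e)" using e by (intro UN_mono) auto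
    finally show ?thesis using k(1) by blast
  qed
  then have "compact (closure (T ` cball 0 1))"
    unfolding compact_eq_totally_bounded by (simp add: complete_eq_closed)
  then show ?thesis using T by (simp add: compact_op_def)
qed

lemma trace_class_imp_compact:
  assumes T: "trace_class T"
  shows "compact_op T"
proof (rule compact_op_approx[OF trace_class_bounded[OF T]])
  fix e :: real assume "e > 0"
  then obtain J :: "'a set" and x y where J: "trace_norm (T - rank1_sum J x y) < e"
    by (rule finite_rank_dense[OF T])
  have "norm (T z - rank1_sum J x y z) \<le> e * norm z" for z
    using norm_le_trace_norm[OF trace_class_diff[OF T trace_class_rank1_sum], of J x y z]
      mult_right_mono[OF less_imp_le[OF J], of "norm z"] by simp
  then show "\<exists>S. compact_op S \<and> (\<forall>x. norm (T x - S x) \<le> e * norm x)"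
    using compact_op_rank1_sum by blast
qed

lemma norm_le_of_unit_ball:
  assumes A: "bounded_clinear A" and le: "\<And>x. norm x \<le> 1 \<Longrightarrow> norm (A x) \<le> e"
  shows "norm (A x) \<le> e * norm x"
proof (cases "x = 0")
  case False
  have "norm (A (complex_of_real (1 / norm x) *\<^sub>C x)) \<le> e"
    by (rule le) (use False in \<open>simp add: norm_scaleC norm_divide\<close>)
  then show ?thesis using False by (simp add: bounded_clinear_scaleC[OF A] norm_scaleC norm_divide field_simps)
qed (simp add: bounded_clinear_zero[OF A])

text \<open>One finite \<open>J\<close> serves all points of a finite net of the compact image, and
  subtracting the coordinate projection does not increase the distance to the net.\<close>

lemma compact_op_coord_proj_approx:
  assumes T: "compact_op T" and e: "e > 0"
  obtains J where "finite J" "J \<subseteq> some_basis" "\<And>x. norm (T x - coord_proj J (T x)) \<le> e * norm x"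
proof -
  note Tb = compact_op_bounded[OF T]
  obtain C where C: "compact C" "\<And>x. norm x \<le> 1 \<Longrightarrow> T x \<in> C" by (rule compact_opE[OF T]) blast
  have e2: "e / 2 > 0" using e by simp
  from C(1) obtain k where k: "finite k" "C \<subseteq> (\<Union>x\<in>k. ball x (e / 2))"
    using e2 unfolding compact_eq_totally_bounded by blast
  have "\<forall>\<^sub>F J in basis_filter. \<forall>y\<in>k. dist (coord_proj J y) y < e / 2"
    by (rule eventually_ball_finite[OF k(1)]) (use tendstoD[OF tendsto_coord_proj e2] in blast)
  then have "\<exists>J. finite J \<and> J \<subseteq> some_basis \<and> (\<forall>y\<in>k. dist (coord_proj J y) y < e / 2)"
    unfolding eventually_finite_subsets_at_top by (meson order_refl)
  then obtain J where J: "finite J" "J \<subseteq> some_basis" and near: "\<And>y. y \<in> k \<Longrightarrow> dist (coord_proj J y) y < e / 2"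
    by blast
  note Pd = bounded_clinear_diff[OF bounded_clinear_coord_proj]
  have unit: "norm (T x - coord_proj J (T x)) \<le> e" if x1: "norm x \<le> 1" for x
  proof -
    have "T x \<in> (\<Union>x\<in>k. ball x (e / 2))" using C(2)[OF x1] k(2) by (rule subsetD[rotated])
    then obtain y where y: "y \<in> k" "dist y (T x) < e / 2" by auto
    have "T x - coord_proj J (T x) = ((T x - y) - coord_proj J (T x - y)) + (y - coord_proj J y)"
      by (simp add: Pd)
    also have "norm \<dots> \<le> norm (T x - y) + norm (y - coord_proj J y)"
      by (rule order_trans[OF norm_triangle_ineq]) (simp add: norm_coord_proj_le[OF orthonormal_some_basis J])
    also have "\<dots> \<le> e / 2 + e / 2"
      using y(2) near[OF y(1)] by (intro add_mono) (simp_all add: dist_norm norm_minus_commute)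
    finally show ?thesis by simp
  qed
  have "bounded_clinear (\<lambda>x. T x - coord_proj J (T x))"
    by (rule bounded_clinear_diff_fun(1)[OF Tb bounded_clinear_compose_fun[OF bounded_clinear_coord_proj Tb]])
  from norm_le_of_unit_ball[OF this unit] that J show thesis by blast
qed

text \<open>Applied to the adjoint, the coordinate approximation says that \<open>K\<close> is small
  on the orthogonal complement of finitely many vectors. This takes the place of spectral theory in
  the Fredholm arguments below.\<close>

lemma trace_class_small_off_finite:
  assumes K: "trace_class K" and e: "e > 0"
  obtains J where "finite J" "\<And>x. (\<And>f. f \<in> J \<Longrightarrow> cinner f x = 0) \<Longrightarrow> norm (K x) \<le> e * norm x"
proof -
  note Kb = trace_class_bounded[OF K]
  obtain J where J: "finite J" and approx: "\<And>x. norm (adj K x - coord_proj J (adj K x)) \<le> e * norm x"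
    by (rule compact_op_coord_proj_approx[OF trace_class_imp_compact[OF trace_class_adj[OF K]] e]) blast
  have "norm (K x) \<le> e * norm x" if x: "\<And>f. f \<in> J \<Longrightarrow> cinner f x = 0" for x
  proof -
    have "coord_proj J x = 0" by (simp add: coord_proj_def x)
    then have "cinner (K x) (K x) = cinner x (adj K (K x) - coord_proj J (adj K (K x)))"
      by (simp add: cinner_adj[OF Kb] cinner_diff_right flip: cinner_coord_proj)
    then have "norm (K x) * norm (K x) = cmod (cinner x (adj K (K x) - coord_proj J (adj K (K x))))"
      by (metis cinner_self_norm power2_eq_square)
    also have "\<dots> \<le> norm x * (e * norm (K x))"
      by (rule order_trans[OF cauchy_schwarz mult_left_mono[OF approx]]) simp
    finally have "norm (K x) * norm (K x) \<le> norm (K x) * (e * norm x)" by (simp add: mult_ac)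
    then show ?thesis using e by (cases "norm (K x) = 0") (simp_all add: mult_le_cancel_left_pos)
  qed
  with J that show thesis by blast
qed


section \<open>Fredholm operators and the restricted Grassmannian\<close>

text \<open>Each linear constraint costs at most one dimension: a single vector \<open>z\<close>
  satisfying the earlier constraints and violating the new one corrects all other vectors.\<close>

lemma finite_codim_of_constraints:
  fixes N :: "'h::chilbert_space set"
  assumes N: "csubspace N" and "finite J"
  shows "\<exists>B. finite B \<and> B \<subseteq> N \<and> (\<forall>x\<in>N. \<exists>b\<in>cspan B. x - b \<in> N \<and> (\<forall>f\<in>J. cinner f (x - b) = 0))"
  using \<open>finite J\<close>
proof induction
  case empty
  show ?case by (intro exI[of _ "{}"]) (auto simp: complex_vector.span_zero)
next
  case (insert e J)
  then obtain B where B: "finite B" "B \<subseteq> N" 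
    "\<And>x. x \<in> N \<Longrightarrow> \<exists>b\<in>cspan B. x - b \<in> N \<and> (\<forall>f\<in>J. cinner f (x - b) = 0)" by blast
  show ?case
  proof (cases "\<forall>x\<in>N. (\<forall>f\<in>J. cinner f x = 0) \<longrightarrow> cinner e x = 0")
    case True
    then show ?thesis using B by (intro exI[of _ B]) (simp, meson)
  next
    case False
    then obtain z where z: "z \<in> N" "\<And>f. f \<in> J \<Longrightarrow> cinner f z = 0" "cinner e z \<noteq> 0" by blast
    have "\<exists>b\<in>cspan (insert z B). x - b \<in> N \<and> (\<forall>f\<in>insert e J. cinner f (x - b) = 0)" if x: "x \<in> N" for x
    proof -
      obtain b where b: "b \<in> cspan B" "x - b \<in> N" "\<And>f. f \<in> J \<Longrightarrow> cinner f (x - b) = 0" using B(3)[OF x] by blast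
      let ?t = "cinner e (x - b) / cinner e z"
      have eq: "x - (b + ?t *\<^sub>C z) = (x - b) - ?t *\<^sub>C z" by simp
      show ?thesis
      proof (intro bexI conjI ballI)
        have "b \<in> cspan (insert z B)" by (rule subsetD[OF complex_vector.span_mono b(1)]) auto
        then show "b + ?t *\<^sub>C z \<in> cspan (insert z B)"
          by (simp add: complex_vector.span_add complex_vector.span_scale complex_vector.span_base)
        show "x - (b + ?t *\<^sub>C z) \<in> N"
          unfolding eq by (intro complex_vector.subspace_diff complex_vector.subspace_scale N b z)
        show "cinner f (x - (b + ?t *\<^sub>C z)) = 0" if "f \<in> insert e J" for f
        proof (cases "f = e")
          case True
          show ?thesis unfolding eq True cinner_diff_right[of e "x - b"] cinner_scaleC_right using z(3) by simp
        next
          case False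
          then show ?thesis unfolding eq cinner_diff_right[of f "x - b"] cinner_scaleC_right
            using that b(3) z(2) by simp
        qed
      qed
    qed
    then show ?thesis using B(1,2) z(1) by (intro exI[of _ "insert z B"]) blast
  qed
qed

text \<open>Vectors of \<open>N\<close> are determined by finitely many inner products, so the
  correction from \<open>cspan B\<close> is the whole vector.\<close>

lemma cfinite_dim_of_constraints:
  fixes N :: "'h::chilbert_space set"
  assumes N: "csubspace N" and J: "finite J" and inj: "\<And>x. x \<in> N \<Longrightarrow> (\<And>f. f \<in> J \<Longrightarrow> cinner f x = 0) \<Longrightarrow> x = 0"
  obtains B where "finite B" "B \<subseteq> N" "N \<subseteq> cspan B"
proof -
  obtain B where B: "finite B" "B \<subseteq> N" 
    "\<And>x. x \<in> N \<Longrightarrow> \<exists>b\<in>cspan B. x - b \<in> N \<and> (\<forall>f\<in>J. cinner f (x - b) = 0)"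
    using finite_codim_of_constraints[OF N J] by blast
  have "x \<in> cspan B" if "x \<in> N" for x
  proof -
    obtain b where b: "b \<in> cspan B" "x - b \<in> N" "\<And>f. f \<in> J \<Longrightarrow> cinner f (x - b) = 0" using B(3)[OF \<open>x \<in> N\<close>] by blast
    have "x - b = 0" by (rule inj[OF b(2,3)])
    then show ?thesis using b(1) by simp
  qed
  with that B show thesis by blast
qed

text \<open>Closedness is obtained by writing the sum as the fixed space of a bounded operator: the
  projection onto \<open>S\<close> plus the projection onto the component \<open>u\<close> of
  \<open>b\<close> orthogonal to \<open>S\<close>.\<close>

lemma closed_csubspace_plus_line:
  fixes S :: "'h::chilbert_space set"
  assumes S: "closed_csubspace S"
  shows "closed_csubspace {x. \<exists>t. x - t *\<^sub>C b \<in> S}"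
proof -
  define u where "u = b - orth_proj S b"
  \<comment> \<open>If \<open>b\<close> lies in \<open>S\<close>, then \<open>u\<close> and hence
    \<open>u'\<close> is zero, and the rank-one term correctly disappears.\<close>
  define u' where "u' = complex_of_real (1 / (norm u)\<^sup>2) *\<^sub>C u"
  have uS: "u \<in> orth S" unfolding u_def by (rule orth_proj_compl[OF S])
  note Ps = bounded_clinear_simps[OF bounded_clinear_orth_proj[OF S]] and S0 = closed_csubspaceD(1)[OF S]
  have proj_u: "rank1 u' u (s + t *\<^sub>C u) = t *\<^sub>C u" if "s \<in> S" for s t
  proof -
    have "cinner u s = 0" using uS that cinner_eq_0_commute by (auto simp: orth_def)
    then show ?thesis by (cases "u = 0") (simp_all add: rank1_def u'_def cinner_simps cinner_self scaleC_scaleC)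
  qed
  have "{x. \<exists>t. x - t *\<^sub>C b \<in> S} = {x. orth_proj S x + rank1 u' u x = x}"
  proof safe
    fix x t assume x: "x - t *\<^sub>C b \<in> S"
    define s where "s = x - t *\<^sub>C u"
    have "s = (x - t *\<^sub>C b) + t *\<^sub>C orth_proj S b"
      by (simp add: s_def u_def complex_vector.scale_right_diff_distrib)
    then have s: "s \<in> S" using x by (simp add: complex_vector.subspace_add complex_vector.subspace_scale S0 orth_proj_in[OF S])
    have xs: "x = s + t *\<^sub>C u" by (simp add: s_def)
    have "orth_proj S x = s"
      unfolding xs by (rule orth_proj_eqI[OF S s]) (simp add: complex_vector.subspace_scale uS)
    then show "orth_proj S x + rank1 u' u x = x" using proj_u[OF s] xs by simp
  next
    fix x assume "orth_proj S x + rank1 u' u x = x"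
    then have "x = orth_proj S x + (cinner u x / (norm u)\<^sup>2) *\<^sub>C (b - orth_proj S b)"
      by (simp add: rank1_def u'_def u_def scaleC_scaleC)
    then have "x - (cinner u x / (norm u)\<^sup>2) *\<^sub>C b = orth_proj S x - (cinner u x / (norm u)\<^sup>2) *\<^sub>C orth_proj S b"
      by (simp add: complex_vector.scale_right_diff_distrib algebra_simps)
    then show "\<exists>t. x - t *\<^sub>C b \<in> S"
      by (metis S S0 complex_vector.subspace_diff complex_vector.subspace_scale orth_proj_in)
  qed
  also have "closed_csubspace \<dots>"
    by (rule closed_fixpoints) (intro bounded_clinear_add_fun bounded_clinear_orth_proj S bounded_clinear_rank1)
  finally show ?thesis .
qed

lemma closed_csubspace_plus_span:
  fixes S :: "'h::chilbert_space set"
  assumes S: "closed_csubspace S" and "finite B"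
  shows "closed_csubspace {x. \<exists>b\<in>cspan B. x - b \<in> S}"
  using \<open>finite B\<close>
proof induction
  case empty
  then show ?case using S by simp
next
  case (insert z B)
  have "{x. \<exists>b\<in>cspan (insert z B). x - b \<in> S} = {x. \<exists>t. x - t *\<^sub>C z \<in> {x. \<exists>b\<in>cspan B. x - b \<in> S}}"
    unfolding mem_Collect_eq
  proof (rule Collect_cong, rule iffI; elim exE bexE)
    fix x b assume "b \<in> cspan (insert z B)" "x - b \<in> S"
    then obtain t where "b - t *\<^sub>C z \<in> cspan B" unfolding complex_vector.span_insert by blast
    moreover have "x - t *\<^sub>C z - (b - t *\<^sub>C z) \<in> S" using \<open>x - b \<in> S\<close> by simp
    ultimately show "\<exists>t. \<exists>b\<in>cspan B. x - t *\<^sub>C z - b \<in> S" by blast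
  next
    fix x t b assume b: "b \<in> cspan B" "x - t *\<^sub>C z - b \<in> S"
    have "b + t *\<^sub>C z \<in> cspan (insert z B)" unfolding complex_vector.span_insert using b(1) by (auto intro!: exI[of _ t])
    moreover have "x - (b + t *\<^sub>C z) \<in> S" using b(2) by (simp add: diff_diff_eq add.commute)
    ultimately show "\<exists>b\<in>cspan (insert z B). x - b \<in> S" by blast
  qed
  with closed_csubspace_plus_line[OF insert.IH, of z] show ?case by simp
qed

lemma closed_csubspace_zero: "closed_csubspace {0 :: 'h::chilbert_space}"
  by (simp add: closed_csubspace_def)

lemma closed_csubspace_span:
  assumes "finite (B :: 'h::chilbert_space set)"
  shows "closed_csubspace (cspan B)"
  using closed_csubspace_plus_span[OF closed_csubspace_zero assms] by simp

text \<open>Removing the projection onto \<open>cspan B\<close> leaves an operator with values on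
  one line, which factors through a rank-one operator; the rest has fewer generators.\<close>

lemma trace_class_finite_range:
  fixes F :: "'h::chilbert_space \<Rightarrow> 'h"
  assumes "finite B" "bounded_clinear F" "range F \<subseteq> cspan B"
  shows "trace_class F"
  using assms
proof (induction arbitrary: F)
  case empty
  then have "F = 0" by (auto simp: fun_eq_iff)
  then show ?case by (simp only: trace_class_zero)
next
  case (insert b B)
  let ?S = "cspan B"
  have S: "closed_csubspace ?S" by (rule closed_csubspace_span[OF insert.hyps(1)])
  note Pb = bounded_clinear_orth_proj[OF S]
  note Ps = bounded_clinear_simps[OF Pb]
  define u where "u = b - orth_proj ?S b"
  define u' where "u' = complex_of_real (1 / (norm u)\<^sup>2) *\<^sub>C u"
  define G where "G = (\<lambda>x. F x - orth_proj ?S (F x))"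
  have Gb: "bounded_clinear G"
    unfolding G_def
    by (rule bounded_clinear_diff_fun(1)[OF insert.prems(1) bounded_clinear_compose_fun[OF Pb insert.prems(1)]])
  have "rank1 u' u (G x) = G x" for x
  proof -
    have "F x \<in> cspan (insert b B)" using insert.prems(2) by blast
    then obtain t where t: "F x - t *\<^sub>C b \<in> ?S" unfolding complex_vector.span_insert by blast
    from orth_proj_fixes[OF S t] have "G x = t *\<^sub>C u"
      by (simp add: G_def u_def Ps complex_vector.scale_right_diff_distrib algebra_simps)
    then show ?thesis by (cases "u = 0") (simp_all add: rank1_def u'_def cinner_simps cinner_self scaleC_scaleC)
  qed
  then have "rank1 u' u \<circ> G = G" by (simp add: fun_eq_iff)
  then have "trace_class G" using trace_class_comp_right[OF Gb trace_class_rank1, of u' u] by simp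
  moreover have "trace_class (orth_proj ?S \<circ> F)"
  proof (rule insert.IH)
    show "bounded_clinear (orth_proj ?S \<circ> F)" by (rule bounded_clinear_compose[OF Pb insert.prems(1)])
  qed (auto simp: orth_proj_in[OF S])
  moreover have "F = G + (orth_proj ?S \<circ> F)" by (simp add: fun_eq_iff G_def)
  ultimately show ?case using trace_class_add by metis
qed

text \<open>\<open>M\<close> inverts \<open>T\<close> on the image of \<open>W\<close> and vanishes
  on the orthogonal complement of that image. As an operator on the whole space it can be composed
  with trace-class operators.\<close>

lemma bounded_below_inverse:
  fixes T :: "'h::chilbert_space \<Rightarrow> 'h"
  assumes T: "bounded_clinear T" and W: "closed_csubspace W" and c: "0 < c"
    and below: "\<And>x. x \<in> W \<Longrightarrow> c * norm x \<le> norm (T x)"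
  shows "closed_csubspace (T ` W)"
    and "\<exists>M. bounded_clinear M \<and> (\<forall>y. M y \<in> W \<and> T (M y) = orth_proj (T ` W) y)"
proof -
  note W0 = closed_csubspaceD(1)[OF W]
  have sub: "csubspace (T ` W)"
    unfolding complex_vector.subspace_def
  proof (intro conjI ballI allI)
    show "0 \<in> T ` W" using bounded_clinear_zero[OF T] complex_vector.subspace_0[OF W0] by force
    show "x + y \<in> T ` W" if "x \<in> T ` W" "y \<in> T ` W" for x y
      using that complex_vector.subspace_add[OF W0] by (auto simp flip: bounded_clinear_add[OF T])
    show "a *\<^sub>C x \<in> T ` W" if "x \<in> T ` W" for a x
      using that complex_vector.subspace_scale[OF W0] by (auto simp flip: bounded_clinear_scaleC[OF T])
  qed
  moreover have "closed (T ` W)"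
    unfolding closed_sequential_limits
  proof (intro allI impI, elim conjE)
    fix y l assume "\<forall>n. y n \<in> T ` W" and l: "y \<longlonglongrightarrow> l"
    then obtain x where x: "\<And>n. x n \<in> W" "\<And>n. y n = T (x n)" unfolding image_iff by metis
    have dist_le: "dist (x m) (x n) \<le> dist (y m) (y n) / c" for m n
      using below[OF complex_vector.subspace_diff[OF W0 x(1) x(1)], of m n] c
      by (simp add: dist_norm x(2) bounded_clinear_diff[OF T] field_simps)
    have "Cauchy x"
    proof (rule metric_CauchyI)
      fix e :: real assume "0 < e"
      then have "0 < e * c" using c by simp
      with LIMSEQ_imp_Cauchy[OF l] obtain N where N: "\<And>m n. m \<ge> N \<Longrightarrow> n \<ge> N \<Longrightarrow> dist (y m) (y n) < e * c"
        unfolding Cauchy_def by blast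
      have "dist (x m) (x n) < e" if "m \<ge> N" "n \<ge> N" for m n
        using dist_le[of m n] divide_strict_right_mono[OF N[OF that] c] c by simp
      then show "\<exists>M. \<forall>m\<ge>M. \<forall>n\<ge>M. dist (x m) (x n) < e" by blast
    qed
    then obtain z where z: "x \<longlonglongrightarrow> z" using Cauchy_convergent_iff convergent_def by blast
    have "z \<in> W" using closed_sequentially[OF closed_csubspaceD(2)[OF W] _ z] x(1) by blast
    moreover have "T z = l"
    proof (rule LIMSEQ_unique[OF bounded_clinear_tendsto[OF T z]])
      show "(\<lambda>n. T (x n)) \<longlonglongrightarrow> l" using l unfolding x(2) .
    qed
    ultimately show "l \<in> T ` W" by blast
  qed
  ultimately show cl: "closed_csubspace (T ` W)" by (simp add: closed_csubspace_def)
  note Ps = bounded_clinear_simps[OF bounded_clinear_orth_proj[OF cl]]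
  have "\<exists>x\<in>W. T x = orth_proj (T ` W) y" for y
    using orth_proj_in[OF cl, of y] by (auto simp: image_iff)
  then obtain M where M: "\<And>y. M y \<in> W" "\<And>y. T (M y) = orth_proj (T ` W) y" by metis
  have inj: "x = y" if "x \<in> W" "y \<in> W" "T x = T y" for x y
  proof -
    have "c * norm (x - y) \<le> 0"
      using below[OF complex_vector.subspace_diff[OF W0 that(1,2)]] that(3) by (simp add: bounded_clinear_diff[OF T])
    then show ?thesis using c by (simp add: mult_le_0_iff)
  qed
  have "bounded_clinear M"
  proof (rule bounded_clinearI)
    show "M (x + y) = M x + M y" for x y
      by (rule inj) (simp_all add: M complex_vector.subspace_add[OF W0] bounded_clinear_add[OF T] Ps)
    show "M (a *\<^sub>C x) = a *\<^sub>C M x" for a x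
      by (rule inj) (simp_all add: M complex_vector.subspace_scale[OF W0] bounded_clinear_scaleC[OF T] Ps)
    show "norm (M x) \<le> (1 / c) * norm x" for x
      using below[OF M(1), of x] norm_orth_proj_le[OF cl, of x] c by (simp add: M(2) field_simps)
  qed
  then show "\<exists>M. bounded_clinear M \<and> (\<forall>y. M y \<in> W \<and> T (M y) = orth_proj (T ` W) y)" using M by blast
qed

section \<open>The trace-class criterion for the Grassmannian\<close>

lemma polarizedD:
  assumes "polarized Hm Hp"
  shows "closed_csubspace Hm" "closed_csubspace Hp" "orth_proj Hm x = x - orth_proj Hp x"
proof -
  show Hm: "closed_csubspace Hm" and Hp: "closed_csubspace Hp" using assms by (simp_all add: polarized_def)
  obtain a b where ab: "a \<in> Hm" "b \<in> Hp" "x = a + b" using assms unfolding polarized_def by blast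
  have "a \<in> orth Hp" "b \<in> orth Hm"
    using assms ab cinner_eq_0_commute unfolding polarized_def orth_def by blast+
  then have "orth_proj Hp x = b" "orth_proj Hm x = a"
    using ab by (auto intro!: orth_proj_eqI Hp Hm)
  then show "orth_proj Hm x = x - orth_proj Hp x" using ab(3) by simp
qed

lemma closed_csubspace_Int:
  "closed_csubspace V \<Longrightarrow> closed_csubspace W \<Longrightarrow> closed_csubspace (V \<inter> W)"
  by (simp add: closed_csubspace_def complex_vector.subspace_inter closed_Int)

lemma closed_csubspace_constraints:
  "closed_csubspace W \<Longrightarrow> closed_csubspace {x \<in> W. \<forall>f\<in>J. cinner f x = 0}"
  using closed_csubspace_Int[OF _ closed_csubspace_orth[of J], of W] by (simp add: orth_def Int_def)

text \<open>Write P_W - P_+ as P_- P_W minus P_+ (1 - P_W). The first term is of trace class by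
  definition, and the adjoint of the second is (1 - P_W) P_+. Up to finite rank, every vector of the
  form P_+ y is P_+ w = w - P_- w with w in W, and 1 - P_W kills w.\<close>

lemma trace_class_proj_diff_of_Gr1res:
  assumes pol: "polarized Hm Hp" and W: "W \<in> Gr1res Hm Hp"
  shows "trace_class (orth_proj W - orth_proj Hp)"
proof -
  note Hp = polarizedD(2)[OF pol] and Hm_eq = polarizedD(3)[OF pol]
  have Wc: "closed_csubspace W" and fred: "fredholm W Hp (orth_proj Hp)"
    and L: "trace_class (orth_proj Hm \<circ> orth_proj W)"
    using W by (auto simp: Gr1res_def L1_def)
  note Pp = bounded_clinear_orth_proj[OF Hp] and PW = bounded_clinear_orth_proj[OF Wc]
  note lin = bounded_clinear_simps[OF Pp] bounded_clinear_simps[OF PW]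
  let ?L = "orth_proj Hm \<circ> orth_proj W" and ?P = "orth_proj Hp"
  have Lx: "?L x = x - ?P x" if "x \<in> W" for x by (simp add: orth_proj_fixes[OF Wc that] Hm_eq)
  obtain J where J: "finite J" and small: "\<And>x. (\<And>f. f \<in> J \<Longrightarrow> cinner f x = 0) \<Longrightarrow> norm (?L x) \<le> (1/2) * norm x"
    by (rule trace_class_small_off_finite[OF L, of "1/2"]) simp_all
  \<comment> \<open>A part of finite codimension in \<open>W\<close> on which the trace-class
    operator \<open>?L\<close> has norm at most 1/2, so that the projection to \<open>Hp\<close> is
    bounded below there.\<close>
  define W1 where "W1 = {x \<in> W. \<forall>f\<in>J. cinner f x = 0}"
  have W1: "closed_csubspace W1" unfolding W1_def by (rule closed_csubspace_constraints[OF Wc])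
  have below: "(1/2) * norm x \<le> norm (?P x)" if "x \<in> W1" for x
  proof -
    have "norm (?L x) \<le> (1/2) * norm x" using that small by (simp add: W1_def)
    moreover have "norm x \<le> norm (?P x) + norm (?L x)"
      using norm_triangle_ineq[of "?P x" "?L x"] Lx[of x] that by (simp add: W1_def)
    ultimately show ?thesis by simp
  qed
  define R where "R = ?P ` W1"
  have R: "closed_csubspace R" and "\<exists>M. bounded_clinear M \<and> (\<forall>y. M y \<in> W1 \<and> ?P (M y) = orth_proj R y)"
    using bounded_below_inverse[OF Pp W1 _ below] by (simp_all add: R_def)
  then obtain M where M: "bounded_clinear M" "\<And>y. M y \<in> W1" "\<And>y. ?P (M y) = orth_proj R y" by blast
  note PR = bounded_clinear_orth_proj[OF R]
  obtain B1 where B1: "finite B1" "\<And>x. x \<in> W \<Longrightarrow> \<exists>b\<in>cspan B1. x - b \<in> W \<and> (\<forall>f\<in>J. cinner f (x - b) = 0)"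
    using finite_codim_of_constraints[OF closed_csubspaceD(1)[OF Wc] J] by blast
  obtain B0 where B0: "finite B0" "\<And>y. y \<in> Hp \<Longrightarrow> \<exists>x\<in>W. \<exists>b\<in>cspan B0. y = ?P x + b"
    using fred unfolding fredholm_def by blast
  \<comment> \<open>Generators of \<open>Hp\<close> modulo \<open>R\<close>: images of the vectors
    that complete \<open>W1\<close> to \<open>W\<close>, together with generators of the cokernel
    provided by the Fredholm condition.\<close>
  define B2 where "B2 = ?P ` B1 \<union> B0"
  define Q where "Q = orth_proj (orth R)"
  have Qb: "bounded_clinear Q" unfolding Q_def by (intro bounded_clinear_orth_proj) simp
  have Qspan: "Q z \<in> cspan (Q ` B2)" if "z \<in> cspan B2" for z
    using that
  proof (induction rule: complex_vector.span_induct_alt)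
    case base
    then show ?case by (simp add: bounded_clinear_zero[OF Qb] complex_vector.span_zero)
  next
    case (step c x y)
    then show ?case
      by (simp add: bounded_clinear_simps[OF Qb] complex_vector.span_add complex_vector.span_scale complex_vector.span_base)
  qed
  have Pspan: "?P z \<in> cspan (?P ` B1)" if "z \<in> cspan B1" for z
    using that
  proof (induction rule: complex_vector.span_induct_alt)
    case base
    then show ?case by (simp add: lin complex_vector.span_zero)
  next
    case (step c x y)
    then show ?case
      by (simp add: lin complex_vector.span_add complex_vector.span_scale complex_vector.span_base)
  qed
  have "Q (?P y) \<in> cspan (Q ` B2)" for y
  proof -
    obtain x b where x: "x \<in> W" "b \<in> cspan B0" "?P y = ?P x + b" using B0(2)[OF orth_proj_in[OF Hp]] by blast
    obtain b1 where b1: "b1 \<in> cspan B1" "x - b1 \<in> W1" using B1(2)[OF x(1)] unfolding W1_def by blast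
    have "?P (x - b1) \<in> R" unfolding R_def using b1(2) by blast
    then have "Q (?P (x - b1)) = 0" by (simp add: Q_def orth_proj_orth[OF R] orth_proj_fixes[OF R])
    moreover have "?P y = ?P (x - b1) + (?P b1 + b)" by (simp add: x(3) lin)
    ultimately have "Q (?P y) = Q (?P b1 + b)" by (simp only: bounded_clinear_add[OF Qb]) simp
    moreover have "?P b1 + b \<in> cspan B2"
      by (rule complex_vector.span_add)
         (use Pspan[OF b1(1)] x(2) complex_vector.span_mono[of _ B2] in \<open>auto simp: B2_def\<close>)
    ultimately show ?thesis using Qspan by simp
  qed
  then have F: "trace_class (Q \<circ> ?P)"
    by (intro trace_class_finite_range[of "Q ` B2"] bounded_clinear_compose Qb Pp)
       (auto simp: B2_def B0(1) B1(1))
  define N where "N = orth_proj (orth W)"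
  have Nb: "bounded_clinear N" unfolding N_def by (intro bounded_clinear_orth_proj) simp
  have N_eq: "N x = x - orth_proj W x" for x by (simp add: N_def orth_proj_orth[OF Wc])
  \<comment> \<open>The preimage \<open>M (?P y)\<close> lies in \<open>W\<close>, where
    \<open>N\<close> vanishes; what remains is a finite-rank term and a term containing the
    trace-class \<open>?L\<close>.\<close>
  have "N \<circ> ?P = (N \<circ> (Q \<circ> ?P)) - (N \<circ> (?L \<circ> (M \<circ> ?P)))"
  proof
    fix y
    have MW: "M (?P y) \<in> W" using M(2) by (simp add: W1_def)
    have "?P y = orth_proj R (?P y) + Q (?P y)" by (simp add: Q_def orth_proj_orth[OF R])
    also have "orth_proj R (?P y) = M (?P y) - ?L (M (?P y))" using M(3) Lx[OF MW] by simp
    finally have "N (?P y) = N (M (?P y) - ?L (M (?P y))) + N (Q (?P y))"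
      by (metis bounded_clinear_add[OF Nb])
    moreover have "N (M (?P y)) = 0" by (simp add: N_eq orth_proj_fixes[OF Wc MW])
    ultimately show "(N \<circ> ?P) y = ((N \<circ> (Q \<circ> ?P)) - (N \<circ> (?L \<circ> (M \<circ> ?P)))) y"
      by (simp add: bounded_clinear_diff[OF Nb])
  qed
  moreover have "trace_class \<dots>"
    by (intro trace_class_diff trace_class_comp_left trace_class_comp_right bounded_clinear_compose Nb F L M(1) Pp)
  ultimately have "trace_class (N \<circ> ?P)" by simp
  then have "trace_class (adj (N \<circ> ?P))" by (rule trace_class_adj)
  moreover have "adj (N \<circ> ?P) = ?P \<circ> N" by (simp add: adj_compose[OF Nb Pp] adj_orth_proj Hp) (simp add: N_def adj_orth_proj)
  ultimately have "trace_class (?L - (?P \<circ> N))" using L by (simp add: trace_class_diff)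
  moreover have "?L - (?P \<circ> N) = orth_proj W - ?P" by (simp add: fun_eq_iff N_eq Hm_eq lin)
  ultimately show ?thesis by simp
qed

text \<open>On the kernel of P_+ in W the difference P_W - P_+ is the identity, and on the part of
  H_+ orthogonal to P_+ W it is minus the identity. A trace-class operator can be isometric only on
  a finite-dimensional space.\<close>

lemma Gr1res_of_trace_class_proj_diff:
  assumes pol: "polarized Hm Hp" and Wc: "closed_csubspace W"
    and K: "trace_class (orth_proj W - orth_proj Hp)"
  shows "W \<in> Gr1res Hm Hp"
proof -
  note Hp = polarizedD(2)[OF pol] and Hm = polarizedD(1)[OF pol] and Hm_eq = polarizedD(3)[OF pol]
  note Pp = bounded_clinear_orth_proj[OF Hp] and PW = bounded_clinear_orth_proj[OF Wc] and Pm = bounded_clinear_orth_proj[OF Hm]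
  note lin = bounded_clinear_simps[OF Pp] bounded_clinear_simps[OF PW]
  let ?P = "orth_proj Hp" and ?K = "orth_proj W - orth_proj Hp"
  have "orth_proj Hm \<circ> orth_proj W = orth_proj Hm \<circ> ?K"
    by (rule ext) (simp add: Hm_eq lin Hp)
  then have "trace_class (orth_proj Hm \<circ> orth_proj W)" using trace_class_comp_left[OF Pm K] by simp
  then have "orth_proj Hm \<circ> orth_proj W \<in> pts (L1 W Hm)"
    using trace_class_bounded by (auto simp: L1_def ops_def orth_proj_in Hm orth_proj_eq_0_iff[OF Wc, THEN iffD2] bounded_clinear_zero[OF Pm])
  moreover have "fredholm W Hp ?P"
    unfolding fredholm_def
  proof (intro conjI)
    show "bounded_clinear_between (hsubspace W) (hsubspace Hp) ?P"
      unfolding bounded_clinear_between_def clinear_between_def hsubspace_def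
      using orth_proj_in[OF Hp] norm_orth_proj_le[OF Hp] by (auto simp: lin intro!: exI[of _ 1])
    obtain J where J: "finite J" and small: "\<And>x. (\<And>f. f \<in> J \<Longrightarrow> cinner f x = 0) \<Longrightarrow> norm (?K x) \<le> (1/2) * norm x"
      by (rule trace_class_small_off_finite[OF K, of "1/2"]) simp_all
    \<comment> \<open>\<open>?K\<close> halves all vectors orthogonal to \<open>J\<close>; an
      isometric one among them must be zero, so finitely many inner products determine a vector of
      \<open>N\<close>.\<close>
    have fin: "\<exists>B. finite B \<and> B \<subseteq> N \<and> N \<subseteq> cspan B" if N: "csubspace N" and eig: "\<And>x. x \<in> N \<Longrightarrow> norm (?K x) = norm x" for N
    proof -
      have "x = 0" if "x \<in> N" "\<And>f. f \<in> J \<Longrightarrow> cinner f x = 0" for x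
        using small[OF that(2)] eig[OF that(1)] by simp
      then show ?thesis using cfinite_dim_of_constraints[OF N J] by metis
    qed
    have W0: "csubspace W" and Hp0: "csubspace Hp" using Wc Hp closed_csubspaceD by blast+
    let ?ker = "{x \<in> W. ?P x = 0}"
    have "csubspace ?ker"
      using complex_vector.subspace_inter[OF W0 closed_csubspaceD(1)[OF closed_kernel[OF Pp]]] by (simp add: Int_def)
    from fin[OF this] show "cfinite_dim ?ker"
      by (auto simp: cfinite_dim_def orth_proj_fixes[OF Wc])
    define W1 where "W1 = {x \<in> W. \<forall>f\<in>J. cinner f x = 0}"
    have W1: "closed_csubspace W1" unfolding W1_def by (rule closed_csubspace_constraints[OF Wc])
    have below: "(1/2) * norm x \<le> norm (?P x)" if "x \<in> W1" for x
    proof -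
      have "norm (?K x) \<le> (1/2) * norm x" using that small by (simp add: W1_def)
      moreover have "norm x \<le> norm (?P x) + norm (?K x)"
        using norm_triangle_ineq[of "?P x" "?K x"] orth_proj_fixes[OF Wc] that by (simp add: W1_def)
      ultimately show ?thesis by simp
    qed
    have R: "closed_csubspace (?P ` W1)" by (rule bounded_below_inverse(1)[OF Pp W1 _ below]) simp_all
    obtain B1 where B1: "finite B1" "B1 \<subseteq> W" "\<And>x. x \<in> W \<Longrightarrow> \<exists>b\<in>cspan B1. x - b \<in> W \<and> (\<forall>f\<in>J. cinner f (x - b) = 0)"
      using finite_codim_of_constraints[OF W0 J] by blast
    have span_W: "cspan B1 \<subseteq> W" using complex_vector.span_minimal[OF B1(2) W0] .
    have Pspan: "cspan (?P ` B1) = ?P ` cspan B1"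
    proof
      show "?P ` cspan B1 \<subseteq> cspan (?P ` B1)"
      proof safe
        fix z assume "z \<in> cspan B1"
        then show "?P z \<in> cspan (?P ` B1)"
        proof (induction rule: complex_vector.span_induct_alt)
          case base
          then show ?case by (simp add: lin complex_vector.span_zero)
        next
          case (step c x y)
          then show ?case
            by (simp add: lin complex_vector.span_add complex_vector.span_scale complex_vector.span_base)
        qed
      qed
      have "csubspace (?P ` cspan B1)"
        unfolding complex_vector.subspace_def
      proof (intro conjI ballI allI)
        show "0 \<in> ?P ` cspan B1" using complex_vector.span_zero[of B1] lin(4) by force
        show "x + y \<in> ?P ` cspan B1" if "x \<in> ?P ` cspan B1" "y \<in> ?P ` cspan B1" for x y
        proof -
          obtain a b where "a \<in> cspan B1" "x = ?P a" "b \<in> cspan B1" "y = ?P b" using \<open>x \<in> _\<close> \<open>y \<in> _\<close> by blast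
          then show ?thesis by (intro image_eqI[of _ _ "a + b"]) (simp_all add: lin complex_vector.span_add)
        qed
        show "c *\<^sub>C x \<in> ?P ` cspan B1" if "x \<in> ?P ` cspan B1" for c x
        proof -
          obtain a where "a \<in> cspan B1" "x = ?P a" using \<open>x \<in> _\<close> by blast
          then show ?thesis by (intro image_eqI[of _ _ "c *\<^sub>C a"]) (simp_all add: lin complex_vector.span_scale)
        qed
      qed
      then show "cspan (?P ` B1) \<subseteq> ?P ` cspan B1"
        by (rule complex_vector.span_minimal[rotated]) (auto intro: complex_vector.span_base)
    qed
    \<comment> \<open>The image of \<open>W\<close> is the closed image of \<open>W1\<close>
      enlarged by a finite-dimensional space, hence closed.\<close>
    have "?P ` W = {y. \<exists>b\<in>cspan (?P ` B1). y - b \<in> ?P ` W1}"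
    proof (intro equalityI subsetI)
      fix y assume "y \<in> ?P ` W"
      then obtain x where "x \<in> W" and y: "y = ?P x" by blast
      then obtain b where "b \<in> cspan B1" "x - b \<in> W1" using B1(3)[of x] unfolding W1_def by blast
      then have "?P b \<in> cspan (?P ` B1)" "?P x - ?P b \<in> ?P ` W1" by (simp_all add: Pspan flip: lin)
      then show "y \<in> {y. \<exists>b\<in>cspan (?P ` B1). y - b \<in> ?P ` W1}" unfolding y by blast
    next
      fix y assume "y \<in> {y. \<exists>b\<in>cspan (?P ` B1). y - b \<in> ?P ` W1}"
      then obtain b b' w where "b' \<in> cspan B1" "b = ?P b'" "w \<in> W1" "y - b = ?P w" unfolding Pspan by blast
      then have "y = ?P (w + b')" "w + b' \<in> W"
        using span_W complex_vector.subspace_add[OF W0] by (auto simp: lin W1_def algebra_simps)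
      then show "y \<in> ?P ` W" by blast
    qed
    then have PW_closed: "closed_csubspace (?P ` W)"
      using closed_csubspace_plus_span[OF R, of "?P ` B1"] B1(1) by simp
    then show "closed (?P ` W)" by (rule closed_csubspaceD)
    \<comment> \<open>An orthogonal model of the cokernel: its vectors are orthogonal to
      \<open>W\<close>, because the projection to \<open>Hp\<close> fixes them and is
      symmetric.\<close>
    let ?N = "Hp \<inter> orth (?P ` W)"
    have "\<exists>B. finite B \<and> B \<subseteq> ?N \<and> ?N \<subseteq> cspan B"
    proof (rule fin)
      show "csubspace ?N" by (intro complex_vector.subspace_inter Hp0 csubspace_orth)
      fix y assume y: "y \<in> ?N"
      have "cinner w y = 0" if "w \<in> W" for w
      proof -
        have "cinner (?P w) y = 0" using y that by (auto simp: orth_def)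
        then show ?thesis using y by (simp add: cinner_orth_proj[OF Hp] orth_proj_fixes[OF Hp])
      qed
      then have "orth_proj W y = 0" by (simp add: orth_proj_eq_0_iff[OF Wc] orth_def)
      then show "norm (?K y) = norm y" using y by (simp add: orth_proj_fixes[OF Hp])
    qed
    then obtain B where B: "finite B" "B \<subseteq> ?N" "?N \<subseteq> cspan B" by blast
    have "\<exists>x\<in>W. \<exists>b\<in>cspan B. y = ?P x + b" if y: "y \<in> Hp" for y
    proof -
      obtain x where x: "x \<in> W" "orth_proj (?P ` W) y = ?P x" using orth_proj_in[OF PW_closed, of y] by blast
      have "y - ?P x \<in> ?N"
        using orth_proj_compl[OF PW_closed, of y] complex_vector.subspace_diff[OF Hp0 y orth_proj_in[OF Hp]]
        by (simp add: x(2))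
      then have "y - ?P x \<in> cspan B" using B(3) by blast
      then show ?thesis using x(1) by (intro bexI[of _ x] bexI[of _ "y - ?P x"]) simp_all
    qed
    then show "\<exists>B. finite B \<and> B \<subseteq> Hp \<and> (\<forall>y\<in>Hp. \<exists>x\<in>W. \<exists>b\<in>cspan B. y = ?P x + b)"
      using B by blast
  qed
  ultimately show ?thesis using Wc by (simp add: Gr1res_def)
qed

lemma Gr1res_iff:
  assumes "polarized Hm Hp"
  shows "W \<in> Gr1res Hm Hp \<longleftrightarrow> closed_csubspace W \<and> trace_class (orth_proj W - orth_proj Hp)"
proof
  assume W: "W \<in> Gr1res Hm Hp"
  then show "closed_csubspace W \<and> trace_class (orth_proj W - orth_proj Hp)"
    using trace_class_proj_diff_of_Gr1res[OF assms W] by (simp add: Gr1res_def)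
qed (use Gr1res_of_trace_class_proj_diff[OF assms] in blast)

section \<open>Normed spaces on a carrier\<close>

lemma cnormed_spaceD:
  assumes "cnormed_space E"
  shows cn_zero: "0 \<in> pts E"
    and cn_add: "x \<in> pts E \<Longrightarrow> y \<in> pts E \<Longrightarrow> x + y \<in> pts E"
    and cn_diff: "x \<in> pts E \<Longrightarrow> y \<in> pts E \<Longrightarrow> x - y \<in> pts E"
    and cn_scale: "x \<in> pts E \<Longrightarrow> c *\<^sub>C x \<in> pts E"
    and nrm_nonneg: "x \<in> pts E \<Longrightarrow> 0 \<le> nrm E x"
    and nrm_eq_0: "x \<in> pts E \<Longrightarrow> nrm E x = 0 \<longleftrightarrow> x = 0"
    and nrm_triangle: "x \<in> pts E \<Longrightarrow> y \<in> pts E \<Longrightarrow> nrm E (x + y) \<le> nrm E x + nrm E y"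
    and nrm_scale: "x \<in> pts E \<Longrightarrow> nrm E (c *\<^sub>C x) = cmod c * nrm E x"
  using assms unfolding cnormed_space_def
  by (auto intro: complex_vector.subspace_0 complex_vector.subspace_add complex_vector.subspace_diff
      complex_vector.subspace_scale)

lemma nrm_zero: "cnormed_space E \<Longrightarrow> nrm E 0 = 0"
  using cn_zero nrm_eq_0 by blast

lemma nrm_minus: "cnormed_space E \<Longrightarrow> x \<in> pts E \<Longrightarrow> nrm E (- x) = nrm E x"
  using nrm_scale[of E x "-1"] by (simp add: scaleC_minus1)

lemma nrm_triangle_diff:
  assumes E: "cnormed_space E" and "x \<in> pts E" "y \<in> pts E"
  shows "nrm E (x - y) \<le> nrm E x + nrm E y"
proof -
  have "- y \<in> pts E" using cn_scale[OF E assms(3), of "-1"] by (simp add: scaleC_minus1)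
  then show ?thesis using nrm_triangle[OF E assms(2), of "- y"] nrm_minus[OF E assms(3)] by simp
qed

lemma nrm_le_add_diff:
  assumes "cnormed_space E" "x \<in> pts E" "y \<in> pts E"
  shows "nrm E x \<le> nrm E y + nrm E (x - y)"
  using nrm_triangle[OF assms(1,3) cn_diff[OF assms]] by simp

lemma clinear_betweenD:
  assumes "clinear_between X Y T"
  shows "x \<in> X \<Longrightarrow> T x \<in> Y" "x \<in> X \<Longrightarrow> y \<in> X \<Longrightarrow> T (x + y) = T x + T y" "x \<in> X \<Longrightarrow> T (c *\<^sub>C x) = c *\<^sub>C T x"
  using assms by (auto simp: clinear_between_def)

lemma bcb_linear: "bounded_clinear_between E F T \<Longrightarrow> clinear_between (pts E) (pts F) T"
  by (simp add: bounded_clinear_between_def)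

lemma bcbD:
  assumes "bounded_clinear_between E F T"
  shows "x \<in> pts E \<Longrightarrow> T x \<in> pts F" "x \<in> pts E \<Longrightarrow> y \<in> pts E \<Longrightarrow> T (x + y) = T x + T y"
    "x \<in> pts E \<Longrightarrow> T (c *\<^sub>C x) = c *\<^sub>C T x"
  using clinear_betweenD[OF bcb_linear[OF assms]] by blast+

lemma bcb_diff:
  assumes E: "cnormed_space E" and T: "bounded_clinear_between E F T" and x: "x \<in> pts E" and y: "y \<in> pts E"
  shows "T (x - y) = T x - T y"
proof -
  have "T (x + (-1) *\<^sub>C y) = T x + (-1) *\<^sub>C T y" using bcbD[OF T] cn_scale[OF E y] x y by metis
  then show ?thesis by (simp add: scaleC_minus1)
qed

lemma bcb_zero: "cnormed_space E \<Longrightarrow> bounded_clinear_between E F T \<Longrightarrow> T 0 = 0"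
  using bcb_diff[OF _ _ cn_zero cn_zero] by fastforce

lemma bcb_bound:
  assumes E: "cnormed_space E" and T: "bounded_clinear_between E F T"
  obtains K where "0 < K" "\<And>x. x \<in> pts E \<Longrightarrow> nrm F (T x) \<le> K * nrm E x"
proof -
  obtain K where K: "\<And>x. x \<in> pts E \<Longrightarrow> nrm F (T x) \<le> K * nrm E x"
    using T unfolding bounded_clinear_between_def by blast
  show thesis
  proof (rule that[of "max K 1"])
    show "nrm F (T x) \<le> max K 1 * nrm E x" if "x \<in> pts E" for x
      using K[OF that] mult_right_mono[of K "max K 1" "nrm E x"] nrm_nonneg[OF E that] by simp
  qed simp
qed

lemma bcbI:
  assumes "\<And>x. x \<in> pts E \<Longrightarrow> T x \<in> pts F" "\<And>x y. x \<in> pts E \<Longrightarrow> y \<in> pts E \<Longrightarrow> T (x + y) = T x + T y"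
    "\<And>c x. x \<in> pts E \<Longrightarrow> T (c *\<^sub>C x) = c *\<^sub>C T x" "\<And>x. x \<in> pts E \<Longrightarrow> nrm F (T x) \<le> K * nrm E x"
  shows "bounded_clinear_between E F T"
  using assms unfolding bounded_clinear_between_def clinear_between_def by blast

lemma bcb_compose:
  assumes E: "cnormed_space E" and F: "cnormed_space F"
    and T: "bounded_clinear_between E F T" and S: "bounded_clinear_between F G S"
  shows "bounded_clinear_between E G (\<lambda>x. S (T x))"
proof -
  obtain K where K: "0 < K" "\<And>x. x \<in> pts E \<Longrightarrow> nrm F (T x) \<le> K * nrm E x" by (rule bcb_bound[OF E T]) blast
  obtain L where L: "0 < L" "\<And>x. x \<in> pts F \<Longrightarrow> nrm G (S x) \<le> L * nrm F x" by (rule bcb_bound[OF F S]) blast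
  show ?thesis
  proof (rule bcbI)
    show "nrm G (S (T x)) \<le> (L * K) * nrm E x" if "x \<in> pts E" for x
      using order_trans[OF L(2)[OF bcbD(1)[OF T that]] mult_left_mono[OF K(2)[OF that]]] L(1)
      by (simp add: mult.assoc)
  qed (simp_all add: bcbD[OF T] bcbD[OF S])
qed

lemma open_in_subset: "open_in E S \<Longrightarrow> S \<subseteq> pts E"
  by (simp add: open_in_def)

lemma open_inE:
  assumes E: "cnormed_space E" and S: "open_in E S" "x \<in> S"
  obtains d where "0 < d" "\<And>h. h \<in> pts E \<Longrightarrow> nrm E h < d \<Longrightarrow> x + h \<in> S"
proof -
  obtain d where d: "0 < d" "\<And>y. y \<in> pts E \<Longrightarrow> nrm E (y - x) < d \<Longrightarrow> y \<in> S"
    using S unfolding open_in_def by blast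
  show thesis
  proof (rule that[OF d(1)])
    fix h assume "h \<in> pts E" "nrm E h < d"
    moreover have "x \<in> pts E" using S open_in_subset by blast
    ultimately show "x + h \<in> S" by (intro d(2)) (simp_all add: cn_add[OF E])
  qed
qed


section \<open>Calculus on normed spaces\<close>

lemma has_fderiv_linear: "has_fderiv E F f x L \<Longrightarrow> bounded_clinear_between E F L"
  by (simp add: has_fderiv_def)

lemma has_fderivE:
  assumes "has_fderiv E F f x L" "0 < e"
  obtains d where "0 < d" "\<And>h. h \<in> pts E \<Longrightarrow> nrm E h < d \<Longrightarrow> nrm F (f (x + h) - f x - L h) \<le> e * nrm E h"
  using assms unfolding has_fderiv_def by blast

lemma has_fderivI:
  assumes "bounded_clinear_between E F L"
    "\<And>e. e > 0 \<Longrightarrow> \<exists>d>0. \<forall>h\<in>pts E. nrm E h < d \<longrightarrow> nrm F (f (x + h) - f x - L h) \<le> e * nrm E h"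
  shows "has_fderiv E F f x L"
  using assms unfolding has_fderiv_def by blast

lemma small_multiple:
  assumes E: "cnormed_space E" and v: "v \<in> pts E" and d: "0 < d"
  obtains t where "0 < t" "nrm E (complex_of_real t *\<^sub>C v) < d"
proof (rule that[of "d / (nrm E v + 1)"])
  have 1: "0 < nrm E v + 1" using nrm_nonneg[OF E v] by simp
  then show pos: "0 < d / (nrm E v + 1)" using d by simp
  have "nrm E (complex_of_real (d / (nrm E v + 1)) *\<^sub>C v) = d / (nrm E v + 1) * nrm E v"
    using pos by (simp only: nrm_scale[OF E v] norm_of_real abs_of_pos)
  also have "\<dots> < d" using 1 d by (simp add: field_simps)
  finally show "nrm E (complex_of_real (d / (nrm E v + 1)) *\<^sub>C v) < d" .
qed

text \<open>At small multiples of \<open>v\<close> the two linear maps differ by a small multiple of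
  the increment; by homogeneity the factor \<open>t\<close> cancels. Carrier memberships are tracked
  because the norm axioms hold only there.\<close>

lemma has_fderiv_unique:
  assumes E: "cnormed_space E" and F: "cnormed_space F" and S: "open_in E S" and x: "x \<in> S"
    and f: "f ` S \<subseteq> pts F" and L: "has_fderiv E F f x L" and L': "has_fderiv E F f x L'" and v: "v \<in> pts E"
  shows "L v = L' v"
proof -
  note Ll = has_fderiv_linear[OF L] and Ll' = has_fderiv_linear[OF L']
  have mem: "L v - L' v \<in> pts F" by (intro cn_diff F bcbD(1)[OF Ll v] bcbD(1)[OF Ll' v])
  have "nrm F (L v - L' v) \<le> 0 + e" if e: "e > 0" for e
  proof -
    define e' where "e' = e / (2 * (nrm E v + 1))"
    have v1: "0 < nrm E v + 1" using nrm_nonneg[OF E v] by simp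
    have e': "0 < e'" using e v1 by (simp add: e'_def)
    obtain d1 where d1: "0 < d1" "\<And>h. h \<in> pts E \<Longrightarrow> nrm E h < d1 \<Longrightarrow> nrm F (f (x + h) - f x - L h) \<le> e' * nrm E h"
      by (rule has_fderivE[OF L e']) blast
    obtain d2 where d2: "0 < d2" "\<And>h. h \<in> pts E \<Longrightarrow> nrm E h < d2 \<Longrightarrow> nrm F (f (x + h) - f x - L' h) \<le> e' * nrm E h"
      by (rule has_fderivE[OF L' e']) blast
    obtain d3 where d3: "0 < d3" "\<And>h. h \<in> pts E \<Longrightarrow> nrm E h < d3 \<Longrightarrow> x + h \<in> S"
      by (rule open_inE[OF E S x]) blast
    obtain t where t: "0 < t" "nrm E (complex_of_real t *\<^sub>C v) < min d1 (min d2 d3)"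
      by (rule small_multiple[OF E v, of "min d1 (min d2 d3)"]) (use d1 d2 d3 in auto)
    let ?h = "complex_of_real t *\<^sub>C v"
    have h: "?h \<in> pts E" by (rule cn_scale[OF E v])
    have "f x \<in> pts F" "f (x + ?h) \<in> pts F" using f x d3(2)[OF h] t(2) by auto
    then have r: "f (x + ?h) - f x - L ?h \<in> pts F" "f (x + ?h) - f x - L' ?h \<in> pts F"
      by (auto intro!: cn_diff F bcbD(1)[OF Ll h] bcbD(1)[OF Ll' h])
    have "L ?h - L' ?h = (f (x + ?h) - f x - L' ?h) - (f (x + ?h) - f x - L ?h)" by simp
    then have "nrm F (L ?h - L' ?h) \<le> nrm F (f (x + ?h) - f x - L' ?h) + nrm F (f (x + ?h) - f x - L ?h)"
      using nrm_triangle_diff[OF F r(2,1)] by simp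
    also have "\<dots> \<le> e' * nrm E ?h + e' * nrm E ?h" using t(2) by (intro add_mono d1(2) d2(2) h) auto
    also have "L ?h - L' ?h = complex_of_real t *\<^sub>C (L v - L' v)"
      by (simp add: bcbD(3)[OF Ll v] bcbD(3)[OF Ll' v] complex_vector.scale_right_diff_distrib)
    finally have "t * nrm F (L v - L' v) \<le> t * (2 * e' * nrm E v)"
      using t(1) by (simp add: nrm_scale[OF F mem] nrm_scale[OF E v])
    then have "nrm F (L v - L' v) \<le> 2 * e' * nrm E v" using t(1) by simp
    also have "\<dots> \<le> e" using e v1 by (simp add: e'_def field_simps)
    finally show ?thesis by simp
  qed
  then have "nrm F (L v - L' v) \<le> 0" by (rule field_le_epsilon)
  then have "L v - L' v = 0" using nrm_nonneg[OF F mem] nrm_eq_0[OF F mem] by simp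
  then show ?thesis by simp
qed

lemma has_fderiv_cong:
  assumes E: "cnormed_space E" and S: "open_in E S" and x: "x \<in> S" and eq: "\<And>y. y \<in> S \<Longrightarrow> f y = g y"
    and f: "has_fderiv E F f x L"
  shows "has_fderiv E F g x L"
proof (rule has_fderivI[OF has_fderiv_linear[OF f]])
  fix e :: real assume "e > 0"
  then obtain d1 where d1: "0 < d1" "\<And>h. h \<in> pts E \<Longrightarrow> nrm E h < d1 \<Longrightarrow> nrm F (f (x + h) - f x - L h) \<le> e * nrm E h"
    by (rule has_fderivE[OF f]) blast
  obtain d3 where d3: "0 < d3" "\<And>h. h \<in> pts E \<Longrightarrow> nrm E h < d3 \<Longrightarrow> x + h \<in> S"
    by (rule open_inE[OF E S x]) blast
  have "nrm F (g (x + h) - g x - L h) \<le> e * nrm E h" if "h \<in> pts E" "nrm E h < min d1 d3" for h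
    using d1(2)[of h] d3(2)[of h] that eq[OF x] eq[of "x + h"] by simp
  then show "\<exists>d>0. \<forall>h\<in>pts E. nrm E h < d \<longrightarrow> nrm F (g (x + h) - g x - L h) \<le> e * nrm E h"
    using d1(1) d3(1) by (intro exI[of _ "min d1 d3"]) simp
qed

lemma has_fderiv_increment:
  assumes E: "cnormed_space E" and F: "cnormed_space F" and S: "open_in E S" and x: "x \<in> S"
    and f: "f ` S \<subseteq> pts F" and L: "has_fderiv E F f x L"
  obtains d K where "0 < d" "0 < K"
    "\<And>h. h \<in> pts E \<Longrightarrow> nrm E h < d \<Longrightarrow> x + h \<in> S \<and> nrm F (f (x + h) - f x) \<le> K * nrm E h"
proof -
  note Ll = has_fderiv_linear[OF L]
  obtain K where K: "0 < K" "\<And>h. h \<in> pts E \<Longrightarrow> nrm F (L h) \<le> K * nrm E h" by (rule bcb_bound[OF E Ll]) blast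
  obtain d1 where d1: "0 < d1" "\<And>h. h \<in> pts E \<Longrightarrow> nrm E h < d1 \<Longrightarrow> nrm F (f (x + h) - f x - L h) \<le> 1 * nrm E h"
    by (rule has_fderivE[OF L zero_less_one]) blast
  obtain d3 where d3: "0 < d3" "\<And>h. h \<in> pts E \<Longrightarrow> nrm E h < d3 \<Longrightarrow> x + h \<in> S"
    by (rule open_inE[OF E S x]) blast
  show thesis
  proof (rule that[of "min d1 d3" "K + 1"])
    fix h assume h: "h \<in> pts E" "nrm E h < min d1 d3"
    then have xh: "x + h \<in> S" using d3(2) by simp
    have m: "f (x + h) - f x \<in> pts F" using f x xh by (auto intro!: cn_diff F)
    have "nrm F (f (x + h) - f x) \<le> nrm F (L h) + nrm F (f (x + h) - f x - L h)"
      by (rule nrm_le_add_diff[OF F m bcbD(1)[OF Ll h(1)]])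
    also have "\<dots> \<le> K * nrm E h + 1 * nrm E h" using h by (intro add_mono K(2) d1(2)) auto
    finally show "x + h \<in> S \<and> nrm F (f (x + h) - f x) \<le> (K + 1) * nrm E h" using xh by (simp add: distrib_right)
  qed (use d1(1) d3(1) K(1) in auto)
qed

lemma diff_times_0_of_fderiv:
  assumes E: "cnormed_space E" and F: "cnormed_space F" and S: "open_in E S"
    and f: "f ` S \<subseteq> pts F" and D: "\<And>x. x \<in> S \<Longrightarrow> has_fderiv E F f x (D x)"
  shows "diff_times 0 E F S f"
  unfolding diff_times.simps
proof (intro conjI f ballI allI impI)
  fix x and e :: real assume x: "x \<in> S" and e: "0 < e"
  obtain d K where d: "0 < d" "0 < K"
    "\<And>h. h \<in> pts E \<Longrightarrow> nrm E h < d \<Longrightarrow> x + h \<in> S \<and> nrm F (f (x + h) - f x) \<le> K * nrm E h"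
    by (rule has_fderiv_increment[OF E F S x f D[OF x]]) blast
  show "\<exists>d>0. \<forall>y\<in>S. nrm E (y - x) < d \<longrightarrow> nrm F (f y - f x) < e"
  proof (intro exI[of _ "min d (e / K)"] conjI ballI impI)
    show "0 < min d (e / K)" using d e by simp
    fix y assume y: "y \<in> S" "nrm E (y - x) < min d (e / K)"
    have "y - x \<in> pts E" using open_in_subset[OF S] x y(1) by (auto intro!: cn_diff E)
    then have "nrm F (f y - f x) \<le> K * nrm E (y - x)" using d(3)[of "y - x"] y(2) by simp
    also have "\<dots> < e" using y(2) d(2) by (simp add: field_simps)
    finally show "nrm F (f y - f x) < e" .
  qed
qed

lemma diff_times_Suc_imp:
  assumes E: "cnormed_space E" and F: "cnormed_space F" and S: "open_in E S"
  shows "diff_times (Suc k) E F S f \<Longrightarrow> diff_times k E F S f"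
proof (induction k arbitrary: f)
  case 0
  then obtain D where "f ` S \<subseteq> pts F" "\<And>x. x \<in> S \<Longrightarrow> has_fderiv E F f x (D x)"
    unfolding diff_times.simps(2)[of 0] by blast
  then show ?case by (rule diff_times_0_of_fderiv[OF E F S])
next
  case (Suc k)
  from Suc.prems obtain D where D: "f ` S \<subseteq> pts F" "\<And>x. x \<in> S \<Longrightarrow> has_fderiv E F f x (D x)"
    "\<And>v. v \<in> pts E \<Longrightarrow> diff_times (Suc k) E F S (\<lambda>x. D x v)" unfolding diff_times.simps(2)[of "Suc k"] by blast
  show ?case unfolding diff_times.simps(2)[of k] using D(1,2) Suc.IH[OF D(3)] by blast
qed

lemma diff_times_0E:
  assumes "diff_times 0 E F S f" "x \<in> S" "0 < e"
  obtains d where "0 < d" "\<And>y. y \<in> S \<Longrightarrow> nrm E (y - x) < d \<Longrightarrow> nrm F (f y - f x) < e"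
proof -
  from assms have "\<exists>d>0. \<forall>y\<in>S. nrm E (y - x) < d \<longrightarrow> nrm F (f y - f x) < e" by simp
  then show thesis using that by blast
qed

lemma diff_times_SucI:
  assumes "f ` S \<subseteq> pts F" "\<And>x. x \<in> S \<Longrightarrow> has_fderiv E F f x (D x)"
    "\<And>v. v \<in> pts E \<Longrightarrow> diff_times k E F S (\<lambda>x. D x v)"
  shows "diff_times (Suc k) E F S f"
  using assms unfolding diff_times.simps(2) by blast

lemma diff_times_SucE:
  assumes "diff_times (Suc k) E F S f"
  obtains D where "f ` S \<subseteq> pts F" "\<And>x. x \<in> S \<Longrightarrow> has_fderiv E F f x (D x)"
    "\<And>v. v \<in> pts E \<Longrightarrow> diff_times k E F S (\<lambda>x. D x v)"
  using assms unfolding diff_times.simps(2) by blast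

lemma diff_times_cong:
  assumes E: "cnormed_space E" and S: "open_in E S" and eq: "\<And>x. x \<in> S \<Longrightarrow> f x = g x"
    and f: "diff_times k E F S f"
  shows "diff_times k E F S g"
proof (cases k)
  case 0
  have "g ` S = f ` S" using eq by (auto simp: image_iff)
  then show ?thesis using f eq unfolding 0 diff_times.simps by auto
next
  case (Suc k')
  obtain D where D: "f ` S \<subseteq> pts F" "\<And>x. x \<in> S \<Longrightarrow> has_fderiv E F f x (D x)"
    "\<And>v. v \<in> pts E \<Longrightarrow> diff_times k' E F S (\<lambda>x. D x v)"
    using f unfolding Suc by (rule diff_times_SucE) blast
  show ?thesis unfolding Suc
  proof (rule diff_times_SucI)
    show "g ` S \<subseteq> pts F" using D(1) eq by auto
    show "has_fderiv E F g x (D x)" if "x \<in> S" for x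
      by (rule has_fderiv_cong[OF E S that eq D(2)[OF that]])
  qed (rule D(3))
qed

lemma diff_times_const:
  assumes E: "cnormed_space E" and F: "cnormed_space F"
  shows "c \<in> pts F \<Longrightarrow> diff_times k E F S (\<lambda>x. c)"
proof (induction k arbitrary: c)
  case 0
  then show ?case using nrm_zero[OF F] by (auto intro!: exI[of _ 1])
next
  case (Suc k)
  show ?case
  proof (rule diff_times_SucI[where D="\<lambda>x v. 0"])
    show "has_fderiv E F (\<lambda>x. c) x (\<lambda>v. 0)" for x
    proof (rule has_fderivI)
      show "bounded_clinear_between E F (\<lambda>v. 0)"
        by (rule bcbI[where K=0]) (simp_all add: cn_zero F nrm_zero)
    qed (auto simp: nrm_zero[OF F] nrm_nonneg[OF E] intro!: exI[of _ 1])
    show "diff_times k E F S (\<lambda>x. 0)" by (rule Suc.IH[OF cn_zero[OF F]])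
  qed (use Suc.prems in auto)
qed

lemma has_fderiv_add:
  assumes E: "cnormed_space E" and F: "cnormed_space F" and S: "open_in E S" and x: "x \<in> S"
    and f: "f ` S \<subseteq> pts F" "has_fderiv E F f x L" and g: "g ` S \<subseteq> pts F" "has_fderiv E F g x M"
  shows "has_fderiv E F (\<lambda>x. f x + g x) x (\<lambda>v. L v + M v)"
proof (rule has_fderivI)
  note Ll = has_fderiv_linear[OF f(2)] and Ml = has_fderiv_linear[OF g(2)]
  obtain K where K: "0 < K" "\<And>h. h \<in> pts E \<Longrightarrow> nrm F (L h) \<le> K * nrm E h" by (rule bcb_bound[OF E Ll]) blast
  obtain K' where K': "0 < K'" "\<And>h. h \<in> pts E \<Longrightarrow> nrm F (M h) \<le> K' * nrm E h" by (rule bcb_bound[OF E Ml]) blast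
  show "bounded_clinear_between E F (\<lambda>v. L v + M v)"
  proof (rule bcbI)
    show "nrm F (L h + M h) \<le> (K + K') * nrm E h" if "h \<in> pts E" for h
      using nrm_triangle[OF F bcbD(1)[OF Ll that] bcbD(1)[OF Ml that]] K(2)[OF that] K'(2)[OF that]
      by (simp add: distrib_right)
  qed (simp_all add: bcbD[OF Ll] bcbD[OF Ml] cn_add F scaleC_add_right)
  fix e :: real assume "e > 0"
  then have e2: "e / 2 > 0" by simp
  obtain d1 where d1: "0 < d1" "\<And>h. h \<in> pts E \<Longrightarrow> nrm E h < d1 \<Longrightarrow> nrm F (f (x + h) - f x - L h) \<le> e / 2 * nrm E h"
    by (rule has_fderivE[OF f(2) e2]) blast
  obtain d2 where d2: "0 < d2" "\<And>h. h \<in> pts E \<Longrightarrow> nrm E h < d2 \<Longrightarrow> nrm F (g (x + h) - g x - M h) \<le> e / 2 * nrm E h"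
    by (rule has_fderivE[OF g(2) e2]) blast
  obtain d3 where d3: "0 < d3" "\<And>h. h \<in> pts E \<Longrightarrow> nrm E h < d3 \<Longrightarrow> x + h \<in> S"
    by (rule open_inE[OF E S x]) blast
  have "nrm F (f (x + h) + g (x + h) - (f x + g x) - (L h + M h)) \<le> e * nrm E h"
    if h: "h \<in> pts E" "nrm E h < min d1 (min d2 d3)" for h
  proof -
    have xh: "x + h \<in> S" using d3(2)[OF h(1)] h(2) by simp
    have m: "f (x + h) - f x - L h \<in> pts F" "g (x + h) - g x - M h \<in> pts F"
      using f(1) g(1) x xh by (auto intro!: cn_diff F bcbD(1)[OF Ll h(1)] bcbD(1)[OF Ml h(1)])
    have eq: "f (x + h) + g (x + h) - (f x + g x) - (L h + M h) = (f (x + h) - f x - L h) + (g (x + h) - g x - M h)"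
      by simp
    have "nrm F (f (x + h) - f x - L h) \<le> e / 2 * nrm E h" "nrm F (g (x + h) - g x - M h) \<le> e / 2 * nrm E h"
      using d1(2)[OF h(1)] d2(2)[OF h(1)] h(2) by auto
    from order_trans[OF nrm_triangle[OF F m] add_mono[OF this]] show ?thesis
      unfolding eq by (simp add: field_simps)
  qed
  then show "\<exists>d>0. \<forall>h\<in>pts E. nrm E h < d \<longrightarrow> nrm F (f (x + h) + g (x + h) - (f x + g x) - (L h + M h)) \<le> e * nrm E h"
    using d1(1) d2(1) d3(1) by (intro exI[of _ "min d1 (min d2 d3)"]) simp
qed

lemma diff_times_add:
  assumes E: "cnormed_space E" and F: "cnormed_space F" and S: "open_in E S"
  shows "diff_times k E F S f \<Longrightarrow> diff_times k E F S g \<Longrightarrow> diff_times k E F S (\<lambda>x. f x + g x)"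
proof (induction k arbitrary: f g)
  case 0
  then have f: "f ` S \<subseteq> pts F" and g: "g ` S \<subseteq> pts F" by simp_all
  show ?case unfolding diff_times.simps
  proof (intro conjI ballI allI impI)
    show "(\<lambda>x. f x + g x) ` S \<subseteq> pts F" using f g by (auto intro!: cn_add F)
    fix x and e :: real assume x: "x \<in> S" and "0 < e"
    then have "0 < e / 2" by simp
    obtain d1 where d1: "0 < d1" "\<And>y. y \<in> S \<Longrightarrow> nrm E (y - x) < d1 \<Longrightarrow> nrm F (f y - f x) < e / 2"
      by (rule diff_times_0E[OF 0(1) x \<open>0 < e / 2\<close>]) blast
    obtain d2 where d2: "0 < d2" "\<And>y. y \<in> S \<Longrightarrow> nrm E (y - x) < d2 \<Longrightarrow> nrm F (g y - g x) < e / 2"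
      by (rule diff_times_0E[OF 0(2) x \<open>0 < e / 2\<close>]) blast
    have "nrm F (f y + g y - (f x + g x)) < e" if y: "y \<in> S" "nrm E (y - x) < min d1 d2" for y
    proof -
      have m: "f y - f x \<in> pts F" "g y - g x \<in> pts F" using f g x y(1) by (auto intro!: cn_diff F)
      have eq: "f y + g y - (f x + g x) = (f y - f x) + (g y - g x)" by simp
      have "nrm F (f y - f x) < e / 2" "nrm F (g y - g x) < e / 2" using d1(2)[OF y(1)] d2(2)[OF y(1)] y(2) by auto
      then show ?thesis unfolding eq using nrm_triangle[OF F m] by linarith
    qed
    then show "\<exists>d>0. \<forall>y\<in>S. nrm E (y - x) < d \<longrightarrow> nrm F (f y + g y - (f x + g x)) < e"
      using d1(1) d2(1) by (intro exI[of _ "min d1 d2"]) simp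
  qed
next
  case (Suc k)
  obtain D where D: "f ` S \<subseteq> pts F" "\<And>x. x \<in> S \<Longrightarrow> has_fderiv E F f x (D x)"
    "\<And>v. v \<in> pts E \<Longrightarrow> diff_times k E F S (\<lambda>x. D x v)"
    by (rule diff_times_SucE[OF Suc.prems(1)]) blast
  obtain D' where D': "g ` S \<subseteq> pts F" "\<And>x. x \<in> S \<Longrightarrow> has_fderiv E F g x (D' x)"
    "\<And>v. v \<in> pts E \<Longrightarrow> diff_times k E F S (\<lambda>x. D' x v)"
    by (rule diff_times_SucE[OF Suc.prems(2)]) blast
  show ?case
  proof (rule diff_times_SucI)
    show "(\<lambda>x. f x + g x) ` S \<subseteq> pts F" using D(1) D'(1) by (auto intro!: cn_add F)
    show "has_fderiv E F (\<lambda>x. f x + g x) x (\<lambda>v. D x v + D' x v)" if "x \<in> S" for x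
      by (rule has_fderiv_add[OF E F S that D(1) D(2)[OF that] D'(1) D'(2)[OF that]])
    show "diff_times k E F S (\<lambda>x. D x v + D' x v)" if "v \<in> pts E" for v
      by (rule Suc.IH[OF D(3)[OF that] D'(3)[OF that]])
  qed
qed

lemma has_fderiv_linear_comp:
  assumes E: "cnormed_space E" and F: "cnormed_space F" and S: "open_in E S" and x: "x \<in> S"
    and f: "f ` S \<subseteq> pts F" "has_fderiv E F f x L" and T: "bounded_clinear_between F G T"
  shows "has_fderiv E G (\<lambda>x. T (f x)) x (\<lambda>v. T (L v))"
proof (rule has_fderivI)
  note Ll = has_fderiv_linear[OF f(2)]
  show "bounded_clinear_between E G (\<lambda>v. T (L v))" by (rule bcb_compose[OF E F Ll T])
  obtain K where K: "0 < K" "\<And>y. y \<in> pts F \<Longrightarrow> nrm G (T y) \<le> K * nrm F y" by (rule bcb_bound[OF F T]) blast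
  fix e :: real assume "e > 0"
  then have e': "e / K > 0" using K(1) by simp
  obtain d1 where d1: "0 < d1" "\<And>h. h \<in> pts E \<Longrightarrow> nrm E h < d1 \<Longrightarrow> nrm F (f (x + h) - f x - L h) \<le> e / K * nrm E h"
    by (rule has_fderivE[OF f(2) e']) blast
  obtain d3 where d3: "0 < d3" "\<And>h. h \<in> pts E \<Longrightarrow> nrm E h < d3 \<Longrightarrow> x + h \<in> S"
    by (rule open_inE[OF E S x]) blast
  have "nrm G (T (f (x + h)) - T (f x) - T (L h)) \<le> e * nrm E h"
    if h: "h \<in> pts E" "nrm E h < min d1 d3" for h
  proof -
    have m: "f (x + h) \<in> pts F" "f x \<in> pts F" "L h \<in> pts F"
      using f(1) x d3(2)[OF h(1)] h(2) bcbD(1)[OF Ll h(1)] by auto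
    have "T (f (x + h)) - T (f x) - T (L h) = T (f (x + h) - f x - L h)"
      using m by (simp add: bcb_diff[OF F T] cn_diff F)
    also have "nrm G \<dots> \<le> K * (e / K * nrm E h)"
      using h m K(1) by (intro order_trans[OF K(2)] mult_left_mono d1(2) cn_diff F) auto
    finally show ?thesis using K(1) by simp
  qed
  then show "\<exists>d>0. \<forall>h\<in>pts E. nrm E h < d \<longrightarrow> nrm G (T (f (x + h)) - T (f x) - T (L h)) \<le> e * nrm E h"
    using d1(1) d3(1) by (intro exI[of _ "min d1 d3"]) simp
qed

lemma diff_times_linear_comp:
  assumes E: "cnormed_space E" and F: "cnormed_space F" and S: "open_in E S" and T: "bounded_clinear_between F G T"
  shows "diff_times k E F S f \<Longrightarrow> diff_times k E G S (\<lambda>x. T (f x))"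
proof (induction k arbitrary: f)
  case 0
  then have f: "f ` S \<subseteq> pts F" by simp
  obtain K where K: "0 < K" "\<And>y. y \<in> pts F \<Longrightarrow> nrm G (T y) \<le> K * nrm F y" by (rule bcb_bound[OF F T]) blast
  show ?case unfolding diff_times.simps
  proof (intro conjI ballI allI impI)
    show "(\<lambda>x. T (f x)) ` S \<subseteq> pts G" using f bcbD(1)[OF T] by auto
    fix x and e :: real assume x: "x \<in> S" and "0 < e"
    then have e': "0 < e / K" using K(1) by simp
    obtain d1 where d1: "0 < d1" "\<And>y. y \<in> S \<Longrightarrow> nrm E (y - x) < d1 \<Longrightarrow> nrm F (f y - f x) < e / K"
      by (rule diff_times_0E[OF 0 x e']) blast
    have "nrm G (T (f y) - T (f x)) < e" if y: "y \<in> S" "nrm E (y - x) < d1" for y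
    proof -
      have m: "f y \<in> pts F" "f x \<in> pts F" using f x y(1) by auto
      have "nrm G (T (f y) - T (f x)) \<le> K * nrm F (f y - f x)"
        using K(2)[OF cn_diff[OF F m]] by (simp add: bcb_diff[OF F T m])
      also have "\<dots> < e" using d1(2)[OF y] K(1) by (simp add: field_simps)
      finally show ?thesis .
    qed
    then show "\<exists>d>0. \<forall>y\<in>S. nrm E (y - x) < d \<longrightarrow> nrm G (T (f y) - T (f x)) < e"
      using d1(1) by blast
  qed
next
  case (Suc k)
  obtain D where D: "f ` S \<subseteq> pts F" "\<And>x. x \<in> S \<Longrightarrow> has_fderiv E F f x (D x)"
    "\<And>v. v \<in> pts E \<Longrightarrow> diff_times k E F S (\<lambda>x. D x v)"
    by (rule diff_times_SucE[OF Suc.prems]) blast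
  show ?case
  proof (rule diff_times_SucI)
    show "(\<lambda>x. T (f x)) ` S \<subseteq> pts G" using D(1) bcbD(1)[OF T] by auto
    show "has_fderiv E G (\<lambda>x. T (f x)) x (\<lambda>v. T (D x v))" if "x \<in> S" for x
      by (rule has_fderiv_linear_comp[OF E F S that D(1) D(2)[OF that] T])
    show "diff_times k E G S (\<lambda>x. T (D x v))" if "v \<in> pts E" for v by (rule Suc.IH[OF D(3)[OF that]])
  qed
qed

section \<open>Bilinear maps and the product rule\<close>

definition bounded_cbilinear ::
    "'a::complex_vector nspace \<Rightarrow> 'b::complex_vector nspace \<Rightarrow> 'c::complex_vector nspace \<Rightarrow> ('a \<Rightarrow> 'b \<Rightarrow> 'c) \<Rightarrow> bool"
  where "bounded_cbilinear F G H b \<longleftrightarrow>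
    (\<forall>x\<in>pts F. clinear_between (pts G) (pts H) (b x)) \<and>
    (\<forall>y\<in>pts G. clinear_between (pts F) (pts H) (\<lambda>x. b x y)) \<and>
    (\<exists>K>0. \<forall>x\<in>pts F. \<forall>y\<in>pts G. nrm H (b x y) \<le> K * nrm F x * nrm G y)"

lemma bounded_cbilinear_right:
  assumes F: "cnormed_space F" and b: "bounded_cbilinear F G H b" and x: "x \<in> pts F"
  shows "bounded_clinear_between G H (b x)"
proof -
  obtain K where "\<forall>x\<in>pts F. \<forall>y\<in>pts G. nrm H (b x y) \<le> K * nrm F x * nrm G y"
    using b unfolding bounded_cbilinear_def by blast
  then show ?thesis using b x unfolding bounded_cbilinear_def bounded_clinear_between_def by blast
qed

lemma bounded_cbilinear_left:
  assumes G: "cnormed_space G" and b: "bounded_cbilinear F G H b" and y: "y \<in> pts G"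
  shows "bounded_clinear_between F H (\<lambda>x. b x y)"
proof -
  obtain K where "\<forall>x\<in>pts F. \<forall>y\<in>pts G. nrm H (b x y) \<le> K * nrm F x * nrm G y"
    using b unfolding bounded_cbilinear_def by blast
  then have "\<forall>x\<in>pts F. nrm H (b x y) \<le> (K * nrm G y) * nrm F x" using y by (auto simp: mult_ac)
  then show ?thesis using b y unfolding bounded_cbilinear_def bounded_clinear_between_def by blast
qed

text \<open>The real arithmetic of the product rule. \<open>f\<close> and \<open>g\<close> stand for
  the norms of the factors at the base point, \<open>rf\<close> and \<open>rg\<close> for the norms
  of the remainders, \<open>k\<close> bounds the derivative of the first factor and \<open>l\<close>
  the increments of the second.\<close>

lemma product_remainder_bound:
  fixes K e :: real
  assumes "0 < K" "0 < e" "0 \<le> f" "0 \<le> g" "0 < k" "0 < l"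
  obtains e' d where "0 < e'" "0 < d"
    "\<And>h rf rg g' i m. 0 \<le> h \<Longrightarrow> h < d \<Longrightarrow> rf \<le> e' * h \<Longrightarrow> rg \<le> e' * h \<Longrightarrow> 0 \<le> rf \<Longrightarrow> 0 \<le> rg \<Longrightarrow> 0 \<le> g' \<Longrightarrow> 0 \<le> i \<Longrightarrow>
      g' \<le> g + i \<Longrightarrow> i \<le> l * h \<Longrightarrow> 0 \<le> m \<Longrightarrow> m \<le> k * h \<Longrightarrow> K * rf * g' + K * m * i + K * f * rg \<le> e * h"
proof (rule that)
  \<comment> \<open>\<open>e'\<close> makes the two remainder terms contribute at most e/2. In
    \<open>d\<close>, the entry \<open>1 / l\<close> keeps the second factor within 1 of its value,
    and the other entry bounds the quadratic term by e/2.\<close>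
  define e' where "e' = e / (2 * K * (f + g + 1))"
  define d where "d = min (1 / l) (e / (2 * K * k * l))"
  have den: "0 < 2 * K * (f + g + 1)" using assms by (intro mult_pos_pos) auto
  show "0 < e'" using den assms by (simp add: e'_def)
  show "0 < d" using assms by (simp add: d_def)
  fix h rf rg g' i m :: real
  assume h: "0 \<le> h" "h < d" and r: "rf \<le> e' * h" "rg \<le> e' * h" "0 \<le> rf" "0 \<le> rg" and g': "0 \<le> g'" "g' \<le> g + i"
    and i: "0 \<le> i" "i \<le> l * h" and m: "0 \<le> m" "m \<le> k * h"
  have "l * h \<le> 1" using h assms by (simp add: d_def field_simps)
  then have "g' \<le> g + 1" using g' i by simp
  then have 1: "rf * g' \<le> (e' * h) * (g + 1)" using r g' \<open>0 < e'\<close> h by (intro mult_mono) auto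
  have 2: "m * i \<le> (k * h) * (l * h)" using m i assms h by (intro mult_mono) auto
  have 3: "f * rg \<le> f * (e' * h)" using r assms by (intro mult_left_mono) auto
  have "K * rf * g' + K * m * i + K * f * rg = K * (rf * g' + m * i + f * rg)" by (simp add: algebra_simps)
  also have "\<dots> \<le> K * ((e' * h) * (g + 1) + (k * h) * (l * h) + f * (e' * h))"
    using 1 2 3 assms by (intro mult_left_mono) auto
  also have "\<dots> = (K * (f + g + 1) * e' + K * k * l * h) * h" by (simp add: algebra_simps)
  also have "\<dots> \<le> (e / 2 + e / 2) * h"
  proof (rule mult_right_mono[OF add_mono h(1)])
    define c where "c = K * (f + g + 1)"
    have "c \<noteq> 0" using den unfolding c_def by auto
    then have "c * (e / (2 * c)) = e / 2" by simp
    then have "K * (f + g + 1) * e' = e / 2" by (simp only: e'_def c_def mult.assoc)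
    then show "K * (f + g + 1) * e' \<le> e / 2" by simp
    have "h \<le> e / (2 * K * k * l)" using h by (simp add: d_def)
    then show "K * k * l * h \<le> e / 2" using assms by (simp add: field_simps)
  qed
  finally show "K * rf * g' + K * m * i + K * f * rg \<le> e * h" by simp
qed

lemma has_fderiv_bilinear:
  assumes E: "cnormed_space E" and F: "cnormed_space F" and G: "cnormed_space G" and H: "cnormed_space H"
    and S: "open_in E S" and x: "x \<in> S" and b: "bounded_cbilinear F G H b"
    and f: "f ` S \<subseteq> pts F" "has_fderiv E F f x L" and g: "g ` S \<subseteq> pts G" "has_fderiv E G g x M"
  shows "has_fderiv E H (\<lambda>x. b (f x) (g x)) x (\<lambda>v. b (L v) (g x) + b (f x) (M v))"
proof (rule has_fderivI)
  note Ll = has_fderiv_linear[OF f(2)] and Ml = has_fderiv_linear[OF g(2)]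
  note br = bounded_cbilinear_right[OF F b] and bl = bounded_cbilinear_left[OF G b]
  obtain K where K: "0 < K" "\<And>x y. x \<in> pts F \<Longrightarrow> y \<in> pts G \<Longrightarrow> nrm H (b x y) \<le> K * nrm F x * nrm G y"
    using b unfolding bounded_cbilinear_def by blast
  have fx: "f x \<in> pts F" and gx: "g x \<in> pts G" using f(1) g(1) x by auto
  obtain k where k: "0 < k" "\<And>h. h \<in> pts E \<Longrightarrow> nrm F (L h) \<le> k * nrm E h" by (rule bcb_bound[OF E Ll]) blast
  have 1: "bounded_clinear_between E H (\<lambda>v. b (L v) (g x))" by (rule bcb_compose[OF E F Ll bl[OF gx]])
  have 2: "bounded_clinear_between E H (\<lambda>v. b (f x) (M v))" by (rule bcb_compose[OF E G Ml br[OF fx]])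
  obtain K1 where K1: "0 < K1" "\<And>h. h \<in> pts E \<Longrightarrow> nrm H (b (L h) (g x)) \<le> K1 * nrm E h" by (rule bcb_bound[OF E 1]) blast
  obtain K2 where K2: "0 < K2" "\<And>h. h \<in> pts E \<Longrightarrow> nrm H (b (f x) (M h)) \<le> K2 * nrm E h" by (rule bcb_bound[OF E 2]) blast
  show "bounded_clinear_between E H (\<lambda>v. b (L v) (g x) + b (f x) (M v))"
  proof (rule bcbI)
    show "nrm H (b (L h) (g x) + b (f x) (M h)) \<le> (K1 + K2) * nrm E h" if "h \<in> pts E" for h
      using nrm_triangle[OF H bcbD(1)[OF 1 that] bcbD(1)[OF 2 that]] K1(2)[OF that] K2(2)[OF that]
      by (simp add: distrib_right)
  qed (simp_all add: bcbD[OF 1] bcbD[OF 2] cn_add H scaleC_add_right)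
  obtain d0 l where l: "0 < d0" "0 < l"
    "\<And>h. h \<in> pts E \<Longrightarrow> nrm E h < d0 \<Longrightarrow> x + h \<in> S \<and> nrm G (g (x + h) - g x) \<le> l * nrm E h"
    by (rule has_fderiv_increment[OF E G S x g]) blast
  fix e :: real assume e: "e > 0"
  obtain e' d where e': "0 < e'" and d: "0 < d" and bound:
    "\<And>h rf rg g' i m. 0 \<le> h \<Longrightarrow> h < d \<Longrightarrow> rf \<le> e' * h \<Longrightarrow> rg \<le> e' * h \<Longrightarrow> 0 \<le> rf \<Longrightarrow> 0 \<le> rg \<Longrightarrow> 0 \<le> g' \<Longrightarrow> 0 \<le> i \<Longrightarrow>
      g' \<le> nrm G (g x) + i \<Longrightarrow> i \<le> l * h \<Longrightarrow> 0 \<le> m \<Longrightarrow> m \<le> k * h \<Longrightarrow>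
      K * rf * g' + K * m * i + K * nrm F (f x) * rg \<le> e * h"
    by (rule product_remainder_bound[OF K(1) e nrm_nonneg[OF F fx] nrm_nonneg[OF G gx] k(1) l(2)]) blast
  obtain d1 where d1: "0 < d1" "\<And>h. h \<in> pts E \<Longrightarrow> nrm E h < d1 \<Longrightarrow> nrm F (f (x + h) - f x - L h) \<le> e' * nrm E h"
    by (rule has_fderivE[OF f(2) e']) blast
  obtain d2 where d2: "0 < d2" "\<And>h. h \<in> pts E \<Longrightarrow> nrm E h < d2 \<Longrightarrow> nrm G (g (x + h) - g x - M h) \<le> e' * nrm E h"
    by (rule has_fderivE[OF g(2) e']) blast
  have "nrm H (b (f (x + h)) (g (x + h)) - b (f x) (g x) - (b (L h) (g x) + b (f x) (M h))) \<le> e * nrm E h"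
    if h: "h \<in> pts E" "nrm E h < min (min d d0) (min d1 d2)" for h
  proof -
    have xh: "x + h \<in> S" and inc: "nrm G (g (x + h) - g x) \<le> l * nrm E h" using l(3)[OF h(1)] h(2) by auto
    have f': "f (x + h) \<in> pts F" and g': "g (x + h) \<in> pts G" using f(1) g(1) xh by auto
    note Lh = bcbD(1)[OF Ll h(1)] and Mh = bcbD(1)[OF Ml h(1)]
    let ?rf = "f (x + h) - f x - L h" and ?rg = "g (x + h) - g x - M h" and ?i = "g (x + h) - g x"
    have rf: "?rf \<in> pts F" and i: "?i \<in> pts G" and rg: "?rg \<in> pts G" by (intro cn_diff F G f' g' fx gx Lh Mh)+
    have m: "b ?rf (g (x + h)) \<in> pts H" "b (L h) ?i \<in> pts H" "b (f x) ?rg \<in> pts H"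
      by (rule bcbD(1)[OF br]; intro rf g' Lh i fx rg)+
    \<comment> \<open>The remainder of the product splits into three: remainder of \<open>f\<close>
      against the new value of \<open>g\<close>, linear part of \<open>f\<close> against the
      increment of \<open>g\<close>, and \<open>f x\<close> against the remainder of
      \<open>g\<close>.\<close>
    have "b ?rf (g (x + h)) = b (f (x + h)) (g (x + h)) - b (f x) (g (x + h)) - b (L h) (g (x + h))"
      by (simp add: bcb_diff[OF F bl[OF g']] cn_diff F f' fx Lh)
    moreover have "b (L h) ?i = b (L h) (g (x + h)) - b (L h) (g x)" by (rule bcb_diff[OF G br[OF Lh] g' gx])
    moreover have "b (f x) ?rg = b (f x) (g (x + h)) - b (f x) (g x) - b (f x) (M h)"
      by (simp add: bcb_diff[OF G br[OF fx]] cn_diff G g' gx Mh)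
    ultimately have "b (f (x + h)) (g (x + h)) - b (f x) (g x) - (b (L h) (g x) + b (f x) (M h))
      = b ?rf (g (x + h)) + b (L h) ?i + b (f x) ?rg" by simp
    moreover have "nrm H (b ?rf (g (x + h)) + b (L h) ?i + b (f x) ?rg)
      \<le> nrm H (b ?rf (g (x + h))) + nrm H (b (L h) ?i) + nrm H (b (f x) ?rg)"
      using nrm_triangle[OF H cn_add[OF H m(1,2)] m(3)] nrm_triangle[OF H m(1,2)] by simp
    moreover have "\<dots> \<le> K * nrm F ?rf * nrm G (g (x + h)) + K * nrm F (L h) * nrm G ?i + K * nrm F (f x) * nrm G ?rg"
      by (intro add_mono K(2) rf g' Lh i fx rg)
    moreover have "\<dots> \<le> e * nrm E h"
    proof (rule bound)
      show "nrm F ?rf \<le> e' * nrm E h" "nrm G ?rg \<le> e' * nrm E h" using d1(2) d2(2) h by auto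
      show "nrm G (g (x + h)) \<le> nrm G (g x) + nrm G ?i" by (rule nrm_le_add_diff[OF G g' gx])
    qed (use h inc k(2)[OF h(1)] in \<open>auto intro: nrm_nonneg[OF E] nrm_nonneg[OF F] nrm_nonneg[OF G] rf rg g' i Lh\<close>)
    ultimately show ?thesis by simp
  qed
  then show "\<exists>d>0. \<forall>h\<in>pts E. nrm E h < d \<longrightarrow>
      nrm H (b (f (x + h)) (g (x + h)) - b (f x) (g x) - (b (L h) (g x) + b (f x) (M h))) \<le> e * nrm E h"
    using d l(1) d1(1) d2(1) by (intro exI[of _ "min (min d d0) (min d1 d2)"]) simp
qed

lemma diff_times_bilinear_0:
  assumes E: "cnormed_space E" and F: "cnormed_space F" and G: "cnormed_space G" and H: "cnormed_space H"
    and b: "bounded_cbilinear F G H b" and f: "diff_times 0 E F S f" and g: "diff_times 0 E G S g"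
  shows "diff_times 0 E H S (\<lambda>x. b (f x) (g x))"
  unfolding diff_times.simps
proof (intro conjI ballI allI impI)
  note br = bounded_cbilinear_right[OF F b] and bl = bounded_cbilinear_left[OF G b]
  have fS: "f y \<in> pts F" and gS: "g y \<in> pts G" if "y \<in> S" for y using f g that by auto
  show "(\<lambda>x. b (f x) (g x)) ` S \<subseteq> pts H" using bcbD(1)[OF br] fS gS by auto
  obtain K where K: "0 < K" "\<And>x y. x \<in> pts F \<Longrightarrow> y \<in> pts G \<Longrightarrow> nrm H (b x y) \<le> K * nrm F x * nrm G y"
    using b unfolding bounded_cbilinear_def by blast
  fix x and e :: real assume x: "x \<in> S" and e: "0 < e"
  let ?a = "nrm F (f x)" and ?c = "nrm G (g x)"
  note a0 = nrm_nonneg[OF F fS[OF x]] and c0 = nrm_nonneg[OF G gS[OF x]]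
  \<comment> \<open>\<open>r \<le> 1\<close> bounds the norm of \<open>g y\<close> by that of
    \<open>g x\<close> plus 1; the other entry brings the two error terms together below
    \<open>e / 2\<close>.\<close>
  define r where "r = min 1 (e / (2 * K * (?a + ?c + 1)))"
  have den: "0 < 2 * K * (?a + ?c + 1)" using K(1) a0 c0 by (intro mult_pos_pos) auto
  have r: "0 < r" "r \<le> 1" "K * r * (?a + ?c + 1) \<le> e / 2"
  proof -
    show "0 < r" "r \<le> 1" using den e by (simp_all add: r_def)
    have "r \<le> e / (2 * K * (?a + ?c + 1))" by (simp add: r_def)
    then have "r * (2 * K * (?a + ?c + 1)) \<le> e" using den by (simp only: pos_le_divide_eq)
    then show "K * r * (?a + ?c + 1) \<le> e / 2" by (simp add: algebra_simps)
  qed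
  obtain d1 where d1: "0 < d1" "\<And>y. y \<in> S \<Longrightarrow> nrm E (y - x) < d1 \<Longrightarrow> nrm F (f y - f x) < r"
    by (rule diff_times_0E[OF f x r(1)]) blast
  obtain d2 where d2: "0 < d2" "\<And>y. y \<in> S \<Longrightarrow> nrm E (y - x) < d2 \<Longrightarrow> nrm G (g y - g x) < r"
    by (rule diff_times_0E[OF g x r(1)]) blast
  have "nrm H (b (f y) (g y) - b (f x) (g x)) < e" if y: "y \<in> S" "nrm E (y - x) < min d1 d2" for y
  proof -
    note m = fS[OF x] gS[OF x] fS[OF y(1)] gS[OF y(1)]
    have df: "f y - f x \<in> pts F" and dg: "g y - g x \<in> pts G" by (intro cn_diff F G m)+
    have rf: "nrm F (f y - f x) \<le> r" and rg: "nrm G (g y - g x) \<le> r"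
      using d1(2)[OF y(1)] d2(2)[OF y(1)] y(2) by auto
    have gy: "nrm G (g y) \<le> ?c + 1" using nrm_le_add_diff[OF G m(4,2)] rg r(2) by simp
    have "b (f y) (g y) - b (f x) (g x) = b (f y - f x) (g y) + b (f x) (g y - g x)"
      by (simp add: bcb_diff[OF F bl[OF m(4)] m(3,1)] bcb_diff[OF G br[OF m(1)] m(4,2)])
    then have "nrm H (b (f y) (g y) - b (f x) (g x)) \<le> nrm H (b (f y - f x) (g y)) + nrm H (b (f x) (g y - g x))"
      using nrm_triangle[OF H bcbD(1)[OF br[OF df] m(4)] bcbD(1)[OF br[OF m(1)] dg]] by simp
    also have "\<dots> \<le> K * nrm F (f y - f x) * nrm G (g y) + K * ?a * nrm G (g y - g x)"
      by (intro add_mono K(2) m df dg)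
    also have "\<dots> \<le> K * r * (?c + 1) + K * ?a * r"
      using rf rg gy K(1) r(1) a0 c0 nrm_nonneg[OF F df] nrm_nonneg[OF G dg] nrm_nonneg[OF G m(4)]
      by (intro add_mono mult_mono) auto
    also have "\<dots> = K * r * (?a + ?c + 1)" by (simp add: algebra_simps)
    also have "\<dots> < e" using r(3) e by simp
    finally show ?thesis .
  qed
  then show "\<exists>d>0. \<forall>y\<in>S. nrm E (y - x) < d \<longrightarrow> nrm H (b (f y) (g y) - b (f x) (g x)) < e"
    using d1(1) d2(1) by (intro exI[of _ "min d1 d2"]) simp
qed

text \<open>In a fixed direction the product rule gives two products, each pairing a derivative of
  order \<open>k\<close> with the other factor, whose order is lowered to \<open>k\<close> by
  \<open>diff_times_Suc_imp\<close>.\<close>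

lemma diff_times_bilinear:
  assumes E: "cnormed_space E" and F: "cnormed_space F" and G: "cnormed_space G" and H: "cnormed_space H"
    and S: "open_in E S" and b: "bounded_cbilinear F G H b"
  shows "diff_times k E F S f \<Longrightarrow> diff_times k E G S g \<Longrightarrow> diff_times k E H S (\<lambda>x. b (f x) (g x))"
proof (induction k arbitrary: f g)
  case 0
  then show ?case by (rule diff_times_bilinear_0[OF E F G H b])
next
  case (Suc k)
  note br = bounded_cbilinear_right[OF F b]
  obtain D where D: "f ` S \<subseteq> pts F" "\<And>x. x \<in> S \<Longrightarrow> has_fderiv E F f x (D x)"
    "\<And>v. v \<in> pts E \<Longrightarrow> diff_times k E F S (\<lambda>x. D x v)"
    by (rule diff_times_SucE[OF Suc.prems(1)]) blast
  obtain D' where D': "g ` S \<subseteq> pts G" "\<And>x. x \<in> S \<Longrightarrow> has_fderiv E G g x (D' x)"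
    "\<And>v. v \<in> pts E \<Longrightarrow> diff_times k E G S (\<lambda>x. D' x v)"
    by (rule diff_times_SucE[OF Suc.prems(2)]) blast
  show ?case
  proof (rule diff_times_SucI)
    show "(\<lambda>x. b (f x) (g x)) ` S \<subseteq> pts H" using D(1) D'(1) bcbD(1)[OF br] by auto
    show "has_fderiv E H (\<lambda>x. b (f x) (g x)) x (\<lambda>v. b (D x v) (g x) + b (f x) (D' x v))" if "x \<in> S" for x
      by (rule has_fderiv_bilinear[OF E F G H S that b D(1) D(2)[OF that] D'(1) D'(2)[OF that]])
    show "diff_times k E H S (\<lambda>x. b (D x v) (g x) + b (f x) (D' x v))" if "v \<in> pts E" for v
      by (intro diff_times_add[OF E H S] Suc.IH D(3) D'(3) that
          diff_times_Suc_imp[OF E F S Suc.prems(1)] diff_times_Suc_imp[OF E G S Suc.prems(2)])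
  qed
qed


section \<open>Spaces of bounded operators and duals\<close>

lemma cnormed_scalars: "cnormed_space scalars"
  by (auto simp: cnormed_space_def scalars_def complex_vector.subspace_def scaleC_complex_def norm_mult norm_triangle_ineq)

lemma hom_space_simps:
  "pts (hom_space E F) = {T. bounded_clinear_between E F T \<and> (\<forall>x. x \<notin> pts E \<longrightarrow> T x = 0)}"
  "nrm (hom_space E F) T = (SUP x\<in>{x\<in>pts E. nrm E x \<le> 1}. nrm F (T x))"
  by (simp_all add: hom_space_def)

lemma hom_bcb: "T \<in> pts (hom_space E F) \<Longrightarrow> bounded_clinear_between E F T"
  by (simp add: hom_space_simps)

lemma hom_off: "T \<in> pts (hom_space E F) \<Longrightarrow> x \<notin> pts E \<Longrightarrow> T x = 0"
  by (simp add: hom_space_simps)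

lemma hom_norm_le:
  assumes E: "cnormed_space E" and C: "0 \<le> C" "\<And>x. x \<in> pts E \<Longrightarrow> nrm F (T x) \<le> C * nrm E x"
  shows "nrm (hom_space E F) T \<le> C"
  unfolding hom_space_simps
proof (rule cSUP_least)
  show "{x \<in> pts E. nrm E x \<le> 1} \<noteq> {}" using cn_zero[OF E] nrm_zero[OF E] by force
  show "nrm F (T x) \<le> C" if "x \<in> {x \<in> pts E. nrm E x \<le> 1}" for x
    using C(2)[of x] mult_left_mono[of "nrm E x" 1 C] C(1) that by simp
qed

lemma hom_norm_bound:
  assumes E: "cnormed_space E" and F: "cnormed_space F" and T: "bounded_clinear_between E F T" and x: "x \<in> pts E"
  shows "nrm F (T x) \<le> nrm (hom_space E F) T * nrm E x"
proof (cases "x = 0")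
  case True
  then show ?thesis by (simp add: bcb_zero[OF E T] nrm_zero E F)
next
  case False
  obtain K where K: "0 < K" "\<And>h. h \<in> pts E \<Longrightarrow> nrm F (T h) \<le> K * nrm E h" by (rule bcb_bound[OF E T]) blast
  have nx: "0 < nrm E x" using False nrm_nonneg[OF E x] nrm_eq_0[OF E x] by simp
  let ?u = "complex_of_real (1 / nrm E x) *\<^sub>C x"
  have u: "?u \<in> pts E" "nrm E ?u \<le> 1"
    using nx by (simp_all add: cn_scale[OF E x] nrm_scale[OF E x] norm_divide)
  have bdd: "bdd_above ((\<lambda>x. nrm F (T x)) ` {x \<in> pts E. nrm E x \<le> 1})"
  proof (rule bdd_aboveI2)
    show "nrm F (T x) \<le> K" if "x \<in> {x \<in> pts E. nrm E x \<le> 1}" for x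
      using order_trans[OF K(2)[of x] mult_left_mono[of "nrm E x" 1 K]] K(1) that by simp
  qed
  have "nrm F (T ?u) \<le> nrm (hom_space E F) T"
    unfolding hom_space_simps by (rule cSUP_upper[OF _ bdd]) (use u in simp)
  then show ?thesis
    using nx by (simp add: bcbD(3)[OF T x] nrm_scale[OF F bcbD(1)[OF T x]] norm_divide field_simps)
qed

lemma hom_norm_nonneg:
  assumes E: "cnormed_space E" and F: "cnormed_space F" and T: "bounded_clinear_between E F T"
  shows "0 \<le> nrm (hom_space E F) T"
proof -
  obtain K where K: "0 < K" "\<And>h. h \<in> pts E \<Longrightarrow> nrm F (T h) \<le> K * nrm E h" by (rule bcb_bound[OF E T]) blast
  have bdd: "bdd_above ((\<lambda>x. nrm F (T x)) ` {x \<in> pts E. nrm E x \<le> 1})"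
  proof (rule bdd_aboveI2)
    show "nrm F (T x) \<le> K" if "x \<in> {x \<in> pts E. nrm E x \<le> 1}" for x
      using order_trans[OF K(2)[of x] mult_left_mono[of "nrm E x" 1 K]] K(1) that by simp
  qed
  have "nrm F (T 0) \<le> nrm (hom_space E F) T"
    unfolding hom_space_simps by (rule cSUP_upper[OF _ bdd]) (simp add: cn_zero nrm_zero E)
  then show ?thesis by (simp add: bcb_zero[OF E T] nrm_zero F)
qed

lemma cnormed_hom_space:
  assumes E: "cnormed_space E" and F: "cnormed_space F"
  shows "cnormed_space (hom_space E F)"
  unfolding cnormed_space_def
proof (intro conjI ballI allI)
  note bnd = hom_norm_bound[OF E F] and nn = hom_norm_nonneg[OF E F]
  have add: "S + T \<in> pts (hom_space E F)" "nrm (hom_space E F) (S + T) \<le> nrm (hom_space E F) S + nrm (hom_space E F) T"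
    if S: "S \<in> pts (hom_space E F)" and T: "T \<in> pts (hom_space E F)" for S T
  proof -
    have le: "nrm F ((S + T) x) \<le> (nrm (hom_space E F) S + nrm (hom_space E F) T) * nrm E x" if "x \<in> pts E" for x
      using nrm_triangle[OF F bcbD(1)[OF hom_bcb[OF S] that] bcbD(1)[OF hom_bcb[OF T] that]]
        bnd[OF hom_bcb[OF S] that] bnd[OF hom_bcb[OF T] that] by (simp add: distrib_right)
    show "nrm (hom_space E F) (S + T) \<le> nrm (hom_space E F) S + nrm (hom_space E F) T"
      by (rule hom_norm_le[OF E _ le]) (simp_all add: nn hom_bcb S T)
    have "bounded_clinear_between E F (S + T)"
      by (rule bcbI[OF _ _ _ le])
         (simp_all add: cn_add F bcbD[OF hom_bcb[OF S]] bcbD[OF hom_bcb[OF T]] scaleC_add_right)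
    then show "S + T \<in> pts (hom_space E F)" using hom_off[OF S] hom_off[OF T] by (simp add: hom_space_simps)
  qed
  have scale: "c *\<^sub>C T \<in> pts (hom_space E F)" "nrm (hom_space E F) (c *\<^sub>C T) \<le> cmod c * nrm (hom_space E F) T"
    if T: "T \<in> pts (hom_space E F)" for c T
  proof -
    have le: "nrm F ((c *\<^sub>C T) x) \<le> (cmod c * nrm (hom_space E F) T) * nrm E x" if "x \<in> pts E" for x
      using bnd[OF hom_bcb[OF T] that]
      by (simp add: scaleC_fun_def nrm_scale[OF F bcbD(1)[OF hom_bcb[OF T] that]] mult.assoc mult_left_mono)
    show "nrm (hom_space E F) (c *\<^sub>C T) \<le> cmod c * nrm (hom_space E F) T"
      by (rule hom_norm_le[OF E _ le]) (simp_all add: nn hom_bcb T)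
    have "bounded_clinear_between E F (c *\<^sub>C T)"
      by (rule bcbI[OF _ _ _ le])
         (simp_all add: scaleC_fun_def cn_scale F bcbD[OF hom_bcb[OF T]] scaleC_add_right scaleC_scaleC mult.commute)
    then show "c *\<^sub>C T \<in> pts (hom_space E F)" using hom_off[OF T] by (simp add: hom_space_simps scaleC_fun_def)
  qed
  have zero: "0 \<in> pts (hom_space E F)"
    unfolding hom_space_simps
    by (auto intro!: bcbI[where K=0] simp: cn_zero F nrm_zero)
  show "csubspace (pts (hom_space E F))"
    unfolding complex_vector.subspace_def using zero add(1) scale(1) by blast
  show "nrm (hom_space E F) (S + T) \<le> nrm (hom_space E F) S + nrm (hom_space E F) T"
    if "S \<in> pts (hom_space E F)" "T \<in> pts (hom_space E F)" for S T by (rule add(2)[OF that])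
  have nrm0: "nrm (hom_space E F) 0 = 0"
    using hom_norm_le[OF E, of 0 F 0] nn[OF hom_bcb[OF zero]] by (simp add: nrm_zero F)
  show "0 \<le> nrm (hom_space E F) T" if "T \<in> pts (hom_space E F)" for T by (rule nn[OF hom_bcb[OF that]])
  show "nrm (hom_space E F) T = 0 \<longleftrightarrow> T = 0" if T: "T \<in> pts (hom_space E F)" for T
  proof
    assume 0: "nrm (hom_space E F) T = 0"
    show "T = 0"
    proof
      fix x
      show "T x = 0 x"
      proof (cases "x \<in> pts E")
        case True
        note Tx = bcbD(1)[OF hom_bcb[OF T] True]
        have "nrm F (T x) \<le> 0" using bnd[OF hom_bcb[OF T] True] 0 by simp
        then show ?thesis using nrm_nonneg[OF F Tx] nrm_eq_0[OF F Tx] by simp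
      qed (simp add: hom_off[OF T])
    qed
  qed (simp only: nrm0)
  show "nrm (hom_space E F) (c *\<^sub>C T) = cmod c * nrm (hom_space E F) T" if T: "T \<in> pts (hom_space E F)" for c T
  proof (cases "c = 0")
    case False
    have "nrm (hom_space E F) (inverse c *\<^sub>C c *\<^sub>C T) \<le> cmod (inverse c) * nrm (hom_space E F) (c *\<^sub>C T)"
      by (rule scale(2)[OF scale(1)[OF T]])
    then have "cmod c * nrm (hom_space E F) T \<le> nrm (hom_space E F) (c *\<^sub>C T)"
      using False by (simp add: scaleC_scaleC norm_inverse norm_divide field_simps)
    then show ?thesis using scale(2)[OF T, of c] by simp
  qed (simp only: scaleC_zero_left nrm0 norm_zero mult_zero_left)
qed

lemma nrm_scalars [simp]: "nrm scalars = cmod" "pts scalars = UNIV"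
  by (simp_all add: scalars_def)

section \<open>Dual spaces\<close>

lemma dual_spaceI:
  assumes "\<And>x y. x \<in> pts E \<Longrightarrow> y \<in> pts E \<Longrightarrow> f (x + y) = f x + f y" "\<And>c x. x \<in> pts E \<Longrightarrow> f (c *\<^sub>C x) = c * f x"
    "\<And>x. x \<in> pts E \<Longrightarrow> cmod (f x) \<le> K * nrm E x" "\<And>x. x \<notin> pts E \<Longrightarrow> f x = 0"
  shows "f \<in> pts (dual_space E)"
  unfolding dual_space_def hom_space_simps
  using assms by (auto intro!: bcbI[where K=K] simp: scaleC_complex_def)

lemma dual_spaceD:
  assumes "f \<in> pts (dual_space E)"
  shows "x \<in> pts E \<Longrightarrow> y \<in> pts E \<Longrightarrow> f (x + y) = f x + f y" "x \<in> pts E \<Longrightarrow> f (c *\<^sub>C x) = c * f x"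
    "x \<notin> pts E \<Longrightarrow> f x = 0"
  using assms bcbD[OF hom_bcb, of f E scalars] hom_off[of f E scalars]
  unfolding dual_space_def by (simp_all add: scaleC_complex_def)

lemma dual_bound:
  assumes "cnormed_space E" "f \<in> pts (dual_space E)" "x \<in> pts E"
  shows "cmod (f x) \<le> nrm (dual_space E) f * nrm E x"
  using hom_norm_bound[OF assms(1) cnormed_scalars hom_bcb assms(3)] assms(2) unfolding dual_space_def by simp

lemma dual_norm_le:
  assumes "cnormed_space E" "0 \<le> C" "\<And>x. x \<in> pts E \<Longrightarrow> cmod (f x) \<le> C * nrm E x"
  shows "nrm (dual_space E) f \<le> C"
  unfolding dual_space_def by (rule hom_norm_le) (use assms in simp_all)

lemma cnormed_dual_space: "cnormed_space E \<Longrightarrow> cnormed_space (dual_space E)"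
  unfolding dual_space_def by (intro cnormed_hom_space cnormed_scalars)

text \<open>The typical fibres of the cotangent bundle are duals of the model spaces. A Cauchy
  sequence converges pointwise, and its uniform estimates survive the limit; off the carrier every
  term is zero.\<close>

lemma cbanach_dual_space:
  assumes E: "cnormed_space E"
  shows "cbanach_space (dual_space E)"
proof -
  have D: "cnormed_space (dual_space E)" by (rule cnormed_dual_space[OF E])
  have "\<exists>f\<in>pts (dual_space E). (\<lambda>n. nrm (dual_space E) (X n - f)) \<longlonglongrightarrow> 0"
    if "range X \<subseteq> pts (dual_space E)" and C: "\<forall>e>0. \<exists>N. \<forall>m\<ge>N. \<forall>n\<ge>N. nrm (dual_space E) (X m - X n) < e"
    for X :: "nat \<Rightarrow> 'a \<Rightarrow> complex"
  proof -
  have X: "X n \<in> pts (dual_space E)" for n using that(1) by auto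
  have unif: "\<exists>N. \<forall>m\<ge>N. \<forall>n\<ge>N. \<forall>x\<in>pts E. cmod (X m x - X n x) \<le> e * nrm E x" if "0 < e" for e
  proof -
    obtain N where N: "\<And>m n. m \<ge> N \<Longrightarrow> n \<ge> N \<Longrightarrow> nrm (dual_space E) (X m - X n) < e" using C \<open>0 < e\<close> by blast
    have "cmod (X m x - X n x) \<le> e * nrm E x" if "m \<ge> N" "n \<ge> N" "x \<in> pts E" for m n x
      using order_trans[OF dual_bound[OF E cn_diff[OF D X X] that(3)]
          mult_right_mono[OF less_imp_le[OF N[OF that(1,2)]] nrm_nonneg[OF E that(3)]]] by simp
    then show ?thesis by blast
  qed
  have "convergent (\<lambda>n. X n x)" for x
  proof (cases "x \<in> pts E")
    case True
    have "Cauchy (\<lambda>n. X n x)"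
    proof (rule metric_CauchyI)
      fix e :: real assume e: "0 < e"
      have x1: "0 < nrm E x + 1" using nrm_nonneg[OF E True] by simp
      then have "0 < e / (nrm E x + 1)" using e by simp
      from unif[OF this] obtain N where
        N: "\<And>m n. m \<ge> N \<Longrightarrow> n \<ge> N \<Longrightarrow> cmod (X m x - X n x) \<le> e / (nrm E x + 1) * nrm E x" using True by blast
      have "e / (nrm E x + 1) * nrm E x < e" using e x1 by (simp add: field_simps)
      then have "dist (X m x) (X n x) < e" if "m \<ge> N" "n \<ge> N" for m n
        unfolding dist_norm using N[OF that] by simp
      then show "\<exists>N. \<forall>m\<ge>N. \<forall>n\<ge>N. dist (X m x) (X n x) < e" by blast
    qed
    then show ?thesis by (simp add: Cauchy_convergent_iff)
  next
    case False
    then have "X n x = 0" for n by (rule dual_spaceD(3)[OF X])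
    then show ?thesis by (simp add: convergent_const)
  qed
  then obtain f where f: "\<And>x. (\<lambda>n. X n x) \<longlonglongrightarrow> f x" unfolding convergent_def by metis
  have lim: "\<exists>N. \<forall>n\<ge>N. \<forall>x\<in>pts E. cmod (X n x - f x) \<le> e * nrm E x" if e: "0 < e" for e
  proof -
    obtain N where N: "\<And>m n x. m \<ge> N \<Longrightarrow> n \<ge> N \<Longrightarrow> x \<in> pts E \<Longrightarrow> cmod (X m x - X n x) \<le> e * nrm E x"
      using unif[OF e] by blast
    have "cmod (X n x - f x) \<le> e * nrm E x" if n: "n \<ge> N" and x: "x \<in> pts E" for n x
    proof (rule tendsto_upperbound)
      show "(\<lambda>m. cmod (X n x - X m x)) \<longlonglongrightarrow> cmod (X n x - f x)" by (intro tendsto_intros f)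
      show "\<forall>\<^sub>F m in sequentially. cmod (X n x - X m x) \<le> e * nrm E x"
        using N[OF n _ x] unfolding eventually_sequentially by blast
    qed simp
    then show ?thesis by blast
  qed
  obtain N where N: "\<And>x. x \<in> pts E \<Longrightarrow> cmod (X N x - f x) \<le> 1 * nrm E x" using lim[of 1] by auto
  have fD: "f \<in> pts (dual_space E)"
  proof (rule dual_spaceI)
    show "f (x + y) = f x + f y" if "x \<in> pts E" "y \<in> pts E" for x y
      using LIMSEQ_unique[OF f[of "x + y"]] tendsto_add[OF f[of x] f[of y]] by (simp add: dual_spaceD(1)[OF X that])
    show "f (c *\<^sub>C x) = c * f x" if "x \<in> pts E" for c x
      using LIMSEQ_unique[OF f[of "c *\<^sub>C x"]] tendsto_mult_left[OF f[of x], of c] by (simp add: dual_spaceD(2)[OF X that])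
    show "f x = 0" if "x \<notin> pts E" for x
      using LIMSEQ_unique[OF f[of x]] by (simp add: dual_spaceD(3)[OF X that])
    show "cmod (f x) \<le> (nrm (dual_space E) (X N) + 1) * nrm E x" if "x \<in> pts E" for x
      using norm_triangle_ineq4[of "X N x" "X N x - f x"] N[OF that] dual_bound[OF E X that, of N]
      by (simp add: distrib_right)
  qed
  show ?thesis
  proof (rule bexI[OF _ fD], rule LIMSEQ_I)
    fix r :: real assume r: "0 < r"
    then obtain N where N: "\<And>n x. n \<ge> N \<Longrightarrow> x \<in> pts E \<Longrightarrow> cmod (X n x - f x) \<le> r / 2 * nrm E x"
      using lim[of "r / 2"] by auto
    have "norm (nrm (dual_space E) (X n - f) - 0) < r" if "n \<ge> N" for n
    proof -
      have "nrm (dual_space E) (X n - f) \<le> r / 2"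
        by (rule dual_norm_le[OF E]) (use r N[OF that] in simp_all)
      then show ?thesis using r nrm_nonneg[OF D cn_diff[OF D X fD], of n] by simp
    qed
    then show "\<exists>N. \<forall>n\<ge>N. norm (nrm (dual_space E) (X n - f) - 0) < r" by blast
  qed
  qed
  then show ?thesis using D unfolding cbanach_space_def by blast
qed

section \<open>The model spaces\<close>

lemma L1_iff:
  "T \<in> pts (L1 X Y) \<longleftrightarrow> trace_class T \<and> (\<forall>x\<in>orth X. T x = 0) \<and> (\<forall>x. T x \<in> Y)"
  by (auto simp: L1_def ops_def trace_class_bounded)

lemma nrm_L1 [simp]: "nrm (L1 X Y) = trace_norm"
  by (simp add: L1_def)

lemma L1_trace_class: "T \<in> pts (L1 X Y) \<Longrightarrow> trace_class T"
  by (simp add: L1_iff)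

lemma cnormed_L1:
  assumes Y: "closed_csubspace Y"
  shows "cnormed_space (L1 X Y)"
proof -
  note Y0 = closed_csubspaceD(1)[OF Y]
  have "csubspace (pts (L1 X Y))"
    unfolding complex_vector.subspace_def
  proof (intro conjI ballI allI)
    show "0 \<in> pts (L1 X Y)"
      unfolding L1_iff using trace_class_zero complex_vector.subspace_0[OF Y0] by simp
    show "S + T \<in> pts (L1 X Y)" if "S \<in> pts (L1 X Y)" "T \<in> pts (L1 X Y)" for S T
      using that trace_class_add[of S T] complex_vector.subspace_add[OF Y0] unfolding L1_iff by simp
    show "c *\<^sub>C T \<in> pts (L1 X Y)" if "T \<in> pts (L1 X Y)" for c T
      using that trace_class_scaleC[of T c] complex_vector.subspace_scale[OF Y0] unfolding L1_iff
      by (auto simp: scaleC_fun_def)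
  qed
  then show ?thesis
    unfolding cnormed_space_def
    by (simp add: L1_trace_class trace_norm_nonneg trace_norm_eq_0_iff trace_norm_triangle trace_norm_scaleC)
qed

lemma cbanach_L1:
  assumes Y: "closed_csubspace Y"
  shows "cbanach_space (L1 X Y)"
  unfolding cbanach_space_def
proof (rule conjI[OF cnormed_L1[OF Y]], intro allI impI, elim conjE)
  fix S :: "nat \<Rightarrow> 'a \<Rightarrow> 'a"
  assume "range S \<subseteq> pts (L1 X Y)" and C: "\<forall>e>0. \<exists>N. \<forall>m\<ge>N. \<forall>n\<ge>N. nrm (L1 X Y) (S m - S n) < e"
  then have S: "S n \<in> pts (L1 X Y)" for n by auto
  obtain T where T: "trace_class T" "\<And>x. (\<lambda>n. S n x) \<longlonglongrightarrow> T x" "(\<lambda>n. trace_norm (S n - T)) \<longlonglongrightarrow> 0"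
  proof (rule trace_norm_complete[of S])
    show "trace_class (S n)" for n by (rule L1_trace_class[OF S])
    show "\<exists>N. \<forall>m\<ge>N. \<forall>n\<ge>N. trace_norm (S m - S n) < e" if "e > 0" for e using C that by simp
  qed blast
  have "T x = 0" if "x \<in> orth X" for x
    using LIMSEQ_unique[OF T(2)[of x]] S that by (simp add: L1_iff)
  moreover have "T x \<in> Y" for x
    by (rule closed_sequentially[OF closed_csubspaceD(2)[OF Y] _ T(2)]) (use S in \<open>simp add: L1_iff\<close>)
  ultimately have "T \<in> pts (L1 X Y)" using T(1) by (simp add: L1_iff)
  then show "\<exists>T\<in>pts (L1 X Y). (\<lambda>n. nrm (L1 X Y) (S n - T)) \<longlonglongrightarrow> 0" using T(3) by auto
qed

text \<open>A single target space for the oblique projections of all charts, whereas the model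
  spaces vary with the chart.\<close>

definition bounded_ops :: "('h::chilbert_space \<Rightarrow> 'h) nspace"
  where "bounded_ops = \<lparr>pts = {T. bounded_clinear T}, nrm = onorm\<rparr>"

lemma bounded_ops_simps [simp]: "T \<in> pts bounded_ops \<longleftrightarrow> bounded_clinear T" "nrm bounded_ops = onorm"
  by (simp_all add: bounded_ops_def)

lemma onorm_add_le: "bounded_clinear S \<Longrightarrow> bounded_clinear T \<Longrightarrow> onorm (S + T) \<le> onorm S + onorm T"
  unfolding plus_fun_def by (intro onorm_triangle bounded_clinear_imp_bounded_linear)

lemma onorm_scaleC_le:
  assumes "bounded_clinear T"
  shows "onorm (c *\<^sub>C T) \<le> cmod c * onorm T"
  by (rule onorm_bound)
     (use bounded_clinear_norm[OF assms] onorm_nonneg[OF assms] in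
       \<open>simp_all add: scaleC_fun_def norm_scaleC mult.assoc mult_left_mono\<close>)

lemma cnormed_bounded_ops: "cnormed_space (bounded_ops :: ('h::chilbert_space \<Rightarrow> 'h) nspace)"
  unfolding cnormed_space_def bounded_ops_simps
proof (intro conjI ballI allI)
  show "csubspace (pts (bounded_ops :: ('h \<Rightarrow> 'h) nspace))"
    unfolding complex_vector.subspace_def
    by (intro conjI ballI allI; simp only: bounded_ops_simps bounded_clinear_const_zero(2)
        bounded_clinear_add_fun(2) bounded_clinear_scaleC_fun(2))
  fix S T :: "'h \<Rightarrow> 'h" and c
  assume "S \<in> pts bounded_ops"
  then have S: "bounded_clinear S" by simp
  show "0 \<le> onorm S" by (rule onorm_nonneg[OF S])
  show "onorm S = 0 \<longleftrightarrow> S = 0"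
    using onorm_eq_0[OF bounded_clinear_imp_bounded_linear[OF S]] by (simp add: fun_eq_iff)
  show "onorm (S + T) \<le> onorm S + onorm T" if "T \<in> pts bounded_ops" using S that by (simp add: onorm_add_le)
  show "onorm (c *\<^sub>C S) = cmod c * onorm S"
  proof (cases "c = 0")
    case False
    have "onorm (inverse c *\<^sub>C c *\<^sub>C S) \<le> cmod (inverse c) * onorm (c *\<^sub>C S)"
      by (rule onorm_scaleC_le[OF bounded_clinear_scaleC_fun(2)[OF S]])
    then have "cmod c * onorm S \<le> onorm (c *\<^sub>C S)"
      using False by (simp add: scaleC_scaleC norm_inverse norm_divide field_simps)
    then show ?thesis using onorm_scaleC_le[OF S, of c] by simp
  next
    case True
    then show ?thesis using onorm_scaleC_le[OF S, of 0] onorm_nonneg[OF bounded_clinear_scaleC_fun(2)[OF S], of 0]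
      by (simp del: scaleC_zero_left)
  qed
qed

lemma bcb_L1_bounded_ops: "bounded_clinear_between (L1 X Y) bounded_ops (\<lambda>T. T)"
  by (rule bcbI[where K=1]) (auto simp: L1_trace_class trace_class_bounded onorm_le_trace_norm)

text \<open>The outer projections force the result into the model space at \<open>V\<close> for
  arbitrary bounded \<open>R\<close> and \<open>X\<close>. Derivatives of chart changes thus become
  values of a bilinear map on \<open>bounded_ops\<close>.\<close>

definition sandwich :: "'h::chilbert_space set \<Rightarrow> ('h \<Rightarrow> 'h) \<Rightarrow> ('h \<Rightarrow> 'h) \<Rightarrow> ('h \<Rightarrow> 'h) \<Rightarrow> 'h \<Rightarrow> 'h"
  where "sandwich V R K X = orth_proj (orth V) \<circ> R \<circ> K \<circ> X \<circ> orth_proj V"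

lemma trace_norm_sandwich_le:
  assumes V: "closed_csubspace V" and R: "bounded_clinear R" and K: "trace_class K" and X: "bounded_clinear X"
  shows "trace_class (R \<circ> K \<circ> X)" "trace_norm (R \<circ> K \<circ> X) \<le> onorm R * onorm X * trace_norm K"
    "sandwich V R K X \<in> pts (L1 V (orth V))"
    "trace_norm (sandwich V R K X) \<le> onorm R * onorm X * trace_norm K"
proof -
  have gen: "trace_class (R \<circ> K \<circ> X)" "trace_norm (R \<circ> K \<circ> X) \<le> onorm R * onorm X * trace_norm K"
    if R: "bounded_clinear R" and K: "trace_class K" and X: "bounded_clinear X" for R K X :: "'a \<Rightarrow> 'a"
  proof -
    have RK: "trace_class (R \<circ> K)" by (rule trace_class_comp_left[OF R K])
    show "trace_class (R \<circ> K \<circ> X)" by (rule trace_class_comp_right[OF X RK])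
    have "trace_norm (R \<circ> K \<circ> X) \<le> onorm X * (onorm R * trace_norm K)"
      by (rule order_trans[OF trace_norm_comp_right[OF X RK]])
         (intro mult_left_mono trace_norm_comp_left R K onorm_nonneg X)
    then show "trace_norm (R \<circ> K \<circ> X) \<le> onorm R * onorm X * trace_norm K" by (simp add: mult_ac)
  qed
  show 1: "trace_class (R \<circ> K \<circ> X)" and 2: "trace_norm (R \<circ> K \<circ> X) \<le> onorm R * onorm X * trace_norm K"
    by (rule gen[OF R K X])+
  have P: "bounded_clinear (orth_proj V)" "bounded_clinear (orth_proj (orth V))"
    by (intro bounded_clinear_orth_proj V closed_csubspace_orth)+
  have eq: "sandwich V R K X = orth_proj (orth V) \<circ> (R \<circ> K \<circ> X) \<circ> orth_proj V"
    by (simp add: sandwich_def comp_assoc)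
  have tc: "trace_class (sandwich V R K X)" unfolding eq by (rule gen[OF P(2) 1 P(1)])
  have "orth_proj V x = 0" if "x \<in> orth V" for x using that orth_proj_eq_0_iff[OF V] by blast
  then show "sandwich V R K X \<in> pts (L1 V (orth V))"
    using tc unfolding L1_iff
    by (auto simp: sandwich_def orth_proj_in bounded_clinear_zero[OF P(2)] bounded_clinear_zero[OF R]
        bounded_clinear_zero[OF X] bounded_clinear_zero[OF trace_class_bounded[OF K]])
  have "trace_norm (sandwich V R K X) \<le> onorm (orth_proj (orth V)) * onorm (orth_proj V) * trace_norm (R \<circ> K \<circ> X)"
    unfolding eq by (rule gen[OF P(2) 1 P(1)])
  also have "\<dots> \<le> (1 * 1) * trace_norm (R \<circ> K \<circ> X)"
    by (intro mult_right_mono mult_mono onorm_orth_proj_le V closed_csubspace_orth onorm_nonneg P trace_norm_nonneg 1) simp_all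
  finally show "trace_norm (sandwich V R K X) \<le> onorm R * onorm X * trace_norm K" using 2 by simp
qed

lemma sandwich_linear:
  assumes V: "closed_csubspace V" and R: "bounded_clinear R"
  shows "sandwich V (R + R') K X = sandwich V R K X + sandwich V R' K X"
    "sandwich V (c *\<^sub>C R) K X = c *\<^sub>C sandwich V R K X"
    "sandwich V R (K + K') X = sandwich V R K X + sandwich V R K' X"
    "sandwich V R (c *\<^sub>C K) X = c *\<^sub>C sandwich V R K X"
    "bounded_clinear K \<Longrightarrow> sandwich V R K (X + X') = sandwich V R K X + sandwich V R K X'"
    "bounded_clinear K \<Longrightarrow> sandwich V R K (c *\<^sub>C X) = c *\<^sub>C sandwich V R K X"
proof -
  note l = bounded_clinear_simps[OF bounded_clinear_orth_proj[OF closed_csubspace_orth]] bounded_clinear_simps[OF R]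
  show "sandwich V (R + R') K X = sandwich V R K X + sandwich V R' K X"
    "sandwich V (c *\<^sub>C R) K X = c *\<^sub>C sandwich V R K X"
    "sandwich V R (K + K') X = sandwich V R K X + sandwich V R K' X"
    "sandwich V R (c *\<^sub>C K) X = c *\<^sub>C sandwich V R K X"
    by (simp_all add: fun_eq_iff sandwich_def scaleC_fun_def l)
  show "sandwich V R K (X + X') = sandwich V R K X + sandwich V R K X'"
    "sandwich V R K (c *\<^sub>C X) = c *\<^sub>C sandwich V R K X" if K: "bounded_clinear K"
    by (simp_all add: fun_eq_iff sandwich_def scaleC_fun_def l bounded_clinear_simps[OF K])
qed

lemma bounded_cbilinear_sandwich:
  assumes V: "closed_csubspace V" and K: "trace_class K"
  shows "bounded_cbilinear bounded_ops bounded_ops (L1 V (orth V)) (\<lambda>R X. sandwich V R K X)"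
  unfolding bounded_cbilinear_def clinear_between_def bounded_ops_simps nrm_L1
proof (intro conjI ballI)
  note Kb = trace_class_bounded[OF K]
  fix R :: "'a \<Rightarrow> 'a" assume "R \<in> pts bounded_ops"
  then have R: "bounded_clinear R" by simp
  show "sandwich V R K ` pts bounded_ops \<subseteq> pts (L1 V (orth V))"
    using trace_norm_sandwich_le(3)[OF V R K] by auto
  show "sandwich V R K (X + Y) = sandwich V R K X + sandwich V R K Y" for X Y
    by (rule sandwich_linear(5)[OF V R Kb])
  show "\<forall>c. \<forall>X\<in>pts bounded_ops. sandwich V R K (c *\<^sub>C X) = c *\<^sub>C sandwich V R K X"
    by (simp add: sandwich_linear(6)[OF V R Kb])
next
  fix X :: "'a \<Rightarrow> 'a" assume "X \<in> pts bounded_ops"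
  then have X: "bounded_clinear X" by simp
  show "(\<lambda>R. sandwich V R K X) ` pts bounded_ops \<subseteq> pts (L1 V (orth V))"
    using trace_norm_sandwich_le(3)[OF V _ K X] by auto
  show "sandwich V (R + R') K X = sandwich V R K X + sandwich V R' K X" if "R \<in> pts bounded_ops" for R R'
    using that by (intro sandwich_linear(1)[OF V]) simp
  show "\<forall>c. \<forall>R\<in>pts bounded_ops. sandwich V (c *\<^sub>C R) K X = c *\<^sub>C sandwich V R K X"
    by (simp add: sandwich_linear(2)[OF V])
next
  have "trace_norm (sandwich V R K X) \<le> (trace_norm K + 1) * onorm R * onorm X"
    if R: "bounded_clinear R" and X: "bounded_clinear X" for R X
  proof -
    have "0 \<le> onorm R * onorm X" using onorm_nonneg[OF R] onorm_nonneg[OF X] by simp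
    then show ?thesis using trace_norm_sandwich_le(4)[OF V R K X] by (simp add: algebra_simps)
  qed
  then show "\<exists>C>0. \<forall>R\<in>pts bounded_ops. \<forall>X\<in>pts bounded_ops. trace_norm (sandwich V R K X) \<le> C * onorm R * onorm X"
    using trace_norm_nonneg[OF K] by (intro exI[of _ "trace_norm K + 1"]) auto
qed


section \<open>Charts of the Grassmannian\<close>

text \<open>\<open>oblique V W J\<close>: \<open>J\<close> is the projection onto \<open>W\<close> along \<open>V\<^sup>\<bottom>\<close>.\<close>

definition oblique :: "'h::chilbert_space set \<Rightarrow> 'h set \<Rightarrow> ('h \<Rightarrow> 'h) \<Rightarrow> bool"
  where "oblique V W J \<longleftrightarrow> bounded_clinear J \<and> (\<forall>x. J x \<in> W) \<and> (\<forall>x\<in>W. J x = x) \<and>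
    (\<forall>x. x - J x \<in> orth V) \<and> (\<forall>x\<in>orth V. J x = 0)"

lemma obliqueD:
  assumes "oblique V W J"
  shows "bounded_clinear J" "J x \<in> W" "x \<in> W \<Longrightarrow> J x = x" "x - J x \<in> orth V" "x \<in> orth V \<Longrightarrow> J x = 0"
  using assms by (auto simp: oblique_def)

lemma oblique_orth_proj:
  assumes J: "oblique V W J" and V: "closed_csubspace V"
  shows "orth_proj V (J x) = orth_proj V x" "J (orth_proj V x) = J x"
proof -
  have "orth_proj V (x - J x) = 0" using obliqueD(4)[OF J] orth_proj_eq_0_iff[OF V] by blast
  then show "orth_proj V (J x) = orth_proj V x"
    by (simp add: bounded_clinear_diff[OF bounded_clinear_orth_proj[OF V]])
  have "J (x - orth_proj V x) = 0" by (rule obliqueD(5)[OF J orth_proj_compl[OF V]])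
  then show "J (orth_proj V x) = J x" by (simp add: bounded_clinear_diff[OF obliqueD(1)[OF J]])
qed

text \<open>The adjoint of an oblique projection is the oblique projection onto the orthogonal complement
  of the kernel; this makes the complementarity condition of the charts symmetric.\<close>

lemma oblique_imp_complementary:
  assumes V: "closed_csubspace V" and J: "oblique V W J"
  shows "V \<inter> orth W = {0}" "\<exists>a\<in>V. \<exists>b\<in>orth W. x = a + b"
proof -
  note Jb = obliqueD(1)[OF J]
  show "V \<inter> orth W = {0}"
  proof
    show "{0} \<subseteq> V \<inter> orth W" using complex_vector.subspace_0 closed_csubspaceD(1)[OF V] csubspace_orth by blast
    show "V \<inter> orth W \<subseteq> {0}"
    proof
      fix y assume y: "y \<in> V \<inter> orth W"
      have "cinner (J y) y = 0" using y obliqueD(2)[OF J] by (simp add: orth_def)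
      moreover have "cinner y (y - J y) = 0" using y obliqueD(4)[OF J, of y] by (simp add: orth_def)
      ultimately have "cinner y y = 0" using cinner_eq_0_commute[of "J y" y] by (simp add: cinner_diff_right)
      then show "y \<in> {0}" by simp
    qed
  qed
  have "adj J x \<in> orth (orth V)"
    unfolding orth_def[of "orth V"] using obliqueD(5)[OF J] by (simp flip: cinner_adj[OF Jb])
  then have "adj J x \<in> V" using V by simp
  moreover have "x - adj J x \<in> orth W"
    unfolding orth_def using obliqueD(3)[OF J] by (simp add: cinner_diff_right flip: cinner_adj[OF Jb])
  ultimately show "\<exists>a\<in>V. \<exists>b\<in>orth W. x = a + b"
    by (intro bexI[of _ "adj J x"] bexI[of _ "x - adj J x"]) simp_all
qed

text \<open>Otherwise unit vectors u_n in V have P_W u_n tending to zero. Since u_n - P_W u_n is the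
  image of u_n under the compact difference, a subsequence of u_n converges to a unit vector in the
  trivial intersection of V with the complement of W.\<close>

lemma proj_bounded_below:
  assumes V: "closed_csubspace V" and W: "closed_csubspace W" and K: "compact_op (orth_proj V - orth_proj W)"
    and int: "V \<inter> orth W = {0}"
  obtains c where "0 < c" "\<And>x. x \<in> V \<Longrightarrow> c * norm x \<le> norm (orth_proj W x)"
proof (rule ccontr)
  assume "\<not> thesis"
  then have neg: "\<not> (\<forall>x\<in>V. c * norm x \<le> norm (orth_proj W x))" if "0 < c" for c
    using that \<open>\<And>c. 0 < c \<Longrightarrow> (\<And>x. x \<in> V \<Longrightarrow> c * norm x \<le> norm (orth_proj W x)) \<Longrightarrow> thesis\<close> by blast
  note PW = bounded_clinear_orth_proj[OF W] and V0 = closed_csubspaceD(1)[OF V]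
  have "\<exists>u\<in>V. norm u = 1 \<and> norm (orth_proj W u) \<le> inverse (real (Suc n))" for n
  proof -
    have "\<not> (\<forall>x\<in>V. inverse (real (Suc n)) * norm x \<le> norm (orth_proj W x))" by (rule neg) simp
    then obtain x where x: "x \<in> V" "norm (orth_proj W x) < inverse (real (Suc n)) * norm x" by force
    then have nx: "0 < norm x" by (metis mult_zero_right norm_ge_zero not_less zero_less_norm_iff norm_zero)
    let ?u = "complex_of_real (1 / norm x) *\<^sub>C x"
    have "?u \<in> V" by (rule complex_vector.subspace_scale[OF V0 x(1)])
    moreover have "norm ?u = 1" using nx by (simp add: norm_scaleC norm_divide)
    moreover have "norm (orth_proj W ?u) \<le> inverse (real (Suc n))"
      using x(2) nx by (simp add: bounded_clinear_scaleC[OF PW] norm_scaleC norm_divide field_simps)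
    ultimately show ?thesis by blast
  qed
  then obtain u where u: "\<And>n. u n \<in> V" "\<And>n. norm (u n) = 1" "\<And>n. norm (orth_proj W (u n)) \<le> inverse (real (Suc n))"
    by metis
  obtain C where C: "compact C" "\<And>x. norm x \<le> 1 \<Longrightarrow> (orth_proj V - orth_proj W) x \<in> C"
    by (rule compact_opE[OF K]) blast
  have "\<forall>n. (orth_proj V - orth_proj W) (u n) \<in> C" using C(2) u(2) by simp
  then obtain l r where r: "strict_mono r" "((\<lambda>n. (orth_proj V - orth_proj W) (u n)) \<circ> r) \<longlonglongrightarrow> l"
    using seq_compactE[OF compact_imp_seq_compact[OF C(1)]] by metis
  have "(\<lambda>n. orth_proj W (u n)) \<longlonglongrightarrow> 0"
    by (rule Lim_null_comparison[OF _ LIMSEQ_inverse_real_of_nat]) (simp add: u(3) del: of_nat_Suc)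
  then have PWu: "(\<lambda>n. orth_proj W (u (r n))) \<longlonglongrightarrow> 0"
    using LIMSEQ_subseq_LIMSEQ[OF _ r(1)] by (fastforce simp: o_def)
  from tendsto_add[OF r(2) this] have ul: "(\<lambda>n. u (r n)) \<longlonglongrightarrow> l"
    by (simp add: o_def orth_proj_fixes[OF V u(1)])
  have "l \<in> V" by (rule closed_sequentially[OF closed_csubspaceD(2)[OF V] _ ul]) (rule u(1))
  moreover have "orth_proj W l = 0" by (rule LIMSEQ_unique[OF bounded_clinear_tendsto[OF PW ul] PWu])
  ultimately have "l = 0" using int orth_proj_eq_0_iff[OF W] by blast
  moreover have "norm l = 1"
    using LIMSEQ_unique[OF tendsto_norm[OF ul]] by (simp add: u(2))
  ultimately show False by simp
qed

text \<open>\<open>P\<close> is the projection onto \<open>V\<close> along \<open>orth W\<close>,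
  bounded because P_W is bounded below on \<open>V\<close> and P_W P = P_W. Its adjoint has range
  \<open>W\<close> and kernel \<open>orth V\<close>.\<close>

lemma oblique_exists:
  assumes V: "closed_csubspace V" and W: "closed_csubspace W" and K: "compact_op (orth_proj V - orth_proj W)"
    and int: "V \<inter> orth W = {0}" and sum: "\<And>x. \<exists>a\<in>V. \<exists>b\<in>orth W. x = a + b"
  obtains J where "oblique V W J"
proof -
  note V0 = closed_csubspaceD(1)[OF V] and PW = bounded_clinear_orth_proj[OF W]
  obtain c where c: "0 < c" "\<And>x. x \<in> V \<Longrightarrow> c * norm x \<le> norm (orth_proj W x)"
    by (rule proj_bounded_below[OF V W K int]) blast
  have "\<exists>a\<in>V. x - a \<in> orth W" for x using sum[of x] by force
  then obtain P where P: "\<And>x. P x \<in> V" "\<And>x. x - P x \<in> orth W" by metis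
  have uniq: "a = a'" if "a \<in> V" "a' \<in> V" "x - a \<in> orth W" "x - a' \<in> orth W" for a a' x
  proof -
    have "a - a' \<in> V" by (rule complex_vector.subspace_diff[OF V0 that(1,2)])
    moreover have "(x - a') - (x - a) \<in> orth W" by (rule complex_vector.subspace_diff[OF csubspace_orth that(4,3)])
    ultimately have "a - a' \<in> V \<inter> orth W" by simp
    then show ?thesis using int by simp
  qed
  have Pb: "bounded_clinear P"
  proof (rule bounded_clinearI)
    show "P (x + y) = P x + P y" for x y
    proof (rule uniq[OF P(1) _ P(2)])
      show "P x + P y \<in> V" by (intro complex_vector.subspace_add V0 P)
      have "(x - P x) + (y - P y) \<in> orth W" by (intro complex_vector.subspace_add csubspace_orth P)
      then show "x + y - (P x + P y) \<in> orth W" by (simp add: algebra_simps)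
    qed
    show "P (a *\<^sub>C x) = a *\<^sub>C P x" for a x
    proof (rule uniq[OF P(1) _ P(2)])
      show "a *\<^sub>C P x \<in> V" by (intro complex_vector.subspace_scale V0 P)
      have "a *\<^sub>C (x - P x) \<in> orth W" by (intro complex_vector.subspace_scale csubspace_orth P)
      then show "a *\<^sub>C x - a *\<^sub>C P x \<in> orth W" by (simp add: complex_vector.scale_right_diff_distrib)
    qed
    show "norm (P x) \<le> (1 / c) * norm x" for x
    proof -
      have "orth_proj W (x - P x) = 0" using P(2) orth_proj_eq_0_iff[OF W] by blast
      then have "orth_proj W (P x) = orth_proj W x" by (simp add: bounded_clinear_diff[OF PW])
      then have "c * norm (P x) \<le> norm x"
        using c(2)[OF P(1), of x] norm_orth_proj_le[OF W, of x] by simp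
      then show ?thesis using c(1) by (simp add: field_simps)
    qed
  qed
  have P0: "P y = 0" if "y \<in> orth W" for y
    by (rule uniq[OF P(1) _ P(2)]) (use that in \<open>simp_all add: complex_vector.subspace_0 V0\<close>)
  have Pid: "P y = y" if "y \<in> V" for y
    by (rule uniq[OF P(1) _ P(2)]) (use that in \<open>simp_all add: complex_vector.subspace_0\<close>)
  have "oblique V W (adj P)"
    unfolding oblique_def
  proof (intro conjI allI ballI)
    show "bounded_clinear (adj P)" by (rule bounded_clinear_adj[OF Pb])
    show "adj P x \<in> W" for x
    proof -
      have "adj P x \<in> orth (orth W)"
        unfolding orth_def[of "orth W"] using P0 by (simp flip: cinner_adj[OF Pb])
      then show ?thesis using W by simp
    qed
    show "adj P x = x" if "x \<in> W" for x
    proof (rule cinner_ext)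
      fix y
      have "cinner x (y - P y) = 0" using that P(2)[of y] by (simp add: orth_def)
      then have "cinner (y - P y) x = 0" using cinner_eq_0_commute by blast
      then show "cinner y (adj P x) = cinner y x" by (simp add: cinner_diff_left flip: cinner_adj[OF Pb])
    qed
    show "x - adj P x \<in> orth V" for x
      unfolding orth_def using Pid by (simp add: cinner_diff_right flip: cinner_adj[OF Pb])
    show "adj P x = 0" if "x \<in> orth V" for x
      by (rule cinner_ext) (use that P(1) in \<open>simp add: orth_def flip: cinner_adj[OF Pb]\<close>)
  qed
  then show thesis by (rule that)
qed

text \<open>The operator inverted in \<open>phi\<close> is injective on \<open>V\<close> because <y,
  P_W y> is the squared norm of P_W y. It then suffices to exhibit its preimage of
  \<open>orth_proj V x\<close>.\<close>

lemma phi_eq_oblique: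
  assumes V: "closed_csubspace V" and W: "closed_csubspace W" and J: "oblique V W J"
  shows "phi V W = J - orth_proj V"
proof
  fix x
  note PV = bounded_clinear_orth_proj[OF V] and PW = bounded_clinear_orth_proj[OF W]
  let ?S = "orth_proj V \<circ> orth_proj W \<circ> orth_proj V"
  have inj: "inj_on ?S V"
  proof (rule inj_onI)
    fix y z assume y: "y \<in> V" and z: "z \<in> V" and eq: "?S y = ?S z"
    have yz: "y - z \<in> V" by (rule complex_vector.subspace_diff[OF closed_csubspaceD(1)[OF V] y z])
    have "orth_proj V (orth_proj W (y - z)) = 0"
      using eq by (simp add: orth_proj_fixes[OF V y] orth_proj_fixes[OF V z] bounded_clinear_diff[OF PV] bounded_clinear_diff[OF PW])
    then have "cinner (y - z) (orth_proj V (orth_proj W (y - z))) = 0" by simp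
    then have "cinner (y - z) (orth_proj W (y - z)) = 0"
      by (simp only: orth_proj_fixes[OF V yz] flip: cinner_orth_proj[OF V])
    then have "cinner (orth_proj W (y - z)) (orth_proj W (y - z)) = 0"
      by (simp only: cinner_orth_proj[OF W] orth_proj_idem[OF W])
    then have "y - z \<in> orth W" using orth_proj_eq_0_iff[OF W] by simp
    then have "y - z \<in> V \<inter> orth W" using yz by (rule IntI[rotated])
    then show "y = z" unfolding oblique_imp_complementary(1)[OF V J] by simp
  qed
  \<comment> \<open>Splitting \<open>J x\<close> along the complementary pair yields
    \<open>z\<close> in \<open>V\<close> with P_W z = J x, and P_V J x = P_V x; so \<open>z\<close>
    is the required preimage.\<close>
  obtain z b where z: "z \<in> V" "b \<in> orth W" "J x = z + b"
    using oblique_imp_complementary(2)[OF V J] by blast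
  have PWz: "orth_proj W z = J x"
    by (rule orth_proj_eqI[OF W obliqueD(2)[OF J]])
       (use z complex_vector.subspace_neg[OF csubspace_orth z(2)] in simp)
  then have "?S z = orth_proj V x" by (simp add: orth_proj_fixes[OF V z(1)] oblique_orth_proj[OF J V])
  then have "inv_into V ?S (orth_proj V x) = z" using inv_into_f_f[OF inj z(1)] by simp
  then have "phi V W x = orth_proj (orth V) (orth_proj W (orth_proj V z))" by (simp add: phi_def)
  also have "\<dots> = J x - orth_proj V (J x)"
    by (simp add: orth_proj_fixes[OF V z(1)] PWz orth_proj_orth[OF V])
  finally show "phi V W x = (J - orth_proj V) x" by (simp add: oblique_orth_proj[OF J V])
qed

text \<open>Recovers the oblique projection from the chart value by adding a constant, so that
  smoothness of one is smoothness of the other.\<close>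

definition obl :: "'h::chilbert_space set \<Rightarrow> 'h set \<Rightarrow> 'h \<Rightarrow> 'h"
  where "obl V W = phi V W + orth_proj V"

locale polarized_space =
  fixes Hm Hp :: "'h::chilbert_space set"
  assumes pol: "polarized Hm Hp"
begin

abbreviation "Gr \<equiv> Gr1res Hm Hp"
abbreviation "\<Omega> \<equiv> Omega Hm Hp"
abbreviation "M V \<equiv> L1 V (orth V)"

lemma Gr_closed: "V \<in> Gr \<Longrightarrow> closed_csubspace V"
  by (simp add: Gr1res_def)

lemma trace_class_Gr_diff:
  assumes "V \<in> Gr" "W \<in> Gr"
  shows "trace_class (orth_proj V - orth_proj W)"
proof -
  have "trace_class ((orth_proj V - orth_proj Hp) - (orth_proj W - orth_proj Hp))"
    using assms by (intro trace_class_diff[of "_ - _"] trace_class_proj_diff_of_Gr1res[OF pol])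
  then show ?thesis by simp
qed

lemma Omega_Gr: "W \<in> \<Omega> V \<Longrightarrow> W \<in> Gr"
  by (simp add: Omega_def)

lemma oblique_obl:
  assumes V: "V \<in> Gr" and W: "W \<in> \<Omega> V"
  shows "oblique V W (obl V W)"
proof -
  note Vc = Gr_closed[OF V] and Wc = Gr_closed[OF Omega_Gr[OF W]]
  have K: "compact_op (orth_proj V - orth_proj W)"
    by (rule trace_class_imp_compact[OF trace_class_Gr_diff[OF V Omega_Gr[OF W]]])
  obtain J where "oblique V W J"
    by (rule oblique_exists[OF Vc Wc K]) (use W in \<open>auto simp: Omega_def\<close>)
  moreover from this have "obl V W = J" by (simp add: obl_def phi_eq_oblique[OF Vc Wc])
  ultimately show ?thesis by simp
qed

lemma Omega_of_oblique:
  assumes V: "V \<in> Gr" and W: "W \<in> Gr" and J: "oblique V W J"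
  shows "W \<in> \<Omega> V" "obl V W = J"
  using oblique_imp_complementary[OF Gr_closed[OF V] J] W
    phi_eq_oblique[OF Gr_closed[OF V] Gr_closed[OF W] J]
  by (auto simp: Omega_def obl_def)

text \<open>Since P_W J = J and P_V J = P_V, the chart value J - P_V equals (P_W - P_V) J, which
  contains a trace-class factor.\<close>

lemma phi_in_L1:
  assumes V: "V \<in> Gr" and W: "W \<in> \<Omega> V"
  shows "phi V W \<in> pts (M V)"
proof -
  note Vc = Gr_closed[OF V] and Wc = Gr_closed[OF Omega_Gr[OF W]] and J = oblique_obl[OF V W]
  have eq: "phi V W = obl V W - orth_proj V" by (simp add: obl_def)
  have x: "phi V W x = ((orth_proj W - orth_proj V) \<circ> (orth_proj W \<circ> obl V W)) x" for x
    unfolding eq by (simp add: orth_proj_fixes[OF Wc obliqueD(2)[OF J]] oblique_orth_proj[OF J Vc])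
  have "trace_class ((orth_proj W - orth_proj V) \<circ> (orth_proj W \<circ> obl V W))"
    by (intro trace_class_comp_right bounded_clinear_compose bounded_clinear_orth_proj Wc obliqueD(1)[OF J]
        trace_class_Gr_diff V Omega_Gr[OF W])
  moreover have "phi V W = (orth_proj W - orth_proj V) \<circ> (orth_proj W \<circ> obl V W)" by (rule ext) (rule x)
  ultimately have "trace_class (phi V W)" by (simp only:)
  moreover have "phi V W y = 0" if "y \<in> orth V" for y
    unfolding eq using obliqueD(5)[OF J that] orth_proj_eq_0_iff[OF Vc] that by simp
  moreover have "phi V W y \<in> orth V" for y
    using orth_proj_eq_0_iff[OF Vc, of "phi V W y"]
    unfolding eq by (simp add: bounded_clinear_diff[OF bounded_clinear_orth_proj[OF Vc]] oblique_orth_proj[OF J Vc] Vc)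
  ultimately show ?thesis by (simp add: L1_iff)
qed

text \<open>The graph of \<open>C\<close> is the range of the idempotent \<open>J = P\<^sub>V + C\<close>. The orthogonal projection \<open>P\<close>
  onto that range satisfies \<open>P - J = - P (J - J\<^sup>*)\<close>, so it differs from \<open>P\<^sub>V\<close> by a trace-class operator.\<close>

lemma graph_in_Omega:
  assumes V: "V \<in> Gr" and C: "C \<in> pts (M V)"
  shows "range (orth_proj V + C) \<in> \<Omega> V" "phi V (range (orth_proj V + C)) = C"
proof -
  note Vc = Gr_closed[OF V]
  note PV = bounded_clinear_orth_proj[OF Vc]
  have Ct: "trace_class C" and C0: "\<And>x. x \<in> orth V \<Longrightarrow> C x = 0" and CV: "\<And>x. C x \<in> orth V"
    using C by (auto simp: L1_iff)
  note Cb = trace_class_bounded[OF Ct]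
  define J where "J = orth_proj V + C"
  have Jb: "bounded_clinear J" unfolding J_def by (intro bounded_clinear_add_fun(2) PV Cb)
  have PC: "orth_proj V (C x) = 0" for x using CV orth_proj_eq_0_iff[OF Vc] by blast
  have CP: "C (orth_proj V x) = C x" for x
  proof -
    have "C (x - orth_proj V x) = 0" by (rule C0[OF orth_proj_compl[OF Vc]])
    then show ?thesis by (simp add: bounded_clinear_diff[OF Cb])
  qed
  have JJ: "J (J x) = J x" for x
    by (simp add: J_def bounded_clinear_simps[OF PV] bounded_clinear_simps[OF Cb] PC CP C0[OF CV] Vc)
  let ?W = "range J"
  have W_eq: "?W = {x. J x = x}" using JJ by (auto simp: image_iff) metis
  have Wc: "closed_csubspace ?W" unfolding W_eq by (rule closed_fixpoints[OF Jb])
  note PW = bounded_clinear_orth_proj[OF Wc]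
  have obl: "oblique V ?W J"
    unfolding oblique_def
  proof (intro conjI allI ballI Jb)
    show "J x = x" if "x \<in> ?W" for x using that W_eq by blast
    show "x - J x \<in> orth V" for x
    proof -
      have "orth_proj V (x - J x) = 0" by (simp add: J_def bounded_clinear_simps[OF PV] PC Vc)
      then show ?thesis using orth_proj_eq_0_iff[OF Vc] by blast
    qed
    show "J x = 0" if "x \<in> orth V" for x
      using that orth_proj_eq_0_iff[OF Vc] by (simp add: J_def C0)
  qed simp
  have adjJ: "adj J = orth_proj V + adj C"
    by (rule adj_eqI) (simp add: J_def cinner_simps cinner_orth_proj[OF Vc] cinner_adj[OF Cb])
  have "orth_proj ?W - J = - (orth_proj ?W \<circ> (C - adj C))"
  proof
    fix x
    have "orth_proj ?W (J x) = J x" by (rule orth_proj_fixes[OF Wc]) simp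
    \<comment> \<open>\<open>J\<close> fixes the range, so J P = P for the projection P onto it;
      taking adjoints gives the claim.\<close>
    moreover have "orth_proj ?W (adj J x) = orth_proj ?W x"
    proof (rule cinner_ext)
      fix z
      have "J (orth_proj ?W z) = orth_proj ?W z" using orth_proj_in[OF Wc, of z] W_eq by blast
      then have "cinner (J (orth_proj ?W z)) x = cinner z (orth_proj ?W x)" by (simp add: cinner_orth_proj[OF Wc])
      then show "cinner z (orth_proj ?W (adj J x)) = cinner z (orth_proj ?W x)"
        by (simp add: cinner_adj[OF Jb] flip: cinner_orth_proj[OF Wc])
    qed
    moreover have "(C - adj C) x = J x - adj J x" by (simp add: adjJ) (simp add: J_def)
    ultimately show "(orth_proj ?W - J) x = (- (orth_proj ?W \<circ> (C - adj C))) x"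
      by (simp add: bounded_clinear_diff[OF PW])
  qed
  then have "trace_class (orth_proj ?W - J)"
    by (simp only:) (intro trace_class_minus trace_class_comp_left PW trace_class_diff Ct trace_class_adj)
  then have "trace_class ((orth_proj ?W - J) + C + (orth_proj V - orth_proj Hp))"
    using V Gr1res_iff[OF pol] by (intro trace_class_add Ct) auto
  moreover have "(orth_proj ?W - J) + C + (orth_proj V - orth_proj Hp) = orth_proj ?W - orth_proj Hp"
    by (simp add: J_def fun_eq_iff)
  ultimately have WGr: "?W \<in> Gr" using Gr1res_iff[OF pol] Wc by simp
  show "range (orth_proj V + C) \<in> \<Omega> V" using Omega_of_oblique(1)[OF V WGr obl] by (simp add: J_def)
  show "phi V (range (orth_proj V + C)) = C"
    using phi_eq_oblique[OF Vc Wc obl] by (simp add: J_def)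
qed

lemma phi_image: "V \<in> Gr \<Longrightarrow> phi V ` \<Omega> V = pts (M V)"
  using phi_in_L1 graph_in_Omega by (auto simp: image_iff) metis

lemma range_obl:
  assumes "V \<in> Gr" "W \<in> \<Omega> V"
  shows "range (obl V W) = W"
  using obliqueD(2,3)[OF oblique_obl[OF assms]] by (auto simp: image_iff) metis

text \<open>The chart value determines the oblique projection, whose range is the point
  itself.\<close>

lemma inj_phi: "V \<in> Gr \<Longrightarrow> inj_on (phi V) (\<Omega> V)"
  by (rule inj_onI) (metis obl_def range_obl)

abbreviation "\<A> \<equiv> Gr_atlas Hm Hp"

abbreviation "graph V \<equiv> inv_chart \<A> V"

lemma graph_phi: "V \<in> Gr \<Longrightarrow> W \<in> \<Omega> V \<Longrightarrow> graph V (phi V W) = W"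
  by (simp add: inv_chart_def Gr_atlas_def inv_into_f_f inj_phi)

lemma self_in_Omega: "V \<in> Gr \<Longrightarrow> V \<in> \<Omega> V"
proof (rule Omega_of_oblique(1))
  assume V: "V \<in> Gr"
  note Vc = Gr_closed[OF V]
  show "oblique V V (orth_proj V)"
    unfolding oblique_def
    by (auto simp: bounded_clinear_orth_proj Vc orth_proj_in orth_proj_fixes orth_proj_compl orth_proj_eq_0_iff[OF Vc])
qed

lemma mcarrier_Gr: "mcarrier \<A> = Gr"
  using self_in_Omega Omega_Gr by (auto simp: mcarrier_def Gr_atlas_def)

text \<open>This identity contains both the differentiability of the chart changes and the formula for
  their derivative.\<close>

lemma oblique_difference:
  assumes J: "oblique V p J" and J': "oblique V p' J'" and Q: "oblique W p Q" and Q': "oblique W p' Q'"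
  shows "J' x - J x = (Q' - Q) (J' x) - J ((Q' - Q) (J' x))"
proof -
  note Jb = obliqueD(1)[OF J]
  have "J (x - J' x) = 0" by (rule obliqueD(5)[OF J obliqueD(4)[OF J']])
  then have "J (J' x) = J x" by (simp add: bounded_clinear_diff[OF Jb])
  moreover have "Q' (J' x) = J' x" by (rule obliqueD(3)[OF Q' obliqueD(2)[OF J']])
  moreover have "J (Q (J' x)) = Q (J' x)" by (rule obliqueD(3)[OF J obliqueD(2)[OF Q]])
  ultimately show ?thesis by (simp add: bounded_clinear_diff[OF Jb])
qed

text \<open>Only the target chart \<open>V\<close> and the point \<open>p\<close> enter; the source
  chart merely restricts the admissible \<open>K\<close>.\<close>

definition dchange :: "'h set \<Rightarrow> 'h set \<Rightarrow> ('h \<Rightarrow> 'h) \<Rightarrow> 'h \<Rightarrow> 'h"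
  where "dchange V p K = (id - obl V p) \<circ> K \<circ> obl V p"

lemma dchange_eq_sandwich:
  assumes V: "V \<in> Gr" and p: "p \<in> \<Omega> V"
  shows "dchange V p K = sandwich V (id - obl V p) K (obl V p)"
proof
  fix x
  note J = oblique_obl[OF V p] and Vc = Gr_closed[OF V]
  show "dchange V p K x = sandwich V (id - obl V p) K (obl V p) x"
    using orth_proj_fixes[OF closed_csubspace_orth obliqueD(4)[OF J]]
    by (simp add: dchange_def sandwich_def oblique_orth_proj[OF J Vc])
qed

lemma bounded_id_minus_obl:
  assumes "V \<in> Gr" "p \<in> \<Omega> V"
  shows "bounded_clinear (id - obl V p)"
  by (intro bounded_clinear_diff_fun(2) bounded_clinear_id(1) obliqueD(1)[OF oblique_obl[OF assms]])

lemma dchange_bcb: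
  assumes V: "V \<in> Gr" and p: "p \<in> \<Omega> V"
  shows "bounded_clinear_between (M W) (M V) (dchange V p)"
proof (rule bcbI)
  note Vc = Gr_closed[OF V] and R = bounded_id_minus_obl[OF V p] and X = obliqueD(1)[OF oblique_obl[OF V p]]
  note eq = dchange_eq_sandwich[OF V p]
  show "dchange V p K \<in> pts (M V)" if "K \<in> pts (M W)" for K
    unfolding eq by (rule trace_norm_sandwich_le(3)[OF Vc R L1_trace_class[OF that] X])
  show "dchange V p (K + K') = dchange V p K + dchange V p K'" for K K'
    unfolding eq by (rule sandwich_linear(3)[OF Vc R])
  show "dchange V p (c *\<^sub>C K) = c *\<^sub>C dchange V p K" for c K
    unfolding eq by (rule sandwich_linear(4)[OF Vc R])
  show "nrm (M V) (dchange V p K) \<le> (onorm (id - obl V p) * onorm (obl V p)) * nrm (M W) K" if "K \<in> pts (M W)" for K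
    unfolding eq nrm_L1 by (rule trace_norm_sandwich_le(4)[OF Vc R L1_trace_class[OF that] X])
qed

text \<open>On p one has J Q' = 1 + J K, where Q' = Q + K projects onto the new point p'. A Neumann
  inverse N of 1 + J K therefore gives the projection onto p' along \<open>orth V\<close> as Q' N
  J.\<close>

lemma overlap_nearby:
  assumes V: "V \<in> Gr" and W: "W \<in> Gr" and pV: "p \<in> \<Omega> V" and pW: "p \<in> \<Omega> W" and K: "K \<in> pts (M W)"
    and small: "onorm (obl V p) * trace_norm K < 1"
  obtains p' where "p' \<in> \<Omega> V" "p' \<in> \<Omega> W" "phi W p' = phi W p + K"
proof -
  note J = oblique_obl[OF V pV] and Q = oblique_obl[OF W pW] and Vc = Gr_closed[OF V]
  define J where "J = obl V p"
  define Q where "Q = obl W p"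
  note J = J[folded J_def] and Q = Q[folded Q_def]
  note Jb = obliqueD(1)[OF J] and Qb = obliqueD(1)[OF Q]
  have Kt: "trace_class K" by (rule L1_trace_class[OF K])
  note Kb = trace_class_bounded[OF Kt]
  have "phi W p + K \<in> pts (M W)" by (rule cn_add[OF cnormed_L1[OF closed_csubspace_orth] phi_in_L1[OF W pW] K])
  then obtain p' where p': "p' \<in> \<Omega> W" "phi W p' = phi W p + K" using phi_image[OF W] by (metis imageE)
  define Q' where "Q' = obl W p'"
  have Q': "oblique W p' Q'" unfolding Q'_def by (rule oblique_obl[OF W p'(1)])
  note Q'b = obliqueD(1)[OF Q']
  have Q'eq: "Q' x = Q x + K x" for x by (simp add: Q'_def Q_def obl_def p'(2))
  have p'Gr: "p' \<in> Gr" by (rule Omega_Gr[OF p'(1)])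
  have JKb: "bounded_clinear (J \<circ> K)" by (rule bounded_clinear_compose[OF Jb Kb])
  have JKle: "norm ((J \<circ> K) x) \<le> (onorm J * trace_norm K) * norm x" for x
  proof -
    have "norm (J (K x)) \<le> onorm J * norm (K x)" by (rule bounded_clinear_norm[OF Jb])
    also have "\<dots> \<le> onorm J * (trace_norm K * norm x)"
      by (intro mult_left_mono norm_le_trace_norm Kt onorm_nonneg Jb)
    finally show ?thesis by (simp add: mult.assoc)
  qed
  obtain N where Nb: "bounded_clinear N" and N1: "\<And>x. N x + (J \<circ> K) (N x) = x" and N2: "\<And>x. N (x + (J \<circ> K) x) = x"
    by (rule neumann_inverse[OF JKb small[folded J_def] JKle]) blast
  define J' where "J' = Q' \<circ> (N \<circ> J)"
  have J'b: "bounded_clinear J'" unfolding J'_def by (intro bounded_clinear_compose Q'b Nb Jb)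
  \<comment> \<open>\<open>N\<close> preserves \<open>p\<close>, by its defining equation and
    because \<open>J\<close> maps into \<open>p\<close>; only on \<open>p\<close> is the formula for
    J Q' available.\<close>
  have NJp: "N (J x) \<in> p" for x
  proof -
    have "N (J x) = J x - J (K (N (J x)))" using N1[of "J x"] by (simp add: eq_diff_eq)
    then show ?thesis
      using complex_vector.subspace_diff[OF closed_csubspaceD(1)[OF Gr_closed[OF Omega_Gr[OF pV]]] obliqueD(2)[OF J] obliqueD(2)[OF J]]
      by metis
  qed
  have JQ': "J (Q' u) = u + J (K u)" if "u \<in> p" for u
    using that by (simp add: Q'eq bounded_clinear_add[OF Jb] obliqueD(3)[OF Q] obliqueD(3)[OF J])
  have JJ': "J (J' x) = J x" for x
    using JQ'[OF NJp, of x] N1[of "J x"] by (simp add: J'_def)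
  \<comment> \<open>Every z in p' is Q' u with u = Q z in p, since Q' kills z - Q z.\<close>
  have fix': "J' z = z" if z: "z \<in> p'" for z
  proof -
    define u where "u = Q z"
    have u: "u \<in> p" unfolding u_def by (rule obliqueD(2)[OF Q])
    have "z - Q z \<in> orth W" by (rule obliqueD(4)[OF Q])
    then have "Q' (z - Q z) = 0" by (rule obliqueD(5)[OF Q'])
    then have zu: "z = Q' u" using obliqueD(3)[OF Q' z] by (simp add: u_def bounded_clinear_diff[OF Q'b])
    have "N (J z) = u" unfolding zu JQ'[OF u] using N2[of u] by simp
    then show ?thesis by (simp add: J'_def zu)
  qed
  have "oblique V p' J'"
    unfolding oblique_def
  proof (intro conjI allI ballI J'b fix')
    show in': "J' x \<in> p'" for x by (simp add: J'_def obliqueD(2)[OF Q'])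
    show "J' x = 0" if "x \<in> orth V" for x
      by (simp add: J'_def obliqueD(5)[OF J that] bounded_clinear_zero Nb Q'b)
    show "x - J' x \<in> orth V" for x
    proof -
      have "orth_proj V (x - J' x) = orth_proj V (J (x - J' x))" by (simp add: oblique_orth_proj[OF J Vc])
      also have "J (x - J' x) = 0" by (simp add: bounded_clinear_diff[OF Jb] JJ')
      finally show ?thesis
        by (simp add: orth_proj_eq_0_iff[OF Vc] bounded_clinear_zero[OF bounded_clinear_orth_proj[OF Vc]])
    qed
  qed
  then have "p' \<in> \<Omega> V" by (rule Omega_of_oblique(1)[OF V p'Gr])
  then show thesis using that p' by blast
qed

lemma cnormed_M: "cnormed_space (M V)"
  by (rule cnormed_L1) simp

lemma overlap_ball:
  assumes V: "V \<in> Gr" and W: "W \<in> Gr" and p: "p \<in> \<Omega> W \<inter> \<Omega> V"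
  obtains d where "0 < d"
    "\<And>K. K \<in> pts (M W) \<Longrightarrow> trace_norm K < d \<Longrightarrow> phi W p + K \<in> phi W ` (\<Omega> W \<inter> \<Omega> V)"
proof (rule that[of "1 / (onorm (obl V p) + 1)"])
  have o: "0 \<le> onorm (obl V p)" by (rule onorm_nonneg[OF obliqueD(1)[OF oblique_obl[OF V]]]) (use p in blast)
  then show "0 < 1 / (onorm (obl V p) + 1)" by simp
  fix K assume K: "K \<in> pts (M W)" "trace_norm K < 1 / (onorm (obl V p) + 1)"
  have "onorm (obl V p) * trace_norm K \<le> (onorm (obl V p) + 1) * trace_norm K"
    using trace_norm_nonneg[OF L1_trace_class[OF K(1)]] by (simp add: distrib_right)
  also have "\<dots> < 1" using K(2) o by (simp add: field_simps)
  finally obtain p' where "p' \<in> \<Omega> V" "p' \<in> \<Omega> W" "phi W p' = phi W p + K"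
    using overlap_nearby[OF V W _ _ K(1)] p by (metis IntD1 IntD2)
  then show "phi W p + K \<in> phi W ` (\<Omega> W \<inter> \<Omega> V)" by (metis IntI imageI)
qed

lemma open_overlap:
  assumes V: "V \<in> Gr" and W: "W \<in> Gr"
  shows "open_in (M W) (phi W ` (\<Omega> W \<inter> \<Omega> V))"
  unfolding open_in_def
proof (intro conjI ballI)
  show sub: "phi W ` (\<Omega> W \<inter> \<Omega> V) \<subseteq> pts (M W)" using phi_in_L1[OF W] by auto
  fix x assume x: "x \<in> phi W ` (\<Omega> W \<inter> \<Omega> V)"
  then obtain p where p: "p \<in> \<Omega> W \<inter> \<Omega> V" and xp: "x = phi W p" by blast
  obtain d where d: "0 < d" "\<And>K. K \<in> pts (M W) \<Longrightarrow> trace_norm K < d \<Longrightarrow> phi W p + K \<in> phi W ` (\<Omega> W \<inter> \<Omega> V)"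
    by (rule overlap_ball[OF V W p]) blast
  have "y \<in> phi W ` (\<Omega> W \<inter> \<Omega> V)" if "y \<in> pts (M W)" "nrm (M W) (y - x) < d" for y
  proof -
    have "y - x \<in> pts (M W)" using that(1) x sub by (intro cn_diff cnormed_M) auto
    from d(2)[OF this] that(2) show ?thesis by (simp add: xp)
  qed
  then show "\<exists>d>0. \<forall>y\<in>pts (M W). nrm (M W) (y - x) < d \<longrightarrow> y \<in> phi W ` (\<Omega> W \<inter> \<Omega> V)" using d(1) by blast
qed

text \<open>For D = J' - J the difference identity reads D = (1 - J) K J', so the remainder D - (1 -
  J) K J equals (1 - J) K D. It is of second order once D is bounded by a multiple of the trace norm
  of K.\<close>

lemma chart_change_fderiv:
  assumes V: "V \<in> Gr" and W: "W \<in> Gr" and p: "p \<in> \<Omega> W \<inter> \<Omega> V"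
  shows "has_fderiv (M W) (M V) (\<lambda>x. phi V (graph W x)) (phi W p) (dchange V p)"
proof (rule has_fderivI)
  show "bounded_clinear_between (M W) (M V) (dchange V p)" by (rule dchange_bcb[OF V]) (use p in blast)
  have pV: "p \<in> \<Omega> V" and pW: "p \<in> \<Omega> W" using p by auto
  note J = oblique_obl[OF V pV] and Q = oblique_obl[OF W pW] and R = bounded_id_minus_obl[OF V pV]
  note Jb = obliqueD(1)[OF J]
  define a where "a = onorm (id - obl V p) + 1"
  define b where "b = onorm (obl V p) + 1"
  have a: "0 < a" "onorm (id - obl V p) \<le> a" using onorm_nonneg[OF R] by (simp_all add: a_def)
  have b: "0 < b" "onorm (obl V p) \<le> b" using onorm_nonneg[OF Jb] by (simp_all add: b_def)
  obtain d where d: "0 < d" "\<And>K. K \<in> pts (M W) \<Longrightarrow> trace_norm K < d \<Longrightarrow> phi W p + K \<in> phi W ` (\<Omega> W \<inter> \<Omega> V)"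
    by (rule overlap_ball[OF V W p]) blast
  fix e :: real assume e: "e > 0"
  \<comment> \<open>The entry with \<open>1 / (2 * a)\<close> lets half of the norm of D be absorbed
    below; the last one turns the resulting quadratic bound into \<open>e\<close> times the norm of
    K.\<close>
  define d' where "d' = min d (min (1 / (2 * a)) (e / (2 * a * a * b)))"
  have d': "0 < d'" using d(1) a b e by (simp add: d'_def)
  have "nrm (M V) (phi V (graph W (phi W p + K)) - phi V (graph W (phi W p)) - dchange V p K) \<le> e * nrm (M W) K"
    if K: "K \<in> pts (M W)" "nrm (M W) K < d'" for K
  proof -
    let ?k = "trace_norm K"
    have k: "?k < d" "?k < 1 / (2 * a)" "?k < e / (2 * a * a * b)" using K(2) by (auto simp: d'_def)
    note Kt = L1_trace_class[OF K(1)]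
    have k0: "0 \<le> ?k" by (rule trace_norm_nonneg[OF Kt])
    obtain p' where p': "p' \<in> \<Omega> W" "p' \<in> \<Omega> V" "phi W p' = phi W p + K" using d(2)[OF K(1) k(1)] by auto
    note J' = oblique_obl[OF V p'(2)] and Q' = oblique_obl[OF W p'(1)]
    note J'b = obliqueD(1)[OF J']
    define D where "D = obl V p' - obl V p"
    have Db: "bounded_clinear D" unfolding D_def by (rule bounded_clinear_diff_fun(2)[OF J'b Jb])
    have KQ: "obl W p' - obl W p = K" using p'(3) by (simp add: obl_def)
    have D_eq: "D = (id - obl V p) \<circ> K \<circ> obl V p'"
      using oblique_difference[OF J J' Q Q'] unfolding KQ by (simp add: D_def fun_eq_iff)
    have rem: "D - dchange V p K = (id - obl V p) \<circ> K \<circ> D"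
    proof
      fix x
      have Dx: "D x = K (obl V p' x) - obl V p (K (obl V p' x))" unfolding D_eq by simp
      have KD: "K (D x) = K (obl V p' x) - K (obl V p x)"
        by (simp add: D_def bounded_clinear_diff[OF trace_class_bounded[OF Kt]])
      have "((id - obl V p) \<circ> K \<circ> D) x = K (D x) - obl V p (K (D x))" by simp
      also have "\<dots> = D x - (K (obl V p x) - obl V p (K (obl V p x)))"
        unfolding KD bounded_clinear_diff[OF Jb] unfolding Dx by simp
      finally show "(D - dchange V p K) x = ((id - obl V p) \<circ> K \<circ> D) x" by (simp add: dchange_def)
    qed
    have "onorm D \<le> 2 * a * ?k * b"
    proof -
      note Gen = trace_norm_sandwich_le(1,2)[OF Gr_closed[OF V] R Kt J'b]
      have "onorm D \<le> trace_norm D" unfolding D_eq by (rule onorm_le_trace_norm[OF Gen(1)])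
      also have "\<dots> \<le> onorm (id - obl V p) * onorm (obl V p') * ?k" unfolding D_eq by (rule Gen(2))
      also have "\<dots> \<le> a * (b + onorm D) * ?k"
      proof (intro mult_right_mono mult_mono a k0)
        have "obl V p' = obl V p + D" by (simp add: D_def)
        then show "onorm (obl V p') \<le> b + onorm D" using onorm_add_le[OF Jb Db] b(2) by simp
      qed (use a onorm_nonneg[OF J'b] in simp_all)
      also have "\<dots> = a * ?k * b + (a * ?k) * onorm D" by (simp add: algebra_simps)
      \<comment> \<open>The bound on D involves J' = J + D and hence D itself; that share is at most
        one half and moves to the left side.\<close>
      also have "\<dots> \<le> a * ?k * b + (1 / 2) * onorm D"
      proof (intro add_left_mono mult_right_mono onorm_nonneg[OF Db])
        show "a * ?k \<le> 1 / 2" using k(2) a(1) by (simp add: field_simps)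
      qed
      finally show ?thesis by simp
    qed
    note Gen = trace_norm_sandwich_le(1,2)[OF Gr_closed[OF V] R Kt Db]
    have "trace_norm (D - dchange V p K) \<le> onorm (id - obl V p) * onorm D * ?k" unfolding rem by (rule Gen(2))
    also have "\<dots> \<le> a * (2 * a * ?k * b) * ?k"
      by (intro mult_right_mono mult_mono a \<open>onorm D \<le> _\<close> onorm_nonneg[OF Db] k0) (use a in simp)
    also have "\<dots> = (2 * a * a * b * ?k) * ?k" by (simp add: algebra_simps)
    also have "\<dots> \<le> e * ?k"
    proof (rule mult_right_mono[OF _ k0])
      have "0 < 2 * a * a * b" using a b by simp
      then have "?k * (2 * a * a * b) \<le> e" using k(3) by (simp only: pos_less_divide_eq less_imp_le)
      then show "2 * a * a * b * ?k \<le> e" by (simp add: mult.commute)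
    qed
    finally have "trace_norm (D - dchange V p K) \<le> e * ?k" .
    moreover have "phi V (graph W (phi W p + K)) - phi V (graph W (phi W p)) = D"
      unfolding p'(3)[symmetric] graph_phi[OF W p'(1)] graph_phi[OF W pW] by (simp add: D_def obl_def)
    ultimately show ?thesis by simp
  qed
  then show "\<exists>d>0. \<forall>K\<in>pts (M W). nrm (M W) K < d \<longrightarrow>
      nrm (M V) (phi V (graph W (phi W p + K)) - phi V (graph W (phi W p)) - dchange V p K) \<le> e * nrm (M W) K"
    using d' by blast
qed

lemma graph_overlap:
  assumes W: "W \<in> Gr" and x: "x \<in> phi W ` (\<Omega> W \<inter> \<Omega> V)"
  shows "graph W x \<in> \<Omega> W \<inter> \<Omega> V" "phi W (graph W x) = x"
  using x graph_phi[OF W] by auto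

lemma diff_times_obl:
  assumes V: "V \<in> Gr" and W: "W \<in> Gr" and S: "open_in (M W) S" "S \<subseteq> phi W ` (\<Omega> W \<inter> \<Omega> V)"
    and phi: "diff_times k (M W) (M V) S (\<lambda>x. phi V (graph W x))"
  shows "diff_times k (M W) bounded_ops S (\<lambda>x. obl V (graph W x))"
    "diff_times k (M W) bounded_ops S (\<lambda>x. id - obl V (graph W x))"
proof -
  note PV = bounded_clinear_orth_proj[OF Gr_closed[OF V]]
  have incl: "diff_times k (M W) bounded_ops S (\<lambda>x. phi V (graph W x))"
    by (rule diff_times_linear_comp[OF cnormed_M cnormed_M S(1) bcb_L1_bounded_ops phi])
  have const: "diff_times k (M W) bounded_ops S (\<lambda>x. T)" if "bounded_clinear T" for T
    by (rule diff_times_const[OF cnormed_M cnormed_bounded_ops]) (simp add: that)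
  show obl: "diff_times k (M W) bounded_ops S (\<lambda>x. obl V (graph W x))"
    unfolding obl_def
    by (rule diff_times_add[OF cnormed_M cnormed_bounded_ops S(1) incl const[OF PV]])
  have neg: "bounded_clinear_between bounded_ops bounded_ops (\<lambda>T. (-1) *\<^sub>C T)"
    by (rule bcbI[where K=1]) (simp_all only: bounded_ops_simps bounded_clinear_scaleC_fun scaleC_add_right
        scaleC_scaleC mult.commute onorm_scaleC_le[of _ "-1", simplified norm_minus_cancel norm_one])
  have "diff_times k (M W) bounded_ops S (\<lambda>x. id + (-1) *\<^sub>C obl V (graph W x))"
    by (rule diff_times_add[OF cnormed_M cnormed_bounded_ops S(1) const[OF bounded_clinear_id(1)]
          diff_times_linear_comp[OF cnormed_M cnormed_bounded_ops S(1) neg obl]])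
  then show "diff_times k (M W) bounded_ops S (\<lambda>x. id - obl V (graph W x))" by (simp add: scaleC_minus1)
qed

text \<open>Order \<open>k\<close> of the chart change gives order \<open>k\<close> of the oblique
  projection, hence of the derivative in a fixed direction, which is order \<open>k + 1\<close> of
  the chart change. An open part \<open>S\<close> of the overlap is allowed because bundle
  transitions are read in a third chart.\<close>

lemma diff_times_chart_change:
  assumes V: "V \<in> Gr" and W: "W \<in> Gr" and S: "open_in (M W) S" "S \<subseteq> phi W ` (\<Omega> W \<inter> \<Omega> V)"
  shows "diff_times k (M W) (M V) S (\<lambda>x. phi V (graph W x))"
proof (induction k)
  have img: "(\<lambda>x. phi V (graph W x)) ` S \<subseteq> pts (M V)" using graph_overlap(1)[OF W] S(2) phi_in_L1[OF V] by blast
  have der: "has_fderiv (M W) (M V) (\<lambda>x. phi V (graph W x)) x (dchange V (graph W x))" if "x \<in> S" for x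
  proof -
    note x = subsetD[OF S(2) that]
    from chart_change_fderiv[OF V W graph_overlap(1)[OF W x]] show ?thesis unfolding graph_overlap(2)[OF W x] .
  qed
  {
    case 0
    show ?case by (rule diff_times_0_of_fderiv[OF cnormed_M cnormed_M S(1) img der])
  next
    case (Suc k)
    show ?case
    proof (rule diff_times_SucI[OF img der])
      fix K assume "K \<in> pts (M W)"
      then have Kt: "trace_class K" by (rule L1_trace_class)
      have "diff_times k (M W) (M V) S (\<lambda>x. sandwich V (id - obl V (graph W x)) K (obl V (graph W x)))"
        by (rule diff_times_bilinear[OF cnormed_M cnormed_bounded_ops cnormed_bounded_ops cnormed_M S(1)
              bounded_cbilinear_sandwich[OF Gr_closed[OF V] Kt] diff_times_obl(2)[OF V W S Suc] diff_times_obl(1)[OF V W S Suc]])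
      then show "diff_times k (M W) (M V) S (\<lambda>x. dchange V (graph W x) K)"
      proof (rule diff_times_cong[OF cnormed_M S(1), rotated])
        show "sandwich V (id - obl V (graph W x)) K (obl V (graph W x)) = dchange V (graph W x) K" if "x \<in> S" for x
          by (rule dchange_eq_sandwich[OF V, symmetric], rule IntD2[OF graph_overlap(1)[OF W subsetD[OF S(2) that]]])
      qed
    qed
  }
qed

lemma atlas_simps [simp]:
  "index \<A> = Gr" "chart_dom \<A> = \<Omega>" "chart \<A> = phi" "model \<A> V = M V"
  by (simp_all add: Gr_atlas_def)

lemma banach_manifold_Gr: "banach_manifold \<A>"
  unfolding banach_manifold_def atlas_simps smooth_map_def
proof (intro conjI ballI allI)
  fix V assume V: "V \<in> Gr"
  show "cbanach_space (M V)" by (rule cbanach_L1) simp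
  show "inj_on (phi V) (\<Omega> V)" by (rule inj_phi[OF V])
  show "open_in (M V) (phi V ` \<Omega> V)" using open_overlap[OF V V] by simp
  fix W assume W: "W \<in> Gr"
  show op: "open_in (M V) (phi V ` (\<Omega> V \<inter> \<Omega> W))" by (rule open_overlap[OF W V])
  show "diff_times k (M V) (M W) (phi V ` (\<Omega> V \<inter> \<Omega> W)) (phi W \<circ> graph V)" for k
    using diff_times_chart_change[OF W V op order_refl] by (simp add: o_def)
qed

end

section \<open>Trace duality between compact and trace-class operators\<close>

lemma L0_iff:
  assumes "closed_csubspace V"
  shows "\<mu> \<in> L0 (orth V) V \<longleftrightarrow> compact_op \<mu> \<and> (\<forall>x\<in>V. \<mu> x = 0) \<and> (\<forall>x. \<mu> x \<in> V)"
  using assms by (auto simp: L0_def ops_def compact_op_bounded)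

lemma L0_compact: "\<mu> \<in> L0 X Y \<Longrightarrow> compact_op \<mu>" and L0_bounded: "\<mu> \<in> L0 X Y \<Longrightarrow> bounded_clinear \<mu>"
  by (auto simp: L0_def compact_op_bounded)

lemma L0_add:
  assumes V: "closed_csubspace V" and "\<mu> \<in> L0 (orth V) V" "\<nu> \<in> L0 (orth V) V"
  shows "\<mu> + \<nu> \<in> L0 (orth V) V"
  using assms complex_vector.subspace_add[OF closed_csubspaceD(1)[OF V]] compact_op_add[of \<mu> \<nu>]
  unfolding L0_iff[OF V] by simp

lemma L0_scaleC:
  assumes V: "closed_csubspace V" and "\<mu> \<in> L0 (orth V) V"
  shows "c *\<^sub>C \<mu> \<in> L0 (orth V) V"
  using assms(2) complex_vector.subspace_scale[OF closed_csubspaceD(1)[OF V]] compact_op_scaleC[of \<mu> c]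
  unfolding L0_iff[OF V] by (auto simp: scaleC_fun_def)

lemma L0_zero:
  assumes V: "closed_csubspace V"
  shows "0 \<in> L0 (orth V) V"
  unfolding L0_iff[OF V] using compact_op_zero complex_vector.subspace_0[OF closed_csubspaceD(1)[OF V]] by simp

lemma L0_rank1:
  assumes V: "closed_csubspace V" and "a \<in> V" "b \<in> orth V"
  shows "rank1 a b \<in> L0 (orth V) V"
proof -
  have "cinner b x = 0" if "x \<in> V" for x
    using assms(3) that cinner_eq_0_commute by (auto simp: orth_def)
  then show ?thesis
    unfolding L0_iff[OF V] using compact_op_rank1 assms(2) complex_vector.subspace_scale[OF closed_csubspaceD(1)[OF V]]
    by (simp add: rank1_def[of a b])
qed

lemma L0_rank1_sum:
  assumes V: "closed_csubspace V" and "\<And>i. i \<in> J \<Longrightarrow> a i \<in> V" "\<And>i. i \<in> J \<Longrightarrow> b i \<in> orth V"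
  shows "rank1_sum J a b \<in> L0 (orth V) V"
  using assms(2,3) unfolding rank1_sum_def
proof (induction J rule: infinite_finite_induct)
  case (insert i J)
  then show ?case unfolding sum.insert[OF insert.hyps] by (intro L0_add V L0_rank1) auto
next
  case (infinite J)
  show ?case unfolding sum.infinite[OF infinite(1)] by (rule L0_zero[OF V])
next
  case empty
  show ?case unfolding sum.empty by (rule L0_zero[OF V])
qed

lemma op_trace_rank1_comp: "bounded_clinear T \<Longrightarrow> op_trace (rank1 a b \<circ> T) = cinner b (T a)"
  by (simp add: rank1_comp op_trace_rank1 cinner_adj')

lemma op_trace_rank1_sum_comp:
  assumes T: "bounded_clinear T"
  shows "op_trace (rank1_sum J a b \<circ> T) = (\<Sum>i\<in>J. cinner (b i) (T (a i)))"
proof -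
  have "rank1_sum J a b \<circ> T = (\<Sum>i\<in>J. rank1 (a i) (adj T (b i)))"
    by (rule ext) (simp add: rank1_sum_def sum_fun_apply flip: rank1_comp[OF T])
  then show ?thesis by (simp add: op_trace_sum trace_class_rank1 op_trace_rank1 cinner_adj'[OF T])
qed

lemma L1_rank1:
  assumes "a \<in> orth V" "b \<in> V"
  shows "rank1 a b \<in> pts (L1 V (orth V))"
proof -
  have "cinner b x = 0" if "x \<in> orth V" for x using that assms(2) by (simp add: orth_def)
  then show ?thesis
    unfolding L1_iff using trace_class_rank1 complex_vector.subspace_scale[OF csubspace_orth assms(1)]
    by (simp add: rank1_def[of a b])
qed

lemma L1_orth_proj:
  assumes V: "closed_csubspace V" and K: "K \<in> pts (L1 V (orth V))"
  shows "orth_proj (orth V) \<circ> K = K" "K \<circ> orth_proj V = K" "orth_proj (orth V) \<circ> K \<circ> orth_proj V = K"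
proof -
  note Kb = trace_class_bounded[OF L1_trace_class[OF K]]
  show 1: "orth_proj (orth V) \<circ> K = K"
    using K by (simp add: fun_eq_iff L1_iff orth_proj_fixes)
  show 2: "K \<circ> orth_proj V = K"
  proof
    fix x
    have "K (x - orth_proj V x) = 0" using K orth_proj_compl[OF V] by (simp add: L1_iff)
    then show "(K \<circ> orth_proj V) x = K x" by (simp add: bounded_clinear_diff[OF Kb])
  qed
  show "orth_proj (orth V) \<circ> K \<circ> orth_proj V = K" by (simp add: 1 2)
qed

text \<open>Rank-one operators already separate: for \<open>y\<close> in \<open>V\<close>, testing
  with \<open>rank1 y (T y)\<close> returns the squared norm of \<open>T y\<close>.\<close>

lemma L1_eq_0:
  assumes V: "closed_csubspace V" and T: "T \<in> pts (L1 V (orth V))"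
    and tr: "\<And>\<mu>. \<mu> \<in> L0 (orth V) V \<Longrightarrow> op_trace (\<mu> \<circ> T) = 0"
  shows "T = 0"
proof
  fix x
  note Tb = trace_class_bounded[OF L1_trace_class[OF T]]
  let ?y = "orth_proj V x"
  have "T ?y \<in> orth V" using T by (simp add: L1_iff)
  then have "op_trace (rank1 ?y (T ?y) \<circ> T) = 0" by (intro tr L0_rank1 V orth_proj_in)
  then have "T ?y = 0" by (simp add: op_trace_rank1_comp[OF Tb])
  then show "T x = 0 x" using L1_orth_proj(2)[OF V T] by (metis comp_apply zero_fun_apply)
qed

text \<open>On rank-one operators \<open>g\<close> is a bounded sesquilinear form, represented by a
  bounded \<open>T\<close>. Values of \<open>g\<close> on finite-rank operators bound the partial
  traces of A T, so \<open>T\<close> is of trace class; finite-rank approximation extends the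
  formula to all compact operators.\<close>

lemma trace_duality:
  fixes g :: "('h::chilbert_space \<Rightarrow> 'h) \<Rightarrow> complex"
  assumes V: "closed_csubspace V" and C: "0 \<le> C"
    and add: "\<And>\<mu> \<nu>. \<mu> \<in> L0 (orth V) V \<Longrightarrow> \<nu> \<in> L0 (orth V) V \<Longrightarrow> g (\<mu> + \<nu>) = g \<mu> + g \<nu>"
    and scale: "\<And>c \<mu>. \<mu> \<in> L0 (orth V) V \<Longrightarrow> g (c *\<^sub>C \<mu>) = c * g \<mu>"
    and bound: "\<And>\<mu>. \<mu> \<in> L0 (orth V) V \<Longrightarrow> cmod (g \<mu>) \<le> C * onorm \<mu>"
  obtains T where "T \<in> pts (L1 V (orth V))" "trace_norm T \<le> C" "\<And>\<mu>. \<mu> \<in> L0 (orth V) V \<Longrightarrow> g \<mu> = op_trace (\<mu> \<circ> T)"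
proof -
  let ?P = "orth_proj V" and ?Q = "orth_proj (orth V)"
  have Vo: "closed_csubspace (orth V)" by simp
  note Pb = bounded_clinear_orth_proj[OF V] and Qb = bounded_clinear_orth_proj[OF Vo]
  note Pl = bounded_clinear_simps[OF Pb] and Ql = bounded_clinear_simps[OF Qb]
  have r: "rank1 (?P x) (?Q y) \<in> L0 (orth V) V" for x y by (intro L0_rank1 V orth_proj_in Vo)
  have g0: "g 0 = 0" using scale[OF L0_zero[OF V], of 0] by simp
  define h where "h x y = g (rank1 (?P x) (?Q y))" for x y
  have h_add_l: "h (x + x') y = h x y + h x' y" for x x' y
  proof -
    have "rank1 (?P (x + x')) (?Q y) = rank1 (?P x) (?Q y) + rank1 (?P x') (?Q y)"
      by (simp add: fun_eq_iff rank1_def Pl scaleC_add_right)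
    then show ?thesis by (simp only: h_def add[OF r r])
  qed
  have h_scale_l: "h (c *\<^sub>C x) y = c * h x y" for c x y
  proof -
    have "rank1 (?P (c *\<^sub>C x)) (?Q y) = c *\<^sub>C rank1 (?P x) (?Q y)"
      by (simp add: fun_eq_iff rank1_def Pl scaleC_scaleC scaleC_fun_def mult.commute)
    then show ?thesis by (simp only: h_def scale[OF r])
  qed
  have h_add_r: "h x (y + y') = h x y + h x y'" for x y y'
  proof -
    have "rank1 (?P x) (?Q (y + y')) = rank1 (?P x) (?Q y) + rank1 (?P x) (?Q y')"
      by (simp add: fun_eq_iff rank1_def Ql cinner_add_left scaleC_add_left)
    then show ?thesis by (simp only: h_def add[OF r r])
  qed
  have h_scale_r: "h x (c *\<^sub>C y) = cnj c * h x y" for c x y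
  proof -
    have "rank1 (?P x) (?Q (c *\<^sub>C y)) = cnj c *\<^sub>C rank1 (?P x) (?Q y)"
      by (simp add: fun_eq_iff rank1_def Ql cinner_scaleC_left scaleC_scaleC scaleC_fun_def)
    then show ?thesis by (simp only: h_def scale[OF r])
  qed
  have h_bound: "cmod (h x y) \<le> (C * norm x) * norm y" for x y
  proof -
    have "onorm (rank1 (?P x) (?Q y)) \<le> norm x * norm y"
      by (rule order_trans[OF onorm_rank1_le]) (intro mult_mono norm_orth_proj_le V Vo norm_ge_zero)
    then show ?thesis
      using order_trans[OF bound[OF r] mult_left_mono[OF _ C], of x y "norm x * norm y"] by (simp add: h_def mult.assoc)
  qed
  \<comment> \<open>\<open>h\<close> is antilinear in its second argument, so its conjugate is the
    linear functional to be represented.\<close>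
  have "\<exists>z. \<forall>y. cnj (h x y) = cinner z y" for x
  proof -
    obtain z where "\<And>y. cnj (h x y) = cinner z y"
      by (rule riesz[of "\<lambda>y. cnj (h x y)" "C * norm x"]) (simp_all add: h_add_r h_scale_r h_bound)
    then show ?thesis by blast
  qed
  then obtain T where T0: "\<And>x y. cnj (h x y) = cinner (T x) y" by metis
  have T: "cinner y (T x) = h x y" for x y
  proof -
    have "cinner y (T x) = cnj (cinner (T x) y)" by (rule cinner_commute)
    then show ?thesis by (simp flip: T0)
  qed
  have Tb: "bounded_clinear T"
  proof (rule bounded_clinearI)
    show "T (x + y) = T x + T y" for x y by (rule cinner_ext) (simp add: T cinner_add_right h_add_l)
    show "T (c *\<^sub>C x) = c *\<^sub>C T x" for c x by (rule cinner_ext) (simp add: T cinner_scaleC_right h_scale_l)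
    show "norm (T x) \<le> C * norm x" for x
    proof -
      have "(norm (T x))\<^sup>2 = cmod (h x (T x))" by (metis T cinner_self_norm)
      also have "\<dots> \<le> (C * norm x) * norm (T x)" by (rule h_bound)
      finally have "norm (T x) * norm (T x) \<le> (C * norm x) * norm (T x)" by (simp add: power2_eq_square)
      then show ?thesis using C by (cases "norm (T x) = 0") (simp_all add: mult_le_cancel_right_pos)
    qed
  qed
  have T_V: "T x = T (?P x)" "?Q (T x) = T x" for x
    by (rule cinner_ext; simp add: T h_def V flip: cinner_orth_proj[OF Vo])+
  have T_orth: "T x \<in> orth V" for x using orth_proj_in[OF Vo, of "T x"] T_V(2) by simp
  have T_zero: "T x = 0" if "x \<in> orth V" for x
  proof -
    have "?P x = 0" using that orth_proj_eq_0_iff[OF V] by blast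
    then show ?thesis by (subst T_V(1)) (simp add: bounded_clinear_zero[OF Tb])
  qed
  \<comment> \<open>This is P_V P_J A P with P the projection onto \<open>orth V\<close> and P_J the
    coordinate projection: a finite-rank element of L0 of norm at most that of \<open>A\<close>,
    whose value under \<open>g\<close> is the partial sum in \<open>trace_bound\<close>.\<close>
  define F where "F J A = rank1_sum J ?P (\<lambda>e. ?Q (adj A e))" for J A
  have F_L0: "F J A \<in> L0 (orth V) V" for J A
    unfolding F_def by (intro L0_rank1_sum V orth_proj_in Vo)
  have g_sum: "g (rank1_sum J ?P (\<lambda>e. ?Q (b e))) = (\<Sum>e\<in>J. h e (b e))" if "finite J" for J :: "'h set" and b
    using that
  proof induction
    case empty
    show ?case unfolding rank1_sum_def sum.empty by (rule g0)
  next
    case (insert e J)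
    have "g (rank1 (?P e) (?Q (b e)) + rank1_sum J ?P (\<lambda>e. ?Q (b e))) = h e (b e) + (\<Sum>e\<in>J. h e (b e))"
      by (simp only: add[OF r L0_rank1_sum[OF V orth_proj_in[OF V] orth_proj_in[OF Vo]]] insert.IH h_def)
    then show ?case using insert.hyps by (simp only: rank1_sum_def sum.insert not_False_eq_True)
  qed
  have F_eq: "F J A = ?P \<circ> (coord_proj J \<circ> (A \<circ> ?Q))" if A: "bounded_clinear A" for J A
    by (rule ext) (simp add: F_def rank1_sum_def sum_fun_apply rank1_def coord_proj_def bounded_clinear_sum[OF Pb]
        Pl cinner_orth_proj[OF Vo] cinner_adj'[OF A])
  have gF: "g (F J A) = (\<Sum>e\<in>J. cinner e (A (T e)))" if A: "bounded_clinear A" and "finite J" for J A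
    unfolding F_def g_sum[OF \<open>finite J\<close>] by (simp add: cinner_adj'[OF A] flip: T)
  have F_norm: "onorm (F J A) \<le> onorm A" if A: "bounded_clinear A" and J: "finite J" "J \<subseteq> some_basis" for J A
  proof (rule onorm_bound[OF onorm_nonneg[OF A]])
    fix x
    have "norm (F J A x) \<le> norm (A (?Q x))"
      unfolding F_eq[OF A] comp_apply
      by (rule order_trans[OF norm_orth_proj_le[OF V] norm_coord_proj_le(1)[OF orthonormal_some_basis J]])
    also have "\<dots> \<le> onorm A * norm (?Q x)" by (rule bounded_clinear_norm[OF A])
    also have "\<dots> \<le> onorm A * norm x" by (intro mult_left_mono norm_orth_proj_le Vo onorm_nonneg A)
    finally show "norm (F J A x) \<le> onorm A * norm x" .
  qed
  have tb: "trace_bound T C"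
  proof (rule trace_boundI[OF Tb C])
    fix A :: "'h \<Rightarrow> 'h" and J :: "'h set" assume A: "bounded_clinear A" and J: "finite J" "J \<subseteq> some_basis"
    have "cmod (g (F J A)) \<le> C * onorm (F J A)" by (rule bound[OF F_L0])
    also have "\<dots> \<le> C * onorm A" by (rule mult_left_mono[OF F_norm[OF A J] C])
    finally show "cmod (\<Sum>e\<in>J. cinner e (A (T e))) \<le> C * onorm A" by (simp add: gF[OF A J(1)])
  qed
  note Ttc = trace_bound_imp(1)[OF tb]
  have tr: "g \<mu> = op_trace (\<mu> \<circ> T)" if \<mu>: "\<mu> \<in> L0 (orth V) V" for \<mu>
  proof -
    note mb = L0_bounded[OF \<mu>]
    have "cmod (g \<mu> - op_trace (\<mu> \<circ> T)) \<le> 0 + e" if e: "e > 0" for e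
    proof -
      have e': "0 < e / (2 * C + 1)" using e C by simp
      obtain J where J: "finite J" "J \<subseteq> some_basis"
        and approx: "\<And>x. norm (\<mu> x - coord_proj J (\<mu> x)) \<le> e / (2 * C + 1) * norm x"
        by (rule compact_op_coord_proj_approx[OF L0_compact[OF \<mu>] e']) blast
      let ?F = "F J \<mu>"
      have mQ: "\<mu> (?Q x) = \<mu> x" for x
      proof -
        have "\<mu> (?P x) = 0" using \<mu> orth_proj_in[OF V] unfolding L0_iff[OF V] by blast
        then show ?thesis by (simp add: orth_proj_orth[OF V] bounded_clinear_diff[OF mb])
      qed
      have mP: "?P (\<mu> x) = \<mu> x" for x using \<mu> orth_proj_fixes[OF V] unfolding L0_iff[OF V] by blast
      \<comment> \<open>The error of truncating \<mu> to the finite-rank \<open>?F\<close>, on which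
        the formula holds. Both \<open>g\<close> and the trace pairing are bounded by
        \<open>C\<close> times its norm.\<close>
      define D where "D = \<mu> + (-1) *\<^sub>C ?F"
      have D: "D \<in> L0 (orth V) V" unfolding D_def by (intro L0_add L0_scaleC V \<mu> F_L0)
      have Dx: "D x = ?P (\<mu> x - coord_proj J (\<mu> x))" for x
        by (simp add: D_def scaleC_fun_def scaleC_minus1 F_eq[OF mb] mQ Pl mP)
      have "onorm D \<le> e / (2 * C + 1)"
        by (rule onorm_bound) (use e' approx order_trans[OF norm_orth_proj_le[OF V] approx] in \<open>simp_all add: Dx\<close>)
      have "g D = g \<mu> - g ?F"
        unfolding D_def add[OF \<mu> L0_scaleC[OF V F_L0]] scale[OF F_L0] by simp
      moreover have "D \<circ> T = (\<mu> \<circ> T) - (?F \<circ> T)" by (simp add: fun_eq_iff D_def scaleC_fun_def scaleC_minus1)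
      then have "op_trace (D \<circ> T) = op_trace (\<mu> \<circ> T) - op_trace (?F \<circ> T)"
        by (simp add: op_trace_diff trace_class_comp_left mb L0_bounded[OF F_L0] Ttc)
      moreover have "op_trace (?F \<circ> T) = (\<Sum>e\<in>J. cinner (?Q (adj \<mu> e)) (T (?P e)))"
        unfolding F_def by (rule op_trace_rank1_sum_comp[OF Tb])
      then have "op_trace (?F \<circ> T) = g ?F"
        by (simp add: gF[OF mb J(1)] cinner_orth_proj[OF Vo] T_V(2) cinner_adj'[OF mb] flip: T_V(1))
      ultimately have eq: "g \<mu> - op_trace (\<mu> \<circ> T) = g D - op_trace (D \<circ> T)" by simp
      have "cmod (g D - op_trace (D \<circ> T)) \<le> C * onorm D + onorm D * C"
        by (rule order_trans[OF norm_triangle_ineq4 add_mono[OF bound[OF D]]])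
           (rule order_trans[OF cmod_op_trace_comp_le[OF L0_bounded[OF D] Ttc]],
            intro mult_left_mono trace_bound_imp(2)[OF tb] onorm_nonneg[OF L0_bounded[OF D]])
      also have "\<dots> = 2 * C * onorm D" by simp
      also have "\<dots> \<le> 2 * C * (e / (2 * C + 1))" using \<open>onorm D \<le> _\<close> C by (intro mult_left_mono) simp_all
      also have "\<dots> \<le> e" using e C by (simp add: field_simps)
      finally show ?thesis unfolding eq by simp
    qed
    then have "cmod (g \<mu> - op_trace (\<mu> \<circ> T)) \<le> 0" by (rule field_le_epsilon)
    then show ?thesis by simp
  qed
  have "T \<in> pts (L1 V (orth V))" unfolding L1_iff using Ttc T_zero T_orth by blast
  then show thesis using that trace_bound_imp(2)[OF tb] tr by blast
qed

definition tr_fun :: "'h::chilbert_space set \<Rightarrow> ('h \<Rightarrow> 'h) \<Rightarrow> ('h \<Rightarrow> 'h) \<Rightarrow> complex"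
  where "tr_fun V \<mu> = zero_off (pts (L1 V (orth V))) (\<lambda>K. op_trace (\<mu> \<circ> K))"

text \<open>The copy of the compact operators inside the dual of the model space; it becomes the
  fixed subspace of the local trivialization at \<open>V\<close>.\<close>

definition tr_funs :: "'h::chilbert_space set \<Rightarrow> (('h \<Rightarrow> 'h) \<Rightarrow> complex) set"
  where "tr_funs V = tr_fun V ` L0 (orth V) V"

lemma tr_fun_apply: "K \<in> pts (L1 V (orth V)) \<Longrightarrow> tr_fun V \<mu> K = op_trace (\<mu> \<circ> K)"
  by (simp add: tr_fun_def zero_off_def)

lemma tr_fun_bound:
  "bounded_clinear \<mu> \<Longrightarrow> K \<in> pts (L1 V (orth V)) \<Longrightarrow> cmod (tr_fun V \<mu> K) \<le> onorm \<mu> * trace_norm K"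
  by (simp add: tr_fun_apply cmod_op_trace_comp_le L1_trace_class)

lemma cnormed_model: "cnormed_space (L1 V (orth V))"
  by (rule cnormed_L1) simp

lemma tr_fun_dual:
  assumes "bounded_clinear \<mu>"
  shows "tr_fun V \<mu> \<in> pts (dual_space (L1 V (orth V)))"
proof (rule dual_spaceI)
  let ?E = "L1 V (orth V)"
  show "tr_fun V \<mu> (K + K') = tr_fun V \<mu> K + tr_fun V \<mu> K'" if K: "K \<in> pts ?E" and K': "K' \<in> pts ?E" for K K'
  proof -
    have "\<mu> \<circ> (K + K') = (\<mu> \<circ> K) + (\<mu> \<circ> K')" by (simp add: fun_eq_iff bounded_clinear_add[OF assms])
    then show ?thesis
      by (simp add: tr_fun_apply cn_add[OF cnormed_model] K K' op_trace_add trace_class_comp_left[OF assms] L1_trace_class[OF K] L1_trace_class[OF K'])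
  qed
  show "tr_fun V \<mu> (c *\<^sub>C K) = c * tr_fun V \<mu> K" if K: "K \<in> pts ?E" for c K
  proof -
    have "\<mu> \<circ> (c *\<^sub>C K) = c *\<^sub>C (\<mu> \<circ> K)" by (simp add: fun_eq_iff scaleC_fun_def bounded_clinear_scaleC[OF assms])
    then show ?thesis
      by (simp add: tr_fun_apply cn_scale[OF cnormed_model] K op_trace_scaleC trace_class_comp_left[OF assms] L1_trace_class[OF K])
  qed
  show "cmod (tr_fun V \<mu> K) \<le> onorm \<mu> * nrm ?E K" if "K \<in> pts ?E" for K
    using tr_fun_bound[OF assms that] by simp
  show "tr_fun V \<mu> K = 0" if "K \<notin> pts ?E" for K using that by (simp add: tr_fun_def zero_off_def)
qed

lemma tr_fun_add:
  assumes "bounded_clinear \<mu>" "bounded_clinear \<nu>"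
  shows "tr_fun V (\<mu> + \<nu>) = tr_fun V \<mu> + tr_fun V \<nu>"
proof
  fix K :: "'a \<Rightarrow> 'a"
  have "(\<mu> + \<nu>) \<circ> K = (\<mu> \<circ> K) + (\<nu> \<circ> K)" by (simp add: fun_eq_iff)
  then show "tr_fun V (\<mu> + \<nu>) K = (tr_fun V \<mu> + tr_fun V \<nu>) K"
    by (simp add: tr_fun_def zero_off_def op_trace_add trace_class_comp_left assms L1_trace_class)
qed

lemma tr_fun_scaleC:
  assumes "bounded_clinear \<mu>"
  shows "tr_fun V (c *\<^sub>C \<mu>) = c *\<^sub>C tr_fun V \<mu>"
proof
  fix K :: "'a \<Rightarrow> 'a"
  have eq: "(c *\<^sub>C \<mu>) \<circ> K = c *\<^sub>C (\<mu> \<circ> K)" by (simp add: fun_eq_iff scaleC_fun_def)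
  have "(c *\<^sub>C tr_fun V \<mu>) K = c * tr_fun V \<mu> K" by (simp add: scaleC_fun_def scaleC_complex_def)
  then show "tr_fun V (c *\<^sub>C \<mu>) K = (c *\<^sub>C tr_fun V \<mu>) K"
    unfolding tr_fun_def zero_off_def eq
    by (simp add: op_trace_scaleC trace_class_comp_left assms L1_trace_class)
qed

text \<open>The harder half of the isometry: pairing \<mu> with the rank-one operator built from the
  \<open>orth V\<close> component of \<open>x\<close> and from \<mu> x gives the squared norm of
  \<mu> x.\<close>

lemma onorm_le_tr_fun:
  assumes V: "closed_csubspace V" and \<mu>: "\<mu> \<in> L0 (orth V) V"
  shows "norm (\<mu> x) \<le> nrm (dual_space (L1 V (orth V))) (tr_fun V \<mu>) * norm x"
proof -
  let ?N = "nrm (dual_space (L1 V (orth V))) (tr_fun V \<mu>)" and ?x = "orth_proj (orth V) x"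
  note mb = L0_bounded[OF \<mu>] and D = tr_fun_dual[OF L0_bounded[OF \<mu>]]
  have N0: "0 \<le> ?N" by (rule nrm_nonneg[OF cnormed_dual_space[OF cnormed_model] D])
  have "\<mu> (orth_proj V x) = 0" using \<mu> orth_proj_in[OF V] unfolding L0_iff[OF V] by blast
  then have mx: "\<mu> ?x = \<mu> x" by (simp add: orth_proj_orth[OF V] bounded_clinear_diff[OF mb])
  have "\<mu> x \<in> V" using \<mu> unfolding L0_iff[OF V] by blast
  then have K: "rank1 ?x (\<mu> x) \<in> pts (L1 V (orth V))" by (intro L1_rank1 orth_proj_in) simp_all
  have "tr_fun V \<mu> (rank1 ?x (\<mu> x)) = cinner (\<mu> x) (\<mu> x)"
    by (simp add: tr_fun_apply[OF K] comp_rank1[OF mb] op_trace_rank1 mx)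
  then have "(norm (\<mu> x))\<^sup>2 \<le> ?N * trace_norm (rank1 ?x (\<mu> x))"
    using dual_bound[OF cnormed_model D K] by (simp add: cinner_self_norm)
  also have "\<dots> \<le> ?N * (norm x * norm (\<mu> x))"
  proof (rule mult_left_mono[OF order_trans[OF trace_norm_rank1_le mult_right_mono] N0])
    show "norm ?x \<le> norm x" by (rule norm_orth_proj_le) simp
  qed simp
  finally have "norm (\<mu> x) * norm (\<mu> x) \<le> norm (\<mu> x) * (?N * norm x)" by (simp add: power2_eq_square mult_ac)
  then show ?thesis using N0 by (cases "norm (\<mu> x) = 0") (simp_all add: mult_le_cancel_left_pos)
qed

lemma csubspace_tr_funs:
  assumes V: "closed_csubspace V"
  shows "csubspace (tr_funs V)"
  unfolding complex_vector.subspace_def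
proof (intro conjI ballI allI)
  have "tr_fun V 0 = 0" using tr_fun_scaleC[OF bounded_clinear_const_zero(2), of V 0] by simp
  then show "0 \<in> tr_funs V" unfolding tr_funs_def using L0_zero[OF V] by (metis imageI)
  show "x + y \<in> tr_funs V" if xy: "x \<in> tr_funs V" "y \<in> tr_funs V" for x y
  proof -
    obtain \<mu> \<nu> where m: "\<mu> \<in> L0 (orth V) V" "x = tr_fun V \<mu>" and n: "\<nu> \<in> L0 (orth V) V" "y = tr_fun V \<nu>"
      using xy unfolding tr_funs_def by blast
    have "x + y = tr_fun V (\<mu> + \<nu>)" by (simp add: m(2) n(2) tr_fun_add[OF L0_bounded[OF m(1)] L0_bounded[OF n(1)]])
    then show ?thesis unfolding tr_funs_def using L0_add[OF V m(1) n(1)] by blast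
  qed
  show "c *\<^sub>C x \<in> tr_funs V" if x: "x \<in> tr_funs V" for c x
  proof -
    obtain \<mu> where m: "\<mu> \<in> L0 (orth V) V" "x = tr_fun V \<mu>" using x unfolding tr_funs_def by blast
    have "c *\<^sub>C x = tr_fun V (c *\<^sub>C \<mu>)" by (simp add: m(2) tr_fun_scaleC[OF L0_bounded[OF m(1)]])
    then show ?thesis unfolding tr_funs_def using L0_scaleC[OF V m(1)] by blast
  qed
qed

text \<open>The trace pairing embeds the compact operators isometrically into the dual, and a uniform limit
  of compact operators is compact.\<close>

lemma closed_in_tr_funs:
  assumes V: "closed_csubspace V"
  shows "closed_in (dual_space (L1 V (orth V))) (tr_funs V)"
proof -
  let ?E = "L1 V (orth V)"
  let ?D = "dual_space ?E"
  have D: "cnormed_space ?D" by (rule cnormed_dual_space[OF cnormed_model])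
  have sub: "tr_funs V \<subseteq> pts ?D" unfolding tr_funs_def using tr_fun_dual L0_bounded by blast
  have lim: "f \<in> tr_funs V" if f: "f \<in> pts ?D" and near: "\<And>d. d > 0 \<Longrightarrow> \<exists>y\<in>tr_funs V. nrm ?D (y - f) < d" for f
  proof -
    have "\<exists>\<mu>. \<mu> \<in> L0 (orth V) V \<and> nrm ?D (tr_fun V \<mu> - f) < inverse (real (Suc n))" for n
      using near[of "inverse (real (Suc n))"] unfolding tr_funs_def by auto
    then obtain m where m: "\<And>n. m n \<in> L0 (orth V) V" "\<And>n. nrm ?D (tr_fun V (m n) - f) < inverse (real (Suc n))"
      by metis
    note mb = L0_bounded[OF m(1)]
    note md = tr_fun_dual[OF mb]
    \<comment> \<open>By the isometry, closeness of the functionals to \<open>f\<close> makes the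
      approximating compact operators Cauchy in operator norm.\<close>
    have diff: "norm (m k x - m l x) \<le> (inverse (real (Suc k)) + inverse (real (Suc l))) * norm x" for k l x
    proof -
      have eq: "m k - m l = m k + (-1) *\<^sub>C m l" by (simp add: scaleC_minus1)
      have L0: "m k - m l \<in> L0 (orth V) V" unfolding eq by (intro L0_add L0_scaleC V m)
      have "tr_fun V (m k - m l) = tr_fun V (m k) - tr_fun V (m l)"
        unfolding eq tr_fun_add[OF mb bounded_clinear_scaleC_fun(2)[OF mb]] tr_fun_scaleC[OF mb] by (simp add: scaleC_minus1)
      then have tr_diff: "tr_fun V (m k - m l) = (tr_fun V (m k) - f) - (tr_fun V (m l) - f)" by simp
      have "nrm ?D (tr_fun V (m k - m l)) \<le> nrm ?D (tr_fun V (m k) - f) + nrm ?D (tr_fun V (m l) - f)"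
        unfolding tr_diff by (intro nrm_triangle_diff D cn_diff md f)
      also have "\<dots> \<le> inverse (real (Suc k)) + inverse (real (Suc l))" by (intro add_mono less_imp_le m(2))
      finally have le: "nrm ?D (tr_fun V (m k - m l)) \<le> inverse (real (Suc k)) + inverse (real (Suc l))" .
      have "norm ((m k - m l) x) \<le> (inverse (real (Suc k)) + inverse (real (Suc l))) * norm x"
        by (rule order_trans[OF onorm_le_tr_fun[OF V L0] mult_right_mono[OF le norm_ge_zero]])
      then show ?thesis by simp
    qed
    have small: "\<exists>N. \<forall>n\<ge>N. inverse (real (Suc n)) < d" if "d > 0" for d
      using LIMSEQ_D[OF LIMSEQ_inverse_real_of_nat that] by simp
    have "\<exists>N. \<forall>k\<ge>N. \<forall>l\<ge>N. \<forall>x. norm (m k x - m l x) \<le> e * norm x" if e: "e > 0" for e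
    proof -
      have "e / 2 > 0" using e by simp
      from small[OF this] obtain N where N: "\<And>n. n \<ge> N \<Longrightarrow> inverse (real (Suc n)) < e / 2" by blast
      have "norm (m k x - m l x) \<le> e * norm x" if "k \<ge> N" "l \<ge> N" for k l x
      proof (rule order_trans[OF diff mult_right_mono])
        show "inverse (real (Suc k)) + inverse (real (Suc l)) \<le> e" using N[OF that(1)] N[OF that(2)] by linarith
      qed simp
      then show ?thesis by blast
    qed
    from bounded_clinear_limit[OF mb this] obtain \<mu> where \<mu>b: "bounded_clinear \<mu>" and \<mu>x: "\<And>x. (\<lambda>n. m n x) \<longlonglongrightarrow> \<mu> x"
      and unif: "\<And>e. e > 0 \<Longrightarrow> \<exists>N. \<forall>n\<ge>N. \<forall>x. norm (m n x - \<mu> x) \<le> e * norm x" by metis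
    have "compact_op \<mu>"
    proof (rule compact_op_approx[OF \<mu>b])
      fix e :: real assume "e > 0"
      from unif[OF this] obtain N where "\<And>x. norm (m N x - \<mu> x) \<le> e * norm x" by blast
      then show "\<exists>S. compact_op S \<and> (\<forall>x. norm (\<mu> x - S x) \<le> e * norm x)"
        using L0_compact[OF m(1)[of N]] by (intro exI[of _ "m N"]) (simp add: norm_minus_commute)
    qed
    moreover have "\<mu> x = 0" if "x \<in> V" for x
      using LIMSEQ_unique[OF \<mu>x[of x]] m(1) that unfolding L0_iff[OF V] by simp
    moreover have "\<mu> x \<in> V" for x
      by (rule closed_sequentially[OF closed_csubspaceD(2)[OF V] _ \<mu>x]) (use m(1) in \<open>simp add: L0_iff[OF V]\<close>)
    ultimately have \<mu>L0: "\<mu> \<in> L0 (orth V) V" unfolding L0_iff[OF V] by blast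
    have "f K = tr_fun V \<mu> K" for K
    proof (cases "K \<in> pts ?E")
      case True
      note Kt = L1_trace_class[OF True]
      have "cmod (f K - tr_fun V \<mu> K) \<le> 0 + e" if e: "e > 0" for e
      proof -
        let ?k = "trace_norm K"
        have k0: "0 \<le> ?k" by (rule trace_norm_nonneg[OF Kt])
        define e' where "e' = e / (2 * (?k + 1))"
        have e': "0 < e'" using e k0 by (simp add: e'_def)
        obtain N1 where N1: "\<And>n. n \<ge> N1 \<Longrightarrow> inverse (real (Suc n)) < e'" using small[OF e'] by blast
        obtain N2 where N2: "\<And>n x. n \<ge> N2 \<Longrightarrow> norm (m n x - \<mu> x) \<le> e' * norm x" using unif[OF e'] by blast
        define n where "n = max N1 N2"
        have "cmod ((tr_fun V (m n) - f) K) \<le> nrm ?D (tr_fun V (m n) - f) * ?k"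
          using dual_bound[OF cnormed_model cn_diff[OF D md f] True] by simp
        also have "\<dots> \<le> e' * ?k"
          using order_less_trans[OF m(2) N1, of n] k0 by (intro mult_right_mono) (simp_all add: n_def)
        finally have 1: "cmod (tr_fun V (m n) K - f K) \<le> e' * ?k" by simp
        have db: "bounded_clinear (m n - \<mu>)" by (intro bounded_clinear_diff_fun(2) mb \<mu>b)
        have "(m n - \<mu>) \<circ> K = (m n \<circ> K) - (\<mu> \<circ> K)" by (simp add: fun_eq_iff)
        then have "tr_fun V (m n) K - tr_fun V \<mu> K = op_trace ((m n - \<mu>) \<circ> K)"
          by (simp add: tr_fun_apply[OF True] op_trace_diff trace_class_comp_left mb \<mu>b Kt)
        also have "cmod \<dots> \<le> onorm (m n - \<mu>) * ?k" by (rule cmod_op_trace_comp_le[OF db Kt])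
        also have "\<dots> \<le> e' * ?k"
        proof (rule mult_right_mono[OF _ k0])
          show "onorm (m n - \<mu>) \<le> e'"
            by (rule onorm_bound) (use e' N2[of n] in \<open>simp_all add: n_def\<close>)
        qed
        finally have 2: "cmod (tr_fun V (m n) K - tr_fun V \<mu> K) \<le> e' * ?k" .
        have "cmod (f K - tr_fun V \<mu> K) \<le> cmod (tr_fun V (m n) K - tr_fun V \<mu> K) + cmod (tr_fun V (m n) K - f K)"
          using norm_triangle_ineq4[of "tr_fun V (m n) K - tr_fun V \<mu> K" "tr_fun V (m n) K - f K"] by simp
        also have "\<dots> \<le> 2 * e' * ?k" using 1 2 by simp
        also have "\<dots> \<le> e" using e k0 by (simp add: e'_def field_simps)
        finally show ?thesis by simp
      qed
      then have "cmod (f K - tr_fun V \<mu> K) \<le> 0" by (rule field_le_epsilon)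
      then show ?thesis by simp
    next
      case False
      then show ?thesis using dual_spaceD(3)[OF f False] by (simp add: tr_fun_def zero_off_def)
    qed
    then have "f = tr_fun V \<mu>" by (rule ext)
    then show ?thesis unfolding tr_funs_def using \<mu>L0 by blast
  qed
  show ?thesis
    unfolding closed_in_def open_in_def
  proof (intro conjI sub ballI)
    fix f assume f: "f \<in> pts ?D - tr_funs V"
    then obtain d where d: "d > 0" "\<And>y. y \<in> tr_funs V \<Longrightarrow> \<not> nrm ?D (y - f) < d" using lim[of f] by blast
    then show "\<exists>d>0. \<forall>y\<in>pts ?D. nrm ?D (y - f) < d \<longrightarrow> y \<in> pts ?D - tr_funs V" by blast
  qed blast
qed

section \<open>Tangent and cotangent spaces of the Grassmannian\<close>

lemma zero_off_in [simp]: "x \<in> S \<Longrightarrow> zero_off S f x = f x"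
  and zero_off_out [simp]: "x \<notin> S \<Longrightarrow> zero_off S f x = 0"
  by (simp_all add: zero_off_def)

text \<open>A norm bound on one preimage of each point is, given injectivity, exactly boundedness of
  the inverse.\<close>

lemma banach_isoI:
  assumes E: "cnormed_space E" and T: "bounded_clinear_between E F T" and inj: "inj_on T (pts E)"
    and surj: "\<And>y. y \<in> pts F \<Longrightarrow> \<exists>x\<in>pts E. T x = y \<and> nrm E x \<le> K * nrm F y"
  shows "banach_iso E F T"
proof -
  have img: "T ` pts E = pts F" using bcbD(1)[OF T] surj by blast
  define I where "I = inv_into (pts E) T"
  have I: "I y \<in> pts E" "T (I y) = y" if "y \<in> pts F" for y
    using that unfolding I_def img[symmetric] by (simp_all add: inv_into_into f_inv_into_f)
  have I_eq: "I (T x) = x" if "x \<in> pts E" for x unfolding I_def by (rule inv_into_f_f[OF inj that])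
  have "bounded_clinear_between F E I"
  proof (rule bcbI)
    show "I y \<in> pts E" if "y \<in> pts F" for y by (rule I(1)[OF that])
    show "I (x + y) = I x + I y" if "x \<in> pts F" "y \<in> pts F" for x y
      using I_eq[OF cn_add[OF E I(1)[OF that(1)] I(1)[OF that(2)]]]
      by (simp add: bcbD(2)[OF T I(1)[OF that(1)] I(1)[OF that(2)]] I(2) that)
    show "I (c *\<^sub>C y) = c *\<^sub>C I y" if "y \<in> pts F" for c y
      using I_eq[OF cn_scale[OF E I(1)[OF that]], of c] by (simp add: bcbD(3)[OF T I(1)[OF that]] I(2) that)
    show "nrm E (I y) \<le> K * nrm F y" if "y \<in> pts F" for y
      using surj[OF that] I_eq by auto
  qed
  then show ?thesis
    unfolding banach_iso_def bij_betw_def I_def using T inj img by blast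
qed

lemma cnormed_subspace_of:
  assumes E: "cnormed_space E" and Z: "csubspace Z" "Z \<subseteq> pts E"
  shows "cnormed_space (subspace_of E Z)"
  using assms nrm_nonneg[OF E] nrm_eq_0[OF E] nrm_triangle[OF E] nrm_scale[OF E]
  unfolding cnormed_space_def subspace_of_def by (simp add: subset_iff)

lemma open_in_Int:
  assumes A: "open_in E A" and B: "open_in E B"
  shows "open_in E (A \<inter> B)"
  unfolding open_in_def
proof (intro conjI ballI)
  show "A \<inter> B \<subseteq> pts E" using open_in_subset[OF A] by blast
  fix x assume x: "x \<in> A \<inter> B"
  obtain d1 where d1: "d1 > 0" "\<forall>y\<in>pts E. nrm E (y - x) < d1 \<longrightarrow> y \<in> A" using A x unfolding open_in_def by blast
  obtain d2 where d2: "d2 > 0" "\<forall>y\<in>pts E. nrm E (y - x) < d2 \<longrightarrow> y \<in> B" using B x unfolding open_in_def by blast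
  show "\<exists>d>0. \<forall>y\<in>pts E. nrm E (y - x) < d \<longrightarrow> y \<in> A \<inter> B"
    using d1 d2 by (intro exI[of _ "min d1 d2"]) simp
qed

context polarized_space
begin

abbreviation "TS p \<equiv> tangent_space \<A> p"

lemma chart_change_fderiv_unique:
  assumes "V \<in> Gr" "W \<in> Gr" "p \<in> \<Omega> W \<inter> \<Omega> V"
    and "has_fderiv (M W) (M V) (phi V \<circ> graph W) (phi W p) L" and "K \<in> pts (M W)"
  shows "L K = dchange V p K"
proof (rule has_fderiv_unique[OF cnormed_M cnormed_M open_overlap[OF assms(1,2)] _ _ assms(4) _ assms(5)])
  show "phi W p \<in> phi W ` (\<Omega> W \<inter> \<Omega> V)" using assms(3) by blast
  show "(phi V \<circ> graph W) ` phi W ` (\<Omega> W \<inter> \<Omega> V) \<subseteq> pts (M V)"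
    using graph_overlap(1)[OF assms(2)] phi_in_L1[OF assms(1)] by auto
  show "has_fderiv (M W) (M V) (phi V \<circ> graph W) (phi W p) (dchange V p)"
    using chart_change_fderiv[OF assms(1-3)] by (simp add: o_def)
qed

text \<open>Uniqueness of the derivative replaces the existentially quantified linear map in the
  definition of tangent vectors by the explicit formula.\<close>

lemma tangent_iff:
  "v \<in> TS p \<longleftrightarrow>
    (\<forall>i. \<not> (i \<in> Gr \<and> p \<in> \<Omega> i) \<longrightarrow> v i = 0) \<and> (\<forall>i\<in>Gr. p \<in> \<Omega> i \<longrightarrow> v i \<in> pts (M i)) \<and>
    (\<forall>i\<in>Gr. \<forall>j\<in>Gr. p \<in> \<Omega> i \<inter> \<Omega> j \<longrightarrow> v j = dchange j p (v i))"
proof -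
  have "(\<exists>L. has_fderiv (M i) (M j) (phi j \<circ> graph i) (phi i p) L \<and> v j = L (v i)) \<longleftrightarrow> v j = dchange j p (v i)"
    if i: "i \<in> Gr" and j: "j \<in> Gr" and p: "p \<in> \<Omega> i \<inter> \<Omega> j" and vi: "v i \<in> pts (M i)" for i j
  proof
    assume "\<exists>L. has_fderiv (M i) (M j) (phi j \<circ> graph i) (phi i p) L \<and> v j = L (v i)"
    then show "v j = dchange j p (v i)" using chart_change_fderiv_unique[OF j i p _ vi] by metis
  next
    assume "v j = dchange j p (v i)"
    moreover have "has_fderiv (M i) (M j) (phi j \<circ> graph i) (phi i p) (dchange j p)"
      using chart_change_fderiv[OF j i p] by (simp add: o_def)
    ultimately show "\<exists>L. has_fderiv (M i) (M j) (phi j \<circ> graph i) (phi i p) L \<and> v j = L (v i)" by blast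
  qed
  then show ?thesis unfolding tangent_space_def atlas_simps by blast
qed

lemma tangentD:
  assumes "v \<in> TS p" "i \<in> Gr" "p \<in> \<Omega> i"
  shows "v i \<in> pts (M i)" "j \<in> Gr \<Longrightarrow> p \<in> \<Omega> j \<Longrightarrow> v j = dchange j p (v i)"
  using assms unfolding tangent_iff by blast+

text \<open>Projections onto the same \<open>p\<close> along different complements satisfy \<open>J J' = J'\<close>, which is the
  cocycle condition for the derivatives of the chart changes.\<close>

lemma dchange_cocycle:
  assumes i: "i \<in> Gr" "p \<in> \<Omega> i" and j: "j \<in> Gr" "p \<in> \<Omega> j"
  shows "dchange j p (dchange i p K) = dchange j p K"
proof
  fix x
  note I = oblique_obl[OF i] and J = oblique_obl[OF j]
  have "obl i p (obl j p x) = obl j p x" by (rule obliqueD(3)[OF I obliqueD(2)[OF J]])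
  moreover have "obl j p (obl i p y) = obl i p y" for y by (rule obliqueD(3)[OF J obliqueD(2)[OF I]])
  ultimately show "dchange j p (dchange i p K) x = dchange j p K x"
    by (simp add: dchange_def bounded_clinear_diff[OF obliqueD(1)[OF J]])
qed

text \<open>For \<open>K\<close> in the model space at i, K J = K since \<open>K\<close> sees only
  the component in i, which J preserves; and J K = 0 since \<open>K\<close> maps into the kernel of
  J.\<close>

lemma dchange_self:
  assumes i: "i \<in> Gr" "p \<in> \<Omega> i" and K: "K \<in> pts (M i)"
  shows "dchange i p K = K"
proof
  fix x
  note I = oblique_obl[OF i] and Vc = Gr_closed[OF i(1)] and Kb = trace_class_bounded[OF L1_trace_class[OF K]]
  have Kx: "K y = K (orth_proj i y)" for y using L1_orth_proj(2)[OF Vc K] by (metis comp_apply)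
  have "K (obl i p x) = K x" by (subst (1 2) Kx) (simp add: oblique_orth_proj[OF I Vc])
  moreover have "obl i p (K x) = 0" using K by (intro obliqueD(5)[OF I]) (simp add: L1_iff)
  ultimately show "dchange i p K x = K x" by (simp add: dchange_def)
qed

lemma tangent_exists:
  assumes i: "i \<in> Gr" "p \<in> \<Omega> i" and K: "K \<in> pts (M i)"
  obtains v where "v \<in> TS p" "v i = K"
proof (rule that)
  \<comment> \<open>Transport \<open>K\<close> from the chart \<open>i\<close> to all other charts;
    the cocycle identity makes this family compatible.\<close>
  define v where "v j = (if j \<in> Gr \<and> p \<in> \<Omega> j then dchange j p K else 0)" for j
  show "v \<in> TS p"
    unfolding tangent_iff
    using bcbD(1)[OF dchange_bcb K] dchange_cocycle by (auto simp: v_def)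
  show "v i = K" using dchange_self[OF i K] i by (simp add: v_def)
qed

lemma tangent_eqI:
  assumes i: "i \<in> Gr" "p \<in> \<Omega> i" and v: "v \<in> TS p" and w: "w \<in> TS p" and eq: "v i = w i"
  shows "v = w"
proof
  fix j
  show "v j = w j"
  proof (cases "j \<in> Gr \<and> p \<in> \<Omega> j")
    case True
    then show ?thesis using tangentD(2)[OF v i, of j] tangentD(2)[OF w i, of j] eq by simp
  next
    case False
    then show ?thesis using v w unfolding tangent_iff by metis
  qed
qed

lemma csubspace_TS: "csubspace (TS p)"
  unfolding complex_vector.subspace_def
proof (intro conjI ballI allI)
  show "0 \<in> TS p"
    unfolding tangent_iff using cn_zero[OF cnormed_M] bcb_zero[OF cnormed_M dchange_bcb] by (simp only: zero_fun_apply) auto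
  show "v + w \<in> TS p" if v: "v \<in> TS p" and w: "w \<in> TS p" for v w
    unfolding tangent_iff
  proof (intro conjI allI ballI impI)
    show "(v + w) i = 0" if "\<not> (i \<in> Gr \<and> p \<in> \<Omega> i)" for i
    proof -
      have "v i = 0" "w i = 0" using v w that unfolding tangent_iff by blast+
      then show ?thesis by (simp only: plus_fun_apply add_0)
    qed
    show "(v + w) i \<in> pts (M i)" if "i \<in> Gr" "p \<in> \<Omega> i" for i
      using cn_add[OF cnormed_M tangentD(1)[OF v that] tangentD(1)[OF w that]] by (simp only: plus_fun_apply)
    show "(v + w) j = dchange j p ((v + w) i)" if "i \<in> Gr" "j \<in> Gr" "p \<in> \<Omega> i \<inter> \<Omega> j" for i j
    proof -
      have p: "p \<in> \<Omega> i" "p \<in> \<Omega> j" using that by auto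
      show ?thesis
        using bcbD(2)[OF dchange_bcb[OF that(2) p(2)] tangentD(1)[OF v that(1) p(1)] tangentD(1)[OF w that(1) p(1)]]
          tangentD(2)[OF v that(1) p(1) that(2) p(2)] tangentD(2)[OF w that(1) p(1) that(2) p(2)]
        by (simp only: plus_fun_apply)
    qed
  qed
  show "c *\<^sub>C v \<in> TS p" if v: "v \<in> TS p" for c v
    unfolding tangent_iff
  proof (intro conjI allI ballI impI)
    have ap: "(c *\<^sub>C v) i = c *\<^sub>C v i" for i by (simp add: scaleC_fun_def)
    show "(c *\<^sub>C v) i = 0" if "\<not> (i \<in> Gr \<and> p \<in> \<Omega> i)" for i
    proof -
      have "v i = 0" using v that unfolding tangent_iff by blast
      then show ?thesis unfolding ap by (simp only: scaleC_zero_right)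
    qed
    show "(c *\<^sub>C v) i \<in> pts (M i)" if "i \<in> Gr" "p \<in> \<Omega> i" for i
      unfolding ap by (rule cn_scale[OF cnormed_M tangentD(1)[OF v that]])
    show "(c *\<^sub>C v) j = dchange j p ((c *\<^sub>C v) i)" if "i \<in> Gr" "j \<in> Gr" "p \<in> \<Omega> i \<inter> \<Omega> j" for i j
    proof -
      have p: "p \<in> \<Omega> i" "p \<in> \<Omega> j" using that by auto
      show ?thesis
        unfolding ap bcbD(3)[OF dchange_bcb[OF that(2) p(2)] tangentD(1)[OF v that(1) p(1)]]
        using tangentD(2)[OF v that(1) p(1) that(2) p(2)] by simp
    qed
  qed
qed

section \<open>Functionals on tangent spaces and the cotangent trivializations\<close>

abbreviation "TN i p \<equiv> tangent_nspace \<A> i p"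

lemma TN_simps: "pts (TN i p) = TS p" "nrm (TN i p) v = trace_norm (v i)"
  by (simp_all add: tangent_nspace_def tangent_chart_def)

lemma fun_scaleC_apply: "(c *\<^sub>C f) x = c *\<^sub>C f x"
  by (simp add: scaleC_fun_def)

lemma cnormed_TN:
  assumes i: "i \<in> Gr" "p \<in> \<Omega> i"
  shows "cnormed_space (TN i p)"
  unfolding cnormed_space_def TN_simps
proof (intro conjI ballI allI)
  show "csubspace (TS p)" by (rule csubspace_TS)
  fix v assume v: "v \<in> TS p"
  note vt = L1_trace_class[OF tangentD(1)[OF v i]]
  show "0 \<le> trace_norm (v i)" by (rule trace_norm_nonneg[OF vt])
  have "0 \<in> TS p" by (rule complex_vector.subspace_0[OF csubspace_TS])
  then have "v i = 0 \<longleftrightarrow> v = 0" using tangent_eqI[OF i v, of 0] by (metis zero_fun_apply)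
  then show "trace_norm (v i) = 0 \<longleftrightarrow> v = 0" by (simp only: trace_norm_eq_0_iff[OF vt])
  show "trace_norm ((c *\<^sub>C v) i) = cmod c * trace_norm (v i)" for c
    unfolding scaleC_fun_def[of c v] by (rule trace_norm_scaleC[OF vt])
  show "trace_norm ((v + w) i) \<le> trace_norm (v i) + trace_norm (w i)" if "w \<in> TS p" for w
    unfolding plus_fun_def[of v w] by (rule trace_norm_triangle[OF vt L1_trace_class[OF tangentD(1)[OF that i]]])
qed

text \<open>The transpose of the tangent map of the chart \<open>i\<close>, inverse to the
  trivialization \<open>triv CB i p\<close> of the cotangent bundle.\<close>

definition pull :: "'h set \<Rightarrow> 'h set \<Rightarrow> (('h \<Rightarrow> 'h) \<Rightarrow> complex) \<Rightarrow> ('h set \<Rightarrow> 'h \<Rightarrow> 'h) \<Rightarrow> complex"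
  where "pull i p f = zero_off (TS p) (\<lambda>v. f (v i))"

abbreviation "CB \<equiv> cotangent_bundle \<A>"

lemma CB_simps:
  "fibre CB = cotangent_space \<A>" "triv_index CB = Gr" "triv_dom CB = \<Omega>" "typical CB = (\<lambda>i. dual_space (M i))"
  "triv CB i p \<alpha> = zero_off (pts (M i)) (\<alpha> \<circ> inv_into (TS p) (tangent_chart i))"
  by (simp_all add: cotangent_bundle_def)

lemma pull_dual_norm_le:
  assumes i: "i \<in> Gr" "p \<in> \<Omega> i" and C: "0 \<le> C" "\<And>K. K \<in> pts (M i) \<Longrightarrow> cmod (f K) \<le> C * trace_norm K"
  shows "nrm (dual_space (TN i p)) (pull i p f) \<le> C"
  by (rule dual_norm_le[OF cnormed_TN[OF i] C(1)])
     (simp add: TN_simps pull_def C(2) tangentD(1)[OF _ i])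

lemma pull_dual:
  assumes i: "i \<in> Gr" "p \<in> \<Omega> i" and l: "f \<in> pts (dual_space (M i))"
  shows "pull i p f \<in> pts (dual_space (TN i p))"
proof (rule dual_spaceI[where K="nrm (dual_space (M i)) f"], unfold TN_simps)
  fix v w c
  show "pull i p f (v + w) = pull i p f v + pull i p f w" if v: "v \<in> TS p" and w: "w \<in> TS p"
    using dual_spaceD(1)[OF l tangentD(1)[OF v i] tangentD(1)[OF w i]]
      complex_vector.subspace_add[OF csubspace_TS v w] v w by (simp add: pull_def)
  show "pull i p f (c *\<^sub>C v) = c * pull i p f v" if v: "v \<in> TS p"
    using dual_spaceD(2)[OF l tangentD(1)[OF v i]] complex_vector.subspace_scale[OF csubspace_TS v] v
    by (simp add: pull_def fun_scaleC_apply)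
  show "cmod (pull i p f v) \<le> nrm (dual_space (M i)) f * trace_norm (v i)" if v: "v \<in> TS p"
    using dual_bound[OF cnormed_M l tangentD(1)[OF v i]] v by (simp add: pull_def)
  show "pull i p f v = 0" if "v \<notin> TS p" using that by (simp add: pull_def)
qed

text \<open>The norms of a tangent space coming from different charts are equivalent.\<close>

lemma dual_TN_indep:
  assumes i: "i \<in> Gr" "p \<in> \<Omega> i" and j: "j \<in> Gr" "p \<in> \<Omega> j" and a: "\<alpha> \<in> pts (dual_space (TN i p))"
  shows "\<alpha> \<in> pts (dual_space (TN j p))"
proof -
  obtain C where C: "0 < C" "\<And>K. K \<in> pts (M j) \<Longrightarrow> nrm (M i) (dchange i p K) \<le> C * nrm (M j) K"
    by (rule bcb_bound[OF cnormed_M dchange_bcb[OF i]]) blast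
  let ?N = "nrm (dual_space (TN i p)) \<alpha>"
  have N: "0 \<le> ?N" by (rule nrm_nonneg[OF cnormed_dual_space[OF cnormed_TN[OF i]] a])
  show ?thesis
  proof (rule dual_spaceI[where K="?N * C"], unfold TN_simps)
    fix v w c
    show "\<alpha> (v + w) = \<alpha> v + \<alpha> w" if "v \<in> TS p" "w \<in> TS p" using dual_spaceD(1)[OF a, of v w] that by (simp add: TN_simps)
    show "\<alpha> (c *\<^sub>C v) = c * \<alpha> v" if "v \<in> TS p" using dual_spaceD(2)[OF a, of v c] that by (simp add: TN_simps)
    show "\<alpha> v = 0" if "v \<notin> TS p" using dual_spaceD(3)[OF a, of v] that by (simp add: TN_simps)
    show "cmod (\<alpha> v) \<le> ?N * C * trace_norm (v j)" if v: "v \<in> TS p"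
    proof -
      have "cmod (\<alpha> v) \<le> ?N * trace_norm (v i)" using dual_bound[OF cnormed_TN[OF i] a, of v] v by (simp add: TN_simps)
      also have "\<dots> \<le> ?N * (C * trace_norm (v j))"
        using mult_left_mono[OF C(2)[OF tangentD(1)[OF v j]] N] tangentD(2)[OF v j i] by simp
      finally show ?thesis by (simp add: mult.assoc)
    qed
  qed
qed

lemma cotangent_eq:
  assumes i: "i \<in> Gr" "p \<in> \<Omega> i"
  shows "cotangent_space \<A> p = pts (dual_space (TN i p))"
  unfolding cotangent_space_def atlas_simps using dual_TN_indep i by blast

lemma tangent_inv:
  assumes i: "i \<in> Gr" "p \<in> \<Omega> i" and K: "K \<in> pts (M i)"
  shows "inv_into (TS p) (tangent_chart i) K \<in> TS p" "inv_into (TS p) (tangent_chart i) K i = K"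
proof -
  obtain v where "v \<in> TS p" "v i = K" by (rule tangent_exists[OF i K])
  then have im: "K \<in> tangent_chart i ` TS p" unfolding tangent_chart_def by blast
  show "inv_into (TS p) (tangent_chart i) K \<in> TS p" by (rule inv_into_into[OF im])
  show "inv_into (TS p) (tangent_chart i) K i = K" using f_inv_into_f[OF im] by (simp add: tangent_chart_def)
qed

lemma triv_apply:
  "K \<in> pts (M i) \<Longrightarrow> triv CB i p \<alpha> K = \<alpha> (inv_into (TS p) (tangent_chart i) K)"
  "K \<notin> pts (M i) \<Longrightarrow> triv CB i p \<alpha> K = 0"
  by (simp_all add: CB_simps)

lemma triv_pull:
  assumes i: "i \<in> Gr" "p \<in> \<Omega> i" and l: "f \<in> pts (dual_space (M i))"
  shows "triv CB i p (pull i p f) = f"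
proof
  fix K
  show "triv CB i p (pull i p f) K = f K"
    by (cases "K \<in> pts (M i)")
       (simp_all add: triv_apply pull_def tangent_inv[OF i] dual_spaceD(3)[OF l])
qed

lemma pull_triv:
  assumes i: "i \<in> Gr" "p \<in> \<Omega> i" and a: "\<alpha> \<in> cotangent_space \<A> p"
  shows "pull i p (triv CB i p \<alpha>) = \<alpha>"
proof
  fix v
  have a': "\<alpha> \<in> pts (dual_space (TN i p))" using a cotangent_eq[OF i] by simp
  show "pull i p (triv CB i p \<alpha>) v = \<alpha> v"
  proof (cases "v \<in> TS p")
    case True
    note K = tangentD(1)[OF True i]
    have "inv_into (TS p) (tangent_chart i) (v i) = v"
      by (rule tangent_eqI[OF i tangent_inv(1)[OF i K] True tangent_inv(2)[OF i K]])
    then show ?thesis using True K by (simp add: pull_def triv_apply)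
  next
    case False
    then show ?thesis using dual_spaceD(3)[OF a', of v] by (simp add: pull_def TN_simps)
  qed
qed

lemma triv_dual:
  assumes i: "i \<in> Gr" "p \<in> \<Omega> i" and a: "\<alpha> \<in> cotangent_space \<A> p"
  shows "triv CB i p \<alpha> \<in> pts (dual_space (M i))"
proof -
  let ?I = "inv_into (TS p) (tangent_chart i)"
  have a': "\<alpha> \<in> pts (dual_space (TN i p))" using a cotangent_eq[OF i] by simp
  note I = tangent_inv[OF i]
  show ?thesis
  proof (rule dual_spaceI[where K="nrm (dual_space (TN i p)) \<alpha>"])
    fix K K' c assume K: "K \<in> pts (M i)"
    show "triv CB i p \<alpha> (K + K') = triv CB i p \<alpha> K + triv CB i p \<alpha> K'" if K': "K' \<in> pts (M i)"
    proof -
      note KK = cn_add[OF cnormed_M K K']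
      have "?I (K + K') = ?I K + ?I K'"
        by (rule tangent_eqI[OF i I(1)[OF KK]])
           (simp_all only: plus_fun_apply[of "?I K" "?I K'"] I(2) KK K K' complex_vector.subspace_add[OF csubspace_TS I(1)[OF K] I(1)[OF K']])
      then show ?thesis
        using dual_spaceD(1)[OF a', of "?I K" "?I K'"] I(1)[OF K] I(1)[OF K'] by (simp add: triv_apply KK K K' TN_simps)
    qed
    show "triv CB i p \<alpha> (c *\<^sub>C K) = c * triv CB i p \<alpha> K"
    proof -
      note cK = cn_scale[OF cnormed_M K, of c]
      have "?I (c *\<^sub>C K) = c *\<^sub>C ?I K"
        by (rule tangent_eqI[OF i I(1)[OF cK]])
           (simp_all only: fun_scaleC_apply[of c "?I K"] I(2) cK K complex_vector.subspace_scale[OF csubspace_TS I(1)[OF K]])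
      then show ?thesis
        using dual_spaceD(2)[OF a', of "?I K" c] I(1)[OF K] by (simp add: triv_apply cK K TN_simps)
    qed
    show "cmod (triv CB i p \<alpha> K) \<le> nrm (dual_space (TN i p)) \<alpha> * nrm (M i) K"
      using dual_bound[OF cnormed_TN[OF i] a', of "?I K"] I(1)[OF K] I(2)[OF K] by (simp add: triv_apply K TN_simps)
  next
    show "triv CB i p \<alpha> K = 0" if "K \<notin> pts (M i)" for K using that by (rule triv_apply)
  qed
qed

lemma bij_triv:
  assumes i: "i \<in> Gr" "p \<in> \<Omega> i"
  shows "bij_betw (triv CB i p) (cotangent_space \<A> p) (pts (dual_space (M i)))"
proof (rule bij_betw_byWitness[where f'="pull i p"])
  show "pull i p ` pts (dual_space (M i)) \<subseteq> cotangent_space \<A> p"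
    unfolding cotangent_eq[OF i] using pull_dual[OF i] by blast
qed (auto simp: pull_triv[OF i] triv_pull[OF i] triv_dual[OF i])

lemma inv_triv:
  assumes i: "i \<in> Gr" "p \<in> \<Omega> i" and l: "f \<in> pts (dual_space (M i))"
  shows "inv_into (cotangent_space \<A> p) (triv CB i p) f = pull i p f"
proof (rule inv_into_f_eq)
  show "inj_on (triv CB i p) (cotangent_space \<A> p)" using bij_triv[OF i] by (rule bij_betw_imp_inj_on)
  show "pull i p f \<in> cotangent_space \<A> p" unfolding cotangent_eq[OF i] by (rule pull_dual[OF i l])
  show "triv CB i p (pull i p f) = f" by (rule triv_pull[OF i l])
qed

text \<open>The transition map of the cotangent bundle with the two occurrences of the oblique
  projection replaced by independent operators, which makes it bilinear.\<close>

definition hom_sandwich :: "'h set \<Rightarrow> 'h set \<Rightarrow> ('h \<Rightarrow> 'h) \<Rightarrow> ('h \<Rightarrow> 'h) \<Rightarrow> (('h \<Rightarrow> 'h) \<Rightarrow> complex) \<Rightarrow> ('h \<Rightarrow> 'h) \<Rightarrow> complex"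
  where "hom_sandwich V W R X =
    zero_off (pts (dual_space (M V))) (\<lambda>f. zero_off (pts (M W)) (\<lambda>K. f (sandwich V R K X)))"

text \<open>In coordinates the transition from \<open>V\<close> to \<open>W\<close> is
  precomposition with the derivative of the opposite chart change, from \<open>W\<close> to
  \<open>V\<close>; hence the projection of \<open>V\<close> appears.\<close>

lemma transition_eq:
  assumes V: "V \<in> Gr" "p \<in> \<Omega> V" and W: "W \<in> Gr" "p \<in> \<Omega> W"
  shows "zero_off (pts (dual_space (M V))) (triv CB W p \<circ> inv_into (cotangent_space \<A> p) (triv CB V p))
    = hom_sandwich V W (id - obl V p) (obl V p)"
proof (rule ext, rule ext)
  fix f K
  show "zero_off (pts (dual_space (M V))) (triv CB W p \<circ> inv_into (cotangent_space \<A> p) (triv CB V p)) f K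
    = hom_sandwich V W (id - obl V p) (obl V p) f K"
  proof (cases "f \<in> pts (dual_space (M V)) \<and> K \<in> pts (M W)")
    case True
    then have l: "f \<in> pts (dual_space (M V))" and K: "K \<in> pts (M W)" by auto
    note I = tangent_inv[OF W K]
    have "triv CB W p (pull V p f) K = f (inv_into (TS p) (tangent_chart W) K V)"
      using I(1) by (simp add: triv_apply K pull_def)
    also have "\<dots> = f (sandwich V (id - obl V p) K (obl V p))"
      using tangentD(2)[OF I(1) W V] by (simp add: I(2) dchange_eq_sandwich[OF V])
    finally show ?thesis by (simp add: hom_sandwich_def l K inv_triv[OF V l])
  next
    case False
    then show ?thesis
      by (cases "f \<in> pts (dual_space (M V))") (simp_all add: hom_sandwich_def triv_apply)
  qed
qed

abbreviation "H V W \<equiv> hom_space (dual_space (M V)) (dual_space (M W))"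

lemma hom_sandwich_apply:
  "f \<in> pts (dual_space (M V)) \<Longrightarrow> K \<in> pts (M W) \<Longrightarrow> hom_sandwich V W R X f K = f (sandwich V R K X)"
  "f \<notin> pts (dual_space (M V)) \<or> K \<notin> pts (M W) \<Longrightarrow> hom_sandwich V W R X f K = 0"
  by (auto simp: hom_sandwich_def zero_off_def)

lemma hom_sandwich_eqI:
  assumes "\<And>f K. f \<in> pts (dual_space (M V)) \<Longrightarrow> K \<in> pts (M W) \<Longrightarrow> hom_sandwich V W R X f K = g f K"
    "\<And>f K. f \<notin> pts (dual_space (M V)) \<or> K \<notin> pts (M W) \<Longrightarrow> g f K = 0"
  shows "hom_sandwich V W R X = g"
proof (rule ext, rule ext)
  show "hom_sandwich V W R X f K = g f K" for f K
    using assms hom_sandwich_apply(2) by (cases "f \<in> pts (dual_space (M V)) \<and> K \<in> pts (M W)") auto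
qed

lemma hom_sandwich_mem:
  assumes V: "V \<in> Gr" and R: "bounded_clinear R" and X: "bounded_clinear X"
  shows "hom_sandwich V W R X \<in> pts (H V W)" "nrm (H V W) (hom_sandwich V W R X) \<le> onorm R * onorm X"
proof -
  let ?D = "dual_space (M V)" and ?D' = "dual_space (M W)" and ?f = "hom_sandwich V W R X"
  note Vc = Gr_closed[OF V] and DV = cnormed_dual_space[OF cnormed_M] and ap = hom_sandwich_apply
  have RX: "0 \<le> onorm R * onorm X" using onorm_nonneg[OF R] onorm_nonneg[OF X] by simp
  have s: "sandwich V R K X \<in> pts (M V)" if "K \<in> pts (M W)" for K
    by (rule trace_norm_sandwich_le(3)[OF Vc R L1_trace_class[OF that] X])
  have bnd: "cmod (?f f K) \<le> (nrm ?D f * (onorm R * onorm X)) * nrm (M W) K"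
    if l: "f \<in> pts ?D" and K: "K \<in> pts (M W)" for f K
  proof -
    have "cmod (f (sandwich V R K X)) \<le> nrm ?D f * trace_norm (sandwich V R K X)"
      using dual_bound[OF cnormed_M l s[OF K]] by simp
    also have "\<dots> \<le> nrm ?D f * (onorm R * onorm X * trace_norm K)"
      by (intro mult_left_mono trace_norm_sandwich_le(4)[OF Vc R L1_trace_class[OF K] X] nrm_nonneg[OF DV l])
    finally show ?thesis by (simp add: ap l K mult.assoc)
  qed
  have dual: "?f f \<in> pts ?D'" if l: "f \<in> pts ?D" for f
  proof (rule dual_spaceI[OF _ _ bnd[OF l]])
    fix K K' c assume K: "K \<in> pts (M W)"
    show "?f f (K + K') = ?f f K + ?f f K'" if K': "K' \<in> pts (M W)"
      by (simp add: ap l K K' cn_add[OF cnormed_M] sandwich_linear(3)[OF Vc R] dual_spaceD(1)[OF l s[OF K] s[OF K']])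
    show "?f f (c *\<^sub>C K) = c * ?f f K"
      by (simp add: ap l K cn_scale[OF cnormed_M] sandwich_linear(4)[OF Vc R] dual_spaceD(2)[OF l s[OF K]])
  qed (simp_all add: ap)
  have le: "nrm ?D' (?f f) \<le> (onorm R * onorm X) * nrm ?D f" if l: "f \<in> pts ?D" for f
    using dual_norm_le[OF cnormed_M _ bnd[OF l]] nrm_nonneg[OF DV l] RX by (simp add: mult.commute)
  have "bounded_clinear_between ?D ?D' ?f"
  proof (rule bcbI[OF dual _ _ le])
    fix f f' c assume l: "f \<in> pts ?D"
    show "?f (f + f') = ?f f + ?f f'" if l': "f' \<in> pts ?D"
    proof
      show "?f (f + f') K = (?f f + ?f f') K" for K
        using cn_add[OF DV l l'] by (cases "K \<in> pts (M W)") (simp_all add: ap l l')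
    qed
    show "?f (c *\<^sub>C f) = c *\<^sub>C ?f f"
    proof
      show "?f (c *\<^sub>C f) K = (c *\<^sub>C ?f f) K" for K
        using cn_scale[OF DV l, of c] by (cases "K \<in> pts (M W)") (simp_all add: ap l fun_scaleC_apply scaleC_complex_def)
    qed
  qed
  moreover have "?f f = 0" if "f \<notin> pts ?D" for f using that by (simp add: fun_eq_iff ap)
  ultimately show "?f \<in> pts (H V W)" unfolding hom_space_simps by blast
  show "nrm (H V W) ?f \<le> onorm R * onorm X" by (rule hom_norm_le[OF DV RX le])
qed

lemma bounded_cbilinear_hom_sandwich:
  assumes V: "V \<in> Gr"
  shows "bounded_cbilinear bounded_ops bounded_ops (H V W) (hom_sandwich V W)"
  unfolding bounded_cbilinear_def clinear_between_def bounded_ops_simps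
proof (intro conjI ballI)
  note Vc = Gr_closed[OF V] and ap = hom_sandwich_apply
  note s = trace_norm_sandwich_le(3)[OF Vc _ L1_trace_class]
  fix R :: "'h \<Rightarrow> 'h" assume "R \<in> pts bounded_ops"
  then have R: "bounded_clinear R" by simp
  show "hom_sandwich V W R ` pts bounded_ops \<subseteq> pts (H V W)" using hom_sandwich_mem(1)[OF V R] by auto
  show "hom_sandwich V W R (X + Y) = hom_sandwich V W R X + hom_sandwich V W R Y"
    if X: "X \<in> pts bounded_ops" and Y: "Y \<in> pts bounded_ops" for X Y
    using X Y by (intro hom_sandwich_eqI)
      (simp_all add: ap sandwich_linear(5)[OF Vc R trace_class_bounded[OF L1_trace_class]] dual_spaceD(1) s R)
  show "\<forall>c. \<forall>X\<in>pts bounded_ops. hom_sandwich V W R (c *\<^sub>C X) = c *\<^sub>C hom_sandwich V W R X"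
  proof (intro allI ballI)
    fix c and X :: "'h \<Rightarrow> 'h" assume "X \<in> pts bounded_ops"
    then show "hom_sandwich V W R (c *\<^sub>C X) = c *\<^sub>C hom_sandwich V W R X"
      by (intro hom_sandwich_eqI)
        (simp_all add: ap fun_scaleC_apply scaleC_complex_def sandwich_linear(6)[OF Vc R trace_class_bounded[OF L1_trace_class]] dual_spaceD(2) s R)
  qed
next
  note Vc = Gr_closed[OF V] and ap = hom_sandwich_apply
  note s = trace_norm_sandwich_le(3)[OF Vc _ L1_trace_class]
  fix X :: "'h \<Rightarrow> 'h" assume "X \<in> pts bounded_ops"
  then have X: "bounded_clinear X" by simp
  show "(\<lambda>R. hom_sandwich V W R X) ` pts bounded_ops \<subseteq> pts (H V W)" using hom_sandwich_mem(1)[OF V _ X] by auto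
  show "hom_sandwich V W (R + R') X = hom_sandwich V W R X + hom_sandwich V W R' X"
    if R: "R \<in> pts bounded_ops" and R': "R' \<in> pts bounded_ops" for R R'
    using R R' by (intro hom_sandwich_eqI)
      (simp_all add: ap sandwich_linear(1)[OF Vc] dual_spaceD(1) s X)
  show "\<forall>c. \<forall>R\<in>pts bounded_ops. hom_sandwich V W (c *\<^sub>C R) X = c *\<^sub>C hom_sandwich V W R X"
  proof (intro allI ballI)
    fix c and R :: "'h \<Rightarrow> 'h" assume "R \<in> pts bounded_ops"
    then show "hom_sandwich V W (c *\<^sub>C R) X = c *\<^sub>C hom_sandwich V W R X"
      by (intro hom_sandwich_eqI)
        (simp_all add: ap fun_scaleC_apply scaleC_complex_def sandwich_linear(2)[OF Vc] dual_spaceD(2) s X)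
  qed
next
  show "\<exists>C>0. \<forall>R\<in>pts bounded_ops. \<forall>X\<in>pts bounded_ops. nrm (H V W) (hom_sandwich V W R X) \<le> C * onorm R * onorm X"
    using hom_sandwich_mem(2)[OF V] by (intro exI[of _ 1]) simp
qed

lemma msmooth_transition:
  assumes V: "V \<in> Gr" and W: "W \<in> Gr"
  shows "msmooth \<A> (H V W) (\<Omega> V \<inter> \<Omega> W)
    (\<lambda>p. zero_off (pts (dual_space (M V))) (triv CB W p \<circ> inv_into (cotangent_space \<A> p) (triv CB V p)))"
  unfolding msmooth_def smooth_map_def atlas_simps
proof (intro ballI allI)
  fix i k assume i: "i \<in> Gr"
  \<comment> \<open>The base point is read in a third chart \<open>i\<close>, so the domain is a
    triple overlap, open as the intersection of two overlaps with \<open>i\<close>.\<close>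
  let ?S = "phi i ` (\<Omega> V \<inter> \<Omega> W \<inter> \<Omega> i)"
  have "?S = phi i ` ((\<Omega> i \<inter> \<Omega> V) \<inter> (\<Omega> i \<inter> \<Omega> W))" by (rule arg_cong[of _ _ "image (phi i)"]) blast
  also have "\<dots> = phi i ` (\<Omega> i \<inter> \<Omega> V) \<inter> phi i ` (\<Omega> i \<inter> \<Omega> W)"
    by (rule inj_on_image_Int[OF inj_phi[OF i]]) auto
  finally have S_eq: "?S = phi i ` (\<Omega> i \<inter> \<Omega> V) \<inter> phi i ` (\<Omega> i \<inter> \<Omega> W)" .
  have S: "open_in (M i) ?S" unfolding S_eq by (intro open_in_Int open_overlap V W i)
  have SV: "?S \<subseteq> phi i ` (\<Omega> i \<inter> \<Omega> V)" by blast
  note obl = diff_times_obl[OF V i S SV diff_times_chart_change[OF V i S SV]]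
  have Hn: "cnormed_space (H V W)" by (intro cnormed_hom_space cnormed_dual_space cnormed_M)
  have "diff_times k (M i) (H V W) ?S (\<lambda>x. hom_sandwich V W (id - obl V (graph i x)) (obl V (graph i x)))"
    by (rule diff_times_bilinear[OF cnormed_M cnormed_bounded_ops cnormed_bounded_ops Hn S
          bounded_cbilinear_hom_sandwich[OF V] obl(2) obl(1)])
  then show "diff_times k (M i) (H V W) ?S
    ((\<lambda>p. zero_off (pts (dual_space (M V))) (triv CB W p \<circ> inv_into (cotangent_space \<A> p) (triv CB V p))) \<circ> graph i)"
  proof (rule diff_times_cong[OF cnormed_M S, rotated])
    fix x assume "x \<in> ?S"
    then obtain p where p: "p \<in> \<Omega> V" "p \<in> \<Omega> W" "p \<in> \<Omega> i" "x = phi i p" by blast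
    have "graph i x = p" unfolding p(4) by (rule graph_phi[OF i p(3)])
    then show "hom_sandwich V W (id - obl V (graph i x)) (obl V (graph i x)) =
      ((\<lambda>p. zero_off (pts (dual_space (M V))) (triv CB W p \<circ> inv_into (cotangent_space \<A> p) (triv CB V p))) \<circ> graph i) x"
      using transition_eq[OF V p(1) W p(2)] by simp
  qed
qed

lemma local_trivialization_CB:
  assumes V: "V \<in> Gr"
  shows "local_trivialization \<A> CB (\<Omega> V) (dual_space (M V)) (triv CB V)"
  unfolding local_trivialization_def CB_simps(1-4)
proof (intro conjI ballI)
  show "mopen \<A> (\<Omega> V)"
    unfolding mopen_def mcarrier_Gr atlas_simps
    using Omega_Gr open_overlap[OF V] by (auto simp: Int_commute)
  show "cbanach_space (dual_space (M V))" by (rule cbanach_dual_space[OF cnormed_M])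
  fix p assume p: "p \<in> \<Omega> V"
  show "bij_betw (triv CB V p) (cotangent_space \<A> p) (pts (dual_space (M V)))" by (rule bij_triv[OF V p])
  show "clinear_between (cotangent_space \<A> p) (pts (dual_space (M V))) (triv CB V p)"
    unfolding clinear_between_def
  proof (intro conjI ballI allI)
    show "triv CB V p ` cotangent_space \<A> p \<subseteq> pts (dual_space (M V))" using triv_dual[OF V p] by blast
    show "triv CB V p (\<alpha> + \<beta>) = triv CB V p \<alpha> + triv CB V p \<beta>" for \<alpha> \<beta>
      by (simp add: CB_simps fun_eq_iff zero_off_def)
    show "triv CB V p (c *\<^sub>C \<alpha>) = c *\<^sub>C triv CB V p \<alpha>" for c \<alpha>
      by (simp add: CB_simps fun_eq_iff zero_off_def fun_scaleC_apply)
  qed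
next
  fix W assume W: "W \<in> Gr"
  show "msmooth \<A> (hom_space (dual_space (M V)) (dual_space (M W))) (\<Omega> V \<inter> \<Omega> W)
      (\<lambda>p. zero_off (pts (dual_space (M V))) (triv CB W p \<circ> inv_into (cotangent_space \<A> p) (triv CB V p)))"
    by (rule msmooth_transition[OF V W])
  show "msmooth \<A> (hom_space (dual_space (M W)) (dual_space (M V))) (\<Omega> V \<inter> \<Omega> W)
      (\<lambda>p. zero_off (pts (dual_space (M W))) (triv CB V p \<circ> inv_into (cotangent_space \<A> p) (triv CB W p)))"
    using msmooth_transition[OF W V] by (simp only: Int_commute)
qed


section \<open>The precotangent bundle\<close>

text \<open>Quantifying over all charts around the point avoids a choice; that every single chart
  already gives the whole fibre is proved next.\<close>

definition precotangent :: "('h set \<times> (('h set \<Rightarrow> 'h \<Rightarrow> 'h) \<Rightarrow> complex)) set"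
  where "precotangent = {(U, \<alpha>). \<exists>V\<in>Gr. U \<in> \<Omega> V \<and> \<alpha> \<in> pull V U ` tr_funs V}"

text \<open>With \<open>J\<close> the projection onto \<open>U\<close> along \<open>W\<^sup>\<bottom>\<close>, cyclicity of the trace turns
  \<open>Tr (\<mu> (1 - J) K J)\<close> into \<open>Tr (J \<mu> (1 - J) K)\<close>, and \<open>J \<mu> (1 - J)\<close> is again compact.\<close>

lemma pull_tr_funs_indep:
  assumes V: "V \<in> Gr" "U \<in> \<Omega> V" and W: "W \<in> Gr" "U \<in> \<Omega> W"
  shows "pull W U ` tr_funs W \<subseteq> pull V U ` tr_funs V"
proof
  fix \<alpha> assume "\<alpha> \<in> pull W U ` tr_funs W"
  then obtain \<mu> where \<mu>: "\<mu> \<in> L0 (orth W) W" and \<alpha>: "\<alpha> = pull W U (tr_fun W \<mu>)" unfolding tr_funs_def by blast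
  let ?J = "obl W U" and ?P = "orth_proj V" and ?Q = "orth_proj (orth V)"
  note Vc = Gr_closed[OF V(1)] and Jb = obliqueD(1)[OF oblique_obl[OF W]] and mb = L0_bounded[OF \<mu>]
  note R = bounded_id_minus_obl[OF W]
  have P: "bounded_clinear ?P" "bounded_clinear ?Q" by (intro bounded_clinear_orth_proj Vc closed_csubspace_orth)+
  \<comment> \<open>The operator J \<mu> (1 - J), cut down by the projections of \<open>V\<close> so
    that it belongs to L0 for the chart \<open>V\<close>.\<close>
  define \<nu> where "\<nu> = (?P \<circ> ?J) \<circ> (\<mu> \<circ> ((id - ?J) \<circ> ?Q))"
  have "compact_op \<nu>"
    unfolding \<nu>_def by (intro compact_op_comp_left compact_op_comp_right bounded_clinear_compose P Jb R L0_compact[OF \<mu>])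
  moreover have "\<nu> x = 0" if "x \<in> V" for x
  proof -
    have "?Q x = 0" by (simp add: orth_proj_orth[OF Vc] orth_proj_fixes[OF Vc that])
    then show ?thesis
      by (simp only: \<nu>_def comp_apply bounded_clinear_zero[OF R] bounded_clinear_zero[OF mb] bounded_clinear_zero[OF Jb] bounded_clinear_zero[OF P(1)])
  qed
  moreover have "\<nu> x \<in> V" for x by (simp add: \<nu>_def orth_proj_in[OF Vc])
  ultimately have \<nu>: "\<nu> \<in> L0 (orth V) V" unfolding L0_iff[OF Vc] by blast
  have "pull W U (tr_fun W \<mu>) v = pull V U (tr_fun V \<nu>) v" for v
  proof (cases "v \<in> TS U")
    case True
    let ?K = "v V"
    have K: "?K \<in> pts (M V)" by (rule tangentD(1)[OF True V])
    have KW: "v W \<in> pts (M W)" by (rule tangentD(1)[OF True W])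
    have Kt: "trace_class ?K" by (rule L1_trace_class[OF K])
    have KP: "?Q \<circ> ?K \<circ> ?P = ?K" by (rule L1_orth_proj(3)[OF Vc K])
    have vW: "v W = (id - ?J) \<circ> ?K \<circ> ?J" using tangentD(2)[OF True V W] by (simp add: dchange_def)
    let ?A = "\<mu> \<circ> ((id - ?J) \<circ> (?Q \<circ> ?K))"
    have A: "trace_class ?A" by (intro trace_class_comp_left mb R P Kt)
    have PJ: "bounded_clinear (?P \<circ> ?J)" by (rule bounded_clinear_compose[OF P(1) Jb])
    \<comment> \<open>The cut-down is harmless, since \<open>v V\<close> already absorbs both
      projections; they are inserted here so that cyclicity moves P_V J to the front.\<close>
    have "\<mu> \<circ> v W = \<mu> \<circ> ((id - ?J) \<circ> (?Q \<circ> ?K \<circ> ?P) \<circ> ?J)" unfolding vW KP ..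
    also have "\<dots> = ?A \<circ> (?P \<circ> ?J)" by (simp only: comp_assoc)
    finally have "op_trace (\<mu> \<circ> v W) = op_trace ((?P \<circ> ?J) \<circ> ?A)"
      by (simp only: op_trace_commute[OF PJ A])
    also have "(?P \<circ> ?J) \<circ> ?A = \<nu> \<circ> ?K" by (simp only: \<nu>_def comp_assoc)
    finally show ?thesis unfolding pull_def zero_off_in[OF True] tr_fun_apply[OF K] tr_fun_apply[OF KW] .
  next
    case False
    then show ?thesis by (simp add: pull_def)
  qed
  then have "\<alpha> = pull V U (tr_fun V \<nu>)" unfolding \<alpha> by (rule ext)
  then show "\<alpha> \<in> pull V U ` tr_funs V" unfolding tr_funs_def using \<nu> by blast
qed

lemma precotangent_fibre:
  assumes "V \<in> Gr" "U \<in> \<Omega> V"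
  shows "precotangent `` {U} = pull V U ` tr_funs V"
  using assms pull_tr_funs_indep[OF assms] by (auto simp: precotangent_def)

lemma pull_tr_fun_eq:
  assumes "V \<in> Gr" "U \<in> \<Omega> V"
  shows "pull V U (tr_fun V \<mu>) = zero_off (TS U) (\<lambda>v. op_trace (\<mu> \<circ> tangent_chart V v))"
  using tangentD(1)[OF _ assms] by (auto simp: pull_def zero_off_def tr_fun_apply tangent_chart_def)

lemma tr_funs_dual: "tr_funs V \<subseteq> pts (dual_space (M V))"
  unfolding tr_funs_def using tr_fun_dual L0_bounded by blast

lemma banach_subbundle_precotangent: "banach_subbundle \<A> CB precotangent"
  unfolding banach_subbundle_def
proof (intro conjI ballI)
  show "precotangent \<subseteq> total_space \<A> CB"
  proof
    fix x assume "x \<in> precotangent"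
    then obtain U \<alpha> V f where x: "x = (U, \<alpha>)" "V \<in> Gr" "U \<in> \<Omega> V" "f \<in> tr_funs V" "\<alpha> = pull V U f"
      unfolding precotangent_def by blast
    have "f \<in> pts (dual_space (M V))" using x(4) tr_funs_dual by blast
    then have "\<alpha> \<in> cotangent_space \<A> U" unfolding x(5) cotangent_eq[OF x(2,3)] by (rule pull_dual[OF x(2,3)])
    then show "x \<in> total_space \<A> CB"
      unfolding total_space_def mcarrier_Gr CB_simps x(1) using Omega_Gr[OF x(3)] by blast
  qed
  fix p assume "p \<in> mcarrier \<A>"
  then have p: "p \<in> Gr" by (simp add: mcarrier_Gr)
  show "\<exists>U Y \<sigma> Z. p \<in> U \<and> local_trivialization \<A> CB U Y \<sigma> \<and> csubspace Z \<and> closed_in Y Z \<and>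
      (\<forall>q\<in>U. \<sigma> q ` (precotangent `` {q}) = Z)"
  proof (intro exI[of _ "\<Omega> p"] exI[of _ "dual_space (M p)"] exI[of _ "triv CB p"] exI[of _ "tr_funs p"] conjI ballI)
    show "p \<in> \<Omega> p" by (rule self_in_Omega[OF p])
    show "local_trivialization \<A> CB (\<Omega> p) (dual_space (M p)) (triv CB p)" by (rule local_trivialization_CB[OF p])
    show "csubspace (tr_funs p)" by (rule csubspace_tr_funs[OF Gr_closed[OF p]])
    show "closed_in (dual_space (M p)) (tr_funs p)" by (rule closed_in_tr_funs[OF Gr_closed[OF p]])
    fix q assume q: "q \<in> \<Omega> p"
    have "triv CB p q ` pull p q ` tr_funs p = (\<lambda>f. triv CB p q (pull p q f)) ` tr_funs p"
      by (simp only: image_image)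
    also have "\<dots> = (\<lambda>f. f) ` tr_funs p"
      by (rule image_cong[OF refl], rule triv_pull[OF p q]) (use tr_funs_dual in blast)
    finally show "triv CB p q ` (precotangent `` {q}) = tr_funs p" unfolding precotangent_fibre[OF p q] by simp
  qed
qed

lemma pull_add: "pull i p (f + f') = pull i p f + pull i p f'"
  by (simp add: pull_def fun_eq_iff zero_off_def)

lemma pull_scaleC: "pull i p (c *\<^sub>C f) = c *\<^sub>C pull i p f"
  by (simp add: pull_def fun_eq_iff zero_off_def fun_scaleC_apply)

text \<open>Evaluation is bounded by the definition of the dual norm and injective because rank-one
  operators separate. A functional on the fibre is turned into one on the compact operators, and
  trace duality represents it by a tangent vector whose norm is controlled.\<close>

lemma banach_iso_precotangent:
  assumes i: "i \<in> Gr" "p \<in> \<Omega> i"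
  shows "banach_iso (TN i p) (dual_space (subspace_of (dual_space (TN i p)) (precotangent `` {p})))
    (\<lambda>v. zero_off (precotangent `` {p}) (\<lambda>\<alpha>. \<alpha> v))"
proof -
  let ?F = "pull i p ` tr_funs i"
  let ?D = "dual_space (TN i p)"
  let ?G = "subspace_of ?D ?F"
  note ic = Gr_closed[OF i(1)]
  have E: "cnormed_space (TN i p)" by (rule cnormed_TN[OF i])
  have D: "cnormed_space ?D" by (rule cnormed_dual_space[OF E])
  note Z = csubspace_tr_funs[OF ic]
  have F_sub: "?F \<subseteq> pts ?D" using pull_dual[OF i] tr_funs_dual by blast
  have F: "csubspace ?F"
    unfolding complex_vector.subspace_def
  proof (intro conjI ballI allI)
    have "pull i p 0 = 0" by (simp add: pull_def fun_eq_iff zero_off_def)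
    then show "0 \<in> ?F" using complex_vector.subspace_0[OF Z] by (metis imageI)
    show "x + y \<in> ?F" if xy: "x \<in> ?F" "y \<in> ?F" for x y
    proof -
      obtain a b where "a \<in> tr_funs i" "x = pull i p a" "b \<in> tr_funs i" "y = pull i p b" using xy by blast
      then have "x + y = pull i p (a + b)" "a + b \<in> tr_funs i"
        by (simp_all only: pull_add complex_vector.subspace_add[OF Z])
      then show ?thesis by blast
    qed
    show "c *\<^sub>C x \<in> ?F" if x: "x \<in> ?F" for c x
    proof -
      obtain a where "a \<in> tr_funs i" "x = pull i p a" using x by blast
      then have "c *\<^sub>C x = pull i p (c *\<^sub>C a)" "c *\<^sub>C a \<in> tr_funs i"
        by (simp_all only: pull_scaleC complex_vector.subspace_scale[OF Z])
      then show ?thesis by blast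
    qed
  qed
  have G: "cnormed_space ?G" by (rule cnormed_subspace_of[OF D F F_sub])
  have G_simps: "pts ?G = ?F" "nrm ?G = nrm ?D" by (simp_all add: subspace_of_def)
  let ?\<Phi> = "\<lambda>v. zero_off ?F (\<lambda>\<alpha>. \<alpha> v)"
  have tr_mem: "pull i p (tr_fun i \<mu>) \<in> ?F" if "\<mu> \<in> L0 (orth i) i" for \<mu>
    using that unfolding tr_funs_def by blast
  have \<Phi>_tr: "?\<Phi> v (pull i p (tr_fun i \<mu>)) = op_trace (\<mu> \<circ> v i)" if v: "v \<in> TS p" and \<mu>: "\<mu> \<in> L0 (orth i) i" for v \<mu>
    using tr_mem[OF \<mu>] v by (simp add: pull_def tr_fun_apply[OF tangentD(1)[OF v i]])
  have norm_tr: "nrm ?D (pull i p (tr_fun i \<mu>)) \<le> onorm \<mu>" if "\<mu> \<in> L0 (orth i) i" for \<mu>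
    by (rule pull_dual_norm_le[OF i onorm_nonneg[OF L0_bounded[OF that]] tr_fun_bound[OF L0_bounded[OF that]]])
  have \<Phi>: "bounded_clinear_between (TN i p) (dual_space ?G) ?\<Phi>"
  proof (rule bcbI[where K=1], unfold TN_simps)
    have le: "cmod (?\<Phi> v \<alpha>) \<le> trace_norm (v i) * nrm ?G \<alpha>" if v: "v \<in> TS p" and a: "\<alpha> \<in> pts ?G" for v \<alpha>
      using dual_bound[OF E, of \<alpha> v] F_sub a v by (auto simp: G_simps TN_simps mult.commute)
    have v0: "0 \<le> trace_norm (v i)" if "v \<in> TS p" for v
      by (rule trace_norm_nonneg[OF L1_trace_class[OF tangentD(1)[OF that i]]])
    show "?\<Phi> v \<in> pts (dual_space ?G)" if v: "v \<in> TS p" for v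
    proof (rule dual_spaceI[OF _ _ le[OF v]], unfold G_simps)
      show "?\<Phi> v (\<alpha> + \<beta>) = ?\<Phi> v \<alpha> + ?\<Phi> v \<beta>" if "\<alpha> \<in> ?F" "\<beta> \<in> ?F" for \<alpha> \<beta>
        using complex_vector.subspace_add[OF F that] that by simp
      show "?\<Phi> v (c *\<^sub>C \<alpha>) = c * ?\<Phi> v \<alpha>" if "\<alpha> \<in> ?F" for c \<alpha>
        using complex_vector.subspace_scale[OF F that] that by (simp add: fun_scaleC_apply scaleC_complex_def)
    qed simp_all
    show "nrm (dual_space ?G) (?\<Phi> v) \<le> 1 * trace_norm (v i)" if v: "v \<in> TS p" for v
      using dual_norm_le[OF G v0[OF v] le[OF v]] by simp
    show "?\<Phi> (v + w) = ?\<Phi> v + ?\<Phi> w" if "v \<in> TS p" "w \<in> TS p" for v w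
    proof
      fix \<alpha>
      show "?\<Phi> (v + w) \<alpha> = (?\<Phi> v + ?\<Phi> w) \<alpha>"
        using dual_spaceD(1)[of \<alpha> "TN i p" v w] F_sub that by (cases "\<alpha> \<in> ?F") (auto simp: TN_simps)
    qed
    show "?\<Phi> (c *\<^sub>C v) = c *\<^sub>C ?\<Phi> v" if "v \<in> TS p" for c v
    proof
      fix \<alpha>
      show "?\<Phi> (c *\<^sub>C v) \<alpha> = (c *\<^sub>C ?\<Phi> v) \<alpha>"
        using dual_spaceD(2)[of \<alpha> "TN i p" v c] F_sub that
        by (cases "\<alpha> \<in> ?F") (auto simp: TN_simps fun_scaleC_apply scaleC_complex_def)
    qed
  qed
  have inj: "inj_on ?\<Phi> (pts (TN i p))"
    unfolding TN_simps
  proof (rule inj_onI)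
    fix v w assume v: "v \<in> TS p" and w: "w \<in> TS p" and eq: "?\<Phi> v = ?\<Phi> w"
    note vi = tangentD(1)[OF v i] and wi = tangentD(1)[OF w i]
    have "v i - w i = 0"
    proof (rule L1_eq_0[OF ic cn_diff[OF cnormed_M vi wi]])
      fix \<mu> assume \<mu>: "\<mu> \<in> L0 (orth i) i"
      have "op_trace (\<mu> \<circ> v i) = op_trace (\<mu> \<circ> w i)"
        using \<Phi>_tr[OF v \<mu>] \<Phi>_tr[OF w \<mu>] fun_cong[OF eq, of "pull i p (tr_fun i \<mu>)"] by (simp only:)
      moreover have "\<mu> \<circ> (v i - w i) = (\<mu> \<circ> v i) - (\<mu> \<circ> w i)"
        by (simp add: fun_eq_iff bounded_clinear_diff[OF L0_bounded[OF \<mu>]])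
      ultimately show "op_trace (\<mu> \<circ> (v i - w i)) = 0"
        by (simp add: op_trace_diff trace_class_comp_left L0_bounded[OF \<mu>] L1_trace_class[OF vi] L1_trace_class[OF wi])
    qed
    then have "v i = w i" by (simp only: right_minus_eq)
    then show "v = w" by (rule tangent_eqI[OF i v w])
  qed
  have surj: "\<exists>v\<in>pts (TN i p). ?\<Phi> v = f \<and> nrm (TN i p) v \<le> 1 * nrm (dual_space ?G) f"
    if f: "f \<in> pts (dual_space ?G)" for f
  proof -
    let ?C = "nrm (dual_space ?G) f"
    \<comment> \<open>Since the functional attached to \<mu> has norm at most
      \<open>onorm \<mu>\<close>, the bound of \<open>f\<close> carries over to \<open>g\<close>
      with the same constant.\<close>
    define g where "g \<mu> = f (pull i p (tr_fun i \<mu>))" for \<mu>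
    have C0: "0 \<le> ?C" by (rule nrm_nonneg[OF cnormed_dual_space[OF G] f])
    obtain T where T: "T \<in> pts (M i)" "trace_norm T \<le> ?C" "\<And>\<mu>. \<mu> \<in> L0 (orth i) i \<Longrightarrow> g \<mu> = op_trace (\<mu> \<circ> T)"
    proof (rule trace_duality[OF ic C0, of g])
      fix \<mu> \<nu> c assume \<mu>: "\<mu> \<in> L0 (orth i) i"
      note m = tr_mem[OF \<mu>]
      show "g (\<mu> + \<nu>) = g \<mu> + g \<nu>" if \<nu>: "\<nu> \<in> L0 (orth i) i"
        using dual_spaceD(1)[OF f, of "pull i p (tr_fun i \<mu>)" "pull i p (tr_fun i \<nu>)"] m tr_mem[OF \<nu>]
        by (simp add: g_def G_simps pull_add tr_fun_add[OF L0_bounded[OF \<mu>] L0_bounded[OF \<nu>]])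
      show "g (c *\<^sub>C \<mu>) = c * g \<mu>"
        using dual_spaceD(2)[OF f, of "pull i p (tr_fun i \<mu>)" c] m
        by (simp add: g_def G_simps pull_scaleC tr_fun_scaleC[OF L0_bounded[OF \<mu>]])
      show "cmod (g \<mu>) \<le> ?C * onorm \<mu>"
        using dual_bound[OF G f, unfolded G_simps, OF m] mult_left_mono[OF norm_tr[OF \<mu>] C0] unfolding g_def
        by (rule order_trans)
    qed blast
    obtain v where v: "v \<in> TS p" "v i = T" by (rule tangent_exists[OF i T(1)])
    have "?\<Phi> v = f"
    proof
      fix \<alpha>
      show "?\<Phi> v \<alpha> = f \<alpha>"
      proof (cases "\<alpha> \<in> ?F")
        case True
        then obtain \<mu> where \<mu>: "\<mu> \<in> L0 (orth i) i" "\<alpha> = pull i p (tr_fun i \<mu>)" unfolding tr_funs_def by blast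
        show ?thesis unfolding \<mu>(2) \<Phi>_tr[OF v(1) \<mu>(1)] v(2) T(3)[OF \<mu>(1), symmetric] g_def ..
      next
        case False
        then show ?thesis using dual_spaceD(3)[OF f, of \<alpha>] by (simp add: G_simps)
      qed
    qed
    then show ?thesis using v T(2) by (intro bexI[of _ v]) (simp_all add: TN_simps)
  qed
  show ?thesis unfolding precotangent_fibre[OF i] by (rule banach_isoI[OF E \<Phi> inj surj])
qed

lemma precotangent_bundle_precotangent: "precotangent_bundle \<A> precotangent"
  unfolding precotangent_bundle_def atlas_simps
  using banach_manifold_Gr banach_subbundle_precotangent banach_iso_precotangent by blast

lemma precotangent_fibre_eq:
  assumes "V \<in> Gr" "U \<in> \<Omega> V"
  shows "precotangent `` {U} = {zero_off (TS U) (\<lambda>v. op_trace (\<mu> \<circ> tangent_chart V v)) | \<mu>. \<mu> \<in> L0 (orth V) V}"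
  unfolding precotangent_fibre[OF assms] tr_funs_def image_image pull_tr_fun_eq[OF assms] by blast

end

theorem theorem3:
  fixes Hm Hp :: "'h::chilbert_space set"
  assumes "polarized Hm Hp"
  shows "\<exists>T. precotangent_bundle (Gr_atlas Hm Hp) T \<and>
    (\<forall>V\<in>Gr1res Hm Hp. \<forall>U\<in>Omega Hm Hp V.
      T `` {U} =
        {zero_off (tangent_space (Gr_atlas Hm Hp) U) (\<lambda>v. op_trace (\<mu> \<circ> tangent_chart V v)) | \<mu>.
          \<mu> \<in> L0 (orth V) V})"
proof -
  interpret polarized_space Hm Hp by unfold_locales (rule assms)
  show ?thesis
    using precotangent_bundle_precotangent precotangent_fibre_eq by (intro exI[of _ precotangent]) blast
qed

end
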